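(* Let $n\ge4$. Let $[D_{0,0}]\in J(\Gamma)$ be the point that corresponds under the spectral map to a generic twisted $n$-gon at time $t=0$, and for integers $t\ge0$ and $0\le i\le n-1$ let $D_{i,t}$ be the pole divisor of the normalized Floquet–Bloch solution $\bar\psi_{i,t}$ of the polygon obtained after $t$ iterations of the pentagram map. Provided that the corresponding spectral data remains generic up to time $t$, $\deg D_{i,t}=g+2$ and the class $[D_{i,t}]$ is given as follows: (odd $n$) $$[D_{i,t}]=[D_{0,0}-tO_1+iO_2+(t-i)W_2]\in J(\Gamma);$$ (even $n$) $$[D_{i,t}]=\Big[D_{0,0}-tO_1+\Big\lfloor\tfrac{1+i}{2}\Big\rfloor O_2+\Big\lfloor\tfrac{i}{2}\Big\rfloor O_3+\Big\lfloor\tfrac{1+t-i}{2}\Big\rfloor W_2+\Big\lfloor\tfrac{t-i}{2}\Big\rfloor W_3\Big].$$ In particular ($i=0$), $[D_{0,t}]=[D_{0,0}-tO_1+tW_2]$ for odd $n$, and $[D_{0,t}]=[D_{0,0}-tO_1+\lfloor\frac{1+t}{2}\rfloor W_2+\lfloor\frac t2\rfloor W_3]$ for even $n$; so for odd $n$ the discrete time evolution in $J(\Gamma)$ goes along a straight line, and for even $n$ along a "staircase" (its square goes along a straight line).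
   Context: $q=\lfloor n/2\rfloor$; all indices of $x_i,y_i$ are mod $n$; $\lfloor\cdot\rfloor$ is the floor function. Polygons. A twisted $n$-gon is a map $\phi:\mathbb Z\to\mathbb{CP}^2$ such that no three consecutive points are collinear and $\phi(k+n)=M\circ\phi(k)$ for all $k$, for some $M\in PSL(3,\mathbb C)$; polygons are considered up to $PSL(3,\mathbb C)$, forming the space $\mathcal P_n$ of dimension $2n$. For arbitrary lifts $V_k\in\mathbb C^3$ of $\phi(k)$ write $V_{j+3}=a_jV_{j+2}+b_jV_{j+1}+c_jV_j$; then $x_i=\frac{a_{i-2}c_{i-1}}{b_{i-2}b_{i-1}}$, $y_i=-\frac{b_{i-1}}{a_{i-2}a_{i-1}}$ do not depend on the lifts, are $n$-periodic, and are coordinates on $\mathcal P_n$ (generically). The pentagram map is $x_i\mapsto x_i\frac{1-x_{i-1}y_{i-1}}{1-x_{i+1}y_{i+1}}$, $y_i\mapsto y_{i+1}\frac{1-x_{i+2}y_{i+2}}{1-x_iy_i}$. Lax matrices. With $x_i,y_i$ the coordinates at time $t$ (after $t$ iterations), $$\tilde L_{i,t}(z)=\begin{pmatrix}1/x_{i+2}&-1/x_{i+2}&0\\1/z&0&1/z\\-y_{i+2}&0&0\end{pmatrix},\qquad \tilde T_{i,t}=\tilde L_{i+n-1,t}\cdots\tilde L_{i+1,t}\tilde L_{i,t}$$ (first index mod $n$). Let $C$ be a fixed cube root of the constant $z^n\det\tilde T_{0,0}(z)$. The function $$R(k,z)=-\det(\tilde T_{i,t}(z)-Ck\,I)/C^3=k^3-k^2\sum_{j=0}^qJ_jz^{j-q}+kz^{-n}\sum_{j=0}^qI_jz^{q-j}-z^{-n}$$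 does not depend on $i,t$. $\Gamma$ is the normalization of the compactification in $\mathbb{CP}^2$ of the curve $R=0$; for generic $I_j,J_j$ its genus is $g=2(n-q-1)$. $J(\Gamma)$ is its Jacobian; $[\cdot]$ denotes the class of a divisor. Marked points. Above $z=0$: $O_1$, where $k$ is finite; for even $n$ two points $O_2,O_3$ where $k$ has a pole; for odd $n$ a single branch point $O_2$ where $k$ has a pole. Above $z=\infty$: $W_1$, where $k$ is finite and nonzero; for even $n$ two points $W_2,W_3$ where $k=0$; for odd $n$ a single branch point $W_2$ where $k=0$. For even $n$ the labels are fixed by the coordinates at $t=0$: $Ckz^q$ tends to $(-1)^q\prod_{j\text{ odd}}x_j^{-1}$ at $O_2$, $(-1)^q\prod_{j\text{ even}}x_j^{-1}$ at $O_3$, $(-1)^q\prod_{j\text{ even}}y_j$ at $W_2$, $(-1)^q\prod_{j\text{ odd}}y_j$ at $W_3$ ($0\le j\le n-1$). Floquet–Bloch solutions. $\bar\psi_{i,t}$ is the meromorphic vector function on $\Gamma$ with $\tilde T_{i,t}(z)\bar\psi_{i,t}=Ck\,\bar\psi_{i,t}$ and sum of its three components $\equiv1$. The spectral map sends a polygon (at time $0$) to $(\Gamma,[D_{0,0}])$. Generic spectral data: $\Gamma$ has parameters $I_j,J_j$ in a suitable Zariski open set (in particular the plane curve $R=0$ is singular at most at the points at $z=0,\infty$), and the class $[D]$ of the pole divisor lies in a suitable Zariski open subset of $J(\Gamma)$ on which the divisors $D-E$, with $E$ running over the finitely many degree-2 divisors supported at the marked points that bound the zeros/poles of the components of $\psi_i:=\tilde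 L_{i-1}\cdots\tilde L_0\bar\psi_0$, $0\le i\le n-1$, are non-special. These $E$ (so that the $j$-th component of $\psi_i$ has divisor $\ge-D+E$) are: for odd $n$, $(1-i)O_2+(1+i)W_2$; $-iO_2+W_1+(1+i)W_2$; $(2-i)O_2+iW_2$ for $j=1,2,3$; for even $n$, $\lfloor\frac{1-i}2\rfloor O_2+\lfloor\frac{2-i}2\rfloor O_3+\lfloor\frac{1+i}2\rfloor W_2+\lfloor\frac{2+i}2\rfloor W_3$; $\lfloor\frac{-i}2\rfloor O_2+\lfloor\frac{1-i}2\rfloor O_3+W_1+\lfloor\frac{1+i}2\rfloor W_2+\lfloor\frac{2+i}2\rfloor W_3$; $\lfloor\frac{2-i}2\rfloor O_2+\lfloor\frac{3-i}2\rfloor O_3+\lfloor\frac{i}2\rfloor W_2+\lfloor\frac{1+i}2\rfloor W_3$ for $j=1,2,3$. *)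

theory Defs
  imports
    "HOL-Analysis.Analysis"
    "HOL-Computational_Algebra.Computational_Algebra"
begin

section \<open>Twisted polygons and the pentagram map\<close>

text \<open>
  A point of the complex projective plane is a one-dimensional subspace of \<open>complex ^ 3\<close>;
  a projective transformation acts on such subspaces by taking images.
\<close>

definition proj_point :: "complex ^ 3 \<Rightarrow> (complex ^ 3) set" where
  "proj_point v = range (\<lambda>c. c *s v)"

definition proj_collinear :: "(complex ^ 3) set \<Rightarrow> (complex ^ 3) set \<Rightarrow> (complex ^ 3) set \<Rightarrow> bool" where
  "proj_collinear p q r \<longleftrightarrow>
     (\<exists>l :: complex ^ 3. l \<noteq> 0 \<and> (\<forall>v \<in> p \<union> q \<union> r. (\<Sum>j\<in>UNIV. l $ j * v $ j) = 0))"

definition twisted_polygon :: "nat \<Rightarrow> (int \<Rightarrow> (complex ^ 3) set) \<Rightarrow> bool" where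
  "twisted_polygon n \<phi> \<longleftrightarrow>
     (\<forall>k. \<exists>v. v \<noteq> 0 \<and> \<phi> k = proj_point v) \<and>
     (\<forall>k. \<not> proj_collinear (\<phi> k) (\<phi> (k + 1)) (\<phi> (k + 2))) \<and>
     (\<exists>M :: complex ^ 3 ^ 3. invertible M \<and> (\<forall>k. \<phi> (k + int n) = (\<lambda>v. M *v v) ` \<phi> k))"

definition is_lift :: "(int \<Rightarrow> (complex ^ 3) set) \<Rightarrow> (int \<Rightarrow> complex ^ 3) \<Rightarrow> bool" where
  "is_lift \<phi> V \<longleftrightarrow> (\<forall>k. V k \<noteq> 0 \<and> \<phi> k = proj_point (V k))"

definition lift_recurrence ::
  "(int \<Rightarrow> complex ^ 3) \<Rightarrow> (int \<Rightarrow> complex) \<Rightarrow> (int \<Rightarrow> complex) \<Rightarrow> (int \<Rightarrow> complex) \<Rightarrow> bool" where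
  "lift_recurrence V a b c \<longleftrightarrow>
     (\<forall>j. V (j + 3) = a j *s V (j + 2) + b j *s V (j + 1) + c j *s V j)"

definition coord_x ::
  "(int \<Rightarrow> complex) \<Rightarrow> (int \<Rightarrow> complex) \<Rightarrow> (int \<Rightarrow> complex) \<Rightarrow> int \<Rightarrow> complex" where
  "coord_x a b c i = a (i - 2) * c (i - 1) / (b (i - 2) * b (i - 1))"

definition coord_y :: "(int \<Rightarrow> complex) \<Rightarrow> (int \<Rightarrow> complex) \<Rightarrow> int \<Rightarrow> complex" where
  "coord_y a b i = - b (i - 1) / (a (i - 2) * a (i - 1))"

definition pentagram ::
  "(int \<Rightarrow> complex) \<times> (int \<Rightarrow> complex) \<Rightarrow> (int \<Rightarrow> complex) \<times> (int \<Rightarrow> complex)" where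
  "pentagram = (\<lambda>(x, y).
     (\<lambda>i. x i * (1 - x (i - 1) * y (i - 1)) / (1 - x (i + 1) * y (i + 1)),
      \<lambda>i. y (i + 1) * (1 - x (i + 2) * y (i + 2)) / (1 - x i * y i)))"


section \<open>Lax matrices and the spectral curve\<close>

text \<open>
  The function field of the spectral curve is the quotient of the polynomial ring in \<open>k\<close> over the
  field of rational functions of \<open>z\<close> by the equation \<open>R\<close> of the curve.  Its elements are given
  by representatives, that is, an \<open>mfun\<close> is a polynomial in \<open>k\<close> over that field, and two of
  them are the same meromorphic function iff \<open>R\<close> divides their difference.
\<close>

type_synonym mfun = "complex poly fract poly"

definition mf_const :: "complex \<Rightarrow> mfun" where
  "mf_const c = [:to_fract [:c:]:]"

definition mf_z :: mfun where
  "mf_z = [:to_fract [:0, 1:]:]"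

definition mf_zinv :: mfun where
  "mf_zinv = [:inverse (to_fract [:0, 1:]):]"

definition mf_k :: mfun where
  "mf_k = [:0, 1:]"

text \<open>
  The matrices are defined over an arbitrary commutative ring: \<open>e\<close> embeds the complex numbers and
  \<open>w\<close> stands for \<open>1/z\<close>.  They are used over \<open>mfun\<close> and, for numerical \<open>z\<close>, over
  \<open>complex\<close>.  The coordinates of a twisted polygon are \<open>n\<close>-periodic, so that no reduction of
  indices is needed.
\<close>

definition lax_matrix ::
  "(complex \<Rightarrow> 'a::comm_ring_1) \<Rightarrow> 'a \<Rightarrow> (int \<Rightarrow> complex) \<Rightarrow> (int \<Rightarrow> complex) \<Rightarrow> int \<Rightarrow> 'a ^ 3 ^ 3" where
  "lax_matrix e w x y i = vector
     [vector [e (1 / x (i + 2)), - e (1 / x (i + 2)), 0],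
      vector [w, 0, w],
      vector [- e (y (i + 2)), 0, 0]]"

primrec lax_product ::
  "(complex \<Rightarrow> 'a::comm_ring_1) \<Rightarrow> 'a \<Rightarrow> (int \<Rightarrow> complex) \<Rightarrow> (int \<Rightarrow> complex) \<Rightarrow> int \<Rightarrow> nat \<Rightarrow> 'a ^ 3 ^ 3" where
  "lax_product e w x y i 0 = mat 1"
| "lax_product e w x y i (Suc m) = lax_matrix e w x y (i + int m) ** lax_product e w x y i m"

definition monodromy ::
  "nat \<Rightarrow> (int \<Rightarrow> complex) \<Rightarrow> (int \<Rightarrow> complex) \<Rightarrow> int \<Rightarrow> mfun ^ 3 ^ 3" where
  "monodromy n x y i = lax_product mf_const mf_zinv x y i n"

definition spectral_poly ::
  "nat \<Rightarrow> (int \<Rightarrow> complex) \<Rightarrow> (int \<Rightarrow> complex) \<Rightarrow> complex \<Rightarrow> mfun" where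
  "spectral_poly n x y C =
     - mf_const (1 / C ^ 3) * det (monodromy n x y 0 - mat (mf_const C * mf_k))"

definition spectral_fun ::
  "nat \<Rightarrow> (int \<Rightarrow> complex) \<Rightarrow> (int \<Rightarrow> complex) \<Rightarrow> complex \<Rightarrow> complex \<Rightarrow> complex \<Rightarrow> complex" where
  "spectral_fun n x y C k z =
     - det (lax_product (\<lambda>c. c) (1 / z) x y 0 n - mat (C * k)) / C ^ 3"


section \<open>Points, divisors and divisor classes\<close>

text \<open>
  The points of the normalization of the projective closure of an irreducible plane curve are the
  normalized discrete valuations of its function field that are trivial on the constants.  Such a
  valuation is a function on representatives; the zero function, whose order is infinite,
  gets the dummy value 0.
\<close>

type_synonym point = "mfun \<Rightarrow> int"

definition curve_point :: "mfun \<Rightarrow> point \<Rightarrow> bool" where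
  "curve_point R P \<longleftrightarrow>
     (\<forall>f g. R dvd f - g \<longrightarrow> P f = P g) \<and>
     (\<forall>f. R dvd f \<longrightarrow> P f = 0) \<and>
     (\<forall>f g. \<not> R dvd f \<longrightarrow> \<not> R dvd g \<longrightarrow> P (f * g) = P f + P g) \<and>
     (\<forall>f g. \<not> R dvd f \<longrightarrow> \<not> R dvd g \<longrightarrow> \<not> R dvd f + g \<longrightarrow> min (P f) (P g) \<le> P (f + g)) \<and>
     (\<forall>c. P (mf_const c) = 0) \<and>
     (\<exists>f. P f = 1)"

definition order_ge :: "mfun \<Rightarrow> point \<Rightarrow> mfun \<Rightarrow> int \<Rightarrow> bool" where
  "order_ge R P f m \<longleftrightarrow> R dvd f \<or> m \<le> P f"

definition tends_to_at :: "mfun \<Rightarrow> point \<Rightarrow> mfun \<Rightarrow> complex \<Rightarrow> bool" where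
  "tends_to_at R P f c \<longleftrightarrow> order_ge R P (f - mf_const c) 1"

type_synonym divisor = "point \<Rightarrow> int"

definition is_divisor :: "mfun \<Rightarrow> divisor \<Rightarrow> bool" where
  "is_divisor R D \<longleftrightarrow> finite {P. D P \<noteq> 0} \<and> (\<forall>P. D P \<noteq> 0 \<longrightarrow> curve_point R P)"

definition div_degree :: "divisor \<Rightarrow> int" where
  "div_degree D = (\<Sum>P | D P \<noteq> 0. D P)"

definition point_div :: "point \<Rightarrow> divisor" where
  "point_div P = (\<lambda>Q. if Q = P then 1 else 0)"

definition lin_equiv :: "mfun \<Rightarrow> divisor \<Rightarrow> divisor \<Rightarrow> bool" where
  "lin_equiv R D D' \<longleftrightarrow>
     (\<exists>f. \<not> R dvd f \<and> (\<forall>P. curve_point R P \<longrightarrow> D P - D' P = P f))"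

definition divisor_class :: "mfun \<Rightarrow> divisor \<Rightarrow> divisor set" where
  "divisor_class R D = {D'. is_divisor R D' \<and> lin_equiv R D D'}"

text \<open>
  The Riemann--Roch space of a divisor; each function is given by its representative of
  least degree in \<open>k\<close>.
\<close>

definition rr_space :: "mfun \<Rightarrow> divisor \<Rightarrow> mfun set" where
  "rr_space R D =
     {f. degree f < degree R \<and> (\<forall>P. curve_point R P \<longrightarrow> order_ge R P f (- D P))}"

definition rr_dim :: "mfun \<Rightarrow> divisor \<Rightarrow> int" where
  "rr_dim R D = int (vector_space.dim (\<lambda>c f. mf_const c * f) (rr_space R D))"

text \<open>Riemann's definition of the genus (the supremum is attained).\<close>

definition genus :: "mfun \<Rightarrow> int" where
  "genus R = (SUP D \<in> {D. is_divisor R D}. div_degree D + 1 - rr_dim R D)"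

definition nonspecial :: "mfun \<Rightarrow> divisor \<Rightarrow> bool" where
  "nonspecial R D \<longleftrightarrow> rr_dim R D = div_degree D + 1 - genus R"

definition pole_divisor :: "mfun \<Rightarrow> mfun ^ 3 \<Rightarrow> divisor" where
  "pole_divisor R \<psi> =
     (\<lambda>P. if curve_point R P then Max (insert 0 (range (\<lambda>j. - P (\<psi> $ j)))) else 0)"


section \<open>Spectral data\<close>

definition floquet_bloch ::
  "nat \<Rightarrow> (int \<Rightarrow> complex) \<Rightarrow> (int \<Rightarrow> complex) \<Rightarrow> complex \<Rightarrow> int \<Rightarrow> mfun ^ 3 \<Rightarrow> bool" where
  "floquet_bloch n x y C i \<psi> \<longleftrightarrow>
     (let R = spectral_poly n x y C in
       (\<forall>j. R dvd (monodromy n x y i *v \<psi> - (mf_const C * mf_k) *s \<psi>) $ j) \<and>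
       R dvd (\<Sum>j\<in>UNIV. \<psi> $ j) - 1)"

text \<open>
  For odd \<open>n\<close> there are no points \<open>O3\<close>, \<open>W3\<close>, and these arguments are ignored.
\<close>

definition marked_points ::
  "nat \<Rightarrow> (int \<Rightarrow> complex) \<Rightarrow> (int \<Rightarrow> complex) \<Rightarrow> complex \<Rightarrow>
   point \<Rightarrow> point \<Rightarrow> point \<Rightarrow> point \<Rightarrow> point \<Rightarrow> point \<Rightarrow> bool" where
  "marked_points n x y C O1 O2 O3 W1 W2 W3 \<longleftrightarrow>
     (let R = spectral_poly n x y C; q = n div 2;
          z0_finite = (\<lambda>P. curve_point R P \<and> P mf_z > 0 \<and> P mf_k \<ge> 0);
          z0_pole = (\<lambda>P. curve_point R P \<and> P mf_z > 0 \<and> P mf_k < 0);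
          zinf_unit = (\<lambda>P. curve_point R P \<and> P mf_z < 0 \<and> P mf_k = 0);
          zinf_zero = (\<lambda>P. curve_point R P \<and> P mf_z < 0 \<and> P mf_k > 0);
          h = mf_const C * mf_k * mf_z ^ q
      in z0_finite O1 \<and> z0_pole O2 \<and> zinf_unit W1 \<and> zinf_zero W2 \<and>
         (even n \<longrightarrow>
            z0_pole O3 \<and> zinf_zero W3 \<and>
            tends_to_at R O2 h ((- 1) ^ q * (\<Prod>j | j < n \<and> odd j. 1 / x (int j))) \<and>
            tends_to_at R O3 h ((- 1) ^ q * (\<Prod>j | j < n \<and> even j. 1 / x (int j))) \<and>
            tends_to_at R W2 h ((- 1) ^ q * (\<Prod>j | j < n \<and> even j. y (int j))) \<and>
            tends_to_at R W3 h ((- 1) ^ q * (\<Prod>j | j < n \<and> odd j. y (int j)))))"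

text \<open>
  The divisor bounding from below the divisor of the \<open>j\<close>-th component (\<open>j = 1, 2, 3\<close>) of
  \<open>\<psi>\<^sub>i\<close> up to the pole divisor of \<open>\<psi>\<^sub>0\<close>.  Integer \<open>div\<close> rounds downwards.
\<close>

definition bound_div ::
  "nat \<Rightarrow> point \<Rightarrow> point \<Rightarrow> point \<Rightarrow> point \<Rightarrow> point \<Rightarrow> int \<Rightarrow> nat \<Rightarrow> divisor" where
  "bound_div n O2 O3 W1 W2 W3 i j =
     (let comb = (\<lambda>o2 o3 w1 w2 w3 Q.
            o2 * point_div O2 Q + o3 * point_div O3 Q +
            w1 * point_div W1 Q + w2 * point_div W2 Q + w3 * point_div W3 Q)
      in if odd n then
           (if j = 1 then comb (1 - i) 0 0 (1 + i) 0
            else if j = 2 then comb (- i) 0 1 (1 + i) 0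
            else comb (2 - i) 0 0 i 0)
         else
           (if j = 1 then comb ((1 - i) div 2) ((2 - i) div 2) 0 ((1 + i) div 2) ((2 + i) div 2)
            else if j = 2 then comb ((- i) div 2) ((1 - i) div 2) 1 ((1 + i) div 2) ((2 + i) div 2)
            else comb ((2 - i) div 2) ((3 - i) div 2) 0 (i div 2) ((1 + i) div 2)))"

text \<open>
  The curve is irreducible, its part over finite \<open>z \<noteq> 0\<close> is smooth, and its genus has the
  generic value.  For even \<open>n\<close>, the two points over \<open>z = 0\<close> where \<open>k\<close> has a pole, and the
  two points over \<open>z = \<infinity>\<close> where \<open>k\<close> has a zero, are distinguished by the limits of
  \<open>C k z ^ (n div 2)\<close>.  All conditions are conditions on the coefficients of \<open>R\<close> only.
\<close>

definition generic_curve ::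
  "nat \<Rightarrow> (int \<Rightarrow> complex) \<Rightarrow> (int \<Rightarrow> complex) \<Rightarrow> complex \<Rightarrow> bool" where
  "generic_curve n x y C \<longleftrightarrow>
     irreducible (spectral_poly n x y C) \<and>
     (\<forall>k z. z \<noteq> 0 \<longrightarrow> spectral_fun n x y C k z = 0 \<longrightarrow>
        deriv (\<lambda>k. spectral_fun n x y C k z) k \<noteq> 0 \<or>
        deriv (\<lambda>z. spectral_fun n x y C k z) z \<noteq> 0) \<and>
     (even n \<longrightarrow>
        (\<Prod>j | j < n \<and> odd j. x (int j)) \<noteq> (\<Prod>j | j < n \<and> even j. x (int j)) \<and>
        (\<Prod>j | j < n \<and> odd j. y (int j)) \<noteq> (\<Prod>j | j < n \<and> even j. y (int j))) \<and>
     genus (spectral_poly n x y C) = 2 * (int n - int (n div 2) - 1)"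

definition generic_spectral_data ::
  "nat \<Rightarrow> (int \<Rightarrow> complex) \<Rightarrow> (int \<Rightarrow> complex) \<Rightarrow> complex \<Rightarrow> divisor \<Rightarrow> bool" where
  "generic_spectral_data n x y C D \<longleftrightarrow>
     generic_curve n x y C \<and>
     (\<forall>O1 O2 O3 W1 W2 W3. marked_points n x y C O1 O2 O3 W1 W2 W3 \<longrightarrow>
        (\<forall>i < n. \<forall>j \<in> {1, 2, 3}.
           nonspecial (spectral_poly n x y C)
             (\<lambda>Q. D Q - bound_div n O2 O3 W1 W2 W3 (int i) j Q)))"

end

theory Submission
  imports Defs
begin

text \<open>
  By the zero curvature equation, both the passage from \<open>i\<close> to \<open>i + 1\<close> and one step of the pentagram
  map carry Floquet--Bloch solutions to Floquet--Bloch solutions by multiplication with a matrix, up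
  to normalization.  The pole divisors before and after therefore differ, up to a principal divisor,
  by the jump of the order of the solution under that matrix.  Away from the points over \<open>z = 0\<close> and
  \<open>z = \<infinity>\<close> the matrix is invertible and there is no jump.  At the points over \<open>z = \<infinity>\<close> the orders never
  drop along an orbit of the Lax matrices, and over a period they grow by the order of the
  eigenvalue; this leaves few possibilities for the leading terms of the components, and the jump is
  read off from them.  The inverse Lax matrices at \<open>z = 0\<close> are of the same kind.

  A function with poles bounded by \<open>D\<^sub>0\<^sub>,\<^sub>0\<close> is a combination of the components of the solution with
  coefficients rational in \<open>z\<close>.  They are regular for \<open>z \<noteq> 0\<close> because the curve is smooth there, and
  the leading terms at the marked points force them to be constant.  Hence the Riemann--Roch space of
  \<open>D\<^sub>0\<^sub>,\<^sub>0 - E\<close>, \<open>E\<close> the bound on the first component, is a line, and non-speciality gives the degree.  In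
  particular the functions without poles form a finite-dimensional space, which is what the proof
  that principal divisors have degree zero requires.
\<close>

text \<open>The curve is given only by an irreducible polynomial and its valuations, and two
  deficits shape the proof. Valuations could be too few to bound a function: over
  \<open>z \<noteq> 0\<close> they are therefore constructed, as orders along power series solutions
  of the equation, and this is where smoothness enters. Over \<open>z = 0\<close> and
  \<open>z = \<infinity>\<close> there could be unlisted ones: the ramification indices in a fibre
  add up to at most 3, the degree of \<open>R\<close> in \<open>k\<close>, and the marked points use
  up this number, for odd \<open>n\<close> because a simple point at which \<open>k\<close> has a
  zero or pole forces an alternation of period two along the orbit. The staircase for even
  \<open>n\<close> has the same source. Along the orbit two shapes of leading terms alternate, and
  the limit of \<open>C k z ^ (n div 2)\<close>, up to sign a product of coordinates or reciprocals
  over one parity class, tells which of them occurs at a given index. A pentagram step preserves the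
  products of the \<open>x\<close> and exchanges those of the \<open>y\<close>; hence
  \<open>W2\<close> and \<open>W3\<close> exchange their roles with respect to the new coordinates,
  whereas the evolution matrix always shifts by the point that currently has the role of
  \<open>W2\<close>.\<close>

no_notation fps_nth (infixl \<open>$\<close> 75)

section \<open>Places of the function field\<close>

lemma mf_const_0 [simp]: "mf_const 0 = 0"
  and mf_const_1 [simp]: "mf_const 1 = 1"
  and mf_const_add: "mf_const (a + b) = mf_const a + mf_const b"
  and mf_const_diff: "mf_const (a - b) = mf_const a - mf_const b"
  and mf_const_uminus: "mf_const (- a) = - mf_const a"
  and mf_const_mult: "mf_const (a * b) = mf_const a * mf_const b"
  by (simp_all add: mf_const_def flip: one_pCons to_fract_add to_fract_diff to_fract_mult to_fract_uminus)

lemma mf_const_power: "mf_const (a ^ n) = mf_const a ^ n"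
  by (induction n) (simp_all add: mf_const_mult)

lemma mf_const_eq_0_iff [simp]: "mf_const c = 0 \<longleftrightarrow> c = 0"
  by (simp add: mf_const_def)

lemma mf_const_inverse: "c \<noteq> 0 \<Longrightarrow> mf_const c * mf_const (inverse c) = 1"
  by (simp flip: mf_const_mult)

definition cpoly_at :: "complex poly \<Rightarrow> mfun \<Rightarrow> mfun" where
  "cpoly_at p f = poly (map_poly mf_const p) f"

lemma cpoly_at_0 [simp]: "cpoly_at 0 f = 0"
  by (simp add: cpoly_at_def)

lemma cpoly_at_pCons [simp]: "cpoly_at (pCons c p) f = mf_const c + f * cpoly_at p f"
  by (cases "pCons c p = 0") (auto simp: cpoly_at_def map_poly_pCons)

lemma cpoly_at_1 [simp]: "cpoly_at 1 f = 1"
  by (simp add: one_pCons)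

lemma cpoly_at_add: "cpoly_at (p + q) f = cpoly_at p f + cpoly_at q f"
  by (induction p q rule: poly_induct2) (simp_all add: mf_const_add algebra_simps)

lemma cpoly_at_smult: "cpoly_at (smult c p) f = mf_const c * cpoly_at p f"
  by (induction p) (simp_all add: mf_const_mult algebra_simps)

lemma cpoly_at_mult: "cpoly_at (p * q) f = cpoly_at p f * cpoly_at q f"
  by (induction p) (simp_all add: cpoly_at_add cpoly_at_smult algebra_simps)

lemma cpoly_at_monom: "cpoly_at (monom c n) f = mf_const c * f ^ n"
  by (induction n) (simp_all add: monom_0 monom_Suc)

lemma cpoly_at_altdef: "degree p \<le> n \<Longrightarrow> cpoly_at p f = (\<Sum>l\<le>n. mf_const (coeff p l) * f ^ l)"
proof (induction n arbitrary: p)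
  case 0
  then obtain c where "p = [:c:]" by (metis degree_eq_zeroE le_zero_eq)
  then show ?case by simp
next
  case (Suc n)
  obtain a q where p: "p = pCons a q" by (cases p)
  with Suc.prems have "degree q \<le> n" by (auto split: if_splits)
  from Suc.IH[OF this] show ?case
    by (subst sum.atMost_Suc_shift) (simp add: p sum_distrib_left algebra_simps)
qed

lemma cpoly_at_linear_factor: "cpoly_at ([:- a, 1:] * q) f = (f - mf_const a) * cpoly_at q f"
  by (subst cpoly_at_mult) (simp add: mf_const_uminus)

definition mf_rat :: "complex poly fract \<Rightarrow> mfun" where
  "mf_rat r = [:r:]"

lemma mf_rat_0 [simp]: "mf_rat 0 = 0"
  and mf_rat_1 [simp]: "mf_rat 1 = 1"
  and mf_rat_add: "mf_rat (a + b) = mf_rat a + mf_rat b"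
  and mf_rat_diff: "mf_rat (a - b) = mf_rat a - mf_rat b"
  and mf_rat_uminus: "mf_rat (- a) = - mf_rat a"
  and mf_rat_mult: "mf_rat (a * b) = mf_rat a * mf_rat b"
  and mf_rat_eq_0_iff [simp]: "mf_rat a = 0 \<longleftrightarrow> a = 0"
  by (simp_all add: mf_rat_def one_pCons)

lemma cpoly_at_z: "cpoly_at p mf_z = mf_rat (to_fract p)"
proof (induction p)
  case (pCons a p)
  have "pCons a p = [:a:] + [:0, 1:] * p" by simp
  then show ?case
    using pCons by (simp only: cpoly_at_pCons to_fract_add to_fract_mult mf_rat_add mf_rat_mult)
      (simp add: mf_const_def mf_z_def mf_rat_def)
qed simp

text \<open>The zero function carries the dummy order 0, so an exact order has to include that the
  function is nonzero on the curve.\<close>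

definition order_eq :: "mfun \<Rightarrow> point \<Rightarrow> mfun \<Rightarrow> int \<Rightarrow> bool" where
  "order_eq R P f m \<longleftrightarrow> \<not> R dvd f \<and> P f = m"

section \<open>The function field as a quotient ring, and the calculus of orders at a place\<close>

locale irreducible_curve =
  fixes R :: mfun
  assumes irreducible_R: "irreducible R"
begin

lemma prime_R: "R dvd f * g \<longleftrightarrow> R dvd f \<or> R dvd g"
  using field_poly_irreducible_imp_prime[OF irreducible_R] prime_elem_dvd_mult_iff by blast

lemma not_dvd_1 [simp]: "\<not> R dvd 1"
  using irreducible_R irreducible_def by blast

lemma not_dvd_const [simp]: "c \<noteq> 0 \<Longrightarrow> \<not> R dvd mf_const c"
  by (metis dvd_mult2 mf_const_inverse not_dvd_1)

lemma R_nonzero [simp]: "R \<noteq> 0"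
  using irreducible_R by auto

lemma degree_R_pos: "degree R > 0"
  using irreducible_R by (metis R_nonzero irreducible_def is_unit_iff_degree neq0_conv)

text \<open>The quotient by \<open>R\<close> is a field. An element of least degree in the ideal of
  \<open>f\<close> and \<open>R\<close> divides both generators by division with remainder; being a
  divisor of \<open>f\<close> it is not a multiple of \<open>R\<close>, so irreducibility makes it a
  unit.\<close>

lemma inverse_mod_R:
  assumes "\<not> R dvd f"
  obtains g where "R dvd f * g - 1" "\<not> R dvd g"
proof -
  define I where "I h \<longleftrightarrow> (\<exists>a b. h = f * a + R * b)" for h
  have I: "I (f * a + R * b)" for a b unfolding I_def by blast
  have IR: "I R" and If: "I f" using I[of 0 1] I[of 1 0] by simp_all
  then obtain g where g: "I g" "g \<noteq> 0" and min: "\<And>h. I h \<Longrightarrow> h \<noteq> 0 \<Longrightarrow> degree g \<le> degree h"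
    using ex_has_least_nat[of "\<lambda>g. I g \<and> g \<noteq> 0" R degree] R_nonzero by blast
  obtain a b where gab: "g = f * a + R * b" using g unfolding I_def by blast
  have dvd: "g dvd h" if hI: "I h" for h
  proof (rule ccontr)
    assume n: "\<not> g dvd h"
    obtain c d where h: "h = f * c + R * d" using hI unfolding I_def by blast
    have "h mod g = f * (c - a * (h div g)) + R * (d - b * (h div g))"
    proof -
      have "h mod g = h - g * (h div g)" by (rule minus_mult_div_eq_mod[symmetric])
      also have "\<dots> = (f * c + R * d) - (f * a + R * b) * (h div g)"
        by (rule arg_cong2[of _ _ _ _ "(-)"], rule h, rule arg_cong2[of _ _ _ _ "(*)"], rule gab, rule refl)
      also have "\<dots> = f * (c - a * (h div g)) + R * (d - b * (h div g))"
        by (simp only: algebra_simps)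
      finally show ?thesis .
    qed
    hence "I (h mod g)" using I by metis
    moreover have "h mod g \<noteq> 0" using n by (simp add: mod_eq_0_iff_dvd)
    ultimately show False using min[of "h mod g"] degree_mod_less[of g h] g(2) by auto
  qed
  have gR: "g dvd R" and gf: "g dvd f" using dvd IR If by blast+
  have "\<not> R dvd g" using gf assms dvd_trans by blast
  then have "is_unit g" using irreducible_R gR unfolding irreducible_altdef by blast
  then obtain u where u: "1 = g * u" by (rule dvdE)
  have "f * (a * u) - 1 = R * (- b * u)"
    by (subst u) (simp add: gab algebra_simps)
  hence 1: "R dvd f * (a * u) - 1" by (rule dvdI)
  moreover have "\<not> R dvd a * u"
  proof
    assume "R dvd a * u"
    hence "R dvd f * (a * u)" by (rule dvd_mult)
    hence "R dvd f * (a * u) - (f * (a * u) - 1)" using 1 by (rule dvd_diff)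
    moreover have "f * (a * u) - (f * (a * u) - 1) = 1" by (simp only: diff_diff_eq2 add_diff_cancel_left')
    ultimately show False using not_dvd_1 by metis
  qed
  ultimately show ?thesis using that by blast
qed

lemma dvd_cong: "R dvd f - g \<Longrightarrow> R dvd f \<longleftrightarrow> R dvd g"
  using dvd_add_right_iff[of R "f - g" g] by simp

end

locale place = irreducible_curve +
  fixes P :: point
  assumes point: "curve_point R P"
begin

abbreviation "ge \<equiv> order_ge R P"
abbreviation "eq \<equiv> order_eq R P"

lemma cong: "R dvd f - g \<Longrightarrow> P f = P g"
  using point unfolding curve_point_def by blast

lemma mult: "\<not> R dvd f \<Longrightarrow> \<not> R dvd g \<Longrightarrow> P (f * g) = P f + P g"
  using point unfolding curve_point_def by blast

lemma const [simp]: "P (mf_const c) = 0"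
  using point unfolding curve_point_def by blast

lemma one [simp]: "P 1 = 0"
  using const[of 1] by simp

lemma ge_cong: "R dvd f - g \<Longrightarrow> ge f m \<longleftrightarrow> ge g m"
  using cong[of f g] dvd_cong[of f g] by (auto simp: order_ge_def)

lemma eq_cong: "R dvd f - g \<Longrightarrow> eq f m \<longleftrightarrow> eq g m"
  using cong[of f g] dvd_cong[of f g] by (auto simp: order_eq_def)

lemma eq_not_dvd: "eq f m \<Longrightarrow> \<not> R dvd f"
  by (simp add: order_eq_def)

lemma eq_order: "\<not> R dvd f \<Longrightarrow> eq f (P f)"
  by (simp add: order_eq_def)

lemma eqD: "eq f m \<Longrightarrow> P f = m"
  by (simp add: order_eq_def)

lemma ge_dvd: "R dvd f \<Longrightarrow> ge f m"
  by (simp add: order_ge_def)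

lemma ge_0 [simp]: "ge 0 m"
  by (simp add: order_ge_def)

lemma ge_mono: "ge f m \<Longrightarrow> l \<le> m \<Longrightarrow> ge f l"
  by (auto simp: order_ge_def)

lemma ge_mult: "ge f m \<Longrightarrow> ge g l \<Longrightarrow> ge (f * g) (m + l)"
  by (cases "R dvd f"; cases "R dvd g") (use mult[of f g] in \<open>auto simp: order_ge_def\<close>)

text \<open>The axiom in \<open>curve_point\<close> covers only the case that both summands and the
  sum are nonzero; a vanishing summand is dropped by congruence modulo \<open>R\<close>.\<close>

lemma ge_add: "ge f m \<Longrightarrow> ge g m \<Longrightarrow> ge (f + g) m"
proof -
  assume *: "ge f m" "ge g m"
  consider "R dvd f" | "R dvd g" | "R dvd f + g" | "\<not> R dvd f" "\<not> R dvd g" "\<not> R dvd f + g" by blast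
  then show ?thesis
  proof cases
    case 1 then show ?thesis using ge_cong[of "f + g" g m] * by simp
  next
    case 2 then show ?thesis using ge_cong[of "f + g" f m] * by simp
  next
    case 4
    then have "min (P f) (P g) \<le> P (f + g)" using point unfolding curve_point_def by blast
    then show ?thesis using * 4 by (auto simp: order_ge_def)
  qed (simp add: order_ge_def)
qed

lemma ge_const [simp]: "ge (mf_const c) 0"
  by (simp add: order_ge_def)

lemma ge_1 [simp]: "ge 1 0"
  by (simp add: order_ge_def)

lemma ge_const_mult: "ge f m \<Longrightarrow> ge (mf_const c * f) m"
  using ge_mult[OF ge_const, of f m c] by simp

lemma ge_minus: "ge f m \<Longrightarrow> ge (- f) m"
  using ge_const_mult[of f m "- 1"] by (simp add: mf_const_uminus)

lemma ge_minus_iff [simp]: "ge (- f) m \<longleftrightarrow> ge f m"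
  using ge_minus[of f m] ge_minus[of "- f" m] by auto

lemma ge_diff: "ge f m \<Longrightarrow> ge g m \<Longrightarrow> ge (f - g) m"
  using ge_add[of f m "- g"] ge_minus[of g m] by simp

lemma ge_sum: "(\<And>i. i \<in> A \<Longrightarrow> ge (f i) m) \<Longrightarrow> ge (sum f A) m"
  by (induction A rule: infinite_finite_induct) (auto intro: ge_add)

lemma ge_power: "ge f m \<Longrightarrow> ge (f ^ n) (int n * m)"
proof (induction n)
  case (Suc n)
  then show ?case using ge_mult[of f m "f ^ n" "int n * m"] by (simp add: algebra_simps)
qed simp

lemma ge_cpoly_at: "ge f 0 \<Longrightarrow> ge (cpoly_at p f) 0"
proof (induction p)
  case (pCons a p)
  then show ?case using ge_mult[of f 0 "cpoly_at p f" 0] by (auto intro: ge_add)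
qed simp

lemma eq_mult: "eq f m \<Longrightarrow> eq g l \<Longrightarrow> eq (f * g) (m + l)"
  using mult[of f g] by (simp add: order_eq_def prime_R)

lemma eq_const [simp]: "c \<noteq> 0 \<Longrightarrow> eq (mf_const c) 0"
  by (simp add: order_eq_def)

lemma eq_1 [simp]: "eq 1 0"
  by (simp add: order_eq_def)

lemma eq_power: "eq f m \<Longrightarrow> eq (f ^ n) (int n * m)"
proof (induction n)
  case (Suc n)
  then show ?case using eq_mult[of f m "f ^ n" "int n * m"] by (simp add: algebra_simps)
qed simp

lemma eq_const_mult: "c \<noteq> 0 \<Longrightarrow> eq f m \<Longrightarrow> eq (mf_const c * f) m"
  using eq_mult[of "mf_const c" 0 f m] by simp

lemma eq_minus: "eq f m \<Longrightarrow> eq (- f) m"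
  using eq_const_mult[of "- 1" f m] by (simp add: mf_const_uminus)

lemma eq_minus_iff [simp]: "eq (- f) m \<longleftrightarrow> eq f m"
  using eq_minus[of f m] eq_minus[of "- f" m] by auto

lemma eq_imp_ge: "eq f m \<Longrightarrow> ge f m"
  by (simp add: order_ge_def order_eq_def)

lemma eq_ge: "eq f m \<Longrightarrow> l \<le> m \<Longrightarrow> ge f l"
  by (simp add: order_ge_def order_eq_def)

lemma eq_not_ge: "eq f m \<Longrightarrow> ge f l \<Longrightarrow> l \<le> m"
  by (simp add: order_ge_def order_eq_def)

lemma eqI: "ge f m \<Longrightarrow> \<not> ge f (m + 1) \<Longrightarrow> eq f m"
  by (auto simp: order_ge_def order_eq_def)

lemma eq_unique: "eq f m \<Longrightarrow> eq f l \<Longrightarrow> m = l"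
  by (auto simp: order_eq_def)

text \<open>If the sum had larger order, subtracting \<open>g\<close> would raise the order of
  \<open>f\<close>: terms of distinct order cannot cancel.\<close>

lemma eq_add: 
  assumes f: "eq f m" and g: "ge g (m + 1)"
  shows "eq (f + g) m"
proof (rule eqI)
  show "ge (f + g) m" using ge_add[OF eq_imp_ge[OF f] ge_mono[OF g]] by simp
  show "\<not> ge (f + g) (m + 1)"
  proof
    assume "ge (f + g) (m + 1)"
    then have "ge (f + g - g) (m + 1)" using g by (rule ge_diff)
    then show False using eq_not_ge[OF f, of "m + 1"] by simp
  qed
qed

lemma eq_add': "ge f (m + 1) \<Longrightarrow> eq g m \<Longrightarrow> eq (f + g) m"
  using eq_add[of g m f] by (simp add: add.commute)

lemma eq_diff: "eq f m \<Longrightarrow> ge g (m + 1) \<Longrightarrow> eq (f - g) m"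
  using eq_add[of f m "- g"] by simp

lemma eq_diff': "ge f (m + 1) \<Longrightarrow> eq g m \<Longrightarrow> eq (f - g) m"
  using eq_add'[of f m "- g"] by simp

lemma ge_mult_cancel: "eq g l \<Longrightarrow> ge (g * f) (l + m) \<Longrightarrow> ge f m"
  by (cases "R dvd f") (use mult[of g f] in \<open>auto simp: order_ge_def order_eq_def prime_R\<close>)

lemma eq_mult_cancel: "eq g l \<Longrightarrow> eq (g * f) (l + m) \<Longrightarrow> eq f m"
  using mult[of g f] by (auto simp: order_eq_def prime_R)

lemma eq_inverse:
  assumes "eq f m" "R dvd f * g - 1"
  shows "eq g (- m)"
proof (rule eq_mult_cancel[OF assms(1)])
  show "eq (f * g) (m + - m)" using eq_cong[OF assms(2), of 0] by simp
qed

lemma dvd_zero: "R dvd f \<Longrightarrow> P f = 0"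
proof -
  have "\<forall>f. R dvd f \<longrightarrow> P f = 0" using point unfolding curve_point_def by (elim conjE)
  then show "R dvd f \<Longrightarrow> P f = 0" by (elim allE impE)
qed

lemma pos_not_dvd: "P f \<noteq> 0 \<Longrightarrow> \<not> R dvd f"
  using dvd_zero[of f] by auto

lemma ex_uniformizer: "\<exists>f. eq f 1"
proof -
  have "\<exists>f. P f = 1" using point unfolding curve_point_def by (elim conjE)
  then obtain f where f: "P f = 1" by (rule exE)
  then have "\<not> R dvd f" using pos_not_dvd by simp
  with f show ?thesis unfolding order_eq_def by (intro exI[of _ f] conjI)
qed

lemma ex_order: "\<exists>f. eq f m"
proof -
  obtain u where u: "eq u 1" using ex_uniformizer by blast
  then obtain v where v: "R dvd u * v - 1" using inverse_mod_R[OF eq_not_dvd[OF u]] by blast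
  have "eq v (- 1)" using u v by (rule eq_inverse)
  then have "eq (v ^ nat (- m)) (int (nat (- m)) * - 1)" by (rule eq_power)
  moreover have "eq (u ^ nat m) (int (nat m) * 1)" using u by (rule eq_power)
  moreover have "int (nat (- m)) * - 1 = m \<or> int (nat m) * 1 = m" by linarith
  ultimately show ?thesis by metis
qed

text \<open>Here the algebraic closedness of the constants is used.\<close>

lemma eq_cpoly_at:
  assumes "p \<noteq> 0" "\<And>c. eq (f - mf_const c) 0"
  shows "eq (cpoly_at p f) 0"
  using assms(1)
proof (induction "degree p" arbitrary: p)
  case 0
  then obtain c where "p = [:c:]" by (metis degree_eq_zeroE)
  with 0 show ?case by simp
next
  case (Suc d)
  then have "\<not> constant (poly p)" by (simp add: constant_degree)
  then obtain a where "poly p a = 0" using fundamental_theorem_of_algebra by blast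
  then obtain q where q: "p = [:- a, 1:] * q" by (auto simp: poly_eq_0_iff_dvd elim: dvdE)
  have "q \<noteq> 0" using Suc q by auto
  then have "degree p = Suc (degree q)" by (subst q, subst degree_mult_eq) auto
  with Suc(2) \<open>q \<noteq> 0\<close> have "eq (cpoly_at q f) 0" by (intro Suc(1)) simp_all
  then have "eq ((f - mf_const a) * cpoly_at q f) 0"
    using eq_mult[OF assms(2)] by fastforce
  then show ?case by (simp only: q cpoly_at_linear_factor)
qed

text \<open>Over the complex numbers \<open>p\<close> splits into linear factors. Factors that are
  units at the place are cancelled one by one; since a nonzero constant has order 0, some factor
  \<open>f - c\<close> must have positive order. This is what produces values of functions at a
  place.\<close>

lemma ge_cpoly_root:
  assumes "p \<noteq> 0" "ge f 0" "ge (cpoly_at p f) 1"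
  obtains c where "poly p c = 0" "ge (f - mf_const c) 1"
proof -
  have "\<exists>c. poly p c = 0 \<and> ge (f - mf_const c) 1"
    using assms(1, 3)
  proof (induction "degree p" arbitrary: p)
    case 0
    then obtain c where "p = [:c:]" by (metis degree_eq_zeroE)
    with 0 show ?case using eq_not_ge[OF eq_const, of c 1] by auto
  next
    case (Suc d)
    then have "\<not> constant (poly p)" by (simp add: constant_degree)
    then obtain a where a: "poly p a = 0" using fundamental_theorem_of_algebra by blast
    then obtain q where q: "p = [:- a, 1:] * q" by (auto simp: poly_eq_0_iff_dvd elim: dvdE)
    show ?case
    proof (cases "ge (f - mf_const a) 1")
      case False
      have "ge (f - mf_const a) 0" using assms(2) by (intro ge_diff) auto
      with False have "eq (f - mf_const a) 0" by (intro eqI) auto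
      moreover have "ge ((f - mf_const a) * cpoly_at q f) 1"
        using Suc by (simp only: q cpoly_at_linear_factor)
      ultimately have "ge (cpoly_at q f) 1" using ge_mult_cancel[of "f - mf_const a" 0 _ 1] by simp
      moreover have "q \<noteq> 0" using Suc q by auto
      moreover from this have "degree p = Suc (degree q)" by (subst q, subst degree_mult_eq) auto
      ultimately obtain c where "poly q c = 0" "ge (f - mf_const c) 1"
        using Suc.hyps by (metis Suc_inject)
      then show ?thesis by (intro exI[of _ c]) (simp add: q)
    qed (use a in auto)
  qed
  with that show ?thesis by blast
qed

end

text \<open>Stated for indexed families, in which a vector may be repeated; \<open>span S\<close>
  with finite \<open>S\<close> takes the place of a dimension bound.\<close>

lemma (in vector_space) ex_nontrivial_combination:
  assumes "finite I" "finite S" "card S < card I" "\<And>i. i \<in> I \<Longrightarrow> g i \<in> span S"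
  shows "\<exists>c. (\<exists>i\<in>I. c i \<noteq> 0) \<and> (\<Sum>i\<in>I. scale (c i) (g i)) = 0"
proof (cases "inj_on g I")
  case True
  have "dependent (g ` I)"
  proof (rule ccontr)
    assume "\<not> dependent (g ` I)"
    then have "card (g ` I) \<le> card S"
      using independent_span_bound[of S "g ` I"] assms by blast
    then show False using card_image[OF True] assms(3) by simp
  qed
  then obtain u where u: "\<exists>v\<in>g ` I. u v \<noteq> 0" "(\<Sum>v\<in>g ` I. scale (u v) v) = 0"
    using dependent_finite[of "g ` I"] assms(1) by auto
  then show ?thesis
    by (intro exI[of _ "u \<circ> g"]) (simp add: sum.reindex[OF True])
next
  case False
  then obtain i j where ij: "i \<in> I" "j \<in> I" "i \<noteq> j" "g i = g j" by (auto simp: inj_on_def)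
  \<comment> \<open>A repeated vector already gives a relation, with coefficients 1 and -1.\<close>
  let ?c = "\<lambda>k. if k = i then 1 else if k = j then - 1 else 0"
  have "(\<Sum>k\<in>I. scale (?c k) (g k)) = (\<Sum>k\<in>{i, j}. scale (?c k) (g k))"
    using ij assms(1) by (intro sum.mono_neutral_right) auto
  also have "\<dots> = 0" using ij by simp
  finally show ?thesis using ij by (intro exI[of _ ?c]) auto
qed

section \<open>Linear algebra over the constants and over the rational functions of
  \<open>z\<close>\<close>

interpretation mf: vector_space "\<lambda>c f. mf_const c * f"
  by unfold_locales (simp_all add: mf_const_add mf_const_mult algebra_simps)

interpretation rat: vector_space "smult :: complex poly fract \<Rightarrow> mfun \<Rightarrow> mfun"
  by unfold_locales (simp_all add: smult_add_right smult_add_left)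

lemma int_mult_ge_1: "0 < (a::int) \<Longrightarrow> 0 < s \<Longrightarrow> 1 \<le> int s * a"
  using mult_mono[of 1 "int s" 1 a] by simp

lemma int_mult_le_uminus: "(a::int) < 0 \<Longrightarrow> int s * a \<le> - int s"
  using mult_left_mono[of a "- 1" "int s"] by simp

lemma mf_rat_mult_eq_smult: "mf_rat r * f = smult r f"
  by (simp add: mf_rat_def)

lemma mf_z_mult_zinv: "mf_z * mf_zinv = 1"
  by (simp add: mf_z_def mf_zinv_def)

lemma cpoly_at_pcompose: "cpoly_at (pcompose p q) f = cpoly_at p (cpoly_at q f)"
  by (induction p) (simp_all add: pcompose_pCons cpoly_at_add cpoly_at_mult)

lemma cpoly_at_z_eq_0_iff: "cpoly_at p mf_z = 0 \<longleftrightarrow> p = 0"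
  by (simp add: cpoly_at_z)

text \<open>The local parameters of the projective line at its points: \<open>1/z\<close> at
  infinity and \<open>z - c\<close> at \<open>c\<close>. The ramification index of a place is the
  order of the parameter at the point below it.\<close>

definition z_parameter :: "mfun \<Rightarrow> bool" where
  "z_parameter f \<longleftrightarrow> f = mf_zinv \<or> (\<exists>c. f = mf_z - mf_const c)"

text \<open>Reversing the coefficients turns a polynomial in \<open>z\<close> into one in
  \<open>1/z\<close>, so that \<open>z = \<infinity>\<close> can be treated like the finite
  values.\<close>

lemma cpoly_at_zinv:
  assumes "degree p \<le> n"
  shows "\<exists>p'. cpoly_at p mf_z * mf_zinv ^ n = cpoly_at p' mf_zinv"
proof (rule exI)
  have "mf_z ^ l * mf_zinv ^ n = mf_zinv ^ (n - l)" if "l \<le> n" for l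
  proof -
    have "mf_zinv ^ n = mf_zinv ^ l * mf_zinv ^ (n - l)" using that by (simp flip: power_add)
    then show ?thesis
      by (simp add: power_mult_distrib[symmetric] mf_z_mult_zinv mult.assoc[symmetric])
  qed
  then show "cpoly_at p mf_z * mf_zinv ^ n =
      cpoly_at (\<Sum>l\<le>n. monom (coeff p l) (n - l)) mf_zinv"
  proof -
    assume *: "\<And>l. l \<le> n \<Longrightarrow> mf_z ^ l * mf_zinv ^ n = mf_zinv ^ (n - l)"
    have sum: "cpoly_at (sum q {..m}) f = (\<Sum>l\<le>m. cpoly_at (q l) f)" for q f and m :: nat
      by (induction m) (simp_all add: cpoly_at_add)
    show ?thesis
      by (simp add: cpoly_at_altdef[OF assms] sum cpoly_at_monom sum_distrib_right mult.assoc *)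
  qed
qed

lemma clear_denominators:
  assumes "finite I"
  shows "\<exists>q. q \<noteq> 0 \<and> (\<forall>i\<in>I. \<exists>p. mf_rat (r i) * cpoly_at q mf_z = cpoly_at p mf_z)"
  using assms
proof (induction I)
  case (insert i I)
  then obtain q where q: "q \<noteq> 0" "\<forall>i\<in>I. \<exists>p. mf_rat (r i) * cpoly_at q mf_z = cpoly_at p mf_z"
    by blast
  obtain a b where "r i = Fract a b" and b: "b \<noteq> 0" by (cases "r i")
  then have ab: "r i = to_fract a / to_fract b" "b \<noteq> 0" by (simp_all add: Fract_conv_to_fract)
  have "mf_rat (r i) * cpoly_at (q * b) mf_z = cpoly_at (q * a) mf_z"
    using ab by (simp add: cpoly_at_z mf_rat_mult[symmetric] mult.commute)
  moreover have "\<exists>p. mf_rat (r j) * cpoly_at (q * b) mf_z = cpoly_at p mf_z" if j: "j \<in> I" for j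
  proof -
    obtain p where "mf_rat (r j) * cpoly_at q mf_z = cpoly_at p mf_z" using q j by blast
    then have "mf_rat (r j) * cpoly_at (q * b) mf_z = cpoly_at (p * b) mf_z"
      by (simp add: cpoly_at_mult mult.assoc[symmetric])
    then show ?thesis by blast
  qed
  ultimately show ?case using q ab by (intro exI[of _ "q * b"]) auto
qed (auto intro: exI[of _ 1])

context irreducible_curve
begin

text \<open>Remainders modulo \<open>R\<close> lie in the span of
  \<open>1, k, ..., k ^ (degree R - 1)\<close> over the rational functions, a space of dimension
  \<open>degree R\<close>.\<close>

lemma ex_dependency_rat:
  assumes "finite I" "degree R < card I"
  shows "\<exists>r. (\<exists>i\<in>I. r i \<noteq> 0) \<and> R dvd (\<Sum>i\<in>I. mf_rat (r i) * u i)"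
proof -
  let ?S = "(\<lambda>l. monom 1 l :: mfun) ` {..<degree R}"
  have span: "f \<in> rat.span ?S" if "degree f < degree R" for f
  proof -
    have "f = (\<Sum>l<degree R. smult (coeff f l) (monom 1 l))"
      using poly_as_sum_of_monoms'[of f "degree R - 1"] that
      by (simp add: smult_monom lessThan_Suc_atMost[symmetric])
    moreover have "(\<Sum>l<degree R. smult (coeff f l) (monom 1 l)) \<in> rat.span ?S"
      by (intro rat.span_sum rat.span_scale rat.span_base) auto
    ultimately show ?thesis by simp
  qed
  have "card ?S < card I" using card_image_le[of "{..<degree R}" "\<lambda>l. monom 1 l :: mfun"] assms by simp
  moreover have "u i mod R \<in> rat.span ?S" for i
    using degree_mod_less[OF R_nonzero, of "u i"] degree_R_pos by (intro span) auto
  ultimately obtain c where c: "\<exists>i\<in>I. c i \<noteq> 0" "(\<Sum>i\<in>I. smult (c i) (u i mod R)) = 0"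
    using rat.ex_nontrivial_combination[of I ?S "\<lambda>i. u i mod R"] assms(1) by auto
  have "R dvd (\<Sum>i\<in>I. mf_rat (c i) * u i) - (\<Sum>i\<in>I. smult (c i) (u i mod R))"
    unfolding sum_subtractf[symmetric]
    by (intro dvd_sum) (simp add: mf_rat_mult_eq_smult smult_diff_right[symmetric] dvd_smult
        minus_mod_eq_mult_div)
  then show ?thesis using c by auto
qed

text \<open>Denominators are cleared and the coefficients are rewritten as polynomials in the
  parameter \<open>f\<close> itself; only then can they be reduced at the zeros of
  \<open>f\<close>.\<close>

lemma ex_dependency:
  assumes "z_parameter f" "finite I" "degree R < card I"
  shows "\<exists>p. (\<exists>i\<in>I. p i \<noteq> 0) \<and> R dvd (\<Sum>i\<in>I. cpoly_at (p i) f * u i)"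
proof -
  obtain r where r: "\<exists>i\<in>I. r i \<noteq> 0" "R dvd (\<Sum>i\<in>I. mf_rat (r i) * u i)"
    using ex_dependency_rat[OF assms(2,3)] by blast
  obtain q p where q: "q \<noteq> 0" and p: "\<And>i. i \<in> I \<Longrightarrow> mf_rat (r i) * cpoly_at q mf_z = cpoly_at (p i) mf_z"
    using clear_denominators[OF assms(2), of r] by metis
  have p0: "p i \<noteq> 0" if "i \<in> I" "r i \<noteq> 0" for i
    using p[OF that(1)] that q by (auto simp: cpoly_at_z)
  have "R dvd (\<Sum>i\<in>I. mf_rat (r i) * u i) * cpoly_at q mf_z" using r(2) by simp
  also have "(\<Sum>i\<in>I. mf_rat (r i) * u i) * cpoly_at q mf_z = (\<Sum>i\<in>I. cpoly_at (p i) mf_z * u i)"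
    unfolding sum_distrib_right by (intro sum.cong refl) (simp add: p[symmetric] mult_ac)
  finally have dvd: "R dvd (\<Sum>i\<in>I. cpoly_at (p i) mf_z * u i)" .
  from assms(1) consider "f = mf_zinv" | c where "f = mf_z - mf_const c" by (auto simp: z_parameter_def)
  then show ?thesis
  proof cases
    case 1
    define n where "n = (\<Sum>i\<in>I. degree (p i))"
    have "degree (p i) \<le> n" if "i \<in> I" for i
      using assms(2) that unfolding n_def by (intro member_le_sum) auto
    then have "\<forall>i\<in>I. \<exists>p'. cpoly_at (p i) mf_z * mf_zinv ^ n = cpoly_at p' mf_zinv"
      using cpoly_at_zinv by blast
    then obtain p' where p': "\<And>i. i \<in> I \<Longrightarrow> cpoly_at (p i) mf_z * mf_zinv ^ n = cpoly_at (p' i) mf_zinv"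
      by metis
    have "p' i \<noteq> 0" if "i \<in> I" "r i \<noteq> 0" for i
      using p'[OF that(1)] p0[OF that] mf_z_mult_zinv by (auto simp: cpoly_at_z_eq_0_iff)
    moreover have "R dvd (\<Sum>i\<in>I. cpoly_at (p' i) mf_zinv * u i)"
    proof -
    have "R dvd (\<Sum>i\<in>I. cpoly_at (p i) mf_z * u i) * mf_zinv ^ n" using dvd by simp
    also have "(\<Sum>i\<in>I. cpoly_at (p i) mf_z * u i) * mf_zinv ^ n = (\<Sum>i\<in>I. cpoly_at (p' i) mf_zinv * u i)"
      unfolding sum_distrib_right by (intro sum.cong refl) (simp add: p'[symmetric] mult_ac)
    finally show ?thesis .
    qed
    ultimately show ?thesis using r 1 by blast
  next
    case 2
    have "cpoly_at (pcompose (p i) [:c, 1:]) f = cpoly_at (p i) mf_z" for i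
      by (simp add: cpoly_at_pcompose 2)
    moreover have "pcompose (p i) [:c, 1:] \<noteq> 0" if "i \<in> I" "r i \<noteq> 0" for i
      using p0[OF that] by (simp add: pcompose_eq_0_iff)
    ultimately show ?thesis using r dvd by (intro exI[of _ "\<lambda>i. pcompose (p i) [:c, 1:]"]) auto
  qed
qed

text \<open>As long as all constant terms vanish, \<open>f\<close> is a common factor and can be
  cancelled because \<open>R\<close> is prime; the sum of the degrees decreases.\<close>

lemma ex_reduced_dependency:
  assumes "\<not> R dvd f" "finite I" "\<exists>i\<in>I. p i \<noteq> 0" "R dvd (\<Sum>i\<in>I. cpoly_at (p i) f * u i)"
  shows "\<exists>p. (\<exists>i\<in>I. coeff (p i) 0 \<noteq> 0) \<and> R dvd (\<Sum>i\<in>I. cpoly_at (p i) f * u i)"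
  using assms(3,4)
proof (induction "\<Sum>i\<in>I. degree (p i)" arbitrary: p rule: less_induct)
  case less
  show ?case
  proof (cases "\<exists>i\<in>I. coeff (p i) 0 \<noteq> 0")
    case False
    define p' where "p' i = poly_shift 1 (p i)" for i
    have p: "p i = pCons 0 (p' i)" if "i \<in> I" for i
      using that False unfolding p'_def
      by (intro poly_eqI) (auto simp: coeff_pCons coeff_poly_shift split: nat.splits)
    obtain j where j: "j \<in> I" "p j \<noteq> 0" using less by blast
    have "(\<Sum>i\<in>I. cpoly_at (p i) f * u i) = f * (\<Sum>i\<in>I. cpoly_at (p' i) f * u i)"
      unfolding sum_distrib_left by (intro sum.cong refl) (simp add: p mult_ac)
    then have "R dvd (\<Sum>i\<in>I. cpoly_at (p' i) f * u i)"
      using less.prems(2) assms(1) by (simp add: prime_R)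
    moreover have "p' j \<noteq> 0" using j p by auto
    moreover have "(\<Sum>i\<in>I. degree (p' i)) < (\<Sum>i\<in>I. degree (p i))"
    proof (rule sum_strict_mono_ex1[OF assms(2)])
      show "\<exists>a\<in>I. degree (p' a) < degree (p a)" using j p by (intro bexI[of _ j]) auto
    qed (simp add: p)
    ultimately show ?thesis using less.hyps[of p'] j by blast
  qed (use less in blast)
qed

section \<open>Independence and approximation of places\<close>

lemma placeI: "curve_point R P \<Longrightarrow> place R P"
  by unfold_locales

text \<open>A discrete valuation ring is a maximal proper subring of its field. If every function
  integral at \<open>P\<close> were integral at \<open>Q\<close>, units at \<open>P\<close> would be
  units at \<open>Q\<close>, which makes \<open>Q\<close> a multiple of \<open>P\<close>; both are
  normalized, so the factor is 1.\<close>

lemma ex_not_ge: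
  assumes P: "curve_point R P" and Q: "curve_point R Q" and ne: "P \<noteq> Q"
  shows "\<exists>f. order_ge R P f 0 \<and> \<not> order_ge R Q f 0"
proof (rule ccontr)
  interpret P: place R P using P by (rule placeI)
  interpret Q: place R Q using Q by (rule placeI)
  assume "\<not> ?thesis"
  then have imp: "Q.ge f 0" if "P.ge f 0" for f using that by blast
  have unit: "Q.eq f 0" if f: "P.eq f 0" for f
  proof -
    obtain g where g: "R dvd f * g - 1" using inverse_mod_R[OF P.eq_not_dvd[OF f]] by blast
    have "P.eq g 0" using P.eq_inverse[OF f g] by simp
    then have "Q.ge g 0" "Q.ge f 0" using imp f P.eq_imp_ge by auto
    moreover have f': "Q.eq f (Q f)" using Q.eq_order P.eq_not_dvd[OF f] .
    moreover have "Q.eq g (- Q f)" using Q.eq_inverse[OF f' g] .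
    ultimately have "Q f = 0" using Q.eq_not_ge[of g "- Q f" 0] Q.eq_not_ge[of f "Q f" 0] by linarith
    then show ?thesis using f' by simp
  qed
  obtain u where u: "P.eq u 1" using P.ex_uniformizer by blast
  obtain v where v: "R dvd u * v - 1" using inverse_mod_R[OF P.eq_not_dvd[OF u]] by blast
  have Pv: "P.eq v (- 1)" using P.eq_inverse[OF u v] .
  have Qu: "Q.eq u (Q u)" using Q.eq_order P.eq_not_dvd[OF u] .
  have Qv: "Q.eq v (- Q u)" using Q.eq_inverse[OF Qu v] .
  have u0: "Q u \<ge> 0" using Q.eq_not_ge[OF Qu imp] P.eq_ge[OF u] by simp
  \<comment> \<open>A power of a uniformizer of \<open>P\<close> or of its inverse turns
    \<open>f\<close> into a unit at \<open>P\<close>, hence at \<open>Q\<close>, and the order of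
    \<open>f\<close> at \<open>Q\<close> can be read off.\<close>
  have main: "Q f = P f * Q u" if f: "\<not> R dvd f" for f
  proof (cases "P f \<ge> 0")
    case True
    have "P.eq (f * v ^ nat (P f)) (P f + int (nat (P f)) * - 1)"
      by (intro P.eq_mult P.eq_power P.eq_order f Pv)
    then have "Q.eq (f * v ^ nat (P f)) 0" using True unit by simp
    moreover have "Q.eq (f * v ^ nat (P f)) (Q f + int (nat (P f)) * - Q u)"
      by (intro Q.eq_mult Q.eq_power Q.eq_order f Qv)
    ultimately have "Q f + int (nat (P f)) * - Q u = 0" using Q.eq_unique by blast
    then show ?thesis using True by simp
  next
    case False
    have "P.eq (f * u ^ nat (- P f)) (P f + int (nat (- P f)) * 1)"
      by (intro P.eq_mult P.eq_power P.eq_order f u)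
    then have "Q.eq (f * u ^ nat (- P f)) 0" using False unit by simp
    moreover have "Q.eq (f * u ^ nat (- P f)) (Q f + int (nat (- P f)) * Q u)"
      by (intro Q.eq_mult Q.eq_power Q.eq_order f Qu)
    ultimately have "Q f + int (nat (- P f)) * Q u = 0" using Q.eq_unique by blast
    then show ?thesis using False by simp
  qed
  obtain w where w: "Q.eq w 1" using Q.ex_uniformizer by blast
  then have "P w * Q u = 1" using main[OF Q.eq_not_dvd[OF w]] Q.eqD[OF w] by simp
  then have Qu1: "Q u = 1" using u0 zmult_eq_1_iff[of "P w" "Q u"] by auto
  have "P = Q"
  proof
    fix f
    show "P f = Q f"
    proof (cases "R dvd f")
      case True
      then show ?thesis using P.dvd_zero Q.dvd_zero by simp
    next
      case False
      then show ?thesis using main[OF False] Qu1 by simp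
    qed
  qed
  then show False using ne by simp
qed

text \<open>The quotient \<open>a / b\<close> works, where \<open>a\<close> is integral at
  \<open>P\<close> but not at \<open>Q\<close> and \<open>b\<close> conversely: strictness comes
  from the denominator at \<open>P\<close> and from the numerator at \<open>Q\<close>.\<close>

lemma ex_separating:
  assumes P: "curve_point R P" and Q: "curve_point R Q" and ne: "P \<noteq> Q"
  shows "\<exists>f. \<not> R dvd f \<and> P f > 0 \<and> Q f < 0"
proof -
  interpret P: place R P using P by (rule placeI)
  interpret Q: place R Q using Q by (rule placeI)
  obtain a where a: "P.ge a 0" "\<not> Q.ge a 0" using ex_not_ge[OF P Q ne] by blast
  obtain b where b: "Q.ge b 0" "\<not> P.ge b 0" using ex_not_ge[OF Q P ne[symmetric]] by blast
  have nd: "\<not> R dvd a" "\<not> R dvd b" using a b P.ge_dvd Q.ge_dvd by blast+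
  obtain c where c: "R dvd b * c - 1" "\<not> R dvd c" using inverse_mod_R[OF nd(2)] by blast
  have "P c = - P b" "Q c = - Q b"
    using P.eqD[OF P.eq_inverse[OF P.eq_order c(1)]] Q.eqD[OF Q.eq_inverse[OF Q.eq_order c(1)]] nd by auto
  then have "P (a * c) > 0" "Q (a * c) < 0"
    using a b nd c P.mult[of a c] Q.mult[of a c] by (auto simp: order_ge_def)
  then show ?thesis using nd c by (intro exI[of _ "a * c"]) (auto simp: prime_R)
qed

lemma ex_separating_set:
  assumes "finite S" "curve_point R P" "\<And>Q. Q \<in> S \<Longrightarrow> curve_point R Q" "P \<notin> S"
  shows "\<exists>f. \<not> R dvd f \<and> P f > 0 \<and> (\<forall>Q\<in>S. Q f < 0)"
  using assms(1,3,4)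
proof (induction S)
  case empty
  interpret P: place R P using assms(2) by (rule placeI)
  from P.ex_uniformizer show ?case by (auto simp: order_eq_def)
next
  case (insert Q0 S)
  interpret P: place R P using assms(2) by (rule placeI)
  interpret Q0: place R Q0 using insert by (intro placeI) auto
  obtain y where y: "\<not> R dvd y" "P y > 0" "\<forall>Q\<in>S. Q y < 0" using insert by auto
  obtain z where z: "\<not> R dvd z" "P z > 0" "Q0 z < 0"
    using ex_separating[OF assms(2) Q0.point] insert by auto
  show ?case
  proof (cases "Q0 y < 0")
    case False
    \<comment> \<open>Where \<open>z\<close> has a pole in \<open>S\<close>, the exponent makes the
      pole of \<open>z ^ m\<close> exceed that of \<open>y\<close>; where \<open>z\<close> is
      regular, \<open>y\<close> dominates. So no pole of the sum is lost.\<close>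
    define m where "m = Suc (\<Sum>Q\<in>S. nat \<bar>Q y\<bar>)"
    have m: "int m > - Q y" if "Q \<in> S" for Q
    proof -
      have "nat \<bar>Q y\<bar> \<le> (\<Sum>Q\<in>S. nat \<bar>Q y\<bar>)" using insert that by (intro member_le_sum) auto
      then show ?thesis unfolding m_def by linarith
    qed
    have "Q0.eq (y + z ^ m) (int m * Q0 z)"
    proof (rule Q0.eq_add')
      have "int m * Q0 z \<le> - 1" 
      proof -
        have "1 \<le> int m" by (simp add: m_def)
        then show ?thesis using int_mult_le_uminus[OF z(3), of m] by linarith
      qed
      then show "Q0.ge y (int m * Q0 z + 1)" using False by (simp add: order_ge_def)
      show "Q0.eq (z ^ m) (int m * Q0 z)" using z by (intro Q0.eq_power Q0.eq_order)
    qed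
    moreover have "int m * Q0 z < 0" using z(3) by (intro mult_pos_neg) (simp_all only: m_def of_nat_0_less_iff zero_less_Suc)
    ultimately have 1: "\<not> R dvd y + z ^ m" "Q0 (y + z ^ m) < 0" by (auto simp: order_eq_def)
    have "int m * P z \<ge> 1" using z(2) by (intro int_mult_ge_1) (simp_all add: m_def)
    then have "P.ge (y + z ^ m) 1"
      using y z P.eq_power[OF P.eq_order[OF z(1)], of m]
      by (intro P.ge_add) (auto simp: order_ge_def order_eq_def)
    then have 2: "P (y + z ^ m) > 0" using 1 by (simp add: order_ge_def)
    have "Q (y + z ^ m) < 0" if Q: "Q \<in> S" for Q
    proof -
      interpret Q: place R Q using insert Q by (intro placeI) auto
      have zm: "Q.eq (z ^ m) (int m * Q z)" using z by (intro Q.eq_power Q.eq_order)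
      have yy: "Q.eq y (Q y)" using y by (intro Q.eq_order)
      show ?thesis
      proof (cases "Q z < 0")
        case True
        have "int m * Q z \<le> - int m" using True by (rule int_mult_le_uminus)
        then have lt: "int m * Q z < Q y" using m[OF Q] by linarith
        then have "Q.eq (y + z ^ m) (int m * Q z)"
          by (intro Q.eq_add' zm Q.eq_ge[OF yy]) simp
        then show ?thesis using Q.eqD lt y(3) Q by fastforce
      next
        case False
        then have "int m * Q z \<ge> 0" by simp
        moreover have "Q y < 0" using y(3) Q by blast
        ultimately have "Q.eq (y + z ^ m) (Q y)"
          by (intro Q.eq_add yy Q.eq_ge[OF zm]) simp
        then show ?thesis using Q.eqD y(3) Q by fastforce
      qed
    qed
    then show ?thesis using 1 2 by (intro exI[of _ "y + z ^ m"]) auto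
  qed (use y in auto)
qed

text \<open>Weak approximation. With \<open>x\<close> vanishing at \<open>P\<close> and having poles
  at the other points, \<open>1 / (1 + x ^ s)\<close> is close to 1 at \<open>P\<close> and to 0 at
  the others; a function of order \<open>j\<close> at \<open>P\<close> is multiplied by it.\<close>

lemma ex_approximation:
  assumes "finite S" "P \<in> S" "\<And>Q. Q \<in> S \<Longrightarrow> curve_point R Q"
  shows "\<exists>u. order_eq R P u j \<and> (\<forall>Q\<in>S - {P}. order_ge R Q u N)"
proof -
  interpret P: place R P using assms by (intro placeI) auto
  obtain x where x: "\<not> R dvd x" "P x > 0" "\<forall>Q\<in>S - {P}. Q x < 0"
    using ex_separating_set[of "S - {P}" P] assms by auto
  obtain w where w: "P.eq w j" using P.ex_order by blast
  \<comment> \<open>Large enough to outweigh both \<open>N\<close> and the poles of \<open>w\<close>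
    at the other points.\<close>
  define s where "s = Suc (nat \<bar>N\<bar> + (\<Sum>Q\<in>S. nat \<bar>Q w\<bar>))"
  have xs: "P.eq (x ^ s) (int s * P x)" using x by (intro P.eq_power P.eq_order)
  have "int s * P x \<ge> 1" using x(2) by (intro int_mult_ge_1) (simp_all add: s_def)
  then have "P.eq (1 + x ^ s) 0" by (intro P.eq_add P.eq_1 P.eq_ge[OF xs]) simp
  note d = this
  obtain g where g: "R dvd (1 + x ^ s) * g - 1" using inverse_mod_R[OF P.eq_not_dvd[OF d]] by blast
  have "P.eq (w * g) (j + - 0)" by (intro P.eq_mult w P.eq_inverse[OF d g])
  moreover have "order_ge R Q (w * g) N" if Q: "Q \<in> S - {P}" for Q
  proof -
    interpret Q: place R Q using assms Q by (intro placeI) auto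
    have "nat \<bar>Q w\<bar> \<le> (\<Sum>Q\<in>S. nat \<bar>Q w\<bar>)" using assms Q by (intro member_le_sum) auto
    then have s: "int s \<ge> N - Q w" "int s \<ge> 1" unfolding s_def by linarith+
    have xs: "Q.eq (x ^ s) (int s * Q x)" using x by (intro Q.eq_power Q.eq_order)
    have "Q x < 0" using x(3) Q by blast
    then have le: "int s * Q x \<le> - int s" by (rule int_mult_le_uminus)
    then have dQ: "Q.eq (1 + x ^ s) (int s * Q x)"
      using s by (intro Q.eq_add' xs Q.ge_mono[OF Q.ge_1]) simp
    have "Q.eq (w * g) (Q w + - (int s * Q x))"
      using P.eq_not_dvd[OF w] by (intro Q.eq_mult Q.eq_order Q.eq_inverse[OF dQ g])
    then show ?thesis using le s by (intro Q.eq_ge) auto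
  qed
  ultimately show ?thesis by (intro exI[of _ "w * g"]) simp
qed

end

section \<open>Ramification and principal divisors\<close>

context irreducible_curve
begin

text \<open>
  The elements \<open>u\<close> have order \<open>j < e\<^sub>P\<close> at \<open>P\<close> and large order at the other zeros; a
  relation is then refuted by the term of smallest order.
\<close>

lemma ex_independent_at_zeros:
  assumes S: "finite S" "\<And>P. P \<in> S \<Longrightarrow> curve_point R P \<and> P f > 0" and f: "\<not> R dvd f"
  shows "\<exists>u. \<forall>p. R dvd (\<Sum>i\<in>Sigma S (\<lambda>P. {..<nat (P f)}). cpoly_at (p i) f * u i) \<longrightarrow>
    (\<forall>i\<in>Sigma S (\<lambda>P. {..<nat (P f)}). p i = 0)"
proof -
  define I where "I = Sigma S (\<lambda>P. {..<nat (P f)})"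
  have fin: "finite I" unfolding I_def using S(1) by auto
  \<comment> \<open>An upper bound for all the orders \<open>P f\<close>, so that at a zero
    \<open>P\<close> the functions belonging to the other zeros have order at least
    \<open>P f\<close>, beyond every admissible \<open>j\<close>.\<close>
  define N where "N = (\<Sum>P\<in>S. \<bar>P f\<bar>)"
  have N: "P f \<le> N" if "P \<in> S" for P
  proof -
    have "\<bar>P f\<bar> \<le> N" unfolding N_def using S(1) that by (intro member_le_sum) auto
    then show ?thesis by linarith
  qed
  have "\<exists>u. order_eq R (fst i) u (int (snd i)) \<and> (\<forall>Q\<in>S - {fst i}. order_ge R Q u N)" if "i \<in> I" for i
    by (rule ex_approximation) (use that S in \<open>auto simp: I_def\<close>)
  then have "\<forall>i\<in>I. \<exists>u. order_eq R (fst i) u (int (snd i)) \<and> (\<forall>Q\<in>S - {fst i}. order_ge R Q u N)"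
    by blast
  from bchoice[OF this] obtain u where "\<forall>i\<in>I. order_eq R (fst i) (u i) (int (snd i)) \<and>
      (\<forall>Q\<in>S - {fst i}. order_ge R Q (u i) N)" by (rule exE)
  then have u: "\<And>i. i \<in> I \<Longrightarrow> order_eq R (fst i) (u i) (int (snd i))"
      "\<And>i Q. i \<in> I \<Longrightarrow> Q \<in> S - {fst i} \<Longrightarrow> order_ge R Q (u i) N"
    by blast+
  have "\<forall>i\<in>I. p i = 0" if p: "R dvd (\<Sum>i\<in>I. cpoly_at (p i) f * u i)" for p
  proof (rule ccontr)
    assume "\<not> (\<forall>i\<in>I. p i = 0)"
    then have "\<exists>i\<in>I. p i \<noteq> 0" by blast
    from ex_reduced_dependency[OF f fin this p] obtain r where
      r: "\<exists>i\<in>I. coeff (r i) 0 \<noteq> 0" "R dvd (\<Sum>i\<in>I. cpoly_at (r i) f * u i)" by blast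
    from r(1) obtain i where i: "i \<in> I" "coeff (r i) 0 \<noteq> 0"
      and min: "\<And>k. k \<in> I \<Longrightarrow> coeff (r k) 0 \<noteq> 0 \<Longrightarrow> snd i \<le> snd k"
    proof -
      assume *: "\<And>i. i \<in> I \<Longrightarrow> coeff (r i) 0 \<noteq> 0 \<Longrightarrow>
        (\<And>k. k \<in> I \<Longrightarrow> coeff (r k) 0 \<noteq> 0 \<Longrightarrow> snd i \<le> snd k) \<Longrightarrow> thesis"
      from r(1) obtain i0 where "i0 \<in> I \<and> coeff (r i0) 0 \<noteq> 0" by (elim bexE) simp
      from ex_has_least_nat[of "\<lambda>i. i \<in> I \<and> coeff (r i) 0 \<noteq> 0", OF this, of snd]
      obtain i1 where i1: "(i1 \<in> I \<and> coeff (r i1) 0 \<noteq> 0) \<and>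
        (\<forall>y. y \<in> I \<and> coeff (r y) 0 \<noteq> 0 \<longrightarrow> snd i1 \<le> snd y)" by (rule exE)
      show thesis by (rule *[of i1]) (use i1 in blast)+
    qed
    define P where "P = fst i"
    define j where "j = int (snd i)"
    have P: "P \<in> S" "j < P f" using i(1) by (auto simp: I_def P_def j_def)
    interpret P: place R P using S(2)[OF P(1)] by (intro placeI) auto
    have fP: "P.eq f (P f)" using f by (rule P.eq_order)
    have Pf: "P f > 0" using S(2)[OF P(1)] by blast
    have poly: "P.ge (cpoly_at q f) 0" for q using P.ge_cpoly_at P.eq_ge[OF fP] Pf by simp
    have decomp: "cpoly_at q f = mf_const (coeff q 0) + f * cpoly_at (poly_shift 1 q) f" for q
    proof -
      have "q = pCons (coeff q 0) (poly_shift 1 q)"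
        by (intro poly_eqI) (auto simp: coeff_pCons coeff_poly_shift split: nat.splits)
      then have "cpoly_at q f = cpoly_at (pCons (coeff q 0) (poly_shift 1 q)) f" by (rule arg_cong)
      then show ?thesis by (simp only: cpoly_at_pCons)
    qed
    have small: "P.ge (f * cpoly_at q f) (P f)" for q
      using P.ge_mult[OF P.eq_imp_ge[OF fP] poly] by simp
    have "P.eq (cpoly_at (r i) f) 0"
      unfolding decomp[of "r i"] using i(2) Pf by (intro P.eq_add P.eq_const P.ge_mono[OF small]) auto
    then have main: "P.eq (cpoly_at (r i) f * u i) j"
      using P.eq_mult[of "cpoly_at (r i) f" 0 "u i" j] u(1)[OF i(1)] by (simp add: P_def j_def)
    \<comment> \<open>Every other term has larger order for one of three reasons: its function
      belongs to another zero, its coefficient is divisible by \<open>f\<close>, or its prescribed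
      order at \<open>P\<close> is larger by minimality.\<close>
    have "P.ge (\<Sum>k\<in>I - {i}. cpoly_at (r k) f * u k) (j + 1)"
    proof (rule P.ge_sum)
      fix k assume k: "k \<in> I - {i}"
      show "P.ge (cpoly_at (r k) f * u k) (j + 1)"
      proof (cases "fst k = P")
        case False
        then have "P \<in> S - {fst k}" using P(1) by blast
        then have "P.ge (u k) N" using u(2) k by blast
        then have "P.ge (u k) (j + 1)" by (rule P.ge_mono) (use N[OF P(1)] P(2) in linarith)
        from P.ge_mult[OF poly this] show ?thesis by simp
      next
        case True
        then have "P.eq (u k) (int (snd k))" using u(1) k by blast
        then have uk: "P.ge (u k) (int (snd k))" by (rule P.eq_imp_ge)
        show ?thesis
        proof (cases "coeff (r k) 0 = 0")
          case True
          then have "P.ge (cpoly_at (r k) f) (P f)"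
            using small[of "poly_shift 1 (r k)"] decomp[of "r k"] by simp
          then have "P.ge (cpoly_at (r k) f * u k) (P f + int (snd k))" using uk by (rule P.ge_mult)
          then show ?thesis by (rule P.ge_mono) (use P in simp)
        next
          case False
          have "snd k \<noteq> snd i" using True k by (auto simp: P_def prod_eq_iff)
          then have "j + 1 \<le> int (snd k)" using min[of k] k False by (simp add: j_def)
          then show ?thesis using P.ge_mult[OF poly P.ge_mono[OF uk], of "j + 1"] by simp
        qed
      qed
    qed
    with main have "P.eq (cpoly_at (r i) f * u i + (\<Sum>k\<in>I - {i}. cpoly_at (r k) f * u k)) j"
      by (rule P.eq_add)
    then have "P.eq (\<Sum>k\<in>I. cpoly_at (r k) f * u k) j"
      by (simp only: sum.remove[OF fin i(1)])
    then show False using r(2) P.eq_not_dvd[of "\<Sum>k\<in>I. cpoly_at (r k) f * u k" j] by simp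
  qed
  then show ?thesis unfolding I_def[symmetric] by (intro exI[of _ u] allI impI)
qed

text \<open>The fundamental inequality between ramification indices and the degree of a field
  extension: by approximation there are as many functions independent over the polynomials in
  \<open>f\<close> as the indices add up to, and any \<open>degree R + 1\<close> functions are
  dependent.\<close>

lemma sum_ramification_le:
  assumes "z_parameter f" "\<not> R dvd f" "finite S" "\<And>P. P \<in> S \<Longrightarrow> curve_point R P \<and> P f > 0"
  shows "(\<Sum>P\<in>S. P f) \<le> int (degree R)"
proof (rule ccontr)
  assume gt: "\<not> ?thesis"
  let ?I = "Sigma S (\<lambda>P. {..<nat (P f)})"
  have fin: "finite ?I" using assms(3) by auto
  have "int (card ?I) = (\<Sum>P\<in>S. int (card {..<nat (P f)}))"
    using assms(3) by (subst card_SigmaI) simp_all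
  also have "\<dots> = (\<Sum>P\<in>S. P f)"
    by (rule sum.cong) (use assms(4) in force)+
  finally have "int (card ?I) = (\<Sum>P\<in>S. P f)" .
  with gt have card: "degree R < card ?I" by linarith
  from ex_independent_at_zeros[OF assms(3,4,2)]
  obtain u where u: "\<forall>p. R dvd (\<Sum>i\<in>?I. cpoly_at (p i) f * u i) \<longrightarrow> (\<forall>i\<in>?I. p i = 0)" by (rule exE)
  from ex_dependency[OF assms(1) fin card, of u]
  obtain p where "\<exists>i\<in>?I. p i \<noteq> 0" "R dvd (\<Sum>i\<in>?I. cpoly_at (p i) f * u i)" by (elim exE conjE)
  with u show False by blast
qed

lemma finite_zeros_z_parameter:
  assumes "z_parameter f" "\<not> R dvd f"
  shows "finite {P. curve_point R P \<and> P f > 0}"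
proof (rule ccontr)
  assume "infinite {P. curve_point R P \<and> P f > 0}"
  then obtain S where S: "S \<subseteq> {P. curve_point R P \<and> P f > 0}" "finite S" "card S = Suc (degree R)"
    using infinite_arbitrarily_large by blast
  have "(\<Sum>P\<in>S. 1) \<le> (\<Sum>P\<in>S. P f)"
  proof (rule sum_mono)
    fix P assume "P \<in> S"
    then have "0 < P f" using S(1) by blast
    then show "1 \<le> P f" by simp
  qed
  also have "\<dots> \<le> int (degree R)" using S assms by (intro sum_ramification_le) auto
  finally show False using S(3) by simp
qed

lemma z_parameter_not_dvd: "z_parameter f \<Longrightarrow> \<not> R dvd f"
proof
  assume "z_parameter f" "R dvd f"
  moreover have "mf_z - mf_const c \<noteq> 0" for c by (simp add: mf_z_def mf_const_def)
  moreover have "mf_zinv \<noteq> 0" by (simp add: mf_zinv_def)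
  moreover have "degree mf_zinv = 0" "degree (mf_z - mf_const c) = 0" for c
    by (simp_all add: mf_zinv_def mf_z_def mf_const_def)
  ultimately show False
    unfolding z_parameter_def using degree_R_pos by (metis dvd_imp_degree_le not_less)
qed

end

section \<open>Places over the projective line, and residues\<close>

context place
begin

lemma z_zinv: "P mf_zinv = - P mf_z"
proof -
  have "\<not> R dvd mf_zinv" using z_parameter_not_dvd by (simp add: z_parameter_def)
  moreover have "\<not> R dvd mf_z"
    using z_parameter_not_dvd[of "mf_z - mf_const 0"] unfolding z_parameter_def by auto
  ultimately have "P (mf_z * mf_zinv) = P mf_z + P mf_zinv" by (intro mult)
  then show ?thesis by (simp add: mf_z_mult_zinv)
qed

lemma z_not_dvd: "\<not> R dvd mf_z"
  using z_parameter_not_dvd[of "mf_z - mf_const 0"] unfolding z_parameter_def by auto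

lemma ex_z_relation:
  obtains p where "p \<noteq> (\<lambda>_. 0)" "\<And>l. l > degree R \<Longrightarrow> p l = 0"
    "R dvd (\<Sum>l\<le>degree R. cpoly_at (p l) mf_z * f ^ l)"
proof -
  have "z_parameter mf_z" unfolding z_parameter_def by (intro disjI2 exI[of _ 0]) simp
  from ex_dependency[OF this, of "{..degree R}" "\<lambda>l. f ^ l"]
  obtain p where p: "\<exists>i\<le>degree R. p i \<noteq> 0" "R dvd (\<Sum>l\<le>degree R. cpoly_at (p l) mf_z * f ^ l)"
    by auto
  let ?p = "\<lambda>l. if l \<le> degree R then p l else 0"
  have "(\<Sum>l\<le>degree R. cpoly_at (p l) mf_z * f ^ l) = (\<Sum>l\<le>degree R. cpoly_at (?p l) mf_z * f ^ l)"
    by (intro sum.cong) auto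
  then show ?thesis using p by (intro that[of ?p]) (auto simp: fun_eq_iff)
qed

text \<open>Otherwise all \<open>z - c\<close> are units and so are, by factorization, all nonzero
  polynomials in \<open>z\<close>; an algebraic relation for a uniformizer then has nonzero terms of
  pairwise different orders and cannot vanish.\<close>

lemma ex_center: "\<exists>f. z_parameter f \<and> P f > 0"
proof (cases "P mf_z < 0")
  case True
  then show ?thesis using z_zinv by (intro exI[of _ mf_zinv]) (simp add: z_parameter_def)
next
  case False
  then have z: "ge mf_z 0" by (simp add: order_ge_def)
  show ?thesis
  proof (rule ccontr)
    assume n: "\<not> ?thesis"
    have unit: "eq (mf_z - mf_const c) 0" for c
    proof -
      have zp: "z_parameter (mf_z - mf_const c)" by (auto simp: z_parameter_def)
      have "ge (mf_z - mf_const c) 0" using z by (intro ge_diff) auto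
      moreover have "\<not> P (mf_z - mf_const c) > 0" using n zp by blast
      ultimately show ?thesis using z_parameter_not_dvd[OF zp] by (auto simp: order_ge_def order_eq_def)
    qed
    obtain f where f: "eq f 1" using ex_uniformizer by blast
    obtain p where p: "p \<noteq> (\<lambda>_. 0)" "\<And>l. l > degree R \<Longrightarrow> p l = 0"
      "R dvd (\<Sum>l\<le>degree R. cpoly_at (p l) mf_z * f ^ l)" using ex_z_relation[of f] by blast
    from p(1) obtain l1 where "p l1 \<noteq> 0" by blast
    then obtain l0 where l0: "p l0 \<noteq> 0" and min: "\<And>l. p l \<noteq> 0 \<Longrightarrow> l0 \<le> l"
      using LeastI[of "\<lambda>l. p l \<noteq> 0"] Least_le[of "\<lambda>l. p l \<noteq> 0"] by blast
    have l0R: "l0 \<le> degree R" using l0 p(2) by (meson not_le)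
    have fl: "eq (f ^ l) (int l)" for l using eq_power[OF f, of l] by simp
    have "eq (cpoly_at (p l0) mf_z * f ^ l0) (int l0)"
      using eq_mult[OF eq_cpoly_at[OF l0 unit] fl] by simp
    moreover have "ge (\<Sum>l\<in>{..degree R} - {l0}. cpoly_at (p l) mf_z * f ^ l) (int l0 + 1)"
    proof (rule ge_sum)
      fix l assume l: "l \<in> {..degree R} - {l0}"
      show "ge (cpoly_at (p l) mf_z * f ^ l) (int l0 + 1)"
      proof (cases "p l = 0")
        case False
        then have "l0 < l" using min[OF False] l by simp
        then have "ge (f ^ l) (int l0 + 1)" by (intro eq_ge[OF fl]) simp
        from ge_mult[OF ge_cpoly_at[OF z] this] show ?thesis by simp
      qed simp
    qed
    ultimately have "eq (cpoly_at (p l0) mf_z * f ^ l0 +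
        (\<Sum>l\<in>{..degree R} - {l0}. cpoly_at (p l) mf_z * f ^ l)) (int l0)" by (rule eq_add)
    also have "cpoly_at (p l0) mf_z * f ^ l0 + (\<Sum>l\<in>{..degree R} - {l0}. cpoly_at (p l) mf_z * f ^ l)
      = (\<Sum>l\<le>degree R. cpoly_at (p l) mf_z * f ^ l)"
      using l0R by (simp add: sum.remove[of "{..degree R}" l0])
    finally show False using p(3) eq_not_dvd by blast
  qed
qed

text \<open>Reducing an algebraic relation of \<open>f\<close> over the polynomials in a parameter
  \<open>t\<close> with \<open>P t > 0\<close> leaves a nonzero polynomial over the constants whose
  value at \<open>f\<close> has positive order; one of its roots is the residue of
  \<open>f\<close>.\<close>

lemma residue:
  assumes f: "ge f 0"
  shows "\<exists>c. ge (f - mf_const c) 1"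
proof -
  obtain t where t: "z_parameter t" "P t > 0" using ex_center by blast
  have nt: "\<not> R dvd t" using t z_parameter_not_dvd by blast
  have tge: "ge t 1" using t(2) by (simp add: order_ge_def)
  from ex_dependency[OF t(1), of "{..degree R}" "\<lambda>l. f ^ l"]
  obtain p where "\<exists>i\<in>{..degree R}. p i \<noteq> 0" "R dvd (\<Sum>l\<in>{..degree R}. cpoly_at (p l) t * f ^ l)"
    by auto
  from ex_reduced_dependency[OF nt _ this] obtain p where
    p: "\<exists>i\<in>{..degree R}. coeff (p i) 0 \<noteq> 0" "R dvd (\<Sum>l\<in>{..degree R}. cpoly_at (p l) t * f ^ l)"
    by auto
  define G where "G = (\<Sum>l\<in>{..degree R}. monom (coeff (p l) 0) l)"
  have G0: "G \<noteq> 0"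
  proof
    assume "G = 0"
    then have "coeff G l = 0" for l by simp
    moreover have "coeff G l = (if l \<le> degree R then coeff (p l) 0 else 0)" for l
      unfolding G_def by (simp add: coeff_sum sum.delta')
    ultimately show False using p(1) by (metis atMost_iff)
  qed
  have G: "cpoly_at G f = (\<Sum>l\<in>{..degree R}. mf_const (coeff (p l) 0) * f ^ l)"
  proof -
    have "cpoly_at (sum q {..m}) f = (\<Sum>l\<in>{..m}. cpoly_at (q l) f)" for q and m :: nat
      by (induction m) (simp_all add: cpoly_at_add)
    then show ?thesis by (simp add: G_def cpoly_at_monom)
  qed
  have fl: "ge (f ^ l) 0" for l using ge_power[OF f, of l] by simp
  have "ge ((\<Sum>l\<in>{..degree R}. cpoly_at (p l) t * f ^ l) - cpoly_at G f) 1"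
    unfolding G sum_subtractf[symmetric]
  proof (rule ge_sum)
    fix l
    have "p l = pCons (coeff (p l) 0) (poly_shift 1 (p l))"
      by (intro poly_eqI) (auto simp: coeff_pCons coeff_poly_shift split: nat.splits)
    then have "cpoly_at (p l) t = mf_const (coeff (p l) 0) + t * cpoly_at (poly_shift 1 (p l)) t"
      by (metis cpoly_at_pCons)
    then have "cpoly_at (p l) t * f ^ l - mf_const (coeff (p l) 0) * f ^ l
      = t * (cpoly_at (poly_shift 1 (p l)) t * f ^ l)" by (simp add: algebra_simps)
    moreover have "ge (t * (cpoly_at (poly_shift 1 (p l)) t * f ^ l)) (1 + (0 + 0))"
      by (intro ge_mult tge ge_cpoly_at fl ge_mono[OF tge]) simp
    ultimately show "ge (cpoly_at (p l) t * f ^ l - mf_const (coeff (p l) 0) * f ^ l) 1" by simp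
  qed
  moreover have "ge (\<Sum>l\<in>{..degree R}. cpoly_at (p l) t * f ^ l) 1" using p(2) by (rule ge_dvd)
  ultimately have "ge (cpoly_at G f) 1" using ge_diff by fastforce
  then show ?thesis using ge_cpoly_root[OF G0 f] by metis
qed

end

section \<open>Finiteness of Riemann-Roch spaces and the degree of principal divisors\<close>

context irreducible_curve
begin

text \<open>At a pole of \<open>f\<close> over a finite value of \<open>z\<close> the highest power
  of \<open>f\<close> in a relation over the polynomials in \<open>z\<close> would dominate unless
  its coefficient vanishes there. So poles lie over infinity or over the finitely many roots of that
  coefficient, and these fibres are finite.\<close>

lemma finite_poles: "finite {P. curve_point R P \<and> P f < 0}"
proof (cases "\<exists>P. curve_point R P")
  case True
  then obtain P0 where P0: "curve_point R P0" by blast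
  interpret P0: place R P0 using P0 by (rule placeI)
  obtain p where p: "p \<noteq> (\<lambda>_. 0)" "\<And>l. l > degree R \<Longrightarrow> p l = 0"
    "R dvd (\<Sum>l\<le>degree R. cpoly_at (p l) mf_z * f ^ l)" using P0.ex_z_relation[of f] by blast
  have "\<exists>m. p m \<noteq> 0 \<and> (\<forall>l. p l \<noteq> 0 \<longrightarrow> l \<le> m)"
  proof -
    have "finite {l. p l \<noteq> 0}" by (rule finite_subset[of _ "{..degree R}"]) (use p(2) in \<open>auto simp: not_less[symmetric]\<close>)
    moreover have "{l. p l \<noteq> 0} \<noteq> {}" using p(1) by auto
    ultimately have "Max {l. p l \<noteq> 0} \<in> {l. p l \<noteq> 0}" "\<And>l. p l \<noteq> 0 \<Longrightarrow> l \<le> Max {l. p l \<noteq> 0}"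
      using Max_in[of "{l. p l \<noteq> 0}"] Max_ge[of "{l. p l \<noteq> 0}"] by blast+
    then show ?thesis by blast
  qed
  then obtain m where m: "p m \<noteq> 0" and max: "\<And>l. p l \<noteq> 0 \<Longrightarrow> l \<le> m" by blast
  have mR: "m \<le> degree R" using m p(2) by (meson not_le)
  let ?Z = "\<lambda>t. {P. curve_point R P \<and> P t > 0}"
  have "{P. curve_point R P \<and> P f < 0} \<subseteq> ?Z mf_zinv \<union> (\<Union>c\<in>{c. poly (p m) c = 0}. ?Z (mf_z - mf_const c))"
  proof
    fix P assume "P \<in> {P. curve_point R P \<and> P f < 0}"
    then have P: "curve_point R P" "P f < 0" by auto
    interpret P: place R P using P(1) by (rule placeI)
    have nf: "\<not> R dvd f" using P.dvd_zero[of f] P(2) by auto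
    show "P \<in> ?Z mf_zinv \<union> (\<Union>c\<in>{c. poly (p m) c = 0}. ?Z (mf_z - mf_const c))"
    proof (cases "P mf_z < 0")
      case True
      then show ?thesis using P P.z_zinv by simp
    next
      case False
      then have z: "P.ge mf_z 0" by (simp add: order_ge_def)
      have fl: "P.eq (f ^ l) (int l * P f)" for l by (intro P.eq_power P.eq_order nf)
      have "P.ge (cpoly_at (p m) mf_z) 1"
      proof (rule ccontr)
        assume "\<not> P.ge (cpoly_at (p m) mf_z) 1"
        then have "P.eq (cpoly_at (p m) mf_z) 0" using P.ge_cpoly_at[OF z] by (intro P.eqI) auto
        then have "P.eq (cpoly_at (p m) mf_z * f ^ m) (int m * P f)"
          using P.eq_mult[OF _ fl, of "cpoly_at (p m) mf_z" 0 m] by simp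
        moreover have "P.ge (\<Sum>l\<in>{..degree R} - {m}. cpoly_at (p l) mf_z * f ^ l) (int m * P f + 1)"
        proof (rule P.ge_sum)
          fix l assume l: "l \<in> {..degree R} - {m}"
          show "P.ge (cpoly_at (p l) mf_z * f ^ l) (int m * P f + 1)"
          proof (cases "p l = 0")
            case False
            then have "l < m" using max[OF False] l by simp
            then have "int (m - l) * P f \<le> - int (m - l)" using P(2) by (intro int_mult_le_uminus)
            then have "int m * P f + 1 \<le> int l * P f" using \<open>l < m\<close> by (simp add: of_nat_diff algebra_simps)
            then have "P.ge (f ^ l) (int m * P f + 1)" by (intro P.eq_ge[OF fl])
            from P.ge_mult[OF P.ge_cpoly_at[OF z] this] show ?thesis by simp
          qed simp
        qed
        ultimately have "P.eq (cpoly_at (p m) mf_z * f ^ m +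
            (\<Sum>l\<in>{..degree R} - {m}. cpoly_at (p l) mf_z * f ^ l)) (int m * P f)" by (rule P.eq_add)
        also have "cpoly_at (p m) mf_z * f ^ m + (\<Sum>l\<in>{..degree R} - {m}. cpoly_at (p l) mf_z * f ^ l)
          = (\<Sum>l\<le>degree R. cpoly_at (p l) mf_z * f ^ l)"
          using mR by (simp add: sum.remove[of "{..degree R}" m])
        finally show False using p(3) P.eq_not_dvd by blast
      qed
      then obtain c where c: "poly (p m) c = 0" "P.ge (mf_z - mf_const c) 1"
        using P.ge_cpoly_root[OF m z] by blast
      have "\<not> R dvd mf_z - mf_const c"
        by (rule z_parameter_not_dvd) (auto simp: z_parameter_def)
      then have "P (mf_z - mf_const c) > 0" using c(2) by (simp add: order_ge_def)
      then show ?thesis using P(1) c(1) by blast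
    qed
  qed
  moreover have "finite (?Z t)" if "z_parameter t" for t
    using that by (intro finite_zeros_z_parameter z_parameter_not_dvd)
  then have "finite (?Z mf_zinv \<union> (\<Union>c\<in>{c. poly (p m) c = 0}. ?Z (mf_z - mf_const c)))"
    using poly_roots_finite[OF m] by (auto simp: z_parameter_def)
  ultimately show ?thesis by (rule finite_subset)
qed simp

text \<open>If some \<open>g\<close> attains the new order at \<open>P\<close>, the residue of
  \<open>f / g\<close> tells which multiple of \<open>g\<close> must be subtracted from
  \<open>f\<close> to return to the smaller space.\<close>

lemma rr_space_add_point:
  assumes P: "curve_point R P" and S: "finite S" "rr_space R B \<subseteq> mf.span S"
  shows "\<exists>S'. finite S' \<and> card S' \<le> Suc (card S) \<and>
    rr_space R (\<lambda>Q. B Q + point_div P Q) \<subseteq> mf.span S'"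
proof -
  interpret P: place R P using P by (rule placeI)
  let ?L = "rr_space R (\<lambda>Q. B Q + point_div P Q)"
  show ?thesis
  proof (cases "?L \<subseteq> rr_space R B")
    case True
    then show ?thesis using S by (intro exI[of _ S]) auto
  next
    case False
    then obtain g where g: "g \<in> ?L" "g \<notin> rr_space R B" by blast
    have other: "order_ge R Q f (- B Q)" if "f \<in> ?L" "curve_point R Q" "Q \<noteq> P" for f Q
      using that unfolding rr_space_def point_div_def by fastforce
    have at_P: "P.ge f (- B P - 1)" if "f \<in> ?L" for f
      using that P unfolding rr_space_def point_div_def by fastforce
    have "\<not> P.ge g (- B P)"
    proof
      assume "P.ge g (- B P)"
      with g(1) other have "g \<in> rr_space R B" unfolding rr_space_def by blast
      with g(2) show False by blast
    qed
    then have eg: "P.eq g (- B P - 1)" using at_P[OF g(1)] by (intro P.eqI) simp_all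
    obtain h where h: "R dvd g * h - 1" using inverse_mod_R[OF P.eq_not_dvd[OF eg]] by blast
    have eh: "P.eq h (B P + 1)" using P.eq_inverse[OF eg h] by (simp add: add.commute)
    have "f \<in> mf.span (insert g S)" if f: "f \<in> ?L" for f
    proof -
      have "P.ge (f * h) (- B P - 1 + (B P + 1))" by (intro P.ge_mult at_P f P.eq_imp_ge eh)
      then have "P.ge (f * h) 0" by simp
      then obtain c where c: "P.ge (f * h - mf_const c) 1" using P.residue by blast
      have "P.ge (g * (f * h - mf_const c)) (- B P - 1 + 1)" by (intro P.ge_mult P.eq_imp_ge eg c)
      moreover have "R dvd g * (f * h - mf_const c) - (f - mf_const c * g)"
      proof -
        have "g * (f * h - mf_const c) - (f - mf_const c * g) = (g * h - 1) * f"
          by (simp add: algebra_simps)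
        then show ?thesis using h by simp
      qed
      ultimately have "P.ge (f - mf_const c * g) (- B P)" using P.ge_cong by simp
      moreover have "order_ge R Q (f - mf_const c * g) (- B Q)" if Q: "curve_point R Q" "Q \<noteq> P" for Q
      proof -
        interpret Q: place R Q using Q(1) by (rule placeI)
        show ?thesis by (intro Q.ge_diff Q.ge_const_mult other f g Q)
      qed
      moreover have "degree (f - mf_const c * g) < degree R"
      proof -
        have "degree f < degree R" "degree g < degree R" using f g(1) unfolding rr_space_def by blast+
        moreover have "degree (mf_const c * g) \<le> degree g" unfolding mf_const_def by simp
        ultimately show ?thesis by (intro degree_diff_less) simp_all
      qed
      ultimately have "f - mf_const c * g \<in> rr_space R B" unfolding rr_space_def by blast
      then have "f - mf_const c * g \<in> mf.span (insert g S)"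
        using S(2) mf.span_mono[of S "insert g S"] by blast
      moreover have "mf_const c * g \<in> mf.span (insert g S)"
        by (intro mf.span_scale mf.span_base) simp
      ultimately show ?thesis using mf.span_add by fastforce
    qed
    then show ?thesis using S(1) by (intro exI[of _ "insert g S"]) (auto simp: card_insert_if)
  qed
qed

text \<open>Each added point costs at most one spanning vector. Spanning sets are tracked instead of
  dimensions because finiteness is part of the claim.\<close>

lemma rr_space_bound:
  assumes F: "finite F" "\<And>P. P \<in> F \<Longrightarrow> curve_point R P" and S: "finite S" "rr_space R B \<subseteq> mf.span S"
  shows "\<exists>S'. finite S' \<and> card S' \<le> card S + (\<Sum>P\<in>F. m P) \<and>
    rr_space R (\<lambda>Q. B Q + (if Q \<in> F then int (m Q) else 0)) \<subseteq> mf.span S'"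
proof (induction "\<Sum>P\<in>F. m P" arbitrary: m)
  case 0
  then have "\<forall>P\<in>F. m P = 0" using F(1) by simp
  then have "(\<lambda>Q. B Q + (if Q \<in> F then int (m Q) else 0)) = B" by (simp add: fun_eq_iff)
  then show ?case using S by (intro exI[of _ S]) simp
next
  case (Suc d)
  then obtain P where P: "P \<in> F" "m P \<noteq> 0" by (metis sum.neutral nat.distinct(1))
  let ?m = "m(P := m P - 1)"
  have "(\<Sum>Q\<in>F. m Q) = m P + (\<Sum>Q\<in>F - {P}. m Q)" by (rule sum.remove[OF F(1) P(1)])
  moreover have "(\<Sum>Q\<in>F. ?m Q) = ?m P + (\<Sum>Q\<in>F - {P}. ?m Q)" by (rule sum.remove[OF F(1) P(1)])
  moreover have "(\<Sum>Q\<in>F - {P}. ?m Q) = (\<Sum>Q\<in>F - {P}. m Q)" by (intro sum.cong) auto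
  ultimately have d: "d = (\<Sum>Q\<in>F. ?m Q)" using Suc(2) P(2) by simp
  from Suc.hyps(1)[OF this] obtain S' where S': "finite S'" "card S' \<le> card S + (\<Sum>P\<in>F. ?m P)"
    "rr_space R (\<lambda>Q. B Q + (if Q \<in> F then int (?m Q) else 0)) \<subseteq> mf.span S'" by (elim exE conjE)
  have eq: "(\<lambda>Q. (B Q + (if Q \<in> F then int (?m Q) else 0)) + point_div P Q)
      = (\<lambda>Q. B Q + (if Q \<in> F then int (m Q) else 0))"
  proof
    fix Q
    show "(B Q + (if Q \<in> F then int (?m Q) else 0)) + point_div P Q = B Q + (if Q \<in> F then int (m Q) else 0)"
      using P by (cases "Q = P") (simp_all add: point_div_def)
  qed
  from rr_space_add_point[OF F(2)[OF P(1)] S'(1,3)] obtain S'' where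
    S'': "finite S''" "card S'' \<le> Suc (card S')"
      "rr_space R (\<lambda>Q. (B Q + (if Q \<in> F then int (?m Q) else 0)) + point_div P Q) \<subseteq> mf.span S''"
    by (elim exE conjE)
  have "card S'' \<le> card S + (\<Sum>P\<in>F. m P)" using S''(2) S'(2) d Suc(2) by linarith
  with S''(1) S''(3)[unfolded eq] show ?case by (intro exI[of _ S''] conjI)
qed

lemma rr_space_mod: "f mod R \<in> rr_space R B \<longleftrightarrow> (\<forall>P. curve_point R P \<longrightarrow> order_ge R P f (- B P))"
proof -
  have "degree (f mod R) < degree R" using degree_mod_less[OF R_nonzero, of f] degree_R_pos by auto
  moreover have "order_ge R P (f mod R) m \<longleftrightarrow> order_ge R P f m" if "curve_point R P" for P m
  proof -
    interpret P: place R P using that by (rule placeI)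
    have "R dvd f mod R - f" using dvd_minus_mod[of R f] by (metis dvd_diff_commute)
    then show ?thesis by (rule P.ge_cong)
  qed
  ultimately show ?thesis by (auto simp: rr_space_def)
qed

lemma finite_zeros:
  assumes "\<not> R dvd f"
  shows "finite {P. curve_point R P \<and> P f > 0}"
proof -
  obtain g where g: "R dvd f * g - 1" using inverse_mod_R[OF assms] by blast
  have "{P. curve_point R P \<and> P f > 0} \<subseteq> {P. curve_point R P \<and> P g < 0}"
  proof clarify
    fix P assume P: "curve_point R P" "P f > 0"
    interpret P: place R P using P(1) by (rule placeI)
    show "P g < 0" using P.eqD[OF P.eq_inverse[OF P.eq_order[OF assms] g]] P(2) by simp
  qed
  then show ?thesis using finite_poles finite_subset by blast
qed

text \<open>A growth comparison. With \<open>u\<close> from \<open>ex_independent_at_zeros\<close>,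
  the functions \<open>f ^ l * u i\<close> for \<open>l \<le> r\<close> are independent over the
  constants, and their number is \<open>r + 1\<close> times the number of zeros. They lie in a
  Riemann-Roch space spanned by at most \<open>r\<close> times the number of poles plus a constant
  many functions, so more zeros than poles is impossible for large \<open>r\<close>.\<close>

lemma zeros_le_poles:
  assumes f: "\<not> R dvd f" and S0: "finite S0" "rr_space R (\<lambda>_. 0) \<subseteq> mf.span S0"
  shows "(\<Sum>P | curve_point R P \<and> P f > 0. P f) \<le> (\<Sum>P | curve_point R P \<and> P f < 0. - P f)"
proof (rule ccontr)
  assume gt: "\<not> ?thesis"
  define Z where "Z = {P. curve_point R P \<and> P f > 0}"
  define W where "W = {P. curve_point R P \<and> P f < 0}"
  have Z: "finite Z" "\<And>P. P \<in> Z \<Longrightarrow> curve_point R P \<and> P f > 0"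
    unfolding Z_def by (rule finite_zeros[OF f]) blast
  define I where "I = Sigma Z (\<lambda>P. {..<nat (P f)})"
  have finI: "finite I" unfolding I_def using Z(1) by auto
  have "int (card I) = (\<Sum>P\<in>Z. int (card {..<nat (P f)}))"
    unfolding I_def using Z(1) by (subst card_SigmaI) simp_all
  also have "\<dots> = (\<Sum>P\<in>Z. P f)" by (rule sum.cong) (use Z(2) in force)+
  finally have cardI: "int (card I) = (\<Sum>P\<in>Z. P f)" .
  from ex_independent_at_zeros[OF Z f] obtain u where
    u: "\<forall>p. R dvd (\<Sum>i\<in>I. cpoly_at (p i) f * u i) \<longrightarrow> (\<forall>i\<in>I. p i = 0)"
    unfolding I_def by (rule exE)
  define F where "F = W \<union> (\<Union>i\<in>I. {P. curve_point R P \<and> P (u i) < 0})"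
  have F: "finite F" "\<And>P. P \<in> F \<Longrightarrow> curve_point R P"
    unfolding F_def W_def using finI finite_poles by auto
  \<comment> \<open>Bounds the poles at \<open>P\<close> of all the \<open>u i\<close> at
    once.\<close>
  define m0 where "m0 P = (\<Sum>i\<in>I. nat (- P (u i)))" for P :: point
  define w where "w = (\<Sum>P\<in>F. nat (- P f))"
  have "int w = (\<Sum>P\<in>F. int (nat (- P f)))" by (simp only: w_def of_nat_sum)
  also have "\<dots> = (\<Sum>P\<in>W. int (nat (- P f)))"
    by (rule sum.mono_neutral_right[OF F(1)]) (use F(2) in \<open>auto simp: F_def W_def\<close>)
  also have "\<dots> = (\<Sum>P\<in>W. - P f)" by (rule sum.cong) (auto simp: W_def)
  finally have w: "int w = (\<Sum>P\<in>W. - P f)" .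
  have w_less: "w < card I" using gt w cardI unfolding Z_def W_def by linarith
  \<comment> \<open>Equal to the constant part of the bound, so that
    \<open>r * w + r < (w + 1) * (r + 1)\<close> applies.\<close>
  define r where "r = card S0 + (\<Sum>P\<in>F. m0 P)"
  obtain S where S: "finite S" "card S \<le> card S0 + (\<Sum>P\<in>F. r * nat (- P f) + m0 P)"
    "rr_space R (\<lambda>Q. 0 + (if Q \<in> F then int (r * nat (- Q f) + m0 Q) else 0)) \<subseteq> mf.span S"
    using rr_space_bound[OF F(1) F(2) S0, of "\<lambda>P. r * nat (- P f) + m0 P"] by blast
  have "(\<Sum>P\<in>F. r * nat (- P f) + m0 P) = r * w + (\<Sum>P\<in>F. m0 P)"
    by (simp add: sum.distrib w_def sum_distrib_left)
  with S(2) have cardS: "card S \<le> r * w + r" unfolding r_def by simp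
  define J where "J = I \<times> {..r}"
  have "card S < card J"
  proof -
    have "r * w + r < Suc w * Suc r" by (simp add: algebra_simps)
    also have "\<dots> \<le> card I * Suc r" using w_less by (intro mult_right_mono) simp_all
    finally show ?thesis using cardS unfolding J_def by (simp add: card_cartesian_product)
  qed
  moreover have "finite J" unfolding J_def using finI by simp
  moreover have "(f ^ snd j * u (fst j)) mod R \<in> mf.span S" if j: "j \<in> J" for j
  proof -
    have ij: "fst j \<in> I" "snd j \<le> r" using j unfolding J_def by auto
    have "order_ge R P (f ^ snd j * u (fst j)) (- (0 + (if P \<in> F then int (r * nat (- P f) + m0 P) else 0)))"
      if P: "curve_point R P" for P
    proof -
      interpret P: place R P using P by (rule placeI)
      have "P.ge (f ^ snd j) (- (int r * int (nat (- P f))))"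
      proof (rule P.eq_ge[OF P.eq_power[OF P.eq_order[OF f]]])
        have "- (int r * int (nat (- P f))) \<le> - (int (snd j) * int (nat (- P f)))"
          using ij(2) by (simp add: mult_right_mono)
        also have "\<dots> \<le> int (snd j) * P f"
          using mult_left_mono[of "- int (nat (- P f))" "P f" "int (snd j)"] by simp
        finally show "- (int r * int (nat (- P f))) \<le> int (snd j) * P f" .
      qed
      moreover have "P.ge (u (fst j)) (- int (m0 P))"
      proof -
        have "nat (- P (u (fst j))) \<le> m0 P"
          unfolding m0_def using finI ij(1) by (intro member_le_sum) simp_all
        then have "- int (m0 P) \<le> P (u (fst j))" by linarith
        then show ?thesis by (simp add: order_ge_def)
      qed
      ultimately have 1: "P.ge (f ^ snd j * u (fst j)) (- (int r * int (nat (- P f))) + - int (m0 P))"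
        by (rule P.ge_mult)
      show ?thesis
      proof (cases "P \<in> F")
        case True
        with 1 show ?thesis by (simp add: algebra_simps)
      next
        case False
        then have "P f \<ge> 0" using P unfolding F_def W_def by auto
        moreover have "P (u (fst j)) \<ge> 0" using False P ij(1) unfolding F_def by force
        ultimately have "P.ge (f ^ snd j) (int (snd j) * 0)" "P.ge (u (fst j)) 0"
          by (intro P.ge_power, simp_all add: order_ge_def)
        from P.ge_mult[OF this] show ?thesis using False by simp
      qed
    qed
    then have "(f ^ snd j * u (fst j)) mod R \<in>
        rr_space R (\<lambda>Q. 0 + (if Q \<in> F then int (r * nat (- Q f) + m0 Q) else 0))"
      unfolding rr_space_mod by blast
    with S(3) show ?thesis by (rule subsetD)
  qed
  ultimately obtain c where c: "\<exists>j\<in>J. c j \<noteq> 0"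
    "(\<Sum>j\<in>J. mf_const (c j) * ((f ^ snd j * u (fst j)) mod R)) = 0"
    using mf.ex_nontrivial_combination[of J S "\<lambda>j. (f ^ snd j * u (fst j)) mod R"] S(1) by blast
  have "R dvd (\<Sum>j\<in>J. mf_const (c j) * (f ^ snd j * u (fst j)))
      - (\<Sum>j\<in>J. mf_const (c j) * ((f ^ snd j * u (fst j)) mod R))"
    unfolding sum_subtractf[symmetric] right_diff_distrib[symmetric]
    by (intro dvd_sum dvd_mult dvd_minus_mod)
  then have dvd: "R dvd (\<Sum>j\<in>J. mf_const (c j) * (f ^ snd j * u (fst j)))" using c(2) by simp
  \<comment> \<open>Collecting powers of \<open>f\<close> turns the relation over the constants into
    one over the polynomials in \<open>f\<close>, which independence refutes.\<close>
  define p where "p i = (\<Sum>l\<le>r. monom (c (i, l)) l)" for i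
  have sum: "cpoly_at (sum q {..m}) f = (\<Sum>l\<le>m. cpoly_at (q l) f)" for q and m :: nat
    by (induction m) (simp_all add: cpoly_at_add)
  have "(\<Sum>j\<in>J. mf_const (c j) * (f ^ snd j * u (fst j))) =
      (\<Sum>i\<in>I. \<Sum>l\<le>r. mf_const (c (i, l)) * (f ^ l * u i))"
    unfolding J_def by (subst sum.cartesian_product) (simp add: case_prod_unfold)
  also have "\<dots> = (\<Sum>i\<in>I. cpoly_at (p i) f * u i)"
    unfolding p_def sum by (simp add: cpoly_at_monom sum_distrib_right mult.assoc)
  finally have "R dvd (\<Sum>i\<in>I. cpoly_at (p i) f * u i)" using dvd by simp
  with u have p0: "\<forall>i\<in>I. p i = 0" by blast
  obtain i l where il: "i \<in> I" "l \<le> r" "c (i, l) \<noteq> 0" using c(1) unfolding J_def by auto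
  have "coeff (p i) l = c (i, l)" unfolding p_def using il(2) by (simp add: coeff_sum sum.delta')
  then show False using p0 il by simp
qed

text \<open>The inequality between zeros and poles is applied to \<open>f\<close> and to its
  inverse.\<close>

proposition principal_divisor:
  assumes f: "\<not> R dvd f" and S0: "finite S0" "rr_space R (\<lambda>_. 0) \<subseteq> mf.span S0"
  shows "finite {P. curve_point R P \<and> P f \<noteq> 0}" "(\<Sum>P | curve_point R P \<and> P f \<noteq> 0. P f) = 0"
proof -
  let ?Z = "{P. curve_point R P \<and> P f > 0}" and ?W = "{P. curve_point R P \<and> P f < 0}"
  have split: "{P. curve_point R P \<and> P f \<noteq> 0} = ?Z \<union> ?W" by auto
  have fin: "finite ?Z" "finite ?W" using finite_zeros[OF f] finite_poles by auto
  then show "finite {P. curve_point R P \<and> P f \<noteq> 0}" unfolding split by simp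
  obtain g where g: "R dvd f * g - 1" "\<not> R dvd g" using inverse_mod_R[OF f] by blast
  have Pg: "P g = - P f" if "curve_point R P" for P
  proof -
    interpret P: place R P using that by (rule placeI)
    show ?thesis using P.eqD[OF P.eq_inverse[OF P.eq_order[OF f] g(1)]] .
  qed
  have "{P. curve_point R P \<and> P g > 0} = ?W" "{P. curve_point R P \<and> P g < 0} = ?Z"
    by (intro Collect_cong conj_cong refl, simp add: Pg)+
  with zeros_le_poles[OF g(2) S0] have "(\<Sum>P\<in>?W. P g) \<le> (\<Sum>P\<in>?Z. - P g)" by simp
  also have "(\<Sum>P\<in>?W. P g) = (\<Sum>P\<in>?W. - P f)" by (rule sum.cong) (simp_all add: Pg)
  also have "(\<Sum>P\<in>?Z. - P g) = (\<Sum>P\<in>?Z. P f)" by (rule sum.cong) (simp_all add: Pg)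
  finally have "(\<Sum>P\<in>?W. - P f) \<le> (\<Sum>P\<in>?Z. P f)" .
  with zeros_le_poles[OF f S0] have "(\<Sum>P\<in>?Z. P f) + (\<Sum>P\<in>?W. P f) = 0" by (simp add: sum_negf)
  then show "(\<Sum>P | curve_point R P \<and> P f \<noteq> 0. P f) = 0"
    unfolding split using fin by (subst sum.union_disjoint) auto
qed

end

section \<open>Lax matrices\<close>

text \<open>Lax matrices and determinants occur over rational functions, \<open>mfun\<close>,
  polynomials and power series; identities between them are transported along such maps.\<close>

locale unital_ring_hom =
  fixes h :: "'a::comm_ring_1 \<Rightarrow> 'b::comm_ring_1"
  assumes one [simp]: "h 1 = 1" and add: "h (a + b) = h a + h b" and mult: "h (a * b) = h a * h b"
begin

lemma zero [simp]: "h 0 = 0"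
  using add[of 0 0] by simp

lemma uminus: "h (- a) = - h a"
proof -
  have "h a + h (- a) = 0" unfolding add[symmetric] by simp
  then show ?thesis by (rule minus_unique[symmetric])
qed

lemma diff: "h (a - b) = h a - h b"
  using add[of a "- b"] by (simp add: uminus)

lemma sum: "h (sum f A) = (\<Sum>i\<in>A. h (f i))"
  by (induction A rule: infinite_finite_induct) (simp_all add: add)

lemma power: "h (a ^ n) = h a ^ n"
  by (induction n) (simp_all add: mult)

lemma lax_matrix:
  "h (lax_matrix e w x y i $ a $ b) = lax_matrix (\<lambda>c. h (e c)) (h w) x y i $ a $ b"
  using exhaust_3[of a] exhaust_3[of b] by (auto simp: lax_matrix_def uminus)

lemma lax_product:
  "h (lax_product e w x y i m $ a $ b) = lax_product (\<lambda>c. h (e c)) (h w) x y i m $ a $ b"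
proof (induction m arbitrary: a b)
  case (Suc m)
  then show ?case by (simp add: matrix_matrix_mult_def sum mult lax_matrix)
qed (simp add: mat_def)

lemma det_3: "h (det (A :: 'a ^ 3 ^ 3)) = det (\<chi> a b. h (A $ a $ b))"
  by (simp add: Determinants.det_3 add diff mult)

end

lemma lax_product_Suc_right:
  "lax_product e w x y i (Suc m) = lax_product e w x y (i + 1) m ** lax_matrix e w x y i"
proof (induction m)
  case (Suc m)
  have "lax_product e w x y i (Suc (Suc m))
      = lax_matrix e w x y (i + 1 + int m) ** lax_product e w x y i (Suc m)"
    by (simp add: add_ac)
  also have "\<dots> = lax_product e w x y (i + 1) (Suc m) ** lax_matrix e w x y i"
    unfolding Suc.IH by (simp add: matrix_mul_assoc)
  finally show ?case .
qed simp

lemma det_lax_matrix: "det (lax_matrix e w x y i) = e (y (i + 2)) * e (1 / x (i + 2)) * w"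
  by (simp add: Determinants.det_3 lax_matrix_def algebra_simps)

lemma det_lax_product_nonzero:
  fixes w :: "'a::idom"
  assumes "w \<noteq> 0" "\<And>j. e (y j) \<noteq> 0" "\<And>j. e (1 / x j) \<noteq> 0"
  shows "det (lax_product e w x y i m) \<noteq> 0"
  by (induction m) (simp_all add: det_mul det_lax_matrix assms)

definition fconst :: "complex \<Rightarrow> complex poly fract" where
  "fconst c = to_fract [:c:]"

definition fz :: "complex poly fract" where
  "fz = to_fract [:0, 1:]"

text \<open>The entries of the monodromy do not involve \<open>k\<close>. Over the field of rational
  functions, unlike over the ring \<open>mfun\<close>, ranks and inverses of matrices are
  available.\<close>

definition fmonodromy :: "nat \<Rightarrow> (int \<Rightarrow> complex) \<Rightarrow> (int \<Rightarrow> complex) \<Rightarrow> int \<Rightarrow> complex poly fract ^ 3 ^ 3" where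
  "fmonodromy n x y i = lax_product fconst (inverse fz) x y i n"

interpretation mf_rat: unital_ring_hom mf_rat
  by unfold_locales (simp_all add: mf_rat_add mf_rat_mult)

interpretation mf_const: unital_ring_hom mf_const
  by unfold_locales (simp_all add: mf_const_add mf_const_mult)

lemma mf_const_conv_mf_rat: "mf_const c = mf_rat (fconst c)"
  by (simp add: mf_const_def mf_rat_def fconst_def)

lemma mf_z_conv_mf_rat: "mf_z = mf_rat fz"
  by (simp add: mf_z_def mf_rat_def fz_def)

lemma mf_zinv_conv_mf_rat: "mf_zinv = mf_rat (inverse fz)"
  by (simp add: mf_zinv_def mf_rat_def fz_def)

lemma monodromy_conv_mf_rat: "monodromy n x y i $ a $ b = mf_rat (fmonodromy n x y i $ a $ b)"
  unfolding monodromy_def fmonodromy_def mf_zinv_conv_mf_rat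
  by (subst mf_rat.lax_product) (simp add: mf_const_conv_mf_rat[symmetric])

lemma det_minus_mat:
  fixes A :: "'a::comm_ring_1 ^ 3 ^ 3"
  shows "det (A - mat s) = det A
    - (A$1$1 * A$2$2 - A$1$2 * A$2$1 + A$1$1 * A$3$3 - A$1$3 * A$3$1 + A$2$2 * A$3$3 - A$2$3 * A$3$2) * s
    + (A$1$1 + A$2$2 + A$3$3) * s ^ 2 - s ^ 3"
  by (simp add: Determinants.det_3 mat_def) (simp add: power2_eq_square power3_eq_cube algebra_simps)

text \<open>The prefactor \<open>- 1 / C ^ 3\<close> makes the polynomial monic in \<open>k\<close>;
  all later degree counts rest on this.\<close>

lemma spectral_poly_coeffs:
  assumes "C \<noteq> 0"
  shows "\<exists>a0 a1 a2. spectral_poly n x y C = [:a0, a1, a2, 1:]"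
proof -
  define A where "A = fmonodromy n x y 0"
  have A: "monodromy n x y 0 $ a $ b = mf_rat (A $ a $ b)" for a b
    by (simp add: A_def monodromy_conv_mf_rat)
  define m where "m = A$1$1 * A$2$2 - A$1$2 * A$2$1 + A$1$1 * A$3$3 - A$1$3 * A$3$1 + A$2$2 * A$3$3 - A$2$3 * A$3$2"
  define t where "t = A$1$1 + A$2$2 + A$3$3"
  have d: "det (monodromy n x y 0) = mf_rat (det A)"
    unfolding mf_rat.det_3 by (simp add: Determinants.det_3 A)
  have "det (monodromy n x y 0 - mat (mf_const C * mf_k)) = mf_rat (det A)
      - mf_rat m * (mf_rat (fconst C) * mf_k) + mf_rat t * (mf_rat (fconst C) * mf_k) ^ 2
      - (mf_rat (fconst C) * mf_k) ^ 3"
    by (simp add: det_minus_mat d A m_def t_def mf_rat_add mf_rat_diff mf_rat_mult mf_const_conv_mf_rat)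
  moreover have "fconst (1 / C ^ 3) * fconst C ^ 3 = 1"
    using assms by (simp add: fconst_def power3_eq_cube flip: to_fract_mult one_pCons)
  ultimately have "spectral_poly n x y C =
     [: - fconst (1 / C ^ 3) * det A, fconst (1 / C ^ 3) * m * fconst C,
        - fconst (1 / C ^ 3) * t * fconst C ^ 2, 1 :]"
    by (simp add: spectral_poly_def mf_const_conv_mf_rat mf_rat_def mf_k_def power2_eq_square
        power3_eq_cube algebra_simps)
  then show ?thesis by blast
qed

lemma det_minus_mat_conjugate:
  fixes A B Q :: "'a::idom ^ 3 ^ 3"
  assumes "A ** Q = Q ** B" "det Q \<noteq> 0"
  shows "det (A - mat s) = det (B - mat s)"
proof -
  have "mat s ** Q = Q ** mat s"
    by (simp add: vec_eq_iff matrix_matrix_mult_def mat_def if_distrib[of "\<lambda>a. a * _"]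
        if_distrib[of "\<lambda>a. _ * a"] mult.commute cong: if_cong)
  then have "(A - mat s) ** Q = Q ** (B - mat s)"
    using assms(1) by (simp add: vec_eq_iff matrix_matrix_mult_def left_diff_distrib right_diff_distrib sum_subtractf)
  then have "det ((A - mat s) ** Q) = det (Q ** (B - mat s))" by (rule arg_cong)
  then show ?thesis using assms(2) by (simp add: det_mul mult.commute)
qed

text \<open>
  The matrix of the zero curvature representation; it is determined up to scalars by the divisor
  \<open>W2 - O1\<close> by which one step of the pentagram map should shift the pole divisor.
\<close>

definition evolution_matrix :: "(int \<Rightarrow> complex) \<Rightarrow> (int \<Rightarrow> complex) \<Rightarrow> int \<Rightarrow> mfun ^ 3 ^ 3" where
  "evolution_matrix x y i = (let X = (\<lambda>j. x (i + j) * y (i + j)) in vector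
     [vector [mf_const (1 - X 2), 0, mf_const (1 - X 2)],
      vector [mf_const (X 1 * (1 - X 2)), mf_const (1 - X 1), mf_const (1 - X 2)],
      vector [0, - (mf_const (y (i + 2) * (1 - X 3)) * mf_z), 0]])"

lemma det_evolution_matrix:
  "det (evolution_matrix x y i) = mf_z * mf_const (y (i + 2) * (1 - x (i + 3) * y (i + 3)) *
     (1 - x (i + 2) * y (i + 2)) ^ 2 * (1 - x (i + 1) * y (i + 1)))"
proof -
  have *: "det (vector [vector [a, 0, a], vector [b, c, d], vector [0, - f, 0]] :: mfun ^ 3 ^ 3) = f * (a * d - a * b)"
    for a b c d f :: mfun
    by (simp add: Determinants.det_3 algebra_simps)
  define X where "X j = x (i + j) * y (i + j)" for j
  have "det (evolution_matrix x y i) = mf_const (y (i + 2) * (1 - X 3)) * mf_z *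
      (mf_const (1 - X 2) * mf_const (1 - X 2) - mf_const (1 - X 2) * mf_const (X 1 * (1 - X 2)))"
    unfolding evolution_matrix_def Let_def * X_def ..
  also have "\<dots> = mf_z * mf_const (y (i + 2) * (1 - X 3) * ((1 - X 2) * (1 - X 2) - (1 - X 2) * (X 1 * (1 - X 2))))"
    by (simp only: mf_const_mult mf_const_diff mult_ac)
  also have "(1 - X 2) * (1 - X 2) - (1 - X 2) * (X 1 * (1 - X 2)) = (1 - X 2)\<^sup>2 * (1 - X 1)"
    by (simp add: power2_eq_square algebra_simps)
  finally show ?thesis by (simp only: X_def mult.assoc)
qed

lemma zero_curvature:
  assumes step: "(x', y') = pentagram (x, y)"
    and nz: "\<And>j. x j \<noteq> 0" "\<And>j. y j \<noteq> 0" "\<And>j. 1 - x j * y j \<noteq> 0"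
  shows "lax_matrix mf_const mf_zinv x' y' i ** evolution_matrix x y i
    = evolution_matrix x y (i + 1) ** lax_matrix mf_const mf_zinv x y i"
proof -
  define X where "X j = x (i + j) * y (i + j)" for j
  have x': "x' (i + 2) = x (i + 2) * (1 - X 1) / (1 - X 3)"
    and y': "y' (i + 2) = y (i + 3) * (1 - X 4) / (1 - X 2)"
    using step by (simp_all add: pentagram_def X_def algebra_simps)
  have nX: "1 - X j \<noteq> 0" for j unfolding X_def by (rule nz)
  have zz: "mf_z * mf_zinv = 1" "mf_zinv * mf_z = 1" using mf_z_mult_zinv by (simp_all add: mult.commute)
  have zz': "mf_z * (mf_zinv * a) = a" for a by (simp add: mult.assoc[symmetric] zz)
  have P: "evolution_matrix x y i = vector
     [vector [mf_const (1 - X 2), 0, mf_const (1 - X 2)],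
      vector [mf_const (X 1 * (1 - X 2)), mf_const (1 - X 1), mf_const (1 - X 2)],
      vector [0, - (mf_const (y (i + 2) * (1 - X 3)) * mf_z), 0]]"
    by (simp add: evolution_matrix_def Let_def X_def)
  have P': "evolution_matrix x y (i + 1) = vector
     [vector [mf_const (1 - X 3), 0, mf_const (1 - X 3)],
      vector [mf_const (X 2 * (1 - X 3)), mf_const (1 - X 2), mf_const (1 - X 3)],
      vector [0, - (mf_const (y (i + 3) * (1 - X 4)) * mf_z), 0]]"
    by (simp add: evolution_matrix_def Let_def X_def add.assoc)
  \<comment> \<open>Four scalar identities stand behind the matrix entries; in each of them the
    pentagram formulas cancel against factors \<open>1 - X j\<close>.\<close>
  have k2: "1 / x' (i + 2) * (1 - X 1) = (1 - X 3) * (1 / x (i + 2))"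
    using nX nz(1)[of "i + 2"] unfolding x' by (simp add: field_simps)
  have k1: "1 / x' (i + 2) * (1 - X 2) - 1 / x' (i + 2) * (X 1 * (1 - X 2)) = (1 - X 3) * (1 / x (i + 2)) - (1 - X 3) * y (i + 2)"
  proof -
    have "1 / x' (i + 2) * (1 - X 2) - 1 / x' (i + 2) * (X 1 * (1 - X 2))
        = (1 / x' (i + 2) * (1 - X 1)) * (1 - X 2)" by (simp only: algebra_simps mult_1_left mult_1_right)
    also have "\<dots> = (1 - X 3) * (1 / x (i + 2)) - (1 - X 3) * (1 / x (i + 2) * X 2)"
      unfolding k2 by (simp only: algebra_simps mult_1_left mult_1_right)
    also have "1 / x (i + 2) * X 2 = y (i + 2)" using nz(1)[of "i + 2"] by (simp add: X_def)
    finally show ?thesis .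
  qed
  have k3: "X 2 * (1 - X 3) * (1 / x (i + 2)) = y (i + 2) * (1 - X 3)"
    using nz(1)[of "i + 2"] by (simp add: X_def)
  have k4: "y' (i + 2) * (1 - X 2) = y (i + 3) * (1 - X 4)"
    using nX unfolding y' by (simp add: field_simps)
  \<comment> \<open>With the reciprocals as opaque symbols, the entries can be compared by ring
    arithmetic and the four identities alone.\<close>
  define u where "u = 1 / x' (i + 2)"
  define v where "v = 1 / x (i + 2)"
  note K = k1[folded u_def v_def, THEN arg_cong, of mf_const] k2[folded u_def v_def, THEN arg_cong, of mf_const]
    k3[folded u_def v_def, THEN arg_cong, of mf_const] k4[THEN arg_cong, of mf_const]
  have L: "lax_matrix mf_const mf_zinv x y i = vector [vector [mf_const v, - mf_const v, 0],
      vector [mf_zinv, 0, mf_zinv], vector [- mf_const (y (i + 2)), 0, 0]]"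
    and L': "lax_matrix mf_const mf_zinv x' y' i = vector [vector [mf_const u, - mf_const u, 0],
      vector [mf_zinv, 0, mf_zinv], vector [- mf_const (y' (i + 2)), 0, 0]]"
    by (simp_all add: lax_matrix_def u_def v_def)
  show ?thesis
    using K unfolding L L' P P' mf_const_mult mf_const_diff mf_const_1
    by (simp add: vec_eq_iff forall_3 matrix_matrix_mult_def sum_3) (auto simp: algebra_simps zz zz')
qed

lemma evolution_matrix_periodic:
  "(\<And>j. x (j + k) = x j) \<Longrightarrow> (\<And>j. y (j + k) = y j) \<Longrightarrow> evolution_matrix x y (i + k) = evolution_matrix x y i"
  by (simp add: evolution_matrix_def Let_def add.commute[of _ k] add.assoc)

lemma pentagram_periodic:
  assumes "(x', y') = pentagram (x, y)" "\<And>j. x (j + k) = x j" "\<And>j. y (j + k) = y j"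
  shows "x' (j + k) = x' j" "y' (j + k) = y' j"
proof -
  have "x (j + k + l) = x (j + l)" "y (j + k + l) = y (j + l)" for l
    using assms(2,3)[of "j + l"] by (simp_all add: add_ac)
  from this[of 1] this[of "-1"] this[of 2] this[of 0]
  show "x' (j + k) = x' j" "y' (j + k) = y' j" using assms(1) by (simp_all add: pentagram_def)
qed

lemma evolution_lax_product:
  assumes "(x', y') = pentagram (x, y)" "\<And>j. x j \<noteq> 0" "\<And>j. y j \<noteq> 0" "\<And>j. 1 - x j * y j \<noteq> 0"
  shows "lax_product mf_const mf_zinv x' y' i m ** evolution_matrix x y i
    = evolution_matrix x y (i + int m) ** lax_product mf_const mf_zinv x y i m"
proof (induction m)
  case (Suc m)
  have "lax_product mf_const mf_zinv x' y' i (Suc m) ** evolution_matrix x y i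
      = lax_matrix mf_const mf_zinv x' y' (i + int m) ** (evolution_matrix x y (i + int m)
        ** lax_product mf_const mf_zinv x y i m)"
    by (simp add: matrix_mul_assoc[symmetric] Suc.IH)
  also have "\<dots> = evolution_matrix x y (i + int m + 1) ** lax_product mf_const mf_zinv x y i (Suc m)"
    by (simp add: matrix_mul_assoc zero_curvature[OF assms])
  finally show ?case by (simp add: add_ac)
qed simp

lemma evolution_monodromy:
  assumes "(x', y') = pentagram (x, y)" "\<And>j. x j \<noteq> 0" "\<And>j. y j \<noteq> 0" "\<And>j. 1 - x j * y j \<noteq> 0"
    and "\<And>j. x (j + int n) = x j" "\<And>j. y (j + int n) = y j"
  shows "monodromy n x' y' i ** evolution_matrix x y i = evolution_matrix x y i ** monodromy n x y i"
proof -
  have "evolution_matrix x y (i + int n) = evolution_matrix x y i"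
    using assms(5,6) by (rule evolution_matrix_periodic)
  then show ?thesis unfolding monodromy_def evolution_lax_product[OF assms(1-4)] by simp
qed

text \<open>The evolution matrix has nonzero determinant and intertwines the two monodromies, so
  their characteristic polynomials agree; one curve serves for all times.\<close>

lemma spectral_poly_pentagram:
  assumes "(x', y') = pentagram (x, y)" "\<And>j. x j \<noteq> 0" "\<And>j. y j \<noteq> 0" "\<And>j. 1 - x j * y j \<noteq> 0"
    and "\<And>j. x (j + int n) = x j" "\<And>j. y (j + int n) = y j"
  shows "spectral_poly n x' y' C = spectral_poly n x y C"
proof -
  have "det (evolution_matrix x y 0) \<noteq> 0"
    using assms(2-4) by (simp add: det_evolution_matrix mf_z_def)
  then show ?thesis
    unfolding spectral_poly_def using det_minus_mat_conjugate[OF evolution_monodromy[OF assms]] by simp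
qed

text \<open>Both sides are the product of \<open>n + 1\<close> consecutive Lax matrices, split at
  either end; periodicity identifies the last factor with the first.\<close>

lemma lax_monodromy:
  assumes "\<And>j. x (j + int n) = x j" "\<And>j. y (j + int n) = y j"
  shows "monodromy n x y (i + 1) ** lax_matrix mf_const mf_zinv x y i
    = lax_matrix mf_const mf_zinv x y i ** monodromy n x y i"
proof -
  have "x (i + int n + 2) = x (i + 2)" "y (i + int n + 2) = y (i + 2)"
    using assms[of "i + 2"] by (simp_all add: add_ac)
  then have "lax_matrix mf_const mf_zinv x y (i + int n) = lax_matrix mf_const mf_zinv x y i"
    by (simp add: lax_matrix_def)
  then show ?thesis unfolding monodromy_def lax_product_Suc_right[symmetric] by simp
qed

text \<open>The coefficients of the covector stay in the field of rational functions, which turns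
  relations between the components of a solution into linear algebra.\<close>

definition row_apply :: "complex poly fract ^ 3 \<Rightarrow> mfun ^ 3 \<Rightarrow> mfun" where
  "row_apply c \<phi> = (\<Sum>j\<in>UNIV. mf_rat (c $ j) * \<phi> $ j)"

lemma row_apply_vmult:
  "row_apply (r v* A) \<phi> = row_apply r ((\<chi> a b. mf_rat (A $ a $ b)) *v \<phi>)"
  by (simp add: row_apply_def vector_matrix_mult_def matrix_vector_mult_def sum_3 mf_rat_add
      mf_rat_mult algebra_simps)

lemma row_apply_0 [simp]: "row_apply 0 \<phi> = 0"
  by (simp add: row_apply_def)

lemma row_apply_diff: "row_apply r (\<phi> - \<psi>) = row_apply r \<phi> - row_apply r \<psi>"
  by (simp add: row_apply_def right_diff_distrib sum_subtractf)

lemma row_apply_smult: "row_apply r (f *s \<phi>) = f * row_apply r \<phi>"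
  by (simp add: row_apply_def sum_distrib_left mult_ac)

lemma row_apply_axis: "row_apply (axis j 1) \<phi> = \<phi> $ j"
  using exhaust_3[of j] by (auto simp: row_apply_def sum_3 axis_def)

lemma row_apply_ones: "row_apply 1 \<phi> = (\<Sum>j\<in>UNIV. \<phi> $ j)"
  by (simp add: row_apply_def)

lemma dvd_row_apply: "(\<And>j. R dvd \<phi> $ j) \<Longrightarrow> R dvd row_apply r \<phi>"
  unfolding row_apply_def by (intro dvd_sum dvd_mult)

lemma dvd_matrix_vector_mult: "(\<And>j. (R::'a::comm_ring_1) dvd \<phi> $ j) \<Longrightarrow> R dvd (A *v \<phi>) $ j"
  unfolding matrix_vector_mult_def by (simp add: dvd_sum)

lemma matrix_vector_mult_smult: "A *v (c *s v) = c *s (A *v (v :: 'a::comm_ring_1 ^ 'n))"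
  by (simp add: vec_eq_iff matrix_vector_mult_def sum_distrib_left mult_ac)

lemma invertible_if_row_kernel:
  fixes A :: "'a::field ^ 3 ^ 3"
  assumes "\<And>r. r v* A = 0 \<Longrightarrow> r = 0"
  obtains B where "B ** A = mat 1"
proof -
  have "\<exists>B. B ** transpose A = mat 1"
    unfolding matrix_left_invertible_ker using assms by simp
  then obtain B where "B ** transpose A = mat 1" by blast
  then have "transpose A ** B = mat 1" by (simp add: matrix_left_right_inverse)
  then have "transpose (transpose A ** B) = mat 1" by simp
  then show ?thesis using that[of "transpose B"] by (simp add: matrix_transpose_mul)
qed

section \<open>The line of eigenvectors over the function field\<close>

locale spectral_curve = irreducible_curve +
  fixes n :: nat and x y :: "int \<Rightarrow> complex" and C :: complex
  assumes R: "R = spectral_poly n x y C" and C: "C \<noteq> 0"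
    and periodic: "\<And>j. x (j + int n) = x j" "\<And>j. y (j + int n) = y j"
    and nonzero: "\<And>j. x j \<noteq> 0" "\<And>j. y j \<noteq> 0"
begin

definition eigenvalue :: mfun where
  "eigenvalue = mf_const C * mf_k"

definition eigenvector :: "int \<Rightarrow> mfun ^ 3 \<Rightarrow> bool" where
  "eigenvector i \<phi> \<longleftrightarrow> (\<forall>j. R dvd (monodromy n x y i *v \<phi> - eigenvalue *s \<phi>) $ j)"

definition normalized :: "int \<Rightarrow> mfun ^ 3 \<Rightarrow> bool" where
  "normalized i \<psi> \<longleftrightarrow> eigenvector i \<psi> \<and> R dvd (\<Sum>j\<in>UNIV. \<psi> $ j) - 1"

lemma floquet_bloch_iff: "floquet_bloch n x y C i \<psi> \<longleftrightarrow> normalized i \<psi>"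
  by (simp add: floquet_bloch_def normalized_def eigenvector_def eigenvalue_def R[symmetric] Let_def)

lemma R_coeffs: "\<exists>a0 a1 a2. R = [:a0, a1, a2, 1:]"
  unfolding R using C by (rule spectral_poly_coeffs)

lemma degree_R: "degree R = 3"
  using R_coeffs by auto

lemma eigenvector_row_apply:
  assumes "eigenvector i \<phi>"
  shows "R dvd row_apply (r v* fmonodromy n x y i) \<phi> - eigenvalue * row_apply r \<phi>"
proof -
  have "(\<chi> a b. mf_rat (fmonodromy n x y i $ a $ b)) = monodromy n x y i"
    by (simp add: vec_eq_iff monodromy_conv_mf_rat)
  then have "row_apply (r v* fmonodromy n x y i) \<phi> - eigenvalue * row_apply r \<phi>
      = row_apply r (monodromy n x y i *v \<phi> - eigenvalue *s \<phi>)"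
    by (simp add: row_apply_vmult row_apply_diff row_apply_smult)
  then show ?thesis using assms unfolding eigenvector_def by (simp add: dvd_row_apply)
qed

text \<open>The Krylov matrix of the covector \<open>(1, 1, 1)\<close>. On an eigenvector its rows
  take the values \<open>s\<close>, \<open>\<lambda> s\<close>, \<open>\<lambda>^2 s\<close>, where
  \<open>s\<close> is the sum of the components and \<open>\<lambda>\<close> the eigenvalue; it
  translates between components and powers of the eigenvalue.\<close>

definition krylov :: "int \<Rightarrow> complex poly fract ^ 3 ^ 3" where
  "krylov i = (let F = fmonodromy n x y i in vector [1, 1 v* F, (1 v* F) v* F])"

definition in_powers :: "complex poly fract ^ 3 \<Rightarrow> mfun" where
  "in_powers r = mf_rat (r $ 1) + mf_rat (r $ 2) * eigenvalue + mf_rat (r $ 3) * eigenvalue ^ 2"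

lemma krylov_apply:
  assumes "eigenvector i \<phi>"
  shows "R dvd row_apply (r v* krylov i) \<phi> - in_powers r * (\<Sum>j\<in>UNIV. \<phi> $ j)"
proof -
  define F where "F = fmonodromy n x y i"
  define s0 where "s0 = row_apply 1 \<phi>"
  define s1 where "s1 = row_apply (1 v* F) \<phi>"
  define s2 where "s2 = row_apply ((1 v* F) v* F) \<phi>"
  have "row_apply (r v* krylov i) \<phi> = mf_rat (r $ 1) * s0 + mf_rat (r $ 2) * s1 + mf_rat (r $ 3) * s2"
    unfolding s0_def s1_def s2_def row_apply_def vector_matrix_mult_def[of r] krylov_def F_def[symmetric] Let_def
    by (simp add: sum_3 mf_rat_add mf_rat_mult algebra_simps)
  moreover have 1: "R dvd s1 - eigenvalue * s0" and 2: "R dvd s2 - eigenvalue * s1"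
    unfolding s0_def s1_def s2_def F_def by (intro eigenvector_row_apply assms)+
  ultimately have "row_apply (r v* krylov i) \<phi> - in_powers r * s0
      = mf_rat (r $ 2) * (s1 - eigenvalue * s0) + mf_rat (r $ 3) * ((s2 - eigenvalue * s1) + eigenvalue * (s1 - eigenvalue * s0))"
    by (simp add: in_powers_def power2_eq_square algebra_simps)
  also have "R dvd \<dots>" by (rule dvd_add[OF dvd_mult[OF 1] dvd_mult[OF dvd_add[OF 2 dvd_mult[OF 1]]]])
  finally show ?thesis unfolding s0_def row_apply_ones .
qed

lemma in_powers_eq: "in_powers r = [: r $ 1, r $ 2 * fconst C, r $ 3 * fconst C ^ 2 :]"
  by (simp add: in_powers_def eigenvalue_def mf_const_conv_mf_rat mf_rat_def mf_k_def power2_eq_square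
      algebra_simps)

lemma fconst_C: "fconst C \<noteq> 0"
  using C by (simp add: fconst_def)

lemma in_powers_dvd: "R dvd in_powers r \<Longrightarrow> r = 0"
proof -
  assume "R dvd in_powers r"
  moreover have "degree (in_powers r) < degree R" unfolding degree_R in_powers_eq by simp
  ultimately have "in_powers r = 0" by (meson dvd_imp_degree_le not_less)
  then show "r = 0" using fconst_C by (simp add: in_powers_eq vec_eq_iff forall_3)
qed

lemma in_powers_surj: "\<exists>r. R dvd f - in_powers r"
proof -
  have "degree (f mod R) < 3" using degree_mod_less[of R f] degree_R R_nonzero by auto
  then have "f mod R = [: coeff (f mod R) 0, coeff (f mod R) 1, coeff (f mod R) 2 :]"
    by (intro poly_eqI) (auto simp: coeff_pCons coeff_eq_0 numeral_2_eq_2 split: nat.splits)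
  also have "\<dots> = in_powers (vector [coeff (f mod R) 0, coeff (f mod R) 1 / fconst C, coeff (f mod R) 2 / fconst C ^ 2])"
    using fconst_C by (simp add: in_powers_eq)
  finally show ?thesis using dvd_minus_mod[of R f] by metis
qed

text \<open>A vanishing combination of the rows would give a nonzero polynomial of degree at most 2
  in \<open>k\<close> that vanishes on the curve, whereas \<open>R\<close> has degree 3.\<close>

lemma krylov_inverse:
  assumes "normalized i \<psi>"
  obtains B where "B ** krylov i = mat 1"
proof (rule invertible_if_row_kernel)
  fix r assume "r v* krylov i = 0"
  then have "R dvd in_powers r * (\<Sum>j\<in>UNIV. \<psi> $ j)"
    using krylov_apply[of i \<psi> r] assms by (simp add: normalized_def)
  moreover have "\<not> R dvd (\<Sum>j\<in>UNIV. \<psi> $ j)"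
    using assms dvd_cong[of "\<Sum>j\<in>UNIV. \<psi> $ j" 1] by (simp add: normalized_def)
  ultimately have "R dvd in_powers r" by (simp only: prime_R) blast
  then show "r = 0" by (rule in_powers_dvd)
qed (use that in blast)

lemma normalized_sum_not_dvd: "normalized i \<psi> \<Longrightarrow> \<not> R dvd (\<Sum>j\<in>UNIV. \<psi> $ j)"
  using dvd_cong[of "\<Sum>j\<in>UNIV. \<psi> $ j" 1] by (simp add: normalized_def)

text \<open>Through the Krylov rows a relation between the components becomes one between the powers
  0, 1, 2 of the eigenvalue.\<close>

lemma normalized_independent:
  assumes \<psi>: "normalized i \<psi>" and c: "R dvd row_apply c \<psi>"
  shows "c = 0"
proof -
  obtain B where B: "B ** krylov i = mat 1" using \<psi> by (rule krylov_inverse)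
  have c': "c = (c v* B) v* krylov i" by (simp add: vector_matrix_mul_assoc B)
  have "R dvd row_apply ((c v* B) v* krylov i) \<psi> - in_powers (c v* B) * (\<Sum>j\<in>UNIV. \<psi> $ j)"
    using \<psi> by (intro krylov_apply) (simp add: normalized_def)
  with c have "R dvd in_powers (c v* B) * (\<Sum>j\<in>UNIV. \<psi> $ j)" using c' dvd_cong by metis
  with normalized_sum_not_dvd[OF \<psi>] have "R dvd in_powers (c v* B)" by (simp only: prime_R) blast
  then have "c v* B = 0" by (rule in_powers_dvd)
  then show ?thesis using c' by simp
qed

text \<open>The eigenspace is a line: each component is a combination of the Krylov rows, whose
  values depend on the eigenvector only through the sum of its components.\<close>

lemma normalized_unique:
  assumes \<psi>: "normalized i \<psi>" and \<omega>: "eigenvector i \<omega>"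
  shows "R dvd \<omega> $ j - (\<Sum>l\<in>UNIV. \<omega> $ l) * \<psi> $ j"
proof -
  obtain B where B: "B ** krylov i = mat 1" using \<psi> by (rule krylov_inverse)
  define s where "s = (\<Sum>l\<in>UNIV. \<omega> $ l)"
  define r where "r = axis j 1 v* B"
  have c': "r v* krylov i = axis j 1" by (simp add: r_def vector_matrix_mul_assoc B)
  have 1: "R dvd \<omega> $ j - in_powers r * s"
    using krylov_apply[OF \<omega>, of r] unfolding c' row_apply_axis s_def .
  have 2: "R dvd \<psi> $ j - in_powers r * (\<Sum>l\<in>UNIV. \<psi> $ l)"
    using krylov_apply[of i \<psi> r] \<psi> unfolding c' row_apply_axis normalized_def by blast
  have 3: "R dvd (\<Sum>l\<in>UNIV. \<psi> $ l) - 1" using \<psi> by (simp add: normalized_def)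
  have "\<omega> $ j - s * \<psi> $ j = (\<omega> $ j - in_powers r * s) - s * (\<psi> $ j - in_powers r * (\<Sum>l\<in>UNIV. \<psi> $ l))
      - s * in_powers r * ((\<Sum>l\<in>UNIV. \<psi> $ l) - 1)"
    by (simp only: algebra_simps mult_1_right) simp
  also have "R dvd \<dots>" by (rule dvd_diff[OF dvd_diff[OF 1 dvd_mult[OF 2]] dvd_mult[OF 3]])
  finally show ?thesis unfolding s_def .
qed

lemma in_powers_apply:
  assumes "normalized i \<psi>"
  shows "R dvd in_powers r - row_apply (r v* krylov i) \<psi>"
proof -
  have "R dvd row_apply (r v* krylov i) \<psi> - in_powers r * (\<Sum>j\<in>UNIV. \<psi> $ j)"
    using assms by (intro krylov_apply) (simp add: normalized_def)
  moreover have "R dvd in_powers r * ((\<Sum>j\<in>UNIV. \<psi> $ j) - 1)"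
    using assms by (intro dvd_mult) (simp add: normalized_def)
  ultimately have "R dvd - (row_apply (r v* krylov i) \<psi> - in_powers r * (\<Sum>j\<in>UNIV. \<psi> $ j))
     - in_powers r * ((\<Sum>j\<in>UNIV. \<psi> $ j) - 1)" by (intro dvd_diff[OF iffD2[OF dvd_minus_iff]])
  also have "\<dots> = in_powers r - row_apply (r v* krylov i) \<psi>" by (simp add: algebra_simps)
  finally show ?thesis .
qed

lemma eigenvector_lax:
  assumes "eigenvector i \<phi>"
  shows "eigenvector (i + 1) (lax_matrix mf_const mf_zinv x y i *v \<phi>)"
proof -
  have lm: "monodromy n x y (i + 1) ** lax_matrix mf_const mf_zinv x y i
    = lax_matrix mf_const mf_zinv x y i ** monodromy n x y i"
    using periodic by (rule lax_monodromy)
  have "monodromy n x y (i + 1) *v (lax_matrix mf_const mf_zinv x y i *v \<phi>)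
      - eigenvalue *s (lax_matrix mf_const mf_zinv x y i *v \<phi>)
      = lax_matrix mf_const mf_zinv x y i *v (monodromy n x y i *v \<phi> - eigenvalue *s \<phi>)"
    by (simp add: matrix_vector_mul_assoc lm matrix_vector_mult_diff_distrib
        matrix_vector_mult_smult)
  then show ?thesis using assms unfolding eigenvector_def by (simp add: dvd_matrix_vector_mult)
qed

lemma eigenvector_evolution:
  assumes "(x', y') = pentagram (x, y)" "\<And>j. 1 - x j * y j \<noteq> 0" "eigenvector i \<phi>"
  shows "R dvd (monodromy n x' y' i *v (evolution_matrix x y i *v \<phi>)
      - eigenvalue *s (evolution_matrix x y i *v \<phi>)) $ j"
proof -
  have em: "monodromy n x' y' i ** evolution_matrix x y i = evolution_matrix x y i ** monodromy n x y i"
    using assms(1) nonzero assms(2) periodic by (rule evolution_monodromy)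
  have "monodromy n x' y' i *v (evolution_matrix x y i *v \<phi>)
      - eigenvalue *s (evolution_matrix x y i *v \<phi>)
      = evolution_matrix x y i *v (monodromy n x y i *v \<phi> - eigenvalue *s \<phi>)"
    by (simp add: matrix_vector_mul_assoc em
        matrix_vector_mult_diff_distrib matrix_vector_mult_smult)
  then show ?thesis using assms(3) unfolding eigenvector_def by (simp add: dvd_matrix_vector_mult)
qed

end

section \<open>Eigenvectors at the marked points\<close>

context place
begin

lemma eq_iff': "eq f m \<longleftrightarrow> ge f m \<and> \<not> ge f (m + 1)"
  using eqI eq_imp_ge eq_not_ge by fastforce

lemma ge_mult_iff:
  assumes "eq g l"
  shows "ge (g * f) (l + m) \<longleftrightarrow> ge f m"
  using ge_mult_cancel[OF assms, of f m] ge_mult[OF eq_imp_ge[OF assms], of f m] by (rule iffI)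

lemma ge_const_mult_iff:
  assumes "c \<noteq> 0"
  shows "ge (mf_const c * f) m \<longleftrightarrow> ge f m"
  using ge_mult_iff[OF eq_const[OF assms], of f m] by simp

text \<open>The least order among the components, as a relation: a minimum of the values
  \<open>P (\<phi> $ j)\<close> would be spoiled by the dummy order of zero components.\<close>

definition vord :: "mfun ^ 3 \<Rightarrow> int \<Rightarrow> bool" where
  "vord \<phi> m \<longleftrightarrow> (\<forall>j. ge (\<phi> $ j) m) \<and> \<not> (\<forall>j. ge (\<phi> $ j) (m + 1))"

lemma vordD: "vord \<phi> m \<Longrightarrow> ge (\<phi> $ j) m"
  by (simp add: vord_def)

lemma vordI: "(\<And>j. ge (\<phi> $ j) m) \<Longrightarrow> eq (\<phi> $ j) m \<Longrightarrow> vord \<phi> m"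
  using eq_not_ge[of "\<phi> $ j" m "m + 1"] by (auto simp: vord_def)

lemma vord_le: "vord \<phi> m \<Longrightarrow> (\<And>j. ge (\<phi> $ j) l) \<Longrightarrow> l \<le> m"
  using ge_mono[of _ l "m + 1"] by (fastforce simp: vord_def)

lemma vord_unique: "vord \<phi> m \<Longrightarrow> vord \<phi> l \<Longrightarrow> m = l"
  using vord_le[of \<phi> m l] vord_le[of \<phi> l m] by (auto simp: vord_def)

lemma ex_vord:
  assumes "\<not> R dvd \<phi> $ j0"
  shows "\<exists>m. vord \<phi> m"
proof -
  define J where "J = {j. \<not> R dvd \<phi> $ j}"
  have J: "finite J" "J \<noteq> {}" using assms by (auto simp: J_def)
  define m where "m = Min ((\<lambda>j. P (\<phi> $ j)) ` J)"
  have "m \<in> (\<lambda>j. P (\<phi> $ j)) ` J" unfolding m_def using J by (intro Min_in) auto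
  then obtain j where j: "j \<in> J" "P (\<phi> $ j) = m" by auto
  have "ge (\<phi> $ j) m" for j
  proof (cases "j \<in> J")
    case True
    then have "m \<le> P (\<phi> $ j)" unfolding m_def using J(1) by (intro Min_le) auto
    then show ?thesis by (simp add: order_ge_def)
  qed (simp add: J_def ge_dvd)
  moreover have "eq (\<phi> $ j) m" using j by (simp add: J_def order_eq_def)
  ultimately show ?thesis using vordI by blast
qed

lemma vord_cong:
  assumes "\<And>j. R dvd \<phi> $ j - \<psi> $ j"
  shows "vord \<phi> m \<longleftrightarrow> vord \<psi> m"
  unfolding vord_def using ge_cong[OF assms] by simp

lemma vord_smult:
  assumes "eq f k" "vord \<phi> m"
  shows "vord (f *s \<phi>) (k + m)"
proof -
  have "ge ((f *s \<phi>) $ j) (k + m)" for j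
    using ge_mult[OF eq_imp_ge[OF assms(1)] vordD[OF assms(2)]] by simp
  moreover have "\<not> (\<forall>j. ge ((f *s \<phi>) $ j) (k + m + 1))"
  proof
    assume "\<forall>j. ge ((f *s \<phi>) $ j) (k + m + 1)"
    then have "ge (\<phi> $ j) (m + 1)" for j
      using ge_mult_cancel[OF assms(1), of "\<phi> $ j" "m + 1"] by (simp add: add.assoc)
    then show False using assms(2) by (simp add: vord_def)
  qed
  ultimately show ?thesis by (simp add: vord_def)
qed

end

text \<open>
  An orbit of the linear problem at a point where \<open>w\<close> has a zero of order \<open>e\<close>.  It covers both the
  points over \<open>z = \<infinity>\<close> (with \<open>w = 1/z\<close>, \<open>\<xi>, \<eta> = x, y\<close>) and, for the inverse Lax
  matrices in a suitable basis, the points over \<open>z = 0\<close> (with \<open>w = z\<close>, \<open>\<xi>, \<eta> = y, x\<close>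
  in reversed order).
\<close>

locale lax_orbit = place +
  fixes w \<kappa> :: mfun and e d :: int and v :: "nat \<Rightarrow> mfun ^ 3" and \<xi> \<eta> :: "nat \<Rightarrow> complex" and n :: nat
  assumes w: "eq w e" "e > 0" and \<kappa>: "eq \<kappa> d" and n: "n > 0"
    and nz: "\<And>i. \<xi> i \<noteq> 0" "\<And>i. \<eta> i \<noteq> 0"
    and step1: "\<And>i. R dvd v (Suc i) $ 1 - mf_const (1 / \<xi> i) * (v i $ 1 - v i $ 2)"
    and step2: "\<And>i. R dvd v (Suc i) $ 2 - w * (v i $ 1 + v i $ 3)"
    and step3: "\<And>i. R dvd v (Suc i) $ 3 - mf_const (- \<eta> i) * v i $ 1"
    and period: "\<And>i j. R dvd v (i + n) $ j - \<kappa> * v i $ j"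
    and nonzero: "\<exists>j. \<not> R dvd v 0 $ j"
begin

lemma ge_step1: "ge (v (Suc i) $ 1) m \<longleftrightarrow> ge (v i $ 1 - v i $ 2) m"
proof -
  have "ge (v (Suc i) $ 1) m \<longleftrightarrow> ge (mf_const (1 / \<xi> i) * (v i $ 1 - v i $ 2)) m"
    by (rule ge_cong[OF step1])
  also have "\<dots> \<longleftrightarrow> ge (v i $ 1 - v i $ 2) m"
    by (rule ge_const_mult_iff) (simp add: nz)
  finally show ?thesis .
qed

lemma ge_step2: "ge (v (Suc i) $ 2) (e + m) \<longleftrightarrow> ge (v i $ 1 + v i $ 3) m"
proof -
  have "ge (v (Suc i) $ 2) (e + m) \<longleftrightarrow> ge (w * (v i $ 1 + v i $ 3)) (e + m)"
    by (rule ge_cong[OF step2])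
  also have "\<dots> \<longleftrightarrow> ge (v i $ 1 + v i $ 3) m"
    by (rule ge_mult_iff[OF w(1)])
  finally show ?thesis .
qed

lemma ge_step3: "ge (v (Suc i) $ 3) m \<longleftrightarrow> ge (v i $ 1) m"
proof -
  have "ge (v (Suc i) $ 3) m \<longleftrightarrow> ge (mf_const (- \<eta> i) * v i $ 1) m"
    by (rule ge_cong[OF step3])
  also have "\<dots> \<longleftrightarrow> ge (v i $ 1) m"
    by (rule ge_const_mult_iff) (simp add: nz)
  finally show ?thesis .
qed

lemma orbit_nonzero: "\<exists>j. \<not> R dvd v i $ j"
proof (induction i)
  case (Suc i)
  show ?case
  proof (rule ccontr)
    assume "\<not> ?thesis"
    then have "R dvd v (Suc i) $ j" for j by blast
    then have "ge (v (Suc i) $ j) m" for j m by (rule ge_dvd)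
    then have 1: "ge (v i $ 1 - v i $ 2) m" "ge (v i $ 1 + v i $ 3) m" "ge (v i $ 1) m" for m
      using ge_step1 ge_step2 ge_step3 by blast+
    have 2: "ge (v i $ 2) m" "ge (v i $ 3) m" for m
      using ge_diff[OF 1(3) 1(1)] ge_diff[OF 1(2) 1(3)] by simp_all
    have "ge (v i $ j) m" for j m using exhaust_3[of j] 1(3)[of m] 2[of m] by auto
    then have "\<not> vord (v i) m" for m by (simp add: vord_def)
    then show False using ex_vord Suc.IH by blast
  qed
qed (rule nonzero)

definition \<mu> :: "nat \<Rightarrow> int" where
  "\<mu> i = (THE m. vord (v i) m)"

lemma \<mu>: "vord (v i) (\<mu> i)"
proof -
  obtain m where "vord (v i) m" using orbit_nonzero ex_vord by blast
  then show ?thesis unfolding \<mu>_def using vord_unique theI[of "vord (v i)" m] by blast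
qed

lemma \<mu>_eqI: "vord (v i) m \<Longrightarrow> \<mu> i = m"
  using \<mu> vord_unique by blast

lemma \<mu>_period: "\<mu> (i + n) = d + \<mu> i"
proof (rule \<mu>_eqI)
  have "vord (\<kappa> *s v i) (d + \<mu> i)" by (rule vord_smult[OF \<kappa> \<mu>])
  then show "vord (v (i + n)) (d + \<mu> i)"
    using vord_cong[of "v (i + n)" "\<kappa> *s v i"] period by simp
qed

lemma ge_period: "ge (v (i + n) $ j) (d + m) \<longleftrightarrow> ge (v i $ j) m"
proof -
  have "ge (v (i + n) $ j) (d + m) \<longleftrightarrow> ge (\<kappa> * v i $ j) (d + m)" by (rule ge_cong[OF period])
  then show ?thesis using ge_mult_iff[OF \<kappa>, of "v i $ j" m] by (rule trans)
qed

text \<open>Shapes of the leading coefficient vector, read off from the Lax matrix at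
  \<open>w = 0\<close>. In \<open>stA\<close> it lies on the third axis, the kernel of that matrix;
  in \<open>stB\<close> its first two entries agree and are nonzero, and it is mapped into the
  kernel; in \<open>stC\<close> the second entry vanishes and the first does not, which persists
  along the orbit.\<close>

definition stA :: "nat \<Rightarrow> bool" where
  "stA i \<longleftrightarrow> ge (v i $ 1) (\<mu> i + 1) \<and> ge (v i $ 2) (\<mu> i + 1)"

definition stB :: "nat \<Rightarrow> bool" where
  "stB i \<longleftrightarrow> eq (v i $ 1) (\<mu> i) \<and> ge (v i $ 1 - v i $ 2) (\<mu> i + 1)"

definition stC :: "nat \<Rightarrow> bool" where
  "stC i \<longleftrightarrow> eq (v i $ 1) (\<mu> i) \<and> ge (v i $ 2) (\<mu> i + 1)"

lemma stA_not_stB: "stA i \<Longrightarrow> \<not> stB i"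
  unfolding stA_def stB_def using eq_not_ge by fastforce

lemma stA_third: "stA i \<Longrightarrow> eq (v i $ 3) (\<mu> i)"
  using \<mu>[of i] unfolding stA_def vord_def by (intro eqI) (auto simp: forall_3)

lemma ge_Suc: "ge (v (Suc i) $ j) (\<mu> i)"
proof -
  have g: "ge (v i $ j) (\<mu> i)" for j using \<mu> vordD by blast
  have "ge (v (Suc i) $ 2) (e + \<mu> i)" unfolding ge_step2 by (rule ge_add[OF g g])
  then have "ge (v (Suc i) $ 2) (\<mu> i)" by (rule ge_mono) (use w(2) in simp)
  moreover have "ge (v (Suc i) $ 1) (\<mu> i)" unfolding ge_step1 by (rule ge_diff[OF g g])
  moreover have "ge (v (Suc i) $ 3) (\<mu> i)" unfolding ge_step3 by (rule g)
  ultimately show ?thesis using exhaust_3[of j] by auto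
qed

lemma \<mu>_mono: "\<mu> i \<le> \<mu> (Suc i)"
  using vord_le[OF \<mu> ge_Suc] .

lemma \<mu>_mono': "\<mu> i \<le> \<mu> (i + k)"
proof (induction k)
  case (Suc k)
  then show ?case using \<mu>_mono[of "i + k"] by simp
qed simp

lemma d_nonneg: "d \<ge> 0"
  using \<mu>_mono'[of 0 n] \<mu>_period[of 0] by simp

text \<open>The matrix at \<open>w = 0\<close> annihilates exactly the vectors on the third axis;
  any other leading vector survives with its order.\<close>

lemma stA_iff: "stA i \<longleftrightarrow> \<mu> i < \<mu> (Suc i)"
proof
  assume A: "stA i"
  have "ge (v (Suc i) $ 1) (\<mu> i + 1)" "ge (v (Suc i) $ 3) (\<mu> i + 1)"
    unfolding ge_step1 ge_step3 using A by (auto simp: stA_def intro: ge_diff)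
  moreover have "ge (v (Suc i) $ 2) (e + \<mu> i)"
    unfolding ge_step2 using \<mu>[of i] by (intro ge_add vordD)
  then have "ge (v (Suc i) $ 2) (\<mu> i + 1)" by (rule ge_mono) (use w(2) in simp)
  ultimately have "ge (v (Suc i) $ j) (\<mu> i + 1)" for j using exhaust_3[of j] by auto
  from vord_le[OF \<mu> this] show "\<mu> i < \<mu> (Suc i)" by simp
next
  assume "\<mu> i < \<mu> (Suc i)"
  then have "ge (v (Suc i) $ j) (\<mu> i + 1)" for j using ge_mono[OF vordD[OF \<mu>]] by simp
  then have 1: "ge (v i $ 1 - v i $ 2) (\<mu> i + 1)" "ge (v i $ 1) (\<mu> i + 1)"
    using ge_step1 ge_step3 by blast+
  show "stA i" unfolding stA_def using 1 ge_diff[OF 1(2) 1(1)] by simp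
qed

lemma not_stA: "\<not> stA i \<Longrightarrow> \<mu> (Suc i) = \<mu> i"
  using stA_iff \<mu>_mono[of i] by simp

text \<open>At \<open>w = 0\<close> the image of the matrix has vanishing second entry, and without
  \<open>stA\<close> the order of the vector has not risen.\<close>

lemma second_small:
  assumes "\<not> stA i"
  shows "ge (v (Suc i) $ 2) (\<mu> (Suc i) + 1)"
proof -
  have "ge (v (Suc i) $ 2) (e + \<mu> i)" unfolding ge_step2 using \<mu>[of i] by (intro ge_add vordD)
  then show ?thesis by (rule ge_mono) (use w(2) not_stA[OF assms] in simp)
qed

lemma stC_Suc:
  assumes "stC i"
  shows "stC (Suc i) \<and> \<mu> (Suc i) = \<mu> i"
proof -
  have "\<not> stA i" using assms eq_not_ge[of "v i $ 1" "\<mu> i" "\<mu> i + 1"] by (auto simp: stA_def stC_def)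
  note m = not_stA[OF this] and s = second_small[OF this]
  have "eq (v i $ 1 - v i $ 2) (\<mu> i)" using assms by (auto simp: stC_def intro: eq_diff)
  then have "eq (v (Suc i) $ 1) (\<mu> i)" by (simp add: eq_iff' ge_step1)
  then show ?thesis using m s by (simp add: stC_def)
qed

lemma stC_period: "stC (i + n) \<longleftrightarrow> stC i"
  using ge_period[of i 1 "\<mu> i"] ge_period[of i 1 "\<mu> i + 1"] ge_period[of i 2 "\<mu> i + 1"]
  by (simp add: stC_def \<mu>_period eq_iff' add.assoc)

lemma stA_period: "stA (i + n) \<longleftrightarrow> stA i"
  using ge_period[of i 1 "\<mu> i + 1"] ge_period[of i 2 "\<mu> i + 1"]
  by (simp add: stA_def \<mu>_period add.assoc)

text \<open>A nondecreasing sequence that returns to its value after a period is constant, so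
  \<open>stA\<close> never occurs; after any step the second entry is small, and excluding
  \<open>stA\<close> leaves \<open>stC\<close>. The third claim comes from the identity
  \<open>v3' + \<xi> \<eta> v1' = - \<eta> v2\<close>, whose right side is small in
  \<open>stC\<close>.\<close>

lemma unit_case:
  assumes "d = 0"
  shows "stC i" "\<mu> (Suc i) = \<mu> i" "ge (v (Suc i) $ 3 + mf_const (\<xi> i * \<eta> i) * v (Suc i) $ 1) (\<mu> i + 1)"
proof -
  have const: "\<mu> (Suc i) = \<mu> i" for i
  proof -
    have "\<mu> (Suc i) \<le> \<mu> (Suc i + (n - 1))" by (rule \<mu>_mono')
    also have "\<dots> = \<mu> (i + n)" using n by simp
    finally show ?thesis using \<mu>_period[of i] assms \<mu>_mono[of i] by simp
  qed
  then have nA: "\<not> stA i" for i using stA_iff by simp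
  have "stC (Suc i)" for i
  proof -
    have s: "ge (v (Suc i) $ 2) (\<mu> (Suc i) + 1)" by (rule second_small[OF nA])
    then have "\<not> ge (v (Suc i) $ 1) (\<mu> (Suc i) + 1)" using nA[of "Suc i"] by (simp add: stA_def)
    then show ?thesis using s \<mu>[of "Suc i"] by (auto simp: stC_def intro: eqI vordD)
  qed
  then have C: "stC i" for i using stC_period[of i] n by (cases "i + n") auto
  show "stC i" "\<mu> (Suc i) = \<mu> i" using C const by auto
  have "ge (mf_const (- \<eta> i) * v i $ 2) (\<mu> i + 1)" using C[of i] by (intro ge_const_mult) (simp add: stC_def)
  moreover have "R dvd (v (Suc i) $ 3 + mf_const (\<xi> i * \<eta> i) * v (Suc i) $ 1) - mf_const (- \<eta> i) * v i $ 2"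
  proof -
    have "mf_const (\<xi> i * \<eta> i) * mf_const (1 / \<xi> i) = mf_const (\<eta> i)"
      using nz(1)[of i] by (simp flip: mf_const_mult)
    then have "(v (Suc i) $ 3 + mf_const (\<xi> i * \<eta> i) * v (Suc i) $ 1) - mf_const (- \<eta> i) * v i $ 2
      = (v (Suc i) $ 3 - mf_const (- \<eta> i) * v i $ 1)
        + mf_const (\<xi> i * \<eta> i) * (v (Suc i) $ 1 - mf_const (1 / \<xi> i) * (v i $ 1 - v i $ 2))"
      by (simp add: right_diff_distrib mult.assoc[symmetric] mf_const_uminus)
    also have "R dvd \<dots>" by (rule dvd_add[OF step3 dvd_mult[OF step1]])
    finally show ?thesis .
  qed
  ultimately show "ge (v (Suc i) $ 3 + mf_const (\<xi> i * \<eta> i) * v (Suc i) $ 1) (\<mu> i + 1)"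
    using ge_cong by blast
qed

section \<open>Orbits whose multiplier vanishes at the point\<close>

context
  assumes d: "d > 0"
begin

text \<open>\<open>stC\<close> would keep the order constant forever, but over a period it grows by
  \<open>d > 0\<close>.\<close>

lemma not_stC: "\<not> stC i"
proof
  assume C: "stC i"
  have "stC (i + k) \<and> \<mu> (i + k) = \<mu> i" for k
  proof (induction k)
    case (Suc k)
    then show ?case using stC_Suc[of "i + k"] by simp
  qed (simp add: C)
  then show False using \<mu>_period[of i] d by simp
qed

text \<open>After one step without growth the second entry is small, and \<open>stC\<close> being
  excluded the first one is small too; hence \<open>stA\<close> follows, and pulling this back
  through the step gives \<open>stB\<close> at the present index.\<close>

lemma stB_if_not_stA:
  assumes "\<not> stA i"
  shows "stB i" "stA (Suc i)" "\<mu> (Suc i) = \<mu> i"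
proof -
  show m: "\<mu> (Suc i) = \<mu> i" using assms by (rule not_stA)
  have s: "ge (v (Suc i) $ 2) (\<mu> (Suc i) + 1)" using assms by (rule second_small)
  then have "\<not> eq (v (Suc i) $ 1) (\<mu> (Suc i))" using not_stC[of "Suc i"] by (simp add: stC_def)
  then have 1: "ge (v (Suc i) $ 1) (\<mu> (Suc i) + 1)" using \<mu>[of "Suc i"] eqI vordD by blast
  show "stA (Suc i)" using 1 s by (simp add: stA_def)
  have g: "ge (v i $ 1 - v i $ 2) (\<mu> i + 1)" using 1 by (simp add: ge_step1 m)
  moreover have "\<not> ge (v i $ 1) (\<mu> i + 1)"
  proof
    assume h: "ge (v i $ 1) (\<mu> i + 1)"
    then have "ge (v i $ 2) (\<mu> i + 1)" using ge_diff[OF h g] by simp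
    then show False using h assms by (simp add: stA_def)
  qed
  ultimately show "stB i" using \<mu>[of i] by (auto simp: stB_def intro: eqI vordD)
qed

lemma stA_second: "stA i \<Longrightarrow> eq (v (Suc i) $ 2) (e + \<mu> i)"
proof -
  assume A: "stA i"
  then have "eq (v i $ 1 + v i $ 3) (\<mu> i)" using stA_third[OF A] by (intro eq_add') (auto simp: stA_def)
  then have "ge (v (Suc i) $ 2) (e + \<mu> i)" "\<not> ge (v (Suc i) $ 2) (e + (\<mu> i + 1))"
    unfolding ge_step2 using eq_imp_ge eq_not_ge by fastforce+
  then show ?thesis by (intro eqI) (simp_all add: add.assoc)
qed

text \<open>If \<open>stA\<close> is never repeated, it recurs at every second index and fails in
  between, which contradicts an odd period.\<close>

lemma alternating_odd_False:
  assumes "odd n" "\<And>i. stA i \<Longrightarrow> \<not> stA (Suc i)"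
  shows False
proof -
  obtain i where i: "stA i" using stB_if_not_stA(2) by blast
  have alt: "stA (i + 2 * k)" for k
  proof (induction k)
    case (Suc k)
    then show ?case using stB_if_not_stA(2)[OF assms(2)[OF Suc.IH]] by simp
  qed (simp add: i)
  obtain q where "n = Suc (2 * q)" using assms(1) by (elim oddE) simp
  then have "\<not> stA (i + n)" using assms(2)[OF alt[of q]] by simp
  then show False using i stA_period by simp
qed

context
  assumes e1: "e = 1"
begin

text \<open>For \<open>e = 1\<close> the step out of the kernel leaves a second entry of order
  exactly \<open>\<mu> i + 1\<close>, which bounds the growth by 1 and excludes \<open>stA\<close>
  at the next index.\<close>

lemma simple_stA:
  assumes A: "stA i"
  shows "stB (Suc i)" "\<mu> (Suc i) = \<mu> i + 1"
proof -
  have s: "eq (v (Suc i) $ 2) (\<mu> i + 1)" using stA_second[OF A] e1 by (simp add: add.commute)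
  have "ge (v (Suc i) $ 2) (\<mu> (Suc i))" using \<mu>[of "Suc i"] by (rule vordD)
  then have "\<mu> (Suc i) \<le> \<mu> i + 1" using s eq_not_ge by blast
  then show m: "\<mu> (Suc i) = \<mu> i + 1" using A stA_iff by simp
  have "\<not> stA (Suc i)" using eq_not_ge[OF s, of "\<mu> i + 2"] by (auto simp: stA_def m add.commute)
  then show "stB (Suc i)" by (rule stB_if_not_stA)
qed

lemma simple_even: "even n"
  using alternating_odd_False simple_stA(1) stA_not_stB by blast

text \<open>Two steps send the leading third entry to the second one with factor \<open>w\<close>;
  by \<open>stB\<close> this agrees with the first one, which returns to the third place with factor
  \<open>- \<eta> (Suc i)\<close>.\<close>

lemma simple_third:
  assumes A: "stA i"
  shows "ge (v (Suc (Suc i)) $ 3 - mf_const (- \<eta> (Suc i)) * (w * v i $ 3)) (\<mu> i + 2)"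
proof -
  let ?c = "mf_const (- \<eta> (Suc i))"
  have 1: "ge (v (Suc i) $ 1 - v (Suc i) $ 2) (\<mu> i + 2)"
    using simple_stA[OF A] by (auto simp: stB_def add.commute)
  have "ge (w * v i $ 1) (e + (\<mu> i + 1))" using A by (intro ge_mult[OF eq_imp_ge[OF w(1)]]) (simp add: stA_def)
  then have 2: "ge (w * v i $ 1) (\<mu> i + 2)" using e1 by (simp add: add.commute)
  have "ge (v (Suc (Suc i)) $ 3 - ?c * v (Suc i) $ 1 + (?c * (v (Suc i) $ 1 - v (Suc i) $ 2)
      + (?c * (v (Suc i) $ 2 - w * (v i $ 1 + v i $ 3)) + ?c * (w * v i $ 1)))) (\<mu> i + 2)"
    by (intro ge_add ge_const_mult 1 2 ge_dvd[OF step3] ge_dvd[OF step2])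
  also have "v (Suc (Suc i)) $ 3 - ?c * v (Suc i) $ 1 + (?c * (v (Suc i) $ 1 - v (Suc i) $ 2)
      + (?c * (v (Suc i) $ 2 - w * (v i $ 1 + v i $ 3)) + ?c * (w * v i $ 1)))
      = v (Suc (Suc i)) $ 3 - ?c * (w * v i $ 3)" by (simp add: algebra_simps)
  finally show ?thesis .
qed

lemma simple_iterate:
  assumes A: "stA i"
  shows "stA (i + 2 * k) \<and> \<mu> (i + 2 * k) = \<mu> i + int k \<and>
    ge (v (i + 2 * k) $ 3 - mf_const (\<Prod>l<k. - \<eta> (i + 2 * l + 1)) * w ^ k * v i $ 3) (\<mu> i + int k + 1)"
proof (induction k)
  case (Suc k)
  then have A': "stA (i + 2 * k)" and m: "\<mu> (i + 2 * k) = \<mu> i + int k" by blast+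
  let ?c = "mf_const (- \<eta> (Suc (i + 2 * k)))" and ?p = "mf_const (\<Prod>l<k. - \<eta> (i + 2 * l + 1))"
  have B: "stB (Suc (i + 2 * k))" "\<mu> (Suc (i + 2 * k)) = \<mu> i + int k + 1"
    using simple_stA[OF A'] m by simp_all
  then have nA: "\<not> stA (Suc (i + 2 * k))" using stA_not_stB by blast
  have 1: "stA (i + 2 * Suc k)" "\<mu> (i + 2 * Suc k) = \<mu> i + int (Suc k)"
    using stB_if_not_stA[OF nA] B(2) by simp_all
  have "ge (?c * (w * (v (i + 2 * k) $ 3 - ?p * w ^ k * v i $ 3))) (e + (\<mu> i + int k + 1))"
    using Suc.IH by (intro ge_const_mult ge_mult[OF eq_imp_ge[OF w(1)]]) blast
  then have 2: "ge (?c * (w * (v (i + 2 * k) $ 3 - ?p * w ^ k * v i $ 3))) (\<mu> i + int k + 2)"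
    using e1 by (simp add: algebra_simps)
  have "ge (v (Suc (Suc (i + 2 * k))) $ 3 - ?c * (w * v (i + 2 * k) $ 3)
      + ?c * (w * (v (i + 2 * k) $ 3 - ?p * w ^ k * v i $ 3))) (\<mu> i + int k + 2)"
    using simple_third[OF A'] m by (intro ge_add 2) simp
  also have "v (Suc (Suc (i + 2 * k))) $ 3 - ?c * (w * v (i + 2 * k) $ 3)
      + ?c * (w * (v (i + 2 * k) $ 3 - ?p * w ^ k * v i $ 3))
      = v (i + 2 * Suc k) $ 3 - mf_const (\<Prod>l<Suc k. - \<eta> (i + 2 * l + 1)) * w ^ Suc k * v i $ 3"
    by (simp add: mf_const_mult mf_const_uminus algebra_simps)
  finally have G: "ge (v (i + 2 * Suc k) $ 3 - mf_const (\<Prod>l<Suc k. - \<eta> (i + 2 * l + 1)) * w ^ Suc k * v i $ 3)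
      (\<mu> i + int k + 2)" .
  have e: "\<mu> i + int k + 2 = \<mu> i + int (Suc k) + 1" by simp
  show ?case using 1 G unfolding e by blast
qed (simp add: A)

text \<open>A period consists of \<open>n div 2\<close> double steps. Comparing their accumulated
  factor with the multiplier \<open>\<kappa>\<close> and cancelling the third entry and the power of
  \<open>w\<close> gives the limit.\<close>

lemma simple_limit:
  assumes A: "stA i" and z: "z * w = 1"
  shows "ge (\<kappa> * z ^ (n div 2) - mf_const (\<Prod>l<n div 2. - \<eta> (i + 2 * l + 1))) 1"
proof -
  define q where "q = n div 2"
  have nq: "n = 2 * q" using simple_even by (simp add: q_def)
  let ?p = "mf_const (\<Prod>l<q. - \<eta> (i + 2 * l + 1))"
  have "ge (v (i + n) $ 3 - ?p * w ^ q * v i $ 3) (\<mu> i + int q + 1)"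
    using simple_iterate[OF A, of q] by (simp add: nq)
  then have "ge ((v (i + n) $ 3 - ?p * w ^ q * v i $ 3) - (v (i + n) $ 3 - \<kappa> * v i $ 3)) (\<mu> i + int q + 1)"
    by (rule ge_diff) (rule ge_dvd[OF period])
  also have "(v (i + n) $ 3 - ?p * w ^ q * v i $ 3) - (v (i + n) $ 3 - \<kappa> * v i $ 3)
      = v i $ 3 * (w ^ q * (\<kappa> * z ^ q - ?p))"
  proof -
    have wz: "w ^ q * z ^ q = 1" using z by (simp flip: power_mult_distrib add: mult.commute)
    have "w ^ q * (\<kappa> * z ^ q) = \<kappa> * (w ^ q * z ^ q)" by (simp only: mult_ac)
    then have "w ^ q * (\<kappa> * z ^ q - ?p) = \<kappa> - ?p * w ^ q"
      by (simp add: wz right_diff_distrib mult.commute)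
    then show ?thesis by (simp only:) (simp add: algebra_simps)
  qed
  finally have "ge (v i $ 3 * (w ^ q * (\<kappa> * z ^ q - ?p))) (\<mu> i + (int q * e + 1))"
    using e1 by (simp add: add.assoc)
  then have "ge (w ^ q * (\<kappa> * z ^ q - ?p)) (int q * e + 1)"
    by (rule ge_mult_cancel[OF stA_third[OF A]])
  then show ?thesis unfolding q_def[symmetric] by (rule ge_mult_cancel[OF eq_power[OF w(1)]])
qed

end

text \<open>With \<open>e = 2\<close> two successive indices of type \<open>stA\<close> are followed
  by a third: otherwise the vector at the third index would have an order so large that, taken back
  one step, it contradicts the exact order of the second entry there. Odd \<open>n\<close> provides
  such a pair, and periodicity spreads it to all indices.\<close>

lemma double_case:
  assumes e2: "e = 2" and odd: "odd n"
  shows "stA i" "\<mu> (Suc i) = \<mu> i + 1" "eq (v i $ 1) (\<mu> i + 1)" "ge (v i $ 1 - v i $ 2) (\<mu> i + 2)"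
proof -
  have AA: "stA (Suc (Suc i)) \<and> \<mu> (Suc i) = \<mu> i + 1" if A: "stA i" "stA (Suc i)" for i
  proof -
    have s: "eq (v (Suc i) $ 2) (\<mu> i + 2)" using stA_second[OF A(1)] e2 by (simp add: add.commute)
    have "ge (v (Suc i) $ 2) (\<mu> (Suc i) + 1)" using A(2) by (simp add: stA_def)
    then have "\<mu> (Suc i) + 1 \<le> \<mu> i + 2" using s eq_not_ge by blast
    then have m: "\<mu> (Suc i) = \<mu> i + 1" using A(1) stA_iff by simp
    have "stA (Suc (Suc i))"
    proof (rule ccontr)
      assume "\<not> stA (Suc (Suc i))"
      then have B: "stB (Suc (Suc i))" by (rule stB_if_not_stA)
      let ?m = "\<mu> (Suc (Suc i))"
      have s': "eq (v (Suc (Suc i)) $ 2) (\<mu> i + 3)" using stA_second[OF A(2)] e2 m by (simp add: add.commute)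
      have "eq (v (Suc (Suc i)) $ 1 - (v (Suc (Suc i)) $ 1 - v (Suc (Suc i)) $ 2)) ?m"
        using B by (intro eq_diff) (auto simp: stB_def)
      then have "?m = \<mu> i + 3" using s' eq_unique by simp
      then have "ge (v (Suc (Suc i)) $ j) (\<mu> i + 3)" for j using vordD[OF \<mu>[of "Suc (Suc i)"]] by simp
      then have "ge (v (Suc i) $ 1) (\<mu> i + 3)" "ge (v (Suc i) $ 1 - v (Suc i) $ 2) (\<mu> i + 3)"
        using ge_step3 ge_step1 by blast+
      from ge_diff[OF this] have "ge (v (Suc i) $ 2) (\<mu> i + 3)" by simp
      then show False using eq_not_ge[OF s] by fastforce
    qed
    with m show ?thesis by blast
  qed
  obtain i0 where i0: "stA i0" "stA (Suc i0)" using alternating_odd_False[OF odd] by blast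
  have later: "stA (i0 + k) \<and> stA (Suc (i0 + k))" for k
  proof (induction k)
    case (Suc k)
    then show ?case using AA[of "i0 + k"] by simp
  qed (simp add: i0)
  have all: "stA i" for i
  proof -
    have per: "stA (i + m * n) \<longleftrightarrow> stA i" for m
    proof (induction m)
      case (Suc m)
      then show ?case using stA_period[of "i + m * n"] by (simp add: algebra_simps)
    qed simp
    have "i0 \<le> i + i0 * n" using n by (simp add: trans_le_add2)
    then have "stA (i + i0 * n)" using later[of "i + i0 * n - i0"] by simp
    then show ?thesis using per by simp
  qed
  show A: "stA i" by (rule all)
  show m: "\<mu> (Suc i) = \<mu> i + 1" using AA all by blast
  have "eq (v (Suc i) $ 3) (\<mu> i + 1)" using stA_third[OF all[of "Suc i"]] m by simp
  then show "eq (v i $ 1) (\<mu> i + 1)" by (simp add: eq_iff' ge_step3)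
  have "ge (v (Suc i) $ 1) (\<mu> i + 2)" using all[of "Suc i"] m by (simp add: stA_def add.commute)
  then show "ge (v i $ 1 - v i $ 2) (\<mu> i + 2)" by (simp add: ge_step1)
qed

end

end

section \<open>Places at smooth points\<close>

lemma fps_X_power_dvd_nth: "fps_X ^ k dvd (f :: 'a::comm_ring_1 fps) \<Longrightarrow> l < k \<Longrightarrow> fps_nth f l = 0"
  by (auto elim!: dvdE simp: fps_X_power_mult_nth)

lemma fps_X_power_dvdI:
  assumes "\<And>l. l < k \<Longrightarrow> fps_nth f l = 0"
  shows "fps_X ^ k dvd (f :: 'a::comm_ring_1 fps)"
proof (rule dvdI)
  show "f = fps_X ^ k * Abs_fps (\<lambda>l. fps_nth f (l + k))"
    using assms by (intro fps_ext) (simp add: fps_X_power_mult_nth)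
qed

lemma poly_taylor2:
  "\<exists>r. poly p (a + h) = poly p a + h * poly (pderiv p) a + h ^ 2 * (r :: 'a::idom)"
proof (induction p)
  case (pCons c p)
  then obtain r where r: "poly p (a + h) = poly p a + h * poly (pderiv p) a + h ^ 2 * r" by blast
  show ?case
    by (rule exI[of _ "poly (pderiv p) a + (a + h) * r"])
      (simp add: r pderiv_pCons power2_eq_square algebra_simps)
qed (auto intro: exI[of _ 0])

text \<open>Newton iteration with the derivative frozen at the starting value: each step gains at
  least one power of the variable, which suffices.\<close>

lemma fps_hensel:
  fixes p :: "complex fps poly"
  assumes root: "fps_nth (poly p (fps_const y0)) 0 = 0"
    and simple: "fps_nth (poly (pderiv p) (fps_const y0)) 0 \<noteq> 0"
  shows "\<exists>Y. fps_nth Y 0 = y0 \<and> poly p Y = 0"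
proof -
  define c where "c = fps_nth (poly (pderiv p) (fps_const y0)) 0"
  have nth0: "fps_nth (poly q Y) 0 = fps_nth (poly q (fps_const y0)) 0" if "fps_nth Y 0 = y0"
    for q :: "complex fps poly" and Y
    by (induction q) (simp_all add: that fps_mult_nth_0)
  define F where "F Y = Y - fps_const (1 / c) * poly p Y" for Y
  define Y where "Y m = (F ^^ m) (fps_const y0)" for m
  have Y_Suc: "Y (Suc m) = Y m + - (fps_const (1 / c) * poly p (Y m))" for m
    by (simp add: Y_def F_def)
  have inv: "fps_nth (Y m) 0 = y0 \<and> fps_X ^ Suc m dvd poly p (Y m)" for m
  proof (induction m)
    case 0
    have "fps_X ^ Suc 0 dvd poly p (Y 0)"
      using root by (intro fps_X_power_dvdI) (simp add: Y_def)
    then show ?case by (simp add: Y_def)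
  next
    case (Suc m)
    define h where "h = - (fps_const (1 / c) * poly p (Y m))"
    have h: "fps_X ^ Suc m dvd h" unfolding h_def using Suc.IH by (simp only: dvd_minus_iff dvd_mult)
    then have "fps_nth h 0 = 0" by (rule fps_X_power_dvd_nth) simp
    then have 1: "fps_nth (Y (Suc m)) 0 = y0" using Suc.IH by (simp add: Y_Suc h_def)
    obtain r where r: "poly p (Y m + h) = poly p (Y m) + h * poly (pderiv p) (Y m) + h ^ 2 * r"
      using poly_taylor2 by blast
    define s where "s = 1 - fps_const (1 / c) * poly (pderiv p) (Y m)"
    have "fps_nth s 0 = 0" using nth0[of "Y m" "pderiv p"] Suc.IH simple
      by (simp add: s_def c_def fps_mult_nth_0)
    then have "fps_X ^ 1 dvd s" by (intro fps_X_power_dvdI) simp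
    then have 2: "fps_X ^ (Suc m + 1) dvd poly p (Y m) * s"
      unfolding power_add using Suc.IH by (intro mult_dvd_mono) blast
    have "fps_X ^ 1 dvd h" using h by (rule power_le_dvd) simp
    then have "fps_X ^ (Suc m + 1) dvd h * h" unfolding power_add using h by (intro mult_dvd_mono)
    then have "fps_X ^ (Suc m + 1) dvd poly p (Y m) * s + (h * h) * r" by (rule dvd_add[OF 2 dvd_mult2])
    also have "poly p (Y m) * s + (h * h) * r = poly p (Y (Suc m))"
      unfolding Y_Suc h_def[symmetric] r s_def by (simp add: h_def power2_eq_square algebra_simps)
    finally show ?case using 1 by simp
  qed
  \<comment> \<open>The diagonal of the iterates: coefficient \<open>l\<close> no longer changes
    after step \<open>l\<close>.\<close>
  define Z where "Z = Abs_fps (\<lambda>l. fps_nth (Y l) l)"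
  have stable: "fps_nth (Y (l + k)) l = fps_nth (Y l) l" for l k
  proof (induction k)
    case (Suc k)
    have "fps_X ^ Suc (l + k) dvd fps_const (1 / c) * poly p (Y (l + k))" using inv by (intro dvd_mult) blast
    then have "fps_nth (fps_const (1 / c) * poly p (Y (l + k))) l = 0" by (rule fps_X_power_dvd_nth) simp
    then have "fps_nth (Y (l + Suc k)) l = fps_nth (Y (l + k)) l" by (simp add: Y_Suc del: fps_mult_left_const_nth)
    then show ?case using Suc by simp
  qed simp
  have "fps_X ^ Suc m dvd poly p Z" for m
  proof -
    have "fps_nth (Z - Y m) l = 0" if "l < Suc m" for l
      using stable[of l "m - l"] that by (simp add: Z_def)
    then have "fps_X ^ Suc m dvd Z - Y m" by (rule fps_X_power_dvdI)
    moreover obtain r where "poly p (Y m + (Z - Y m)) = poly p (Y m) + (Z - Y m) * poly (pderiv p) (Y m) + (Z - Y m) ^ 2 * r"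
      using poly_taylor2 by blast
    then have "poly p Z = poly p (Y m) + (Z - Y m) * (poly (pderiv p) (Y m) + (Z - Y m) * r)"
      by (simp add: power2_eq_square algebra_simps)
    ultimately show ?thesis using inv[of m] by (simp only: dvd_add dvd_mult2)
  qed
  then have "poly p Z = 0" by (intro fps_ext) (metis fps_X_power_dvd_nth lessI fps_zero_nth)
  moreover have "fps_nth Z 0 = y0" by (simp add: Z_def Y_def)
  ultimately show ?thesis by blast
qed

context unital_ring_hom
begin

lemma map_poly_pCons [simp]: "map_poly h (pCons a p) = pCons (h a) (map_poly h p)"
  by (rule poly_eqI) (simp add: coeff_map_poly coeff_pCons split: nat.splits)

lemma map_poly_add: "map_poly h (p + q) = map_poly h p + map_poly h q"
  by (rule poly_eqI) (simp add: coeff_map_poly add)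

lemma map_poly_mult: "map_poly h (p * q) = map_poly h p * map_poly h q"
  by (rule poly_eqI) (simp add: coeff_map_poly coeff_mult sum mult)

lemma map_poly_hom: "unital_ring_hom (map_poly h)"
  by unfold_locales (simp_all add: map_poly_add map_poly_mult)

lemma of_nat: "h (of_nat n) = of_nat n"
  by (induction n) (simp_all add: add)

lemma poly_map: "h (poly p a) = poly (map_poly h p) (h a)"
  by (induction p) (simp_all add: add mult)

lemma poly_map_poly_hom: "unital_ring_hom (\<lambda>p. poly (map_poly h p) a)"
  by unfold_locales (simp_all add: map_poly_add map_poly_mult)

end

lemma map_poly_pderiv:
  fixes h :: "'a::idom \<Rightarrow> 'b::idom"
  assumes "unital_ring_hom h"
  shows "map_poly h (pderiv p) = pderiv (map_poly h p)"
proof -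
  interpret unital_ring_hom h by fact
  show ?thesis by (rule poly_eqI) (simp add: coeff_map_poly coeff_pderiv mult of_nat add)
qed

interpretation poly_eval: unital_ring_hom "\<lambda>p. poly p a" for a :: "'a::comm_ring_1"
  by unfold_locales simp_all

interpretation fps_nth_0: unital_ring_hom "\<lambda>f :: 'a::comm_ring_1 fps. fps_nth f 0"
  by unfold_locales (simp_all add: fps_mult_nth_0)

interpretation fps_to_fls: unital_ring_hom "fps_to_fls :: complex fps \<Rightarrow> complex fls"
  by unfold_locales (simp_all add: fls_times_fps_to_fls)

interpretation fps_const: unital_ring_hom "fps_const :: complex \<Rightarrow> complex fps"
  by unfold_locales (simp_all add: fps_const_mult[symmetric] fps_const_add[symmetric] del: fps_const_mult fps_const_add)

interpretation fls_const: unital_ring_hom "fls_const :: complex \<Rightarrow> complex fls"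
  by unfold_locales (simp_all add: fls_const_mult_const fls_plus_const)

text \<open>Clearing denominators: \<open>z\<close> times the Lax matrix is polynomial in \<open>z\<close>.\<close>

definition plax_matrix ::
  "(complex \<Rightarrow> 'a::comm_ring_1) \<Rightarrow> 'a \<Rightarrow> (int \<Rightarrow> complex) \<Rightarrow> (int \<Rightarrow> complex) \<Rightarrow> int \<Rightarrow> 'a ^ 3 ^ 3" where
  "plax_matrix e z x y i = vector
     [vector [z * e (1 / x (i + 2)), - (z * e (1 / x (i + 2))), 0],
      vector [1, 0, 1],
      vector [- (z * e (y (i + 2))), 0, 0]]"

primrec plax_product ::
  "(complex \<Rightarrow> 'a::comm_ring_1) \<Rightarrow> 'a \<Rightarrow> (int \<Rightarrow> complex) \<Rightarrow> (int \<Rightarrow> complex) \<Rightarrow> nat \<Rightarrow> 'a ^ 3 ^ 3" where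
  "plax_product e z x y 0 = mat 1"
| "plax_product e z x y (Suc m) = plax_matrix e z x y (int m) ** plax_product e z x y m"

text \<open>Up to the factor \<open>z ^ (3 * n)\<close> the determinant that defines the curve, but
  polynomial in \<open>z\<close> and \<open>k\<close>, so that numbers, polynomials and power series
  may be substituted.\<close>

definition plax_det ::
  "nat \<Rightarrow> (int \<Rightarrow> complex) \<Rightarrow> (int \<Rightarrow> complex) \<Rightarrow> complex \<Rightarrow> (complex \<Rightarrow> 'a::comm_ring_1) \<Rightarrow> 'a \<Rightarrow> 'a \<Rightarrow> 'a" where
  "plax_det n x y C e z k = det (plax_product e z x y n - mat (e C * k * z ^ n))"

lemma plax_product_eq:
  assumes "z * w = 1"
  shows "plax_product e z x y m $ a $ b = z ^ m * lax_product e w x y 0 m $ a $ b"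
proof (induction m arbitrary: a b)
  case (Suc m)
  have L: "plax_matrix e z x y i $ a $ b = z * lax_matrix e w x y i $ a $ b" for i a b
    using exhaust_3[of a] exhaust_3[of b] assms by (auto simp: plax_matrix_def lax_matrix_def)
  show ?case by (simp add: matrix_matrix_mult_def L Suc.IH sum_distrib_left mult_ac)
qed (simp add: mat_def)

lemma plax_det_eq:
  assumes "z * w = 1"
  shows "plax_det n x y C e z k = z ^ (3 * n) * det (lax_product e w x y 0 n - mat (e C * k))"
proof -
  have E: "(plax_product e z x y n - mat (e C * k * z ^ n)) $ a $ b
      = z ^ n * (lax_product e w x y 0 n - mat (e C * k)) $ a $ b" for a b
    by (simp add: plax_product_eq[OF assms] mat_def right_diff_distrib mult_ac)
  have "3 * n = n + n + n" by simp
  then have Z: "z ^ (3 * n) = z ^ n * z ^ n * z ^ n" by (simp only: power_add)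
  show ?thesis unfolding plax_det_def Determinants.det_3 E Z by (simp only: algebra_simps)
qed

lemma (in unital_ring_hom) plax_product:
  "h (plax_product e z x y m $ a $ b) = plax_product (\<lambda>c. h (e c)) (h z) x y m $ a $ b"
proof (induction m arbitrary: a b)
  case (Suc m)
  have "h (plax_matrix e z x y i $ a $ b) = plax_matrix (\<lambda>c. h (e c)) (h z) x y i $ a $ b" for i a b
    using exhaust_3[of a] exhaust_3[of b] by (auto simp: plax_matrix_def uminus mult)
  with Suc show ?case by (simp add: matrix_matrix_mult_def sum mult)
qed (simp add: mat_def)

lemma (in unital_ring_hom) plax_det:
  "h (plax_det n x y C e z k) = plax_det n x y C (\<lambda>c. h (e c)) (h z) (h k)"
proof -
  have "h ((plax_product e z x y n - mat (e C * k * z ^ n)) $ a $ b)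
    = (plax_product (\<lambda>c. h (e c)) (h z) x y n - mat (h (e C) * h k * h z ^ n)) $ a $ b" for a b
    by (simp add: diff plax_product mat_def mult power)
  then show ?thesis unfolding plax_det_def det_3 by (simp add: Determinants.det_3)
qed

subsection \<open>Parametrized branches\<close>

text \<open>Meaningful only for transcendental \<open>\<zeta>\<close>: otherwise the denominator may vanish at \<open>\<zeta>\<close>.\<close>

definition fract_at :: "complex fls \<Rightarrow> complex poly fract \<Rightarrow> complex fls" where
  "fract_at \<zeta> r = (let (a, b) = (SOME (a, b). r = Fract a b \<and> b \<noteq> 0)
     in poly (map_poly fls_const a) \<zeta> / poly (map_poly fls_const b) \<zeta>)"

definition mf_at :: "complex fls \<Rightarrow> complex fls \<Rightarrow> mfun \<Rightarrow> complex fls" where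
  "mf_at \<zeta> \<kappa> f = poly (map_poly (fract_at \<zeta>) f) \<kappa>"

locale branch =
  fixes \<zeta> :: "complex fls"
  assumes transcendental: "\<And>c. \<zeta> \<noteq> fls_const c"
begin

text \<open>A polynomial over the constants splits, and no factor \<open>\<zeta> - c\<close> is
  zero.\<close>

lemma poly_at_nonzero: "q \<noteq> 0 \<Longrightarrow> poly (map_poly fls_const q) \<zeta> \<noteq> 0"
proof (induction "degree q" arbitrary: q)
  case 0
  then obtain c where "q = [:c:]" by (metis degree_eq_zeroE)
  with 0 show ?case by simp
next
  case (Suc d)
  then have "\<not> constant (poly q)" by (simp add: constant_degree)
  then obtain a where "poly q a = 0" using fundamental_theorem_of_algebra by blast
  then obtain q' where q': "q = [:- a, 1:] * q'" by (auto simp: poly_eq_0_iff_dvd elim: dvdE)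
  have "q' \<noteq> 0" using Suc q' by auto
  then have "degree q = Suc (degree q')" by (subst q', subst degree_mult_eq) auto
  with Suc(2) \<open>q' \<noteq> 0\<close> have "poly (map_poly fls_const q') \<zeta> \<noteq> 0" by (intro Suc(1)) simp_all
  moreover have "poly (map_poly fls_const [:- a, 1:]) \<zeta> = \<zeta> - fls_const a"
    by (simp add: fls_const.uminus)
  ultimately show ?case unfolding q' fls_const.map_poly_mult poly_mult using transcendental by simp
qed

lemma fract_at_Fract:
  assumes "b \<noteq> 0"
  shows "fract_at \<zeta> (Fract a b) = poly (map_poly fls_const a) \<zeta> / poly (map_poly fls_const b) \<zeta>"
proof -
  obtain a' b' where ab: "(SOME (a', b'). Fract a b = Fract a' b' \<and> b' \<noteq> 0) = (a', b')" by fastforce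
  have "case (a', b') of (a', b') \<Rightarrow> Fract a b = Fract a' b' \<and> b' \<noteq> 0"
    unfolding ab[symmetric] by (rule someI[of _ "(a, b)"]) (simp add: assms)
  then have eq: "Fract a b = Fract a' b'" and b': "b' \<noteq> 0" by auto
  then have "a * b' = a' * b" using assms by (simp add: eq_fract)
  then have "poly (map_poly fls_const (a * b')) \<zeta> = poly (map_poly fls_const (a' * b)) \<zeta>" by simp
  then show ?thesis using poly_at_nonzero[OF assms] poly_at_nonzero[OF b']
    by (simp add: fract_at_def ab fls_const.map_poly_mult frac_eq_eq)
qed

sublocale fract_at: unital_ring_hom "fract_at \<zeta>"
proof
  show "fract_at \<zeta> 1 = 1" unfolding One_fract_def by (subst fract_at_Fract) simp_all
  fix r s :: "complex poly fract"
  obtain a b where r: "r = Fract a b" "b \<noteq> 0" by (cases r)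
  obtain c d where s: "s = Fract c d" "d \<noteq> 0" by (cases s)
  have nz: "poly (map_poly fls_const b) \<zeta> \<noteq> 0" "poly (map_poly fls_const d) \<zeta> \<noteq> 0"
    using r s poly_at_nonzero by auto
  show "fract_at \<zeta> (r + s) = fract_at \<zeta> r + fract_at \<zeta> s"
    using r(2) s(2) nz unfolding r(1) s(1)
    by (simp add: fract_at_Fract fls_const.map_poly_mult fls_const.map_poly_add add_frac_eq)
  show "fract_at \<zeta> (r * s) = fract_at \<zeta> r * fract_at \<zeta> s"
    using r(2) s(2) unfolding r(1) s(1) by (simp add: fract_at_Fract fls_const.map_poly_mult)
qed

lemma mf_at_hom: "unital_ring_hom (mf_at \<zeta> \<kappa>)"
  unfolding mf_at_def by (rule fract_at.poly_map_poly_hom)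

lemma fract_at_fconst [simp]: "fract_at \<zeta> (fconst c) = fls_const c"
  unfolding fconst_def to_fract_def by (subst fract_at_Fract) simp_all

lemma fract_at_fz [simp]: "fract_at \<zeta> fz = \<zeta>"
  unfolding fz_def to_fract_def by (subst fract_at_Fract) simp_all

lemma mf_at_rat [simp]: "mf_at \<zeta> \<kappa> (mf_rat r) = fract_at \<zeta> r"
  by (simp add: mf_at_def mf_rat_def)

lemma mf_at_const [simp]: "mf_at \<zeta> \<kappa> (mf_const c) = fls_const c"
  by (simp add: mf_const_conv_mf_rat)

lemma mf_at_z [simp]: "mf_at \<zeta> \<kappa> mf_z = \<zeta>"
  by (simp add: mf_z_conv_mf_rat)

lemma mf_at_k [simp]: "mf_at \<zeta> \<kappa> mf_k = \<kappa>"
  by (simp add: mf_at_def mf_k_def)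

end

text \<open>Evaluation along the branch is a ring homomorphism that kills \<open>R\<close>.
  Everything outside the ideal of \<open>R\<close> is invertible modulo \<open>R\<close>, so nothing
  else is killed, and the order of the series is a valuation; \<open>u\<close> guarantees that it is
  normalized.\<close>

lemma (in irreducible_curve) curve_point_branch:
  assumes "branch \<zeta>" and R: "mf_at \<zeta> \<kappa> R = 0" and u: "fls_subdegree (mf_at \<zeta> \<kappa> u) = 1"
  shows "curve_point R (\<lambda>f. fls_subdegree (mf_at \<zeta> \<kappa> f))"
    and "R dvd f \<longleftrightarrow> mf_at \<zeta> \<kappa> f = 0"
proof -
  interpret branch \<zeta> by fact
  interpret h: unital_ring_hom "mf_at \<zeta> \<kappa>" by (rule mf_at_hom)
  show kernel: "R dvd f \<longleftrightarrow> mf_at \<zeta> \<kappa> f = 0" for f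
  proof
    assume "R dvd f"
    then show "mf_at \<zeta> \<kappa> f = 0" using R by (auto elim!: dvdE simp: h.mult)
  next
    assume f: "mf_at \<zeta> \<kappa> f = 0"
    show "R dvd f"
    proof (rule ccontr)
      assume "\<not> R dvd f"
      then obtain g where "R dvd f * g - 1" using inverse_mod_R by blast
      then have "mf_at \<zeta> \<kappa> (f * g - 1) = 0" using R by (auto elim!: dvdE simp: h.mult)
      then show False using f by (simp add: h.diff h.mult)
    qed
  qed
  have "fls_subdegree (mf_at \<zeta> \<kappa> f) = fls_subdegree (mf_at \<zeta> \<kappa> g)" if "R dvd f - g" for f g
    using that unfolding kernel by (simp add: h.diff)
  moreover have "min (fls_subdegree (mf_at \<zeta> \<kappa> f)) (fls_subdegree (mf_at \<zeta> \<kappa> g))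
      \<le> fls_subdegree (mf_at \<zeta> \<kappa> (f + g))" if "\<not> R dvd f + g" for f g
    using that unfolding kernel h.add by (rule fls_plus_subdegree)
  ultimately show "curve_point R (\<lambda>f. fls_subdegree (mf_at \<zeta> \<kappa> f))"
    unfolding curve_point_def using u by (auto simp: kernel h.mult intro: exI[of _ u])
qed

interpretation const_poly: unital_ring_hom "\<lambda>c :: 'a::comm_ring_1. [:c:]"
  by unfold_locales simp_all

locale smooth_spectral_curve = spectral_curve +
  assumes smooth: "\<And>k z. z \<noteq> 0 \<Longrightarrow> spectral_fun n x y C k z = 0 \<Longrightarrow>
        deriv (\<lambda>k. spectral_fun n x y C k z) k \<noteq> 0 \<or>
        deriv (\<lambda>z. spectral_fun n x y C k z) z \<noteq> 0"
begin

definition kpoly :: "complex \<Rightarrow> complex poly" where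
  "kpoly a = plax_det n x y C (\<lambda>c. [:c:]) [:a:] [:0, 1:]"

definition zpoly :: "complex \<Rightarrow> complex poly" where
  "zpoly k = plax_det n x y C (\<lambda>c. [:c:]) [:0, 1:] [:k:]"

lemma poly_kpoly: "poly (kpoly a) k = plax_det n x y C (\<lambda>c. c) a k"
  unfolding kpoly_def poly_eval.plax_det by simp

lemma poly_zpoly: "poly (zpoly k) a = plax_det n x y C (\<lambda>c. c) a k"
  unfolding zpoly_def poly_eval.plax_det by simp

lemma spectral_fun_eq:
  assumes "z \<noteq> 0"
  shows "spectral_fun n x y C k z = - (plax_det n x y C (\<lambda>c. c) z k / (z ^ (3 * n) * C ^ 3))"
proof -
  have "z * (1 / z) = 1" using assms by simp
  then have "plax_det n x y C (\<lambda>c. c) z k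
      = z ^ (3 * n) * det (lax_product (\<lambda>c. c) (1 / z) x y 0 n - mat (C * k))"
    by (rule plax_det_eq)
  then show ?thesis using assms C by (simp add: spectral_fun_def)
qed

text \<open>The leading coefficient in \<open>k\<close> is, up to sign, the cube of
  \<open>C * a ^ n\<close>, so no point of the fibre over \<open>a\<close> escapes to
  infinity.\<close>

lemma degree_kpoly:
  assumes "a \<noteq> 0"
  shows "degree (kpoly a) = 3"
proof -
  define A where "A = plax_product (\<lambda>c. c) a x y n"
  define B where "B = plax_product (\<lambda>c. [:c:]) [:a:] x y n"
  define s where "s = C * a ^ n"
  have AB: "B $ i $ j = [: A $ i $ j :]" for i j
    unfolding A_def B_def const_poly.plax_product ..
  have d: "det B = [: det A :]"
    unfolding const_poly.det_3 by (simp add: Determinants.det_3 AB)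
  have "[:C:] * [:0, 1:] * [:a:] ^ n = [:0, s:]"
    unfolding const_poly.power[symmetric] by (simp add: s_def)
  then have "kpoly a = det (B - mat [:0, s:])"
    unfolding kpoly_def plax_det_def B_def by simp
  also have "\<dots> = [: det A, - (s * (A$1$1 * A$2$2 - A$1$2 * A$2$1 + A$1$1 * A$3$3 - A$1$3 * A$3$1
      + A$2$2 * A$3$3 - A$2$3 * A$3$2)), s ^ 2 * (A$1$1 + A$2$2 + A$3$3), - (s ^ 3) :]"
    unfolding det_minus_mat d AB by (simp add: power2_eq_square power3_eq_cube algebra_simps)
  finally show ?thesis using assms C by (simp add: s_def)
qed

lemma smooth_poly:
  assumes a: "a \<noteq> 0" and root: "poly (kpoly a) k0 = 0"
  shows "poly (pderiv (kpoly a)) k0 \<noteq> 0 \<or> poly (pderiv (zpoly k0)) a \<noteq> 0"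
proof (rule ccontr)
  assume "\<not> ?thesis"
  then have k: "poly (pderiv (kpoly a)) k0 = 0" and z: "poly (pderiv (zpoly k0)) a = 0" by auto
  have z0: "poly (zpoly k0) a = 0" using root by (simp add: poly_kpoly poly_zpoly)
  have "((\<lambda>k. - (poly (kpoly a) k / (a ^ (3 * n) * C ^ 3))) has_field_derivative
      - (poly (pderiv (kpoly a)) k0 / (a ^ (3 * n) * C ^ 3))) (at k0)"
    by (intro DERIV_minus DERIV_cdivide poly_DERIV)
  then have "((\<lambda>k. spectral_fun n x y C k a) has_field_derivative 0) (at k0)"
    by (simp add: k spectral_fun_eq[OF a] poly_kpoly)
  then have 1: "deriv (\<lambda>k. spectral_fun n x y C k a) k0 = 0" by (rule DERIV_imp_deriv)
  \<comment> \<open>The quotient rule also differentiates the denominator, but that term carries the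
    value of \<open>zpoly k0\<close> at its zero \<open>a\<close>.\<close>
  have "((\<lambda>z. - (poly (zpoly k0) z / (z ^ (3 * n) * C ^ 3))) has_field_derivative
     - ((poly (pderiv (zpoly k0)) a * (a ^ (3 * n) * C ^ 3) -
        poly (zpoly k0) a * (of_nat (3 * n) * a ^ (3 * n - 1) * C ^ 3)) / ((a ^ (3 * n) * C ^ 3) * (a ^ (3 * n) * C ^ 3)))) (at a)"
    using a C by (intro DERIV_minus DERIV_divide poly_DERIV DERIV_cmult_right) (auto intro!: derivative_eq_intros)
  then have "((\<lambda>z. - (poly (zpoly k0) z / (z ^ (3 * n) * C ^ 3))) has_field_derivative 0) (at a)"
    by (simp add: z z0)
  moreover have "\<forall>\<^sub>F z in nhds a. - (poly (zpoly k0) z / (z ^ (3 * n) * C ^ 3)) = spectral_fun n x y C k0 z"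
    using t1_space_nhds[of a 0] a by (auto elim!: eventually_mono simp: spectral_fun_eq poly_zpoly)
  ultimately have "((\<lambda>z. spectral_fun n x y C k0 z) has_field_derivative 0) (at a)"
    by (subst DERIV_cong_ev[OF refl _ refl, symmetric])
  then have 2: "deriv (\<lambda>z. spectral_fun n x y C k0 z) a = 0" by (rule DERIV_imp_deriv)
  have "spectral_fun n x y C k0 a = 0" using root by (simp add: spectral_fun_eq[OF a] poly_kpoly)
  then show False using smooth[OF a] 1 2 by blast
qed

lemma curve_point_series:
  assumes Z: "fps_nth Z 0 \<noteq> 0" "\<And>c. Z \<noteq> fps_const c"
    and eq: "plax_det n x y C fps_const Z K = 0"
    and u: "fls_subdegree (mf_at (fps_to_fls Z) (fps_to_fls K) u) = 1"
  shows "curve_point R (\<lambda>f. fls_subdegree (mf_at (fps_to_fls Z) (fps_to_fls K) f))"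
    and "R dvd f \<longleftrightarrow> mf_at (fps_to_fls Z) (fps_to_fls K) f = 0"
proof -
  let ?\<zeta> = "fps_to_fls Z" and ?\<kappa> = "fps_to_fls K"
  have Z0: "?\<zeta> \<noteq> 0" using Z(1) by (metis fps_to_fls_eq_0_iff fps_zero_nth)
  have br: "branch ?\<zeta>"
    by unfold_locales (metis Z(2) fps_to_fls_eq_iff fps_const_to_fls)
  interpret branch ?\<zeta> by (rule br)
  interpret h: unital_ring_hom "mf_at ?\<zeta> ?\<kappa>" by (rule mf_at_hom)
  have "0 = fps_to_fls (plax_det n x y C fps_const Z K)" using eq by simp
  also have "\<dots> = plax_det n x y C fls_const ?\<zeta> ?\<kappa>"
    unfolding fps_to_fls.plax_det by simp
  finally have "plax_det n x y C fls_const ?\<zeta> ?\<kappa> = 0" by simp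
  moreover have "plax_det n x y C fls_const ?\<zeta> ?\<kappa>
      = ?\<zeta> ^ (3 * n) * det (lax_product fls_const (inverse ?\<zeta>) x y 0 n - mat (fls_const C * ?\<kappa>))"
    using Z0 by (intro plax_det_eq) simp
  ultimately have D: "det (lax_product fls_const (inverse ?\<zeta>) x y 0 n - mat (fls_const C * ?\<kappa>)) = 0"
    using Z0 by simp
  have "?\<zeta> * mf_at ?\<zeta> ?\<kappa> mf_zinv = mf_at ?\<zeta> ?\<kappa> (mf_z * mf_zinv)" by (simp add: h.mult)
  then have zi: "mf_at ?\<zeta> ?\<kappa> mf_zinv = inverse ?\<zeta>"
    using Z0 by (simp add: mf_z_mult_zinv field_simps)
  have entries: "mf_at ?\<zeta> ?\<kappa> ((monodromy n x y 0 - mat (mf_const C * mf_k)) $ i $ j)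
      = (lax_product fls_const (inverse ?\<zeta>) x y 0 n - mat (fls_const C * ?\<kappa>)) $ i $ j" for i j
    by (simp add: h.diff monodromy_def h.lax_product zi mat_def h.mult)
  have "mf_at ?\<zeta> ?\<kappa> R = 0"
  proof -
    have "(\<chi> i j. mf_at ?\<zeta> ?\<kappa> ((monodromy n x y 0 - mat (mf_const C * mf_k)) $ i $ j))
      = lax_product fls_const (inverse ?\<zeta>) x y 0 n - mat (fls_const C * ?\<kappa>)"
      by (intro iffD2[OF vec_eq_iff] allI) (simp only: vec_lambda_beta entries)
    then show ?thesis
      unfolding R spectral_poly_def h.mult h.uminus h.det_3 by (simp only: D) simp
  qed
  note cp = curve_point_branch[OF br this u]
  show "curve_point R (\<lambda>f. fls_subdegree (mf_at ?\<zeta> ?\<kappa> f))" by (rule cp(1))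
  show "R dvd f \<longleftrightarrow> mf_at ?\<zeta> ?\<kappa> f = 0" by (rule cp(2))
qed

lemma nth0_poly_map:
  "fps_nth (poly p (fps_const c)) 0 = poly (map_poly (\<lambda>f. fps_nth f 0) p) (c :: complex)"
  using fps_nth_0.poly_map[of p "fps_const c"] by simp

lemma order_ge_series:
  assumes "R dvd f \<longleftrightarrow> mf_at (fps_to_fls Z) (fps_to_fls K) f = 0"
    and "mf_at (fps_to_fls Z) (fps_to_fls K) f = fps_to_fls g" "fps_X ^ m dvd g"
  shows "order_ge R (\<lambda>f. fls_subdegree (mf_at (fps_to_fls Z) (fps_to_fls K) f)) f (int m)"
proof (cases "g = 0")
  case False
  then have "m \<le> subdegree g" using fps_X_power_dvd_nth[OF assms(3)] by (intro subdegree_geI) auto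
  then show ?thesis using assms(2) by (simp add: order_ge_def fls_subdegree_fls_to_fps)
qed (use assms in \<open>simp add: order_ge_def\<close>)

text \<open>If \<open>k0\<close> is a simple root of the fibre polynomial, \<open>z - a\<close> is a
  local parameter and \<open>k\<close> a power series in it. Otherwise smoothness makes
  \<open>k - k0\<close> a parameter, and the multiplicity of the root bounds the order of
  \<open>z - a\<close> from below.\<close>

lemma smooth_place:
  assumes a: "a \<noteq> 0" and root: "poly (kpoly a) k0 = 0"
  shows "\<exists>P. curve_point R P \<and> order_ge R P (mf_z - mf_const a) (int (order k0 (kpoly a))) \<and>
    order_ge R P (mf_k - mf_const k0) 1 \<and> (order k0 (kpoly a) > 1 \<longrightarrow> P (mf_k - mf_const k0) = 1)"
proof -
  have k0: "kpoly a \<noteq> 0" using degree_kpoly[OF a] by auto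
  have sub1: "fls_subdegree (fps_to_fls fps_X :: complex fls) = 1"
    by (simp add: fls_subdegree_fls_to_fps)
  show ?thesis
  proof (cases "poly (pderiv (kpoly a)) k0 = 0")
    case False
    define Z where "Z = fps_const a + fps_X"
    define p where "p = plax_det n x y C (\<lambda>c. [:fps_const c:]) [:Z:] [:0, 1:]"
    have p0: "map_poly (\<lambda>f. fps_nth f 0) p = kpoly a"
      unfolding p_def kpoly_def unital_ring_hom.plax_det[OF fps_nth_0.map_poly_hom]
      by (simp add: Z_def)
    have "fps_nth (poly p (fps_const k0)) 0 = 0" by (simp add: nth0_poly_map p0 root)
    moreover have "fps_nth (poly (pderiv p) (fps_const k0)) 0 \<noteq> 0"
      using False by (simp add: nth0_poly_map map_poly_pderiv[OF fps_nth_0.unital_ring_hom_axioms] p0)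
    ultimately obtain K where K: "fps_nth K 0 = k0" "poly p K = 0" using fps_hensel by blast
    have eq: "plax_det n x y C fps_const Z K = 0"
      using K(2) unfolding p_def poly_eval.plax_det by simp
    have Z: "fps_nth Z 0 \<noteq> 0" "Z \<noteq> fps_const c" for c
      using a fps_nonzero_nth[of "Z - fps_const c"] by (auto simp: Z_def fps_eq_iff intro: exI[of _ 1])
    interpret branch "fps_to_fls Z" by unfold_locales (metis Z(2) fps_to_fls_eq_iff fps_const_to_fls)
    interpret h: unital_ring_hom "mf_at (fps_to_fls Z) (fps_to_fls K)" by (rule mf_at_hom)
    have z: "mf_at (fps_to_fls Z) (fps_to_fls K) (mf_z - mf_const a) = fps_to_fls fps_X"
    proof -
      have "mf_at (fps_to_fls Z) (fps_to_fls K) (mf_z - mf_const a) = fps_to_fls (Z - fps_const a)"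
        by (simp only: h.diff mf_at_z mf_at_const fps_to_fls.diff fps_const_to_fls)
      then show ?thesis by (simp add: Z_def)
    qed
    have k: "mf_at (fps_to_fls Z) (fps_to_fls K) (mf_k - mf_const k0) = fps_to_fls (K - fps_const k0)"
      by (simp add: h.diff fps_to_fls.diff fps_const_to_fls)
    note cp = curve_point_series[OF Z eq, of "mf_z - mf_const a", unfolded z, OF sub1]
    have "order k0 (kpoly a) = 1"
    proof -
      have "pderiv (kpoly a) \<noteq> 0" using False by auto
      moreover have "order k0 (kpoly a) \<noteq> 0" using root k0 by (simp add: order_root)
      ultimately show ?thesis using order_pderiv[of "kpoly a" k0] order_0I[OF False] k0 root by simp
    qed
    moreover have "fps_X ^ 1 dvd K - fps_const k0" using K(1) by (intro fps_X_power_dvdI) simp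
    ultimately show ?thesis
      using cp(1) order_ge_series[OF cp(2) z, of 1] order_ge_series[OF cp(2) k, of 1]
      by (intro exI[of _ "\<lambda>f. fls_subdegree (mf_at (fps_to_fls Z) (fps_to_fls K) f)"]) simp
  next
    case True
    then have nz: "poly (pderiv (zpoly k0)) a \<noteq> 0" using smooth_poly[OF a root] by blast
    define K where "K = fps_const k0 + fps_X"
    define p where "p = plax_det n x y C (\<lambda>c. [:fps_const c:]) [:0, 1:] [:K:]"
    have p0: "map_poly (\<lambda>f. fps_nth f 0) p = zpoly k0"
      unfolding p_def zpoly_def unital_ring_hom.plax_det[OF fps_nth_0.map_poly_hom]
      by (simp add: K_def)
    have r: "fps_nth (poly p (fps_const a)) 0 = 0"
      using root by (simp add: nth0_poly_map p0 poly_kpoly poly_zpoly)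
    have d: "fps_nth (poly (pderiv p) (fps_const a)) 0 \<noteq> 0"
      using nz by (simp add: nth0_poly_map map_poly_pderiv[OF fps_nth_0.unital_ring_hom_axioms] p0)
    obtain Z where Z0: "fps_nth Z 0 = a" "poly p Z = 0" using fps_hensel[OF r d] by blast
    have eq: "plax_det n x y C fps_const Z K = 0"
      using Z0(2) unfolding p_def poly_eval.plax_det by simp
    define m where "m = order k0 (kpoly a)"
    obtain q where "kpoly a = [:- k0, 1:] ^ m * q" "\<not> [:- k0, 1:] dvd q"
      using order_decomp[OF k0, of k0] unfolding m_def by blast
    then have q: "kpoly a = [:- k0, 1:] ^ m * q" "poly q k0 \<noteq> 0" by (simp_all only: poly_eq_0_iff_dvd not_False_eq_True)
    have "poly p (fps_const a) = plax_det n x y C fps_const (fps_const a) K"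
      unfolding p_def poly_eval.plax_det by simp
    also have "\<dots> = poly (map_poly fps_const (kpoly a)) K"
      unfolding kpoly_def unital_ring_hom.plax_det[OF fps_const.poly_map_poly_hom] by simp
    also have "\<dots> = poly (map_poly fps_const [:- k0, 1:]) K ^ m * poly (map_poly fps_const q) K"
      by (simp only: q(1) fps_const.map_poly_mult poly_mult
        unital_ring_hom.power[OF fps_const.map_poly_hom] poly_power)
    also have "poly (map_poly fps_const [:- k0, 1:]) K = fps_X"
      by (simp add: K_def add.assoc[symmetric])
    finally have pa: "poly p (fps_const a) = fps_X ^ m * poly (map_poly fps_const q) K" .
    have "fps_nth (poly (map_poly fps_const q) K) 0 = poly q k0"
      by (induction q) (simp_all add: K_def fps_mult_nth_0)
    then have pa0: "poly p (fps_const a) \<noteq> 0" using q(2) pa by auto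
    \<comment> \<open>Expanding \<open>p\<close> at the constant series \<open>a\<close> exhibits
      \<open>Z - a\<close> as its value there times a unit; that value is divisible by the
      \<open>m\<close>-th power of the variable, since \<open>k0\<close> is a root of multiplicity
      \<open>m\<close>.\<close>
    obtain s where s: "poly p (fps_const a + (Z - fps_const a)) = poly p (fps_const a)
        + (Z - fps_const a) * poly (pderiv p) (fps_const a) + (Z - fps_const a) ^ 2 * s"
      using poly_taylor2 by blast
    define U where "U = poly (pderiv p) (fps_const a) + (Z - fps_const a) * s"
    have U0: "fps_nth U 0 \<noteq> 0" using d Z0 by (simp add: U_def fps_mult_nth_0)
    have "(Z - fps_const a) * U = - poly p (fps_const a)"
      using s Z0(2) by (simp add: U_def power2_eq_square algebra_simps add_eq_0_iff2)
    then have ZU: "Z - fps_const a = - poly p (fps_const a) * inverse U"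
      using inverse_mult_eq_1[OF U0] by (metis mult.assoc mult.commute mult_1_right)
    have dvdZ: "fps_X ^ m dvd Z - fps_const a" unfolding ZU pa by (simp add: dvd_mult2)
    have Z: "fps_nth Z 0 \<noteq> 0" "Z \<noteq> fps_const c" for c
    proof -
      show "fps_nth Z 0 \<noteq> 0" using Z0 a by simp
      show "Z \<noteq> fps_const c"
      proof
        assume "Z = fps_const c"
        then have "Z = fps_const a" using Z0(1) by simp
        then show False using pa0 Z0(2) by simp
      qed
    qed
    interpret branch "fps_to_fls Z" by unfold_locales (metis Z(2) fps_to_fls_eq_iff fps_const_to_fls)
    interpret h: unital_ring_hom "mf_at (fps_to_fls Z) (fps_to_fls K)" by (rule mf_at_hom)
    have z: "mf_at (fps_to_fls Z) (fps_to_fls K) (mf_z - mf_const a) = fps_to_fls (Z - fps_const a)"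
      by (simp add: h.diff fps_to_fls.diff fps_const_to_fls)
    have k: "mf_at (fps_to_fls Z) (fps_to_fls K) (mf_k - mf_const k0) = fps_to_fls fps_X"
    proof -
      have "mf_at (fps_to_fls Z) (fps_to_fls K) (mf_k - mf_const k0) = fps_to_fls (K - fps_const k0)"
        by (simp only: h.diff mf_at_k mf_at_const fps_to_fls.diff fps_const_to_fls)
      then show ?thesis by (simp add: K_def)
    qed
    note cp = curve_point_series[OF Z eq, of "mf_k - mf_const k0", unfolded k, OF sub1]
    show ?thesis
      using cp(1) order_ge_series[OF cp(2) z dvdZ] order_ge_series[OF cp(2) k, of 1] k sub1 m_def
      by (intro exI[of _ "\<lambda>f. fls_subdegree (mf_at (fps_to_fls Z) (fps_to_fls K) f)"]) simp
  qed
qed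

end

text \<open>The local ring of the affine line at \<open>a\<close>. Only some representation must
  have a nonvanishing denominator, as others may contain common factors.\<close>

definition regular_at :: "complex \<Rightarrow> complex poly fract \<Rightarrow> bool" where
  "regular_at a r \<longleftrightarrow> (\<exists>p q. r = Fract p q \<and> poly q a \<noteq> 0)"

lemma regular_at_add: "regular_at a r \<Longrightarrow> regular_at a s \<Longrightarrow> regular_at a (r + s)"
proof -
  assume "regular_at a r" "regular_at a s"
  then obtain p q p' q' where *: "r = Fract p q" "poly q a \<noteq> 0" "s = Fract p' q'" "poly q' a \<noteq> 0"
    unfolding regular_at_def by blast
  then have "q \<noteq> 0" "q' \<noteq> 0" by auto
  then have "r + s = Fract (p * q' + p' * q) (q * q')" unfolding *(1,3) by (rule add_fract)
  then show ?thesis using * unfolding regular_at_def by (intro exI[of _ "p * q' + p' * q"] exI[of _ "q * q'"]) simp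
qed

lemma regular_at_mult: "regular_at a r \<Longrightarrow> regular_at a s \<Longrightarrow> regular_at a (r * s)"
proof -
  assume "regular_at a r" "regular_at a s"
  then obtain p q p' q' where *: "r = Fract p q" "poly q a \<noteq> 0" "s = Fract p' q'" "poly q' a \<noteq> 0"
    unfolding regular_at_def by blast
  then have "r * s = Fract (p * p') (q * q')" by simp
  then show ?thesis using * unfolding regular_at_def by (intro exI[of _ "p * p'"] exI[of _ "q * q'"]) simp
qed

lemma regular_at_to_fract: "regular_at a (to_fract p)"
  unfolding regular_at_def to_fract_def by (intro exI[of _ p] exI[of _ 1]) simp

lemma regular_at_fconst: "regular_at a (fconst c)"
  unfolding fconst_def by (rule regular_at_to_fract)

lemma regular_at_0: "regular_at a 0"
  using regular_at_fconst[of a 0] by (simp add: fconst_def)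

lemma regular_at_sum: "(\<And>i. i \<in> A \<Longrightarrow> regular_at a (f i)) \<Longrightarrow> regular_at a (sum f A)"
  by (induction A rule: infinite_finite_induct) (auto intro: regular_at_add regular_at_0)

lemma regular_at_inverse_fz:
  assumes "a \<noteq> 0"
  shows "regular_at a (inverse fz)"
proof -
  have "inverse fz = Fract 1 [:0, 1:]" by (simp add: fz_def to_fract_def)
  then show ?thesis using assms unfolding regular_at_def by (intro exI[of _ 1] exI[of _ "[:0, 1:]"]) simp
qed

lemma poly_split_at: "\<exists>p'. (p :: complex poly) = [:poly p a:] + [:- a, 1:] * p'"
proof -
  have "poly (p - [:poly p a:]) a = 0" by simp
  then have "[:- a, 1:] dvd p - [:poly p a:]" by (simp only: poly_eq_0_iff_dvd)
  then obtain p' where "p - [:poly p a:] = [:- a, 1:] * p'" by (rule dvdE)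
  then show ?thesis by (intro exI[of _ p']) (simp only: diff_eq_eq add.commute)
qed

lemma to_fract_linear: "to_fract [:- a, 1:] = fz - fconst a"
  by (simp add: fz_def fconst_def flip: to_fract_diff)

lemma regular_at_split:
  assumes "regular_at a s"
  shows "\<exists>c s'. s = fconst c + (fz - fconst a) * s' \<and> regular_at a s'"
proof -
  obtain p q where s: "s = Fract p q" and q: "poly q a \<noteq> 0" using assms unfolding regular_at_def by blast
  have q0: "q \<noteq> 0" using q by auto
  define c where "c = poly p a / poly q a"
  have "poly (p - smult c q) a = 0" using q by (simp add: c_def)
  then have "[:- a, 1:] dvd p - smult c q" by (simp only: poly_eq_0_iff_dvd)
  then obtain p' where p': "p - smult c q = [:- a, 1:] * p'" by (rule dvdE)
  have "p = smult c q + (p - smult c q)" by simp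
  also have "\<dots> = [:c:] * q + [:- a, 1:] * p'" unfolding p' by simp
  finally have "p = [:c:] * q + [:- a, 1:] * p'" .
  then have "to_fract p = fconst c * to_fract q + (fz - fconst a) * to_fract p'"
    by (simp only: to_fract_add to_fract_mult to_fract_linear fconst_def)
  then have "s = fconst c + (fz - fconst a) * (to_fract p' / to_fract q)"
    using q0 by (simp add: s Fract_conv_to_fract add_divide_distrib)
  moreover have "regular_at a (to_fract p' / to_fract q)"
    using q unfolding regular_at_def by (intro exI[of _ p'] exI[of _ q]) (simp add: Fract_conv_to_fract)
  ultimately show ?thesis by blast
qed

lemma to_fract_power: "to_fract (p ^ m) = to_fract p ^ m"
  by (induction m) simp_all

lemma ex_regular_power: "\<exists>m. \<forall>l\<ge>m. regular_at a ((fz - fconst a) ^ l * r)"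
proof -
  obtain p q where r: "r = Fract p q" "q \<noteq> 0" by (cases r)
  define m where "m = order a q"
  obtain q' where q': "q = [:- a, 1:] ^ m * q'" "\<not> [:- a, 1:] dvd q'"
    using order_decomp[OF r(2), of a] unfolding m_def by blast
  have "regular_at a ((fz - fconst a) ^ l * r)" if "l \<ge> m" for l
  proof -
    define U where "U = fz - fconst a"
    have U: "U \<noteq> 0" unfolding U_def to_fract_linear[symmetric] by simp
    have q'0: "to_fract q' \<noteq> 0" using q' by auto
    have "U ^ l = U ^ (l - m) * U ^ m" using that by (simp flip: power_add)
    moreover have "to_fract q = U ^ m * to_fract q'"
      unfolding q'(1) to_fract_mult to_fract_power to_fract_linear U_def ..
    ultimately have "U ^ l * r = U ^ (l - m) * (to_fract p / to_fract q')"
      unfolding r(1) Fract_conv_to_fract using U q'0 by simp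
    then have "(fz - fconst a) ^ l * r = (fz - fconst a) ^ (l - m) * (to_fract p / to_fract q')"
      unfolding U_def .
    moreover have "regular_at a (to_fract p / to_fract q')"
      using q'(2) unfolding regular_at_def
      by (intro exI[of _ p] exI[of _ q']) (simp add: Fract_conv_to_fract poly_eq_0_iff_dvd)
    moreover have "regular_at a ((fz - fconst a) ^ j)" for j
      by (induction j) (auto intro: regular_at_mult regular_at_to_fract[of a 1, simplified]
          regular_at_to_fract[of a "[:- a, 1:]", unfolded to_fract_linear])
    ultimately show ?thesis by (simp only: regular_at_mult)
  qed
  then show ?thesis by blast
qed

lemma (in place) ge_regular:
  assumes P: "ge (mf_z - mf_const a) 1" and r: "regular_at a r"
  shows "ge (mf_rat r) 0"
proof -
  obtain p q where pq: "r = Fract p q" "poly q a \<noteq> 0" using r unfolding regular_at_def by blast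
  have "ge (mf_z - mf_const a + mf_const a) 0" using P by (intro ge_add ge_const) (rule ge_mono, auto)
  then have z: "ge mf_z 0" by simp
  obtain q' where q': "q = [:poly q a:] + [:- a, 1:] * q'" using poly_split_at by blast
  have "cpoly_at q mf_z = mf_const (poly q a) + (mf_z - mf_const a) * cpoly_at q' mf_z"
    by (subst q') (simp only: cpoly_at_add cpoly_at_linear_factor, simp)
  moreover have "ge ((mf_z - mf_const a) * cpoly_at q' mf_z) (1 + 0)" by (intro ge_mult P ge_cpoly_at z)
  ultimately have e: "eq (cpoly_at q mf_z) 0" using pq(2) by (simp add: eq_add)
  have "q \<noteq> 0" using pq(2) by auto
  then have "cpoly_at q mf_z * mf_rat r = cpoly_at p mf_z"
    by (simp add: cpoly_at_z pq Fract_conv_to_fract mf_rat_mult[symmetric])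
  then have "ge (cpoly_at q mf_z * mf_rat r) (0 + 0)" using ge_cpoly_at[OF z] by simp
  then show ?thesis by (rule ge_mult_cancel[OF e])
qed

context smooth_spectral_curve
begin

text \<open>
  The ring \<open>\<complex>[z]\<^sub>a[k]\<close> is integrally closed for \<open>a \<noteq> 0\<close>: otherwise a nonzero polynomial in \<open>k\<close> of
  degree at most 2 would vanish at all points over \<open>a\<close>, counted with multiplicity.
\<close>

lemma regular_in_powers:
  assumes a: "a \<noteq> 0" and f: "R dvd f - in_powers r"
    and ge: "\<And>P. curve_point R P \<Longrightarrow> order_ge R P (mf_z - mf_const a) 1 \<Longrightarrow> order_ge R P f 0"
  shows "regular_at a (r $ i)"
proof -
  define u where "u = fz - fconst a"
  have mu: "mf_rat u = mf_z - mf_const a"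
    by (simp add: u_def mf_rat_diff mf_z_conv_mf_rat mf_const_conv_mf_rat)
  have u0: "u \<noteq> 0" unfolding u_def to_fract_linear[symmetric] by simp
  \<comment> \<open>The least power of \<open>z - a\<close> that clears all denominators is
    considered; the claim is that it is the zeroth.\<close>
  define good where "good m \<longleftrightarrow> (\<forall>j. regular_at a (u ^ m * r $ j))" for m
  have "\<exists>m. good m"
  proof -
    have "\<forall>j. \<exists>m. \<forall>l\<ge>m. regular_at a (u ^ l * r $ j)"
      using ex_regular_power[of a] unfolding u_def by blast
    then obtain m where m: "\<And>j. \<forall>l\<ge>m j. regular_at a (u ^ l * r $ j)" by metis
    have "good (m 1 + m 2 + m 3)" unfolding good_def forall_3 using m by simp
    then show ?thesis by blast
  qed
  then have least: "good (LEAST m. good m)" by (rule LeastI_ex)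
  define m where "m = (LEAST m. good m)"
  have "m = 0"
  proof (rule ccontr)
    assume m0: "m \<noteq> 0"
    have "\<exists>c s'. u ^ m * r $ j = fconst c + u * s' \<and> regular_at a s'" for j
      unfolding u_def using least by (intro regular_at_split) (simp add: good_def m_def u_def)
    then have "\<forall>j. \<exists>c s'. u ^ m * r $ j = fconst c + u * s' \<and> regular_at a s'" by blast
    then obtain c s where cs: "\<And>j. u ^ m * r $ j = fconst (c j) + u * s j" "\<And>j. regular_at a (s j)"
      by metis
    \<comment> \<open>The coefficients of \<open>(z - a) ^ m * f\<close> at \<open>z = a\<close>, in
      powers of \<open>k\<close> instead of the eigenvalue, whence the powers of \<open>C\<close>.
      If all of them vanished, a smaller \<open>m\<close> would do.\<close>
    define G where "G = [:c 1, c 2 * C, c 3 * C ^ 2:]"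
    have "G \<noteq> 0"
    proof
      assume "G = 0"
      then have c0: "c j = 0" for j using C exhaust_3[of j] by (auto simp: G_def)
      have "u * (u ^ (m - 1) * r $ j) = u * s j" for j
        using cs(1)[of j] m0 c0[of j] by (simp add: fconst_def power_eq_if[of u m] mult.assoc split: if_splits)
      then have "good (m - 1)" using u0 cs(2) by (simp add: good_def)
      then have "m \<le> m - 1" unfolding m_def by (rule Least_le)
      with m0 show False by simp
    qed
    have kp: "kpoly a \<noteq> 0" using degree_kpoly[OF a] by auto
    \<comment> \<open>At a root of multiplicity \<open>m0\<close> there is a place where
      \<open>z - a\<close> has order at least \<open>m0\<close>. There \<open>G\<close> agrees with
      \<open>(z - a) ^ m * f\<close> up to an integral multiple of \<open>z - a\<close>, and
      \<open>m > 0\<close>, so its order is at least \<open>m0\<close>.\<close>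
    have ord: "order k0 (kpoly a) \<le> order k0 G" for k0
    proof (cases "poly (kpoly a) k0 = 0")
      case True
      define m0 where "m0 = order k0 (kpoly a)"
      have m01: "m0 \<ge> 1" using True kp order_root[of "kpoly a" k0] by (simp add: m0_def)
      obtain P where P: "curve_point R P" "order_ge R P (mf_z - mf_const a) (int m0)"
        "order_ge R P (mf_k - mf_const k0) 1" "m0 > 1 \<longrightarrow> P (mf_k - mf_const k0) = 1"
        using smooth_place[OF a True] unfolding m0_def by blast
      interpret P: place R P using P(1) by (rule placeI)
      have z1: "P.ge (mf_z - mf_const a) 1" using P(2) by (rule P.ge_mono) (use m01 in simp)
      have fP: "P.ge f 0" using ge P(1) z1 by blast
      have "P.ge (mf_k - mf_const k0 + mf_const k0) 0"
        by (rule P.ge_add[OF P.ge_mono[OF P(3)] P.ge_const]) simp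
      then have k: "P.ge mf_k 0" by simp
      have ev: "P.ge eigenvalue 0" unfolding eigenvalue_def by (rule P.ge_const_mult[OF k])
      define w where "w = mf_rat (s 1) + mf_rat (s 2) * eigenvalue + mf_rat (s 3) * eigenvalue ^ 2"
      have "P.ge (mf_rat (s 1) + mf_rat (s 2) * eigenvalue + mf_rat (s 3) * (eigenvalue * eigenvalue)) 0"
        using P.ge_regular[OF z1 cs(2)] P.ge_mult[OF P.ge_regular[OF z1 cs(2)] ev]
          P.ge_mult[OF P.ge_regular[OF z1 cs(2)] P.ge_mult[OF ev ev]]
        by (intro P.ge_add) simp_all
      then have w: "P.ge w 0" by (simp add: w_def power2_eq_square)
      have "mf_rat u ^ m * in_powers r = mf_rat (u ^ m * r $ 1) + mf_rat (u ^ m * r $ 2) * eigenvalue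
          + mf_rat (u ^ m * r $ 3) * eigenvalue ^ 2"
        unfolding in_powers_def mf_rat_mult mf_rat.power by (simp only: distrib_left mult.assoc)
      also have "\<dots> = cpoly_at G mf_k + mf_rat u * w"
      proof -
        have "cpoly_at G mf_k = mf_const (c 1) + mf_const (c 2) * eigenvalue + mf_const (c 3) * eigenvalue ^ 2"
          by (simp only: G_def cpoly_at_pCons cpoly_at_0 eigenvalue_def mf_const_mult mf_const_power
              power2_eq_square mult_zero_right add_0_right) (simp only: algebra_simps)
        then show ?thesis
          by (simp only: cs(1) mf_rat_add mf_rat_mult mf_const_conv_mf_rat[symmetric] w_def)
            (simp only: algebra_simps)
      qed
      finally have eq: "cpoly_at G mf_k = mf_rat u ^ m * in_powers r - mf_rat u * w" by simp
      have um: "P.ge (mf_rat u) (int m0)" using P(2) by (simp add: mu)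
      have "P.ge (in_powers r) 0" using fP P.ge_cong[OF f] by simp
      moreover have "P.ge (mf_rat u ^ m) (int m * int m0)" using um by (rule P.ge_power)
      ultimately have "P.ge (mf_rat u ^ m * in_powers r) (int m * int m0 + 0)" by (intro P.ge_mult)
      moreover have "int m0 \<le> int m * int m0 + 0"
      proof -
        have "1 \<le> int m" using m0 by simp
        then have "1 * int m0 \<le> int m * int m0" by (rule mult_right_mono) simp
        then show ?thesis by (simp only: mult_1_left add_0_right)
      qed
      ultimately have "P.ge (mf_rat u ^ m * in_powers r) (int m0)" by (rule P.ge_mono)
      moreover have "P.ge (mf_rat u * w) (int m0 + 0)" using um w by (rule P.ge_mult)
      ultimately have geG: "P.ge (cpoly_at G mf_k) (int m0)" unfolding eq by (intro P.ge_diff) simp_all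
      obtain H where H: "G = [:- k0, 1:] ^ order k0 G * H" "\<not> [:- k0, 1:] dvd H"
        using order_decomp[OF \<open>G \<noteq> 0\<close>, of k0] by blast
      define t where "t = order k0 G"
      obtain H' where H': "H = [:poly H k0:] + [:- k0, 1:] * H'" using poly_split_at by blast
      have "cpoly_at H mf_k = mf_const (poly H k0) + (mf_k - mf_const k0) * cpoly_at H' mf_k"
        by (subst H') (simp only: cpoly_at_add cpoly_at_linear_factor, simp)
      moreover have "P.ge ((mf_k - mf_const k0) * cpoly_at H' mf_k) (1 + 0)"
        by (intro P.ge_mult P(3) P.ge_cpoly_at k)
      ultimately have eH: "P.eq (cpoly_at H mf_k) 0"
        using H(2) by (simp add: P.eq_add poly_eq_0_iff_dvd)
      have "cpoly_at ([:- k0, 1:] ^ j * H) mf_k = (mf_k - mf_const k0) ^ j * cpoly_at H mf_k" for j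
        by (induction j) (simp_all only: power_0 mult_1_left power_Suc mult.assoc cpoly_at_linear_factor)
      then have Gk: "cpoly_at G mf_k = (mf_k - mf_const k0) ^ t * cpoly_at H mf_k"
        by (subst H(1)) (simp add: t_def)
      have nk: "\<not> R dvd mf_k - mf_const k0"
      proof
        assume "R dvd mf_k - mf_const k0"
        moreover have "mf_k - mf_const k0 \<noteq> 0" "degree (mf_k - mf_const k0) < degree R"
          unfolding degree_R by (simp_all add: mf_k_def mf_const_def)
        ultimately show False by (meson dvd_imp_degree_le not_less)
      qed
      have "P.eq ((mf_k - mf_const k0) ^ t * cpoly_at H mf_k) (int t * P (mf_k - mf_const k0) + 0)"
        by (intro P.eq_mult eH P.eq_power P.eq_order nk)
      then have le: "int m0 \<le> int t * P (mf_k - mf_const k0)" using geG P.eq_not_ge unfolding Gk by fastforce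
      have "m0 \<le> t"
      \<comment> \<open>For a simple root the order of \<open>k - k0\<close> may exceed 1, but then
        it is enough that \<open>G\<close> vanishes at \<open>k0\<close>.\<close>
      proof (cases "m0 = 1")
        case True
        with le show ?thesis by (cases "t = 0") auto
      next
        case False
        with m01 P(4) le show ?thesis by simp
      qed
      then show ?thesis by (simp add: m0_def t_def)
    qed (simp add: order_0I)
    \<comment> \<open>Three roots with multiplicity do not fit into a nonzero polynomial of degree
      at most 2.\<close>
    have "proots (kpoly a) \<subseteq># proots G"
      unfolding subseteq_mset_def using ord kp \<open>G \<noteq> 0\<close> by simp
    then have "size (proots (kpoly a)) \<le> size (proots G)" by (rule size_mset_mono)
    moreover have "size (proots (kpoly a)) = 3" by (simp add: size_proots_complex degree_kpoly[OF a])
    moreover have "size (proots G) \<le> degree G" by (rule size_proots_le)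
    moreover have "degree G \<le> 2" by (simp add: G_def)
    ultimately show False by simp
  qed
  then show ?thesis using least unfolding m_def good_def by simp
qed

end

section \<open>Periodicity of the coordinates\<close>

lemma row_kernel_trivial:
  fixes A :: "'a::field ^ 3 ^ 3"
  assumes "\<And>l. A *v l = 0 \<Longrightarrow> l = 0" "r v* A = 0"
  shows "r = 0"
proof -
  have "\<exists>B. B ** A = mat 1" unfolding matrix_left_invertible_ker using assms(1) by blast
  then obtain B where "A ** B = mat 1" using matrix_left_right_inverse by blast
  then have "r = (r v* A) v* B" by (simp add: vector_matrix_mul_assoc)
  then show ?thesis using assms(2) by simp
qed

text \<open>A covector annihilating the three lifts would be a line through the three points; as
  there is none, the matrix of lifts is invertible and has independent rows.\<close>

lemma lift_independent:
  assumes "is_lift \<phi> V" "\<not> proj_collinear (\<phi> k) (\<phi> (k + 1)) (\<phi> (k + 2))"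
    and eq: "\<alpha> *s V (k + 2) + \<beta> *s V (k + 1) + \<gamma> *s V k = 0"
  shows "\<alpha> = 0" "\<beta> = 0" "\<gamma> = 0"
proof -
  define A :: "complex ^ 3 ^ 3" where "A = vector [V (k + 2), V (k + 1), V k]"
  have kernel: "l = 0" if "A *v l = 0" for l
  proof (rule ccontr)
    assume l: "l \<noteq> 0"
    have "(A *v l) $ i = 0" for i using that by simp
    then have dot: "(\<Sum>j\<in>UNIV. l $ j * V i $ j) = 0" if "i \<in> {k, k + 1, k + 2}" for i
      using that unfolding matrix_vector_mult_def A_def
      by (auto simp: mult.commute dest: meta_spec[of _ 1] meta_spec[of _ 2] meta_spec[of _ 3])
    have "(\<Sum>j\<in>UNIV. l $ j * v $ j) = 0" if v: "v \<in> \<phi> k \<union> \<phi> (k + 1) \<union> \<phi> (k + 2)" for v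
    proof -
      obtain i c where i: "i \<in> {k, k + 1, k + 2}" "v = c *s V i"
        using v assms(1) unfolding is_lift_def proj_point_def by auto
      have "(\<Sum>j\<in>UNIV. l $ j * v $ j) = c * (\<Sum>j\<in>UNIV. l $ j * V i $ j)"
        by (simp add: i(2) sum_distrib_left mult_ac)
      then show ?thesis using dot[OF i(1)] by simp
    qed
    then show False using assms(2) l unfolding proj_collinear_def by blast
  qed
  have "vector [\<alpha>, \<beta>, \<gamma>] v* A = \<alpha> *s V (k + 2) + \<beta> *s V (k + 1) + \<gamma> *s V k"
    by (simp add: vec_eq_iff vector_matrix_mult_def A_def sum_3 mult.commute)
  also have "\<dots> = 0" by (rule eq)
  finally have zero: "vector [\<alpha>, \<beta>, \<gamma>] v* A = 0" .
  have "vector [\<alpha>, \<beta>, \<gamma>] = (0 :: complex ^ 3)" by (rule row_kernel_trivial[OF kernel zero])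
  then have "vector [\<alpha>, \<beta>, \<gamma>] $ i = (0 :: complex ^ 3) $ i" for i by (rule arg_cong)
  from this[of 1] this[of 2] this[of 3] show "\<alpha> = 0" "\<beta> = 0" "\<gamma> = 0" by simp_all
qed

text \<open>The lifts are arbitrary, so \<open>V (k + n)\<close> is the image of \<open>V k\<close>
  under \<open>M\<close> only up to a factor \<open>l k\<close>. Comparing the recurrences rescales
  \<open>a\<close>, \<open>b\<close>, \<open>c\<close> by quotients of these factors, which cancel
  in \<open>x\<close> and \<open>y\<close>.\<close>

lemma coords_periodic:
  assumes "twisted_polygon n \<phi>" "is_lift \<phi> V" "lift_recurrence V a b c"
  shows "coord_x a b c (i + int n) = coord_x a b c i" "coord_y a b (i + int n) = coord_y a b i"
proof -
  obtain M :: "complex ^ 3 ^ 3" where M: "invertible M" "\<And>k. \<phi> (k + int n) = (\<lambda>v. M *v v) ` \<phi> k"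
    using assms(1) unfolding twisted_polygon_def by blast
  have lift: "V k \<noteq> 0" "\<phi> k = proj_point (V k)" for k using assms(2) by (simp_all add: is_lift_def)
  have "\<exists>l. l \<noteq> 0 \<and> V (k + int n) = l *s (M *v V k)" for k
  proof -
    have "V (k + int n) \<in> proj_point (V (k + int n))"
      unfolding proj_point_def by (rule range_eqI[of _ _ 1]) simp
    then have "V (k + int n) \<in> (\<lambda>v. M *v v) ` proj_point (V k)" using M(2)[of k] lift(2) by simp
    then obtain l where l: "V (k + int n) = M *v (l *s V k)" unfolding proj_point_def by blast
    then have "l \<noteq> 0" using lift(1)[of "k + int n"] by auto
    then show ?thesis using l by (intro exI[of _ l]) (simp add: matrix_vector_mult_smult)
  qed
  then have "\<forall>k. \<exists>l. l \<noteq> 0 \<and> V (k + int n) = l *s (M *v V k)" by blast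
  then obtain l where l: "\<And>k. l k \<noteq> 0" "\<And>k. V (k + int n) = l k *s (M *v V k)" by metis
  have coeff: "a (j + int n) * l (j + 2) = l (j + 3) * a j"
    "b (j + int n) * l (j + 1) = l (j + 3) * b j" "c (j + int n) * l j = l (j + 3) * c j" for j
  proof -
    define \<alpha> where "\<alpha> = l (j + 3) * a j - a (j + int n) * l (j + 2)"
    define \<beta> where "\<beta> = l (j + 3) * b j - b (j + int n) * l (j + 1)"
    define \<gamma> where "\<gamma> = l (j + 3) * c j - c (j + int n) * l j"
    have rec: "V (k + 3) = a k *s V (k + 2) + b k *s V (k + 1) + c k *s V k" for k
      using assms(3) by (simp add: lift_recurrence_def)
    have sh: "j + int n + 3 = j + 3 + int n" "j + int n + 2 = j + 2 + int n" "j + int n + 1 = j + 1 + int n" by simp_all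
    have "l (j + 3) *s (M *v V (j + 3)) = a (j + int n) *s (l (j + 2) *s (M *v V (j + 2)))
        + b (j + int n) *s (l (j + 1) *s (M *v V (j + 1))) + c (j + int n) *s (l j *s (M *v V j))"
      using rec[of "j + int n"] unfolding sh l(2) .
    moreover have "M *v V (j + 3) = a j *s (M *v V (j + 2)) + b j *s (M *v V (j + 1)) + c j *s (M *v V j)"
      unfolding rec[of j] by (simp add: matrix_vector_right_distrib matrix_vector_mult_smult)
    ultimately have "\<alpha> *s (M *v V (j + 2)) + \<beta> *s (M *v V (j + 1)) + \<gamma> *s (M *v V j) = 0"
      unfolding \<alpha>_def \<beta>_def \<gamma>_def by (simp add: vec_eq_iff algebra_simps)
    then have "M *v (\<alpha> *s V (j + 2) + \<beta> *s V (j + 1) + \<gamma> *s V j) = 0"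
      by (simp add: matrix_vector_right_distrib matrix_vector_mult_smult)
    then have "\<alpha> *s V (j + 2) + \<beta> *s V (j + 1) + \<gamma> *s V j = 0"
      using M(1) by (metis invertible_def matrix_vector_mul_assoc matrix_vector_mul_lid matrix_vector_mult_0_right)
    moreover have "\<not> proj_collinear (\<phi> j) (\<phi> (j + 1)) (\<phi> (j + 2))"
      using assms(1) by (simp add: twisted_polygon_def)
    ultimately have "\<alpha> = 0" "\<beta> = 0" "\<gamma> = 0" using lift_independent[OF assms(2)] by blast+
    then show "a (j + int n) * l (j + 2) = l (j + 3) * a j"
      "b (j + int n) * l (j + 1) = l (j + 3) * b j" "c (j + int n) * l j = l (j + 3) * c j"
      by (simp_all add: \<alpha>_def \<beta>_def \<gamma>_def)
  qed
  have a: "a (j + int n) = l (j + 3) / l (j + 2) * a j" and b: "b (j + int n) = l (j + 3) / l (j + 1) * b j"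
    and c: "c (j + int n) = l (j + 3) / l j * c j" for j
    using coeff[of j] l(1) by (simp_all add: field_simps)
  have ix: "i + int n - 2 = i - 2 + int n" "i + int n - 1 = i - 1 + int n" by simp_all
  have "coord_x a b c (i + int n) = (l (i + 1) / l i * (l (i + 2) / l (i - 1)) / (l (i + 1) / l (i - 1) * (l (i + 2) / l i)))
    * coord_x a b c i"
    unfolding coord_x_def ix a b c by (simp add: add.commute)
  also have "l (i + 1) / l i * (l (i + 2) / l (i - 1)) / (l (i + 1) / l (i - 1) * (l (i + 2) / l i)) = 1"
    using l(1) by (simp add: field_simps)
  finally show "coord_x a b c (i + int n) = coord_x a b c i" by simp
  have "coord_y a b (i + int n) = (l (i + 2) / l i / (l (i + 1) / l i * (l (i + 2) / l (i + 1)))) * coord_y a b i"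
    unfolding coord_y_def ix a b by (simp add: add.commute)
  also have "l (i + 2) / l i / (l (i + 1) / l i * (l (i + 2) / l (i + 1))) = 1"
    using l(1) by (simp add: field_simps)
  finally show "coord_y a b (i + int n) = coord_y a b i" by simp
qed

section \<open>Orbits of the Lax matrices over zero and infinity\<close>

text \<open>The relation of \<open>unit_case\<close> holds after a step; taken at the end of a
  period and divided by the multiplier, here a unit, it reaches index 0.\<close>

lemma (in lax_orbit) unit_case_0:
  assumes "d = 0"
  shows "ge (v 0 $ 3 + mf_const (\<xi> (n - 1) * \<eta> (n - 1)) * v 0 $ 1) (\<mu> 0 + 1)"
proof -
  let ?c = "mf_const (\<xi> (n - 1) * \<eta> (n - 1))"
  have n': "Suc (n - 1) = n" using n by simp
  have "\<mu> (n - 1) = \<mu> 0"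
    using unit_case(2)[OF assms] \<mu>_mono'[of 0 "n - 1"] \<mu>_mono'[of "n - 1" 1] \<mu>_period[of 0] assms n' by simp
  then have 1: "ge (v n $ 3 + ?c * v n $ 1) (\<mu> 0 + 1)"
    using unit_case(3)[OF assms, of "n - 1"] unfolding n' by simp
  have "v n $ 3 + ?c * v n $ 1 - \<kappa> * (v 0 $ 3 + ?c * v 0 $ 1)
      = (v n $ 3 - \<kappa> * v 0 $ 3) + ?c * (v n $ 1 - \<kappa> * v 0 $ 1)" by (simp add: algebra_simps)
  also have "R dvd \<dots>" using period[of 0] by (intro dvd_add dvd_mult) simp_all
  finally have "ge (\<kappa> * (v 0 $ 3 + ?c * v 0 $ 1)) (d + (\<mu> 0 + 1))"
    using 1 ge_cong assms by simp
  then show ?thesis by (rule ge_mult_cancel[OF \<kappa>])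
qed

definition inverse_lax :: "(int \<Rightarrow> complex) \<Rightarrow> (int \<Rightarrow> complex) \<Rightarrow> int \<Rightarrow> mfun ^ 3 ^ 3" where
  "inverse_lax x y i = vector
     [vector [0, 0, - mf_const (1 / y (i + 2))],
      vector [- mf_const (x (i + 2)), 0, - mf_const (1 / y (i + 2))],
      vector [0, mf_z, mf_const (1 / y (i + 2))]]"

lemma inverse_lax:
  assumes "x (i + 2) \<noteq> 0" "y (i + 2) \<noteq> 0"
  shows "lax_matrix mf_const mf_zinv x y i ** inverse_lax x y i = mat 1"
    and "inverse_lax x y i ** lax_matrix mf_const mf_zinv x y i = mat 1"
proof -
  have 1: "mf_const (1 / x (i + 2)) * mf_const (x (i + 2)) = 1" "mf_const (1 / y (i + 2)) * mf_const (y (i + 2)) = 1"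
    using assms by (simp_all flip: mf_const_mult)
  have 2: "mf_zinv * mf_z = 1" using mf_z_mult_zinv by (simp add: mult.commute)
  have 3: "mf_const (x (i + 2)) * mf_const (1 / x (i + 2)) = 1" "mf_const (y (i + 2)) * mf_const (1 / y (i + 2)) = 1"
    using 1 by (simp_all add: mult.commute)
  show "lax_matrix mf_const mf_zinv x y i ** inverse_lax x y i = mat 1"
    unfolding lax_matrix_def inverse_lax_def
    by (simp add: vec_eq_iff forall_3 matrix_matrix_mult_def sum_3 mat_def 1 2 3 mf_z_mult_zinv)
  then show "inverse_lax x y i ** lax_matrix mf_const mf_zinv x y i = mat 1"
    unfolding lax_matrix_def inverse_lax_def
    by (simp add: vec_eq_iff forall_3 matrix_matrix_mult_def sum_3 mat_def 1 2 3 mf_z_mult_zinv algebra_simps)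
qed

lemma lax_matrix_apply:
  "(lax_matrix e w x y i *v u) $ 1 = e (1 / x (i + 2)) * (u $ 1 - u $ 2)"
  "(lax_matrix e w x y i *v u) $ 2 = w * (u $ 1 + u $ 3)"
  "(lax_matrix e w x y i *v u) $ 3 = - e (y (i + 2)) * u $ 1"
  by (simp_all add: lax_matrix_def matrix_vector_mult_def sum_3 algebra_simps)

lemma inverse_lax_apply:
  "(inverse_lax x y i *v u) $ 1 = - mf_const (1 / y (i + 2)) * u $ 3"
  "(inverse_lax x y i *v u) $ 2 = - mf_const (x (i + 2)) * u $ 1 - mf_const (1 / y (i + 2)) * u $ 3"
  "(inverse_lax x y i *v u) $ 3 = mf_z * u $ 2 + mf_const (1 / y (i + 2)) * u $ 3"
  by (simp_all add: inverse_lax_def matrix_vector_mult_def sum_3)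

lemma lax_product_add:
  "lax_product e w x y i (m + k) = lax_product e w x y (i + int m) k ** lax_product e w x y i m"
  by (induction k) (simp_all add: matrix_mul_assoc add.assoc)

primrec backward :: "(int \<Rightarrow> complex) \<Rightarrow> (int \<Rightarrow> complex) \<Rightarrow> int \<Rightarrow> mfun ^ 3 \<Rightarrow> nat \<Rightarrow> mfun ^ 3" where
  "backward x y i \<phi> 0 = \<phi>"
| "backward x y i \<phi> (Suc m) = inverse_lax x y (i - 1 - int m) *v backward x y i \<phi> m"

text \<open>In this basis the inverse Lax matrix is a Lax matrix with \<open>x, y\<close> exchanged and \<open>1/z\<close> replaced by \<open>z\<close>.\<close>

definition dual_basis :: "mfun ^ 3 \<Rightarrow> mfun ^ 3" where
  "dual_basis u = vector [- u $ 1, - (u $ 1 + u $ 3), u $ 1 - u $ 2]"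

context place
begin

lemma vord_dual_basis: "vord (dual_basis u) m \<longleftrightarrow> vord u m"
proof -
  have "(\<forall>j. ge (dual_basis u $ j) l) \<longleftrightarrow> (\<forall>j. ge (u $ j) l)" for l
  proof
    assume "\<forall>j. ge (dual_basis u $ j) l"
    then have 1: "ge (u $ 1) l" and 2: "ge (u $ 1 + u $ 3) l" and 3: "ge (u $ 1 - u $ 2) l"
      by (simp_all add: forall_3 dual_basis_def minus_add_distrib[symmetric] del: minus_add_distrib)
    have "ge (u $ 2) l" "ge (u $ 3) l" using ge_diff[OF 1 3] ge_diff[OF 2 1] by simp_all
    with 1 show "\<forall>j. ge (u $ j) l" by (simp add: forall_3)
  next
    assume u: "\<forall>j. ge (u $ j) l"
    then have "ge (u $ 1 + u $ 3) l" "ge (u $ 1 - u $ 2) l" by (simp_all add: ge_add ge_diff)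
    with u show "\<forall>j. ge (dual_basis u $ j) l"
      by (simp add: forall_3 dual_basis_def minus_add_distrib[symmetric] del: minus_add_distrib)
  qed
  then show ?thesis by (simp add: vord_def)
qed

end

context spectral_curve
begin

lemma eigenvalue_order: "place R P \<Longrightarrow> order_eq R P eigenvalue (P mf_k)"
proof -
  assume "place R P"
  then interpret P: place R P .
  have "\<not> R dvd mf_k"
  proof
    assume "R dvd mf_k"
    moreover have "mf_k \<noteq> 0" "degree mf_k < degree R" unfolding degree_R by (simp_all add: mf_k_def)
    ultimately show False by (meson dvd_imp_degree_le not_less)
  qed
  then show ?thesis unfolding eigenvalue_def by (intro P.eq_const_mult C P.eq_order)
qed

lemma eigenvectorD: "eigenvector i \<phi> \<Longrightarrow> R dvd (monodromy n x y i *v \<phi>) $ j - eigenvalue * \<phi> $ j"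
  by (simp add: eigenvector_def)

lemma eigenvector_product: "eigenvector i \<phi> \<Longrightarrow> eigenvector (i + int m) (lax_product mf_const mf_zinv x y i m *v \<phi>)"
proof (induction m)
  case (Suc m)
  then have "eigenvector (i + int m + 1)
      (lax_matrix mf_const mf_zinv x y (i + int m) *v (lax_product mf_const mf_zinv x y i m *v \<phi>))"
    by (intro eigenvector_lax)
  then show ?case by (simp add: matrix_vector_mul_assoc add_ac)
qed simp

lemma eigenvector_inverse_lax:
  assumes "eigenvector (i + 1) \<phi>"
  shows "eigenvector i (inverse_lax x y i *v \<phi>)"
proof -
  define L where "L = lax_matrix mf_const mf_zinv x y i"
  define S where "S = inverse_lax x y i"
  have LS: "L ** S = mat 1" "S ** L = mat 1" unfolding L_def S_def using nonzero by (intro inverse_lax; simp)+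
  have lm: "monodromy n x y (i + 1) ** L = L ** monodromy n x y i"
    unfolding L_def using periodic by (rule lax_monodromy)
  have "monodromy n x y i ** S = (S ** L) ** monodromy n x y i ** S" by (simp add: LS)
  also have "\<dots> = S ** (L ** monodromy n x y i) ** S" by (simp only: matrix_mul_assoc)
  also have "\<dots> = S ** monodromy n x y (i + 1) ** (L ** S)" unfolding lm[symmetric] by (simp only: matrix_mul_assoc)
  finally have MS: "monodromy n x y i ** S = S ** monodromy n x y (i + 1)" by (simp add: LS)
  have "monodromy n x y i *v (S *v \<phi>) - eigenvalue *s (S *v \<phi>)
      = S *v (monodromy n x y (i + 1) *v \<phi> - eigenvalue *s \<phi>)"
    by (simp add: matrix_vector_mul_assoc MS matrix_vector_mult_diff_distrib matrix_vector_mult_smult)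
  then show ?thesis using assms unfolding eigenvector_def S_def by (simp add: dvd_matrix_vector_mult)
qed

lemma eigenvector_backward: "eigenvector i \<phi> \<Longrightarrow> eigenvector (i - int m) (backward x y i \<phi> m)"
proof (induction m)
  case (Suc m)
  have ix: "i - int m = i - 1 - int m + 1" "i - int (Suc m) = i - 1 - int m" by simp_all
  have "eigenvector (i - 1 - int m + 1) (backward x y i \<phi> m)" using Suc unfolding ix(1) by blast
  then show ?case unfolding backward.simps ix(2) by (rule eigenvector_inverse_lax)
qed simp

lemma lax_product_backward:
  "lax_product mf_const mf_zinv x y (i - int (m + k)) k *v backward x y i \<phi> (m + k) = backward x y i \<phi> m"
proof (induction k)
  case (Suc k)
  have ix: "i - int (m + Suc k) + 1 = i - int (m + k)" "i - int (m + Suc k) = i - 1 - int (m + k)"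
    "i - 1 - int (m + k) + 1 = i - int (m + k)" by simp_all
  have LS: "lax_matrix mf_const mf_zinv x y (i - 1 - int (m + k)) ** inverse_lax x y (i - 1 - int (m + k)) = mat 1"
    using nonzero by (intro inverse_lax) simp_all
  have "lax_product mf_const mf_zinv x y (i - int (m + Suc k)) (Suc k) *v backward x y i \<phi> (m + Suc k)
    = lax_product mf_const mf_zinv x y (i - int (m + k)) k *v
      ((lax_matrix mf_const mf_zinv x y (i - 1 - int (m + k)) ** inverse_lax x y (i - 1 - int (m + k))) *v backward x y i \<phi> (m + k))"
    unfolding lax_product_Suc_right ix
    by (simp only: add_Suc_right backward.simps matrix_vector_mul_assoc matrix_mul_assoc ix)
  then show ?case unfolding LS using Suc by simp
qed simp

lemma orbit_infinity:
  assumes P: "place R P" and z: "P mf_z < 0" and \<phi>: "eigenvector i \<phi>" "\<exists>j. \<not> R dvd \<phi> $ j" and n: "n > 0"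
  shows "lax_orbit R P mf_zinv eigenvalue (- P mf_z) (P mf_k)
    (\<lambda>m. lax_product mf_const mf_zinv x y i m *v \<phi>) (\<lambda>m. x (i + int m + 2)) (\<lambda>m. y (i + int m + 2)) n"
proof -
  interpret P: place R P by fact
  define v where "v m = lax_product mf_const mf_zinv x y i m *v \<phi>" for m
  have step: "v (Suc m) = lax_matrix mf_const mf_zinv x y (i + int m) *v v m" for m
    by (simp add: v_def matrix_vector_mul_assoc)
  have per: "R dvd v (m + n) $ j - eigenvalue * v m $ j" for m j
  proof -
    have "v (m + n) = monodromy n x y (i + int m) *v v m"
      by (simp add: v_def lax_product_add monodromy_def matrix_vector_mul_assoc)
    then show ?thesis using eigenvectorD[OF eigenvector_product[OF \<phi>(1)]] by (simp add: v_def)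
  qed
  have zo: "P.eq mf_zinv (- P mf_z)"
    using P.eq_order[OF z_parameter_not_dvd, of mf_zinv] P.z_zinv by (simp add: z_parameter_def)
  have nz: "\<exists>j. \<not> R dvd v 0 $ j" using \<phi>(2) by (simp add: v_def)
  have "lax_orbit R P mf_zinv eigenvalue (- P mf_z) (P mf_k) v
      (\<lambda>m. x (i + int m + 2)) (\<lambda>m. y (i + int m + 2)) n"
    by unfold_locales
      (use z n nonzero zo eigenvalue_order[OF P] per nz in
        \<open>simp_all add: step lax_matrix_apply mf_const_uminus\<close>)
  then show ?thesis unfolding v_def .
qed

text \<open>Running backwards over a period divides by the eigenvalue; hence the multiplier
  \<open>\<kappa>\<close> is its inverse, and a pole of \<open>k\<close> becomes a zero of the
  multiplier.\<close>

lemma orbit_zero: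
  assumes P: "place R P" and z: "P mf_z > 0" and \<phi>: "eigenvector i \<phi>" "\<exists>j. \<not> R dvd \<phi> $ j" and n: "n > 0"
    and \<kappa>: "R dvd eigenvalue * \<kappa> - 1"
  shows "lax_orbit R P mf_z \<kappa> (P mf_z) (- P mf_k)
    (\<lambda>m. dual_basis (backward x y i \<phi> m)) (\<lambda>m. y (i + 1 - int m)) (\<lambda>m. x (i + 1 - int m)) n"
proof -
  interpret P: place R P by fact
  let ?u = "backward x y i \<phi>"
  have step: "?u (Suc m) $ 1 = - mf_const (1 / y (i + 1 - int m)) * ?u m $ 3"
    "?u (Suc m) $ 2 = - mf_const (x (i + 1 - int m)) * ?u m $ 1 - mf_const (1 / y (i + 1 - int m)) * ?u m $ 3"
    "?u (Suc m) $ 3 = mf_z * ?u m $ 2 + mf_const (1 / y (i + 1 - int m)) * ?u m $ 3" for m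
  proof -
    have "i - 1 - int m + 2 = i + 1 - int m" by simp
    then show "?u (Suc m) $ 1 = - mf_const (1 / y (i + 1 - int m)) * ?u m $ 3"
    "?u (Suc m) $ 2 = - mf_const (x (i + 1 - int m)) * ?u m $ 1 - mf_const (1 / y (i + 1 - int m)) * ?u m $ 3"
    "?u (Suc m) $ 3 = mf_z * ?u m $ 2 + mf_const (1 / y (i + 1 - int m)) * ?u m $ 3"
      by (simp_all only: backward.simps inverse_lax_apply)
  qed
  have per: "R dvd ?u (m + n) $ j - \<kappa> * ?u m $ j" for m j
  proof -
    have "?u m = monodromy n x y (i - int (m + n)) *v ?u (m + n)"
      unfolding monodromy_def by (rule lax_product_backward[symmetric])
    then have 1: "R dvd ?u m $ j - eigenvalue * ?u (m + n) $ j"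
      using eigenvectorD[OF eigenvector_backward[OF \<phi>(1), of "m + n"]] by simp
    have "?u (m + n) $ j - \<kappa> * ?u m $ j
        = - ((eigenvalue * \<kappa> - 1) * ?u (m + n) $ j + \<kappa> * (?u m $ j - eigenvalue * ?u (m + n) $ j))"
      by (simp add: algebra_simps)
    also have "R dvd \<dots>" unfolding dvd_minus_iff by (rule dvd_add[OF dvd_mult2[OF \<kappa>] dvd_mult[OF 1]])
    finally show ?thesis .
  qed
  have per': "R dvd dual_basis (?u (m + n)) $ j - \<kappa> * dual_basis (?u m) $ j" for m j
  proof -
    note p = per[of m 1] per[of m 2] per[of m 3]
    have e: "- ?u (m + n) $ 1 - \<kappa> * - ?u m $ 1 = - (?u (m + n) $ 1 - \<kappa> * ?u m $ 1)"
      "- (?u (m + n) $ 1 + ?u (m + n) $ 3) - \<kappa> * - (?u m $ 1 + ?u m $ 3)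
        = - ((?u (m + n) $ 1 - \<kappa> * ?u m $ 1) + (?u (m + n) $ 3 - \<kappa> * ?u m $ 3))"
      "(?u (m + n) $ 1 - ?u (m + n) $ 2) - \<kappa> * (?u m $ 1 - ?u m $ 2)
        = (?u (m + n) $ 1 - \<kappa> * ?u m $ 1) - (?u (m + n) $ 2 - \<kappa> * ?u m $ 2)"
      by (simp_all add: algebra_simps)
    have "R dvd - ?u (m + n) $ 1 - \<kappa> * - ?u m $ 1"
      "R dvd - (?u (m + n) $ 1 + ?u (m + n) $ 3) - \<kappa> * - (?u m $ 1 + ?u m $ 3)"
      "R dvd (?u (m + n) $ 1 - ?u (m + n) $ 2) - \<kappa> * (?u m $ 1 - ?u m $ 2)"
      unfolding e dvd_minus_iff by (rule p, rule dvd_add[OF p(1,3)], rule dvd_diff[OF p(1,2)])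
    then show ?thesis using exhaust_3[of j] unfolding dual_basis_def by (elim disjE) (simp_all only: vector_3)
  qed
  have "P.eq eigenvalue (P mf_k)" by (rule eigenvalue_order[OF P])
  then have \<kappa>': "P.eq \<kappa> (- P mf_k)" using \<kappa> by (rule P.eq_inverse)
  have zo: "P.eq mf_z (P mf_z)" by (rule P.eq_order[OF P.z_not_dvd])
  have nz: "\<exists>j. \<not> R dvd dual_basis (?u 0) $ j"
  proof -
    obtain j where j: "\<not> R dvd \<phi> $ j" using \<phi>(2) by blast
    obtain m where "P.vord \<phi> m" using P.ex_vord[OF j] by blast
    then have "\<not> (\<forall>j. P.ge (dual_basis \<phi> $ j) (m + 1))"
      using P.vord_dual_basis[of \<phi> m] by (simp add: P.vord_def)
    then show ?thesis using P.ge_dvd by auto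
  qed
  have 1: "dual_basis (?u (Suc m)) $ 1 = mf_const (1 / y (i + 1 - int m)) * (dual_basis (?u m) $ 1 - dual_basis (?u m) $ 2)"
    and 2: "dual_basis (?u (Suc m)) $ 2 = mf_z * (dual_basis (?u m) $ 1 + dual_basis (?u m) $ 3)"
    and 3: "dual_basis (?u (Suc m)) $ 3 = mf_const (- x (i + 1 - int m)) * dual_basis (?u m) $ 1" for m
    unfolding dual_basis_def by (simp_all add: step mf_const_uminus del: backward.simps)
  show ?thesis
    by unfold_locales (use z n nonzero zo \<kappa>' per' nz 1 2 3 in \<open>simp_all del: backward.simps\<close>)
qed

end

text \<open>One parity class of a period, entered at \<open>p\<close>. For nowhere vanishing
  \<open>f\<close> of period \<open>2 * q\<close> only the parity of \<open>p\<close>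
  matters.\<close>

definition alt_prod :: "nat \<Rightarrow> (int \<Rightarrow> complex) \<Rightarrow> int \<Rightarrow> complex" where
  "alt_prod q f p = (\<Prod>l<q. f (p + 2 * int l))"

lemma alt_prod_shift:
  assumes "\<And>j. f (j + 2 * int q) = f j" "\<And>j. f j \<noteq> 0"
  shows "alt_prod q f (p + 2) = alt_prod q f p"
proof -
  have "f p * alt_prod q f (p + 2) = (\<Prod>l<Suc q. f (p + 2 * int l))"
    unfolding alt_prod_def prod.lessThan_Suc_shift by (simp add: algebra_simps)
  also have "\<dots> = alt_prod q f p * f p" by (simp add: alt_prod_def assms(1))
  finally show ?thesis using assms(2)[of p] by simp
qed

lemma alt_prod_parity:
  assumes "\<And>j. f (j + 2 * int q) = f j" "\<And>j. f j \<noteq> 0"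
  shows "alt_prod q f p = (if even p then \<Prod>j | j < 2 * q \<and> even j. f (int j) else \<Prod>j | j < 2 * q \<and> odd j. f (int j))"
proof -
  have up: "alt_prod q f (p + 2 * int k) = alt_prod q f p" for p k
  proof (induction k)
    case (Suc k)
    have "alt_prod q f (p + 2 * int (Suc k)) = alt_prod q f ((p + 2 * int k) + 2)" by (simp add: algebra_simps)
    then show ?case using Suc alt_prod_shift[where f = f and q = q, OF assms] by simp
  qed simp
  have mod: "alt_prod q f p = alt_prod q f (p mod 2)"
  proof (cases "p div 2 \<ge> 0")
    case True
    then have "p = p mod 2 + 2 * int (nat (p div 2))" by simp
    then show ?thesis using up[of "p mod 2" "nat (p div 2)"] by simp
  next
    case False
    then have "- (p div 2) \<ge> 0" by linarith
    then have "int (nat (- (p div 2))) = - (p div 2)" by (rule nat_0_le)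
    then have "p mod 2 = p + 2 * int (nat (- (p div 2)))" using mult_div_mod_eq[of 2 p] by linarith
    then show ?thesis using up[of p "nat (- (p div 2))"] by simp
  qed
  have 0: "alt_prod q f 0 = (\<Prod>j | j < 2 * q \<and> even j. f (int j))"
    unfolding alt_prod_def
    by (rule prod.reindex_bij_witness[of _ "\<lambda>j. j div 2" "\<lambda>l. 2 * l"]) auto
  have 1: "alt_prod q f 1 = (\<Prod>j | j < 2 * q \<and> odd j. f (int j))"
    unfolding alt_prod_def
    by (rule prod.reindex_bij_witness[of _ "\<lambda>j. j div 2" "\<lambda>l. Suc (2 * l)"]) (auto elim!: oddE)
  show ?thesis using mod 0 1 by (cases "even p") (auto simp: odd_iff_mod_2_eq_one)
qed

lemma alt_prod_backwards: "(\<Prod>l<q. f (i - 2 * int l)) = alt_prod q f (i - 2 * (int q - 1))"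
proof -
  have "(\<Prod>l<q. f (i - 2 * int l)) = (\<Prod>l<q. f (i - 2 * int (q - Suc l)))"
    by (rule prod.nat_diff_reindex[symmetric])
  also have "\<dots> = alt_prod q f (i - 2 * (int q - 1))"
    unfolding alt_prod_def by (rule prod.cong) (auto simp: of_nat_diff algebra_simps)
  finally show ?thesis .
qed

lemma prod_uminus: "(\<Prod>l<q. - f l) = (- 1) ^ q * (\<Prod>l<q. f l :: complex)"
  by (induction q) simp_all

section \<open>The fibres over zero and infinity, and the leading terms of eigenvectors
  there\<close>

locale marked_curve = smooth_spectral_curve +
  fixes O1 O2 O3 W1 W2 W3 :: point and \<psi> :: "mfun ^ 3"
  assumes n4: "n \<ge> 4"
    and marked: "marked_points n x y C O1 O2 O3 W1 W2 W3"
    and distinct_products: "even n \<Longrightarrow> (\<Prod>j | j < n \<and> odd j. x (int j)) \<noteq> (\<Prod>j | j < n \<and> even j. x (int j))"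
      "even n \<Longrightarrow> (\<Prod>j | j < n \<and> odd j. y (int j)) \<noteq> (\<Prod>j | j < n \<and> even j. y (int j))"
    and \<psi>: "normalized 0 \<psi>"
begin

lemma n0: "n > 0"
  using n4 by simp

definition q :: nat where "q = n div 2"

lemma marked':
  "curve_point R O1" "O1 mf_z > 0" "O1 mf_k \<ge> 0" "curve_point R O2" "O2 mf_z > 0" "O2 mf_k < 0"
  "curve_point R W1" "W1 mf_z < 0" "W1 mf_k = 0" "curve_point R W2" "W2 mf_z < 0" "W2 mf_k > 0"
  "even n \<Longrightarrow> curve_point R O3" "even n \<Longrightarrow> O3 mf_z > 0" "even n \<Longrightarrow> O3 mf_k < 0"
  "even n \<Longrightarrow> curve_point R W3" "even n \<Longrightarrow> W3 mf_z < 0" "even n \<Longrightarrow> W3 mf_k > 0"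
  using marked unfolding marked_points_def Let_def R[symmetric] by auto

lemma limits:
  assumes "even n"
  shows "order_ge R O2 (eigenvalue * mf_z ^ q - mf_const ((- 1) ^ q * (\<Prod>j | j < n \<and> odd j. 1 / x (int j)))) 1"
    "order_ge R O3 (eigenvalue * mf_z ^ q - mf_const ((- 1) ^ q * (\<Prod>j | j < n \<and> even j. 1 / x (int j)))) 1"
    "order_ge R W2 (eigenvalue * mf_z ^ q - mf_const ((- 1) ^ q * (\<Prod>j | j < n \<and> even j. y (int j)))) 1"
    "order_ge R W3 (eigenvalue * mf_z ^ q - mf_const ((- 1) ^ q * (\<Prod>j | j < n \<and> odd j. y (int j)))) 1"
  using marked assms unfolding marked_points_def Let_def R[symmetric] tends_to_at_def eigenvalue_def q_def by auto

lemma unique_limit: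
  assumes "place R P" "order_ge R P (f - mf_const a) 1" "order_ge R P (f - mf_const b) 1"
  shows "a = b"
proof (rule ccontr)
  interpret P: place R P by fact
  assume "a \<noteq> b"
  then have "P.eq (mf_const (b - a)) 0" by (intro P.eq_const) simp
  moreover have "P.ge ((f - mf_const a) - (f - mf_const b)) 1" using assms(2,3) by (rule P.ge_diff)
  then have "P.ge (mf_const (b - a)) 1" by (simp add: mf_const_diff)
  ultimately show False using P.eq_not_ge by fastforce
qed

lemma q: "even n \<Longrightarrow> n = 2 * q"
  by (simp add: q_def)

lemma x_prod_inverse: "(\<Prod>j\<in>A. 1 / x (int j)) = 1 / (\<Prod>j\<in>A. x (int j))"
  by (simp add: prod_dividef)

lemma W2_W3: "even n \<Longrightarrow> W2 \<noteq> W3"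
proof
  assume e: "even n" and "W2 = W3"
  then have "(- 1) ^ q * (\<Prod>j | j < n \<and> even j. y (int j)) = (- 1) ^ q * (\<Prod>j | j < n \<and> odd j. y (int j))"
    using limits(3,4)[OF e] marked'(10) unique_limit placeI by metis
  then show False using distinct_products(2)[OF e] by simp
qed

lemma O2_O3: "even n \<Longrightarrow> O2 \<noteq> O3"
proof
  assume e: "even n" and "O2 = O3"
  then have "(- 1) ^ q * (\<Prod>j | j < n \<and> odd j. 1 / x (int j)) = (- 1) ^ q * (\<Prod>j | j < n \<and> even j. 1 / x (int j))"
    using limits(1,2)[OF e] marked'(4) unique_limit placeI by metis
  then show False using distinct_products(1)[OF e] unfolding x_prod_inverse by simp
qed

lemma eigenvector_at:
  obtains \<phi> where "eigenvector (int i) \<phi>" "\<exists>j. \<not> R dvd \<phi> $ j"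
proof -
  let ?\<phi> = "lax_product mf_const mf_zinv x y 0 i *v \<psi>"
  have e: "eigenvector 0 \<psi>" using \<psi> by (simp add: normalized_def)
  have W: "place R W1" using marked' placeI by blast
  have nz: "\<exists>j. \<not> R dvd \<psi> $ j"
    using normalized_sum_not_dvd[OF \<psi>] by (meson dvd_sum)
  have "\<exists>j. \<not> R dvd ?\<phi> $ j"
    using lax_orbit.orbit_nonzero[OF orbit_infinity[OF W marked'(8) e nz n0], of i] by simp
  moreover have "eigenvector (int i) ?\<phi>" using eigenvector_product[OF e, of i] by simp
  ultimately show ?thesis using that by blast
qed

lemma inverse_eigenvalue:
  obtains \<kappa> where "R dvd eigenvalue * \<kappa> - 1"
proof -
  have "\<not> R dvd eigenvalue"
    using eigenvalue_order[OF placeI[OF marked'(1)]] by (simp add: order_eq_def)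
  then show ?thesis using inverse_mod_R that by blast
qed

text \<open>Orders never drop along the forward orbit, so the eigenvalue has no pole over infinity.
  If it has a zero at an unramified point there, \<open>stA\<close> and \<open>stB\<close> alternate
  and \<open>n\<close> is even.\<close>

lemma infinity_k:
  assumes "curve_point R P" "P mf_z < 0"
  shows "P mf_k \<ge> 0" "P mf_k > 0 \<Longrightarrow> odd n \<Longrightarrow> P mf_z \<le> - 2"
proof -
  have P: "place R P" using assms(1) by (rule placeI)
  obtain \<phi> where \<phi>: "eigenvector (int 0) \<phi>" "\<exists>j. \<not> R dvd \<phi> $ j" using eigenvector_at .
  note orb = orbit_infinity[OF P assms(2) \<phi> n0]
  show "P mf_k \<ge> 0" by (rule lax_orbit.d_nonneg[OF orb])
  show "P mf_z \<le> - 2" if "P mf_k > 0" "odd n"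
  proof (rule ccontr)
    assume "\<not> P mf_z \<le> - 2"
    then have "- P mf_z = 1" using assms(2) by simp
    from lax_orbit.simple_even[OF orb that(1) this] that(2) show False by simp
  qed
qed

lemma zero_k:
  assumes "curve_point R P" "P mf_z > 0"
  shows "P mf_k \<le> 0" "P mf_k < 0 \<Longrightarrow> odd n \<Longrightarrow> P mf_z \<ge> 2"
proof -
  have P: "place R P" using assms(1) by (rule placeI)
  obtain \<kappa> where \<kappa>: "R dvd eigenvalue * \<kappa> - 1" using inverse_eigenvalue .
  obtain \<phi> where \<phi>: "eigenvector (int 0) \<phi>" "\<exists>j. \<not> R dvd \<phi> $ j" using eigenvector_at .
  note orb = orbit_zero[OF P assms(2) \<phi> n0 \<kappa>]
  show "P mf_k \<le> 0" using lax_orbit.d_nonneg[OF orb] by simp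
  show "P mf_z \<ge> 2" if "P mf_k < 0" "odd n"
  proof (rule ccontr)
    assume "\<not> P mf_z \<ge> 2"
    then have "P mf_z = 1" using assms(2) by simp
    moreover have "0 < - P mf_k" using that(1) by simp
    ultimately show False using lax_orbit.simple_even[OF orb] that(2) by simp
  qed
qed

lemma O1_k: "O1 mf_k = 0"
  using zero_k(1)[OF marked'(1,2)] marked'(3) by simp

lemma z_ramification:
  assumes "finite S" "\<And>P. P \<in> S \<Longrightarrow> curve_point R P \<and> P mf_z > 0"
  shows "(\<Sum>P\<in>S. P mf_z) \<le> 3"
proof -
  have zp: "z_parameter mf_z" unfolding z_parameter_def by (intro disjI2 exI[of _ 0]) simp
  show ?thesis using sum_ramification_le[OF zp z_parameter_not_dvd[OF zp] assms] by (simp add: degree_R)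
qed

lemma zinv_ramification:
  assumes "finite S" "\<And>P. P \<in> S \<Longrightarrow> curve_point R P \<and> P mf_z < 0"
  shows "(\<Sum>P\<in>S. - P mf_z) \<le> 3"
proof -
  have zp: "z_parameter mf_zinv" unfolding z_parameter_def by simp
  have zi: "P mf_zinv = - P mf_z" if "curve_point R P" for P
    by (rule place.z_zinv[OF placeI[OF that]])
  have "(\<Sum>P\<in>S. P mf_zinv) \<le> int (degree R)"
  proof (rule sum_ramification_le[OF zp z_parameter_not_dvd[OF zp] assms(1)])
    fix P assume "P \<in> S"
    then show "curve_point R P \<and> 0 < P mf_zinv" using assms(2)[of P] zi[of P] by simp
  qed
  moreover have "(\<Sum>P\<in>S. P mf_zinv) = (\<Sum>P\<in>S. - P mf_z)" using assms(2) zi by (intro sum.cong) auto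
  ultimately show ?thesis by (simp add: degree_R)
qed

text \<open>\<open>W1\<close> contributes at least 1 and \<open>W2\<close> at least 2 to a total of
  at most 3; so both numbers are exact and no room is left for another point.\<close>

lemma infinity_odd:
  assumes "odd n"
  shows "W1 mf_z = - 1" "W2 mf_z = - 2" "curve_point R P \<Longrightarrow> P mf_z < 0 \<Longrightarrow> P = W1 \<or> P = W2"
proof -
  have ne: "W1 \<noteq> W2" using marked' by auto
  have le: "W2 mf_z \<le> - 2" using infinity_k(2)[OF marked'(10,11,12) assms] .
  have "(\<Sum>P\<in>{W1, W2}. - P mf_z) \<le> 3" by (rule zinv_ramification) (use marked' in auto)
  then have "- W1 mf_z - W2 mf_z \<le> 3" using ne by simp
  then show "W1 mf_z = - 1" "W2 mf_z = - 2" using le marked'(8) by linarith+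
  show "P = W1 \<or> P = W2" if P: "curve_point R P" "P mf_z < 0"
  proof (rule ccontr)
    assume n: "\<not> ?thesis"
    have "(\<Sum>P\<in>{P, W1, W2}. - P mf_z) \<le> 3" by (rule zinv_ramification) (use marked' P in auto)
    moreover have "(\<Sum>P\<in>{P, W1, W2}. - P mf_z) = - W1 mf_z - W2 mf_z - P mf_z" using n ne by simp
    ultimately show False using le marked'(8) P(2) by linarith
  qed
qed

text \<open>Three distinct points already exhaust the total of 3; \<open>W2\<close> and
  \<open>W3\<close> are distinct because their limits are.\<close>

lemma infinity_even:
  assumes "even n"
  shows "W1 mf_z = - 1" "W2 mf_z = - 1" "W3 mf_z = - 1"
    "curve_point R P \<Longrightarrow> P mf_z < 0 \<Longrightarrow> P = W1 \<or> P = W2 \<or> P = W3"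
proof -
  have ne: "W1 \<noteq> W2" "W1 \<noteq> W3" "W2 \<noteq> W3" using marked' assms W2_W3[OF assms] by auto
  have "(\<Sum>P\<in>{W1, W2, W3}. - P mf_z) \<le> 3" by (rule zinv_ramification) (use marked' assms in auto)
  then have "- W1 mf_z - W2 mf_z - W3 mf_z \<le> 3" using ne by simp
  then show "W1 mf_z = - 1" "W2 mf_z = - 1" "W3 mf_z = - 1"
    using marked'(8,11) marked'(17)[OF assms] by linarith+
  show "P = W1 \<or> P = W2 \<or> P = W3" if P: "curve_point R P" "P mf_z < 0"
  proof (rule ccontr)
    assume n: "\<not> ?thesis"
    have "(\<Sum>P\<in>{P, W1, W2, W3}. - P mf_z) \<le> 3" by (rule zinv_ramification) (use marked' P assms in auto)
    moreover have "(\<Sum>P\<in>{P, W1, W2, W3}. - P mf_z) = - W1 mf_z - W2 mf_z - W3 mf_z - P mf_z" using n ne by simp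
    ultimately show False using marked'(8,11) marked'(17)[OF assms] P(2) by linarith
  qed
qed

lemma zero_odd:
  assumes "odd n"
  shows "O1 mf_z = 1" "O2 mf_z = 2" "curve_point R P \<Longrightarrow> P mf_z > 0 \<Longrightarrow> P = O1 \<or> P = O2"
proof -
  have ne: "O1 \<noteq> O2" using marked' by auto
  have le: "O2 mf_z \<ge> 2" using zero_k(2)[OF marked'(4,5,6) assms] .
  have "(\<Sum>P\<in>{O1, O2}. P mf_z) \<le> 3" by (rule z_ramification) (use marked' in auto)
  then have "O1 mf_z + O2 mf_z \<le> 3" using ne by simp
  then show "O1 mf_z = 1" "O2 mf_z = 2" using le marked'(2) by linarith+
  show "P = O1 \<or> P = O2" if P: "curve_point R P" "P mf_z > 0"
  proof (rule ccontr)
    assume n: "\<not> ?thesis"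
    have "(\<Sum>P\<in>{P, O1, O2}. P mf_z) \<le> 3" by (rule z_ramification) (use marked' P in auto)
    moreover have "(\<Sum>P\<in>{P, O1, O2}. P mf_z) = O1 mf_z + O2 mf_z + P mf_z" using n ne by simp
    ultimately show False using le marked'(2) P(2) by linarith
  qed
qed

lemma zero_even:
  assumes "even n"
  shows "O1 mf_z = 1" "O2 mf_z = 1" "O3 mf_z = 1"
    "curve_point R P \<Longrightarrow> P mf_z > 0 \<Longrightarrow> P = O1 \<or> P = O2 \<or> P = O3"
proof -
  have ne: "O1 \<noteq> O2" "O1 \<noteq> O3" "O2 \<noteq> O3" using marked' assms O2_O3[OF assms] by auto
  have "(\<Sum>P\<in>{O1, O2, O3}. P mf_z) \<le> 3" by (rule z_ramification) (use marked' assms in auto)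
  then have "O1 mf_z + O2 mf_z + O3 mf_z \<le> 3" using ne by simp
  then show "O1 mf_z = 1" "O2 mf_z = 1" "O3 mf_z = 1"
    using marked'(2,5) marked'(14)[OF assms] by linarith+
  show "P = O1 \<or> P = O2 \<or> P = O3" if P: "curve_point R P" "P mf_z > 0"
  proof (rule ccontr)
    assume n: "\<not> ?thesis"
    have "(\<Sum>P\<in>{P, O1, O2, O3}. P mf_z) \<le> 3" by (rule z_ramification) (use marked' P assms in auto)
    moreover have "(\<Sum>P\<in>{P, O1, O2, O3}. P mf_z) = O1 mf_z + O2 mf_z + O3 mf_z + P mf_z" using n ne by simp
    ultimately show False using marked'(2,5) marked'(14)[OF assms] P(2) by linarith
  qed
qed

lemma alt_prod_y:
  assumes "even n"
  shows "alt_prod q y p = (if even p then \<Prod>j | j < n \<and> even j. y (int j) else \<Prod>j | j < n \<and> odd j. y (int j))"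
proof -
  have q2: "2 * int q = int n" using q[OF assms] by simp
  have "y (j + 2 * int q) = y j" for j using periodic(2)[of j] q2 by simp
  from alt_prod_parity[where f = y and q = q, OF this nonzero(2)] show ?thesis using q[OF assms] by simp
qed

lemma alt_prod_x:
  assumes "even n"
  shows "alt_prod q x p = (if even p then \<Prod>j | j < n \<and> even j. x (int j) else \<Prod>j | j < n \<and> odd j. x (int j))"
proof -
  have q2: "2 * int q = int n" using q[OF assms] by simp
  have "x (j + 2 * int q) = x j" for j using periodic(1)[of j] q2 by simp
  from alt_prod_parity[where f = x and q = q, OF this nonzero(1)] show ?thesis using q[OF assms] by simp
qed

context
  fixes P :: point and i :: int and \<phi> :: "mfun ^ 3" and m :: int
  assumes P: "curve_point R P" and \<phi>: "eigenvector i \<phi>" and m: "place.vord R P \<phi> m"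
begin

interpretation P: place R P using P by (rule placeI)

lemma phi_nonzero: "\<exists>j. \<not> R dvd \<phi> $ j"
  using m P.ge_dvd unfolding P.vord_def by blast

lemma infinity_W1_type:
  assumes z: "P mf_z < 0" and k: "P mf_k = 0"
  shows "P.eq (\<phi> $ 1) m" "P.ge (\<phi> $ 2) (m + 1)"
    "P.ge (\<phi> $ 3 + mf_const (x (i + 1) * y (i + 1)) * \<phi> $ 1) (m + 1)"
    "P.vord (lax_matrix mf_const mf_zinv x y i *v \<phi>) m"
proof -
  interpret orb: lax_orbit R P mf_zinv eigenvalue "- P mf_z" "P mf_k"
    "\<lambda>m. lax_product mf_const mf_zinv x y i m *v \<phi>" "\<lambda>m. x (i + int m + 2)" "\<lambda>m. y (i + int m + 2)" n
    using P.place_axioms z \<phi> phi_nonzero n0 by (rule orbit_infinity)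
  have mu: "orb.\<mu> 0 = m" using m by (intro orb.\<mu>_eqI) simp
  have C: "orb.stC 0" using orb.unit_case(1)[OF k] .
  then show "P.eq (\<phi> $ 1) m" "P.ge (\<phi> $ 2) (m + 1)" by (simp_all add: orb.stC_def mu)
  have "orb.\<mu> (Suc 0) = m" using orb.unit_case(2)[OF k, of 0] mu by simp
  then show "P.vord (lax_matrix mf_const mf_zinv x y i *v \<phi>) m" using orb.\<mu>[of "Suc 0"] by simp
  have xy: "x (i + int (n - 1) + 2) = x (i + 1)" "y (i + int (n - 1) + 2) = y (i + 1)"
    using periodic[of "i + 1"] n0 by (simp_all add: of_nat_diff algebra_simps)
  show "P.ge (\<phi> $ 3 + mf_const (x (i + 1) * y (i + 1)) * \<phi> $ 1) (m + 1)"
    using orb.unit_case_0[OF k] unfolding mu xy by simp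
qed

lemma infinity_double_type:
  assumes z: "P mf_z = - 2" and k: "P mf_k > 0" and odd: "odd n"
  shows "P.eq (\<phi> $ 3) m" "P.eq (\<phi> $ 1) (m + 1)" "P.ge (\<phi> $ 1 - \<phi> $ 2) (m + 2)"
    "P.vord (lax_matrix mf_const mf_zinv x y i *v \<phi>) (m + 1)"
proof -
  have z': "P mf_z < 0" using z by simp
  interpret orb: lax_orbit R P mf_zinv eigenvalue "- P mf_z" "P mf_k"
    "\<lambda>m. lax_product mf_const mf_zinv x y i m *v \<phi>" "\<lambda>m. x (i + int m + 2)" "\<lambda>m. y (i + int m + 2)" n
    using P.place_axioms z' \<phi> phi_nonzero n0 by (rule orbit_infinity)
  have mu: "orb.\<mu> 0 = m" using m by (intro orb.\<mu>_eqI) simp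
  have z2: "- P mf_z = 2" using z by simp
  note D = orb.double_case[OF k z2 odd, of 0]
  show "P.eq (\<phi> $ 3) m" using orb.stA_third[OF D(1)] by (simp add: mu)
  show "P.eq (\<phi> $ 1) (m + 1)" "P.ge (\<phi> $ 1 - \<phi> $ 2) (m + 2)" using D(3,4) by (simp_all add: mu)
  have "orb.\<mu> (Suc 0) = m + 1" using D(2) mu by simp
  then show "P.vord (lax_matrix mf_const mf_zinv x y i *v \<phi>) (m + 1)" using orb.\<mu>[of "Suc 0"] by simp
qed

text \<open>The alternatives are \<open>stA\<close> and \<open>stB\<close> at the start of the
  orbit. Each is stated with the limit that it forces, and at a point with known limit this decides
  between them.\<close>

lemma infinity_simple_type:
  assumes z: "P mf_z = - 1" and k: "P mf_k > 0" and even: "even n"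
  shows "P.ge (\<phi> $ 1) (m + 1) \<and> P.ge (\<phi> $ 2) (m + 1) \<and> P.eq (\<phi> $ 3) m \<and>
      P.vord (lax_matrix mf_const mf_zinv x y i *v \<phi>) (m + 1) \<and>
      P.ge (eigenvalue * mf_z ^ q - mf_const ((- 1) ^ q * alt_prod q y (i + 1))) 1
    \<or> P.eq (\<phi> $ 1) m \<and> P.ge (\<phi> $ 1 - \<phi> $ 2) (m + 1) \<and>
      P.vord (lax_matrix mf_const mf_zinv x y i *v \<phi>) m \<and>
      P.ge (eigenvalue * mf_z ^ q - mf_const ((- 1) ^ q * alt_prod q y i)) 1"
proof -
  have z': "P mf_z < 0" using z by simp
  interpret orb: lax_orbit R P mf_zinv eigenvalue "- P mf_z" "P mf_k"
    "\<lambda>m. lax_product mf_const mf_zinv x y i m *v \<phi>" "\<lambda>m. x (i + int m + 2)" "\<lambda>m. y (i + int m + 2)" n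
    using P.place_axioms z' \<phi> phi_nonzero n0 by (rule orbit_infinity)
  have mu: "orb.\<mu> 0 = m" using m by (intro orb.\<mu>_eqI) simp
  have z1: "- P mf_z = 1" using z by simp
  have ap: "alt_prod q y (p + 2) = alt_prod q y p" for p
    using alt_prod_y[OF even] by simp
  have prod: "(\<Prod>l<n div 2. - y (i + int (j + 2 * l + 1) + 2)) = (- 1) ^ q * alt_prod q y (i + int j + 1)" for j
  proof -
    have "(\<Prod>l<n div 2. - y (i + int (j + 2 * l + 1) + 2)) = (- 1) ^ q * (\<Prod>l<q. y (i + int (j + 2 * l + 1) + 2))"
      unfolding q_def by (rule prod_uminus)
    also have "(\<Prod>l<q. y (i + int (j + 2 * l + 1) + 2)) = alt_prod q y (i + int j + 1 + 2)"
      unfolding alt_prod_def by (rule prod.cong) (simp_all add: algebra_simps)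
    finally show ?thesis unfolding ap .
  qed
  have lim: "P.ge (eigenvalue * mf_z ^ q - mf_const ((- 1) ^ q * alt_prod q y (i + int j + 1))) 1"
    if "orb.stA j" for j
    using orb.simple_limit[OF k z1 that mf_z_mult_zinv] unfolding prod unfolding q_def .
  show ?thesis
  proof (cases "orb.stA 0")
    case True
    have "orb.\<mu> (Suc 0) = m + 1" using orb.simple_stA(2)[OF k z1 True] mu by simp
    then have "P.vord (lax_matrix mf_const mf_zinv x y i *v \<phi>) (m + 1)" using orb.\<mu>[of "Suc 0"] by simp
    moreover have "P.ge (\<phi> $ 1) (m + 1)" "P.ge (\<phi> $ 2) (m + 1)"
      using True by (simp_all add: orb.stA_def mu)
    moreover have "P.eq (\<phi> $ 3) m" using orb.stA_third[OF True] mu by simp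
    ultimately show ?thesis using lim[OF True] by simp
  next
    case False
    note B = orb.stB_if_not_stA[OF k False]
    have "orb.\<mu> (Suc 0) = m" using B(3) mu by simp
    then have "P.vord (lax_matrix mf_const mf_zinv x y i *v \<phi>) m" using orb.\<mu>[of "Suc 0"] by simp
    moreover have "P.eq (\<phi> $ 1) m" "P.ge (\<phi> $ 1 - \<phi> $ 2) (m + 1)"
      using B(1) by (simp_all add: orb.stB_def mu)
    \<comment> \<open>Here \<open>stA\<close> holds at the next index, for which the product starts
      two places after \<open>i\<close>, in the same parity class.\<close>
    moreover have "alt_prod q y (i + int (Suc 0) + 1) = alt_prod q y i" using ap[of i] by (simp add: add.assoc)
    ultimately show ?thesis using lim[OF B(2)] by simp
  qed
qed

lemma zero_O1_type:
  assumes z: "P mf_z > 0" and k: "P mf_k = 0"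
  shows "P.eq (\<phi> $ 1) m" "P.ge (\<phi> $ 1 + \<phi> $ 3) (m + 1)"
    "P.ge (\<phi> $ 1 - \<phi> $ 2 - mf_const (x (i + 2) * y (i + 2)) * \<phi> $ 1) (m + 1)"
    "P.vord (inverse_lax x y (i - 1) *v \<phi>) m"
proof -
  obtain \<kappa> where \<kappa>: "R dvd eigenvalue * \<kappa> - 1" using inverse_eigenvalue .
  define v where "v m = dual_basis (backward x y i \<phi> m)" for m
  have v: "v = (\<lambda>m. dual_basis (backward x y i \<phi> m))" by (simp add: v_def fun_eq_iff)
  have v0: "v 0 $ 1 = - \<phi> $ 1" "v 0 $ 2 = - (\<phi> $ 1 + \<phi> $ 3)" "v 0 $ 3 = \<phi> $ 1 - \<phi> $ 2"
    by (simp_all add: v_def dual_basis_def)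
  have v1: "P.vord (v 0) l \<longleftrightarrow> P.vord \<phi> l" "P.vord (v (Suc 0)) l \<longleftrightarrow> P.vord (inverse_lax x y (i - 1) *v \<phi>) l" for l
    by (simp_all add: v_def P.vord_dual_basis)
  interpret orb: lax_orbit R P mf_z \<kappa> "P mf_z" "- P mf_k" v
    "\<lambda>m. y (i + 1 - int m)" "\<lambda>m. x (i + 1 - int m)" n
    unfolding v using P.place_axioms z \<phi> phi_nonzero n0 \<kappa> by (rule orbit_zero)
  have k': "- P mf_k = 0" using k by simp
  have mu: "orb.\<mu> 0 = m" using m by (intro orb.\<mu>_eqI) (simp add: v1)
  have C: "orb.stC 0" using orb.unit_case(1)[OF k'] .
  have "P.eq (- (\<phi> $ 1)) m" "P.ge (- (\<phi> $ 1 + \<phi> $ 3)) (m + 1)"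
    using C unfolding orb.stC_def mu v0 by simp_all
  then show "P.eq (\<phi> $ 1) m" "P.ge (\<phi> $ 1 + \<phi> $ 3) (m + 1)"
    using P.eq_minus_iff P.ge_minus_iff by blast+
  have "orb.\<mu> (Suc 0) = m" using orb.unit_case(2)[OF k', of 0] mu by simp
  then show "P.vord (inverse_lax x y (i - 1) *v \<phi>) m"
    using orb.\<mu>[of "Suc 0"] by (simp add: v1)
  have xy: "x (i + 1 - int (n - 1)) = x (i + 2)" "y (i + 1 - int (n - 1)) = y (i + 2)"
    using periodic[of "i + 2 - int n"] n0 by (simp_all add: of_nat_diff algebra_simps)
  show "P.ge (\<phi> $ 1 - \<phi> $ 2 - mf_const (x (i + 2) * y (i + 2)) * \<phi> $ 1) (m + 1)"
    using orb.unit_case_0[OF k'] unfolding mu xy by (simp add: v0 mult.commute)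
qed

lemma zero_double_type:
  assumes z: "P mf_z = 2" and k: "P mf_k < 0" and odd: "odd n"
  shows "P.eq (\<phi> $ 2) m" "P.eq (\<phi> $ 1) (m + 1)" "P.ge (\<phi> $ 3) (m + 2)"
    "P.vord (inverse_lax x y (i - 1) *v \<phi>) (m + 1)"
proof -
  obtain \<kappa> where \<kappa>: "R dvd eigenvalue * \<kappa> - 1" using inverse_eigenvalue .
  have z': "P mf_z > 0" using z by simp
  define v where "v m = dual_basis (backward x y i \<phi> m)" for m
  have v: "v = (\<lambda>m. dual_basis (backward x y i \<phi> m))" by (simp add: v_def fun_eq_iff)
  have v0: "v 0 $ 1 = - \<phi> $ 1" "v 0 $ 2 = - (\<phi> $ 1 + \<phi> $ 3)" "v 0 $ 3 = \<phi> $ 1 - \<phi> $ 2"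
    by (simp_all add: v_def dual_basis_def)
  have v1: "P.vord (v 0) l \<longleftrightarrow> P.vord \<phi> l" "P.vord (v (Suc 0)) l \<longleftrightarrow> P.vord (inverse_lax x y (i - 1) *v \<phi>) l" for l
    by (simp_all add: v_def P.vord_dual_basis)
  interpret orb: lax_orbit R P mf_z \<kappa> "P mf_z" "- P mf_k" v
    "\<lambda>m. y (i + 1 - int m)" "\<lambda>m. x (i + 1 - int m)" n
    unfolding v using P.place_axioms z' \<phi> phi_nonzero n0 \<kappa> by (rule orbit_zero)
  have k': "- P mf_k > 0" using k by simp
  have mu: "orb.\<mu> 0 = m" using m by (intro orb.\<mu>_eqI) (simp add: v1)
  note D = orb.double_case[OF k' z odd, of 0]
  have 1: "P.eq (- (\<phi> $ 1)) (m + 1)" using D(3) by (simp add: mu v0)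
  then show e1: "P.eq (\<phi> $ 1) (m + 1)" using P.eq_minus_iff by blast
  show "P.ge (\<phi> $ 3) (m + 2)" using D(4) by (simp add: mu v0)
  have e3: "P.eq (\<phi> $ 1 - \<phi> $ 2) m" using orb.stA_third[OF D(1)] by (simp add: mu v0)
  have "P.eq (\<phi> $ 1 - (\<phi> $ 1 - \<phi> $ 2)) m" using P.eq_diff'[OF P.eq_imp_ge[OF e1] e3] .
  then show "P.eq (\<phi> $ 2) m" by simp
  have "orb.\<mu> (Suc 0) = m + 1" using D(2) mu by simp
  then show "P.vord (inverse_lax x y (i - 1) *v \<phi>) (m + 1)"
    using orb.\<mu>[of "Suc 0"] by (simp add: v1)
qed

lemma zero_simple_type:
  assumes z: "P mf_z = 1" and k: "P mf_k < 0" and even: "even n"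
  shows "P.ge (\<phi> $ 1) (m + 1) \<and> P.eq (\<phi> $ 2) m \<and> P.ge (\<phi> $ 3) (m + 1) \<and>
      P.vord (inverse_lax x y (i - 1) *v \<phi>) (m + 1) \<and>
      P.ge (eigenvalue * mf_z ^ q - mf_const ((- 1) ^ q * (1 / alt_prod q x i))) 1
    \<or> P.eq (\<phi> $ 1) m \<and> P.ge (\<phi> $ 3) (m + 1) \<and>
      P.vord (inverse_lax x y (i - 1) *v \<phi>) m \<and>
      P.ge (eigenvalue * mf_z ^ q - mf_const ((- 1) ^ q * (1 / alt_prod q x (i + 1)))) 1"
proof -
  obtain \<kappa> where \<kappa>: "R dvd eigenvalue * \<kappa> - 1" using inverse_eigenvalue .
  have z': "P mf_z > 0" using z by simp
  define v where "v m = dual_basis (backward x y i \<phi> m)" for m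
  have v: "v = (\<lambda>m. dual_basis (backward x y i \<phi> m))" by (simp add: v_def fun_eq_iff)
  have v0: "v 0 $ 1 = - \<phi> $ 1" "v 0 $ 2 = - (\<phi> $ 1 + \<phi> $ 3)" "v 0 $ 3 = \<phi> $ 1 - \<phi> $ 2"
    by (simp_all add: v_def dual_basis_def)
  have v1: "P.vord (v 0) l \<longleftrightarrow> P.vord \<phi> l" "P.vord (v (Suc 0)) l \<longleftrightarrow> P.vord (inverse_lax x y (i - 1) *v \<phi>) l" for l
    by (simp_all add: v_def P.vord_dual_basis)
  interpret orb: lax_orbit R P mf_z \<kappa> "P mf_z" "- P mf_k" v
    "\<lambda>m. y (i + 1 - int m)" "\<lambda>m. x (i + 1 - int m)" n
    unfolding v using P.place_axioms z' \<phi> phi_nonzero n0 \<kappa> by (rule orbit_zero)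
  have k': "- P mf_k > 0" using k by simp
  have mu: "orb.\<mu> 0 = m" using m by (intro orb.\<mu>_eqI) (simp add: v1)
  have zz: "mf_zinv * mf_z = 1" using mf_z_mult_zinv by (simp add: mult.commute)
  have prod: "(\<Prod>l<n div 2. - x (i + 1 - int (j + 2 * l + 1))) = (- 1) ^ q * alt_prod q x (i - int j)" for j
  proof -
    have "(\<Prod>l<n div 2. - x (i + 1 - int (j + 2 * l + 1))) = (- 1) ^ q * (\<Prod>l<q. x (i + 1 - int (j + 2 * l + 1)))"
      unfolding q_def by (rule prod_uminus)
    also have "(\<Prod>l<q. x (i + 1 - int (j + 2 * l + 1))) = (\<Prod>l<q. x ((i - int j) - 2 * int l))"
      by (rule prod.cong) (simp_all add: algebra_simps)
    also have "\<dots> = alt_prod q x (i - int j - 2 * (int q - 1))" by (rule alt_prod_backwards)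
    also have "\<dots> = alt_prod q x (i - int j)" unfolding alt_prod_x[OF even] by simp
    finally show ?thesis .
  qed
  have lim: "P.ge (eigenvalue * mf_z ^ q - mf_const ((- 1) ^ q * (1 / alt_prod q x (i - int j)))) 1"
    if A: "orb.stA j" for j
  proof -
    \<comment> \<open>The backward orbit yields the limit of \<open>\<kappa> * mf_zinv ^ q\<close>,
      the inverse of the function in question; the desired limit is the reciprocal of
      \<open>c\<close>.\<close>
    define c where "c = (- 1) ^ q * alt_prod q x (i - int j)"
    have c0: "c \<noteq> 0" using nonzero(1) by (simp add: c_def alt_prod_def)
    let ?h = "eigenvalue * mf_z ^ q" and ?g = "\<kappa> * mf_zinv ^ q"
    have 1: "P.ge (?g - mf_const c) 1"
      using orb.simple_limit[OF k' z A zz] unfolding prod unfolding c_def q_def .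
    have zq: "mf_z ^ q * mf_zinv ^ q = 1" by (simp flip: power_mult_distrib add: mf_z_mult_zinv)
    have "?h * ?g = (mf_z ^ q * mf_zinv ^ q) * (eigenvalue * \<kappa>)" by (simp only: mult_ac)
    then have "?h * ?g = eigenvalue * \<kappa>" unfolding zq by simp
    then have hg: "R dvd ?h * ?g - 1" using \<kappa> by (simp only:)
    have "P.eq (mf_const c + (?g - mf_const c)) 0" using c0 1 by (intro P.eq_add P.eq_const) simp_all
    then have g: "P.eq ?g 0" by simp
    have "P.eq ?h 0"
    proof (rule P.eq_mult_cancel[OF g])
      show "P.eq (?g * ?h) (0 + 0)" using P.eq_cong[OF hg, of 0] by (simp add: mult.commute)
    qed
    then have "P.ge (mf_const (1 / c) * (?h * (?g - mf_const c))) (0 + 1)"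
      by (intro P.ge_const_mult P.ge_mult 1 P.eq_imp_ge)
    moreover have "P.ge (mf_const (1 / c) * (?h * ?g - 1)) 1"
      by (intro P.ge_const_mult P.ge_dvd hg)
    ultimately have "P.ge (mf_const (1 / c) * (?h * ?g - 1) - mf_const (1 / c) * (?h * (?g - mf_const c))) 1"
      by (intro P.ge_diff) simp_all
    also have "mf_const (1 / c) * (?h * ?g - 1) - mf_const (1 / c) * (?h * (?g - mf_const c))
        = (mf_const (1 / c) * mf_const c) * ?h - mf_const (1 / c)"
      by (simp only: algebra_simps mult_1_right) simp
    also have "mf_const (1 / c) * mf_const c = 1" using c0 by (simp flip: mf_const_mult)
    finally have "P.ge (?h - mf_const (1 / c)) 1" by simp
    moreover have "1 / c = (- 1) ^ q * (1 / alt_prod q x (i - int j))"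
      by (cases "even q") (simp_all add: c_def)
    ultimately show ?thesis by simp
  qed
  show ?thesis
  proof (cases "orb.stA 0")
    case True
    have "orb.\<mu> (Suc 0) = m + 1" using orb.simple_stA(2)[OF k' z True] mu by simp
    then have vo: "P.vord (inverse_lax x y (i - 1) *v \<phi>) (m + 1)"
      using orb.\<mu>[of "Suc 0"] by (simp add: v1)
    have "P.ge (- (\<phi> $ 1)) (m + 1)" "P.ge (- (\<phi> $ 1 + \<phi> $ 3)) (m + 1)"
      using True unfolding orb.stA_def mu v0 by simp_all
    then have g: "P.ge (\<phi> $ 1) (m + 1)" "P.ge (\<phi> $ 1 + \<phi> $ 3) (m + 1)" using P.ge_minus_iff by blast+
    have g3: "P.ge (\<phi> $ 3) (m + 1)" using P.ge_diff[OF g(2,1)] by simp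
    have e3: "P.eq (\<phi> $ 1 - \<phi> $ 2) m" using orb.stA_third[OF True] by (simp add: mu v0)
    have "P.eq (\<phi> $ 1 - (\<phi> $ 1 - \<phi> $ 2)) m" using P.eq_diff'[OF g(1) e3] .
    then have "P.eq (\<phi> $ 2) m" by simp
    with vo g g3 lim[OF True] show ?thesis by simp
  next
    case False
    note B = orb.stB_if_not_stA[OF k' False]
    have "orb.\<mu> (Suc 0) = m" using B(3) mu by simp
    then have vo: "P.vord (inverse_lax x y (i - 1) *v \<phi>) m"
      using orb.\<mu>[of "Suc 0"] by (simp add: v1)
    have "P.eq (- (\<phi> $ 1)) m" and g3: "P.ge (\<phi> $ 3) (m + 1)"
      using B(1) unfolding orb.stB_def mu v0 by simp_all
    then have e1: "P.eq (\<phi> $ 1) m" using P.eq_minus_iff by blast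
    have "alt_prod q x (i - int (Suc 0)) = alt_prod q x (i + 1)" unfolding alt_prod_x[OF even] by simp
    with vo e1 g3 lim[OF B(2)] show ?thesis by simp
  qed
qed

end

end

section \<open>Jumps of the order at the marked points\<close>

text \<open>After the first entry is subtracted from the second, the image consists, up to constant
  factors, of \<open>u1 + u3\<close>, \<open>u2 - c u1\<close> and \<open>z u2\<close>, where
  \<open>c\<close> is \<open>1 - x (i + 2) * y (i + 2)\<close>. Jumps can be read off from the
  orders of these three.\<close>

lemma evolution_matrix_apply:
  "(evolution_matrix x y i *v u) $ 1 = mf_const (1 - x (i + 2) * y (i + 2)) * (u $ 1 + u $ 3)"
  "(evolution_matrix x y i *v u) $ 2 - (evolution_matrix x y i *v u) $ 1
    = mf_const (1 - x (i + 1) * y (i + 1)) * (u $ 2 - mf_const (1 - x (i + 2) * y (i + 2)) * u $ 1)"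
  "(evolution_matrix x y i *v u) $ 3 = mf_const (- y (i + 2) * (1 - x (i + 3) * y (i + 3))) * (mf_z * u $ 2)"
proof -
  define X where "X j = x (i + j) * y (i + j)" for j
  have E: "evolution_matrix x y i = vector
     [vector [mf_const (1 - X 2), 0, mf_const (1 - X 2)],
      vector [mf_const (X 1 * (1 - X 2)), mf_const (1 - X 1), mf_const (1 - X 2)],
      vector [0, - (mf_const (y (i + 2) * (1 - X 3)) * mf_z), 0]]"
    by (simp add: evolution_matrix_def Let_def X_def)
  have 1: "(evolution_matrix x y i *v u) $ 1 = mf_const (1 - X 2) * (u $ 1 + u $ 3)"
    unfolding E by (simp add: matrix_vector_mult_def sum_3 distrib_left)
  have 2: "(evolution_matrix x y i *v u) $ 2
      = mf_const (X 1 * (1 - X 2)) * u $ 1 + mf_const (1 - X 1) * u $ 2 + mf_const (1 - X 2) * u $ 3"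
    unfolding E by (simp add: matrix_vector_mult_def sum_3)
  have 3: "(evolution_matrix x y i *v u) $ 3 = - (mf_const (y (i + 2) * (1 - X 3)) * mf_z) * u $ 2"
    unfolding E by (simp add: matrix_vector_mult_def sum_3)
  show "(evolution_matrix x y i *v u) $ 1 = mf_const (1 - x (i + 2) * y (i + 2)) * (u $ 1 + u $ 3)"
    using 1 by (simp only: X_def)
  show "(evolution_matrix x y i *v u) $ 2 - (evolution_matrix x y i *v u) $ 1
    = mf_const (1 - x (i + 1) * y (i + 1)) * (u $ 2 - mf_const (1 - x (i + 2) * y (i + 2)) * u $ 1)"
    unfolding 1 2 X_def[symmetric] by (simp only: mf_const_mult mf_const_diff mf_const_1 mult_1_left mult_1_right algebra_simps)
  show "(evolution_matrix x y i *v u) $ 3 = mf_const (- y (i + 2) * (1 - x (i + 3) * y (i + 3))) * (mf_z * u $ 2)"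
    unfolding 3 X_def by (simp add: mf_const_uminus mult.assoc)
qed

context place
begin

lemma ge_evolution_iff:
  assumes "\<And>j. 1 - x j * y j \<noteq> 0" "\<And>j. y j \<noteq> 0"
  shows "(\<forall>j. ge ((evolution_matrix x y i *v u) $ j) l) \<longleftrightarrow>
    ge (u $ 1 + u $ 3) l \<and> ge (mf_z * u $ 2) l \<and> ge (u $ 2 - mf_const (1 - x (i + 2) * y (i + 2)) * u $ 1) l"
proof -
  let ?w = "evolution_matrix x y i *v u"
  have c: "- y (i + 2) * (1 - x (i + 3) * y (i + 3)) \<noteq> 0"
    using assms(1)[of "i + 3"] assms(2)[of "i + 2"] by simp
  have 1: "ge (?w $ 1) l \<longleftrightarrow> ge (u $ 1 + u $ 3) l"
    unfolding evolution_matrix_apply(1) by (rule ge_const_mult_iff[OF assms(1)])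
  have 2: "ge (?w $ 2 - ?w $ 1) l \<longleftrightarrow> ge (u $ 2 - mf_const (1 - x (i + 2) * y (i + 2)) * u $ 1) l"
    unfolding evolution_matrix_apply(2) by (rule ge_const_mult_iff[OF assms(1)])
  have 3: "ge (?w $ 3) l \<longleftrightarrow> ge (mf_z * u $ 2) l"
    unfolding evolution_matrix_apply(3) by (rule ge_const_mult_iff[OF c])
  have "ge (?w $ 1) l \<Longrightarrow> ge (?w $ 2) l \<longleftrightarrow> ge (?w $ 2 - ?w $ 1) l"
    using ge_diff[of "?w $ 2" l "?w $ 1"] ge_add[of "?w $ 2 - ?w $ 1" l "?w $ 1"] by auto
  then show ?thesis unfolding forall_3 1[symmetric] 2[symmetric] 3[symmetric] by blast
qed

lemma vord_maximalI:
  assumes "\<And>j. ge (u $ j) m" "\<And>l. (\<And>j. ge (u $ j) l) \<Longrightarrow> l \<le> m"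
  shows "vord u m"
  using assms(1) assms(2)[of "m + 1"] by (auto simp: vord_def)

end

context marked_curve
begin

text \<open>Where \<open>z\<close> is a unit, both the Lax matrix and its inverse have entries
  without poles.\<close>

lemma vord_lax_finite:
  assumes P: "curve_point R P" and z: "P mf_z = 0" and m: "place.vord R P \<phi> m"
  shows "place.vord R P (lax_matrix mf_const mf_zinv x y i *v \<phi>) m"
proof -
  interpret P: place R P using P by (rule placeI)
  let ?L = "lax_matrix mf_const mf_zinv x y i"
  have z0: "P.ge mf_z 0" "P.ge mf_zinv 0" using z P.z_zinv by (simp_all add: order_ge_def)
  have cge: "P.ge (mf_const c * f) l" if "P.ge f l" for c f l using that by (rule P.ge_const_mult)
  have zge: "P.ge (mf_z * f) l" "P.ge (mf_zinv * f) l" if "P.ge f l" for f l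
    using P.ge_mult[OF z0(1) that] P.ge_mult[OF z0(2) that] by simp_all
  have fwd: "P.ge ((?L *v u) $ j) l" if u: "\<And>j. P.ge (u $ j) l" for u l j
  proof -
    have "P.ge ((?L *v u) $ 1) l" unfolding lax_matrix_apply(1) by (intro cge P.ge_diff u)
    moreover have "P.ge ((?L *v u) $ 2) l" unfolding lax_matrix_apply(2) by (intro zge P.ge_add u)
    moreover have "P.ge ((?L *v u) $ 3) l" unfolding lax_matrix_apply(3) mf_const_uminus[symmetric] by (intro cge u)
    ultimately show ?thesis using exhaust_3[of j] by auto
  qed
  have bwd: "P.ge ((inverse_lax x y i *v u) $ j) l" if u: "\<And>j. P.ge (u $ j) l" for u l j
  proof -
    have "P.ge ((inverse_lax x y i *v u) $ 1) l" unfolding inverse_lax_apply(1) mf_const_uminus[symmetric]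
      by (intro cge u)
    moreover have "P.ge ((inverse_lax x y i *v u) $ 2) l" unfolding inverse_lax_apply(2) mf_const_uminus[symmetric]
      by (intro cge P.ge_diff u)
    moreover have "P.ge ((inverse_lax x y i *v u) $ 3) l" unfolding inverse_lax_apply(3)
      by (intro cge zge P.ge_add u)
    ultimately show ?thesis using exhaust_3[of j] by auto
  qed
  have SL: "inverse_lax x y i *v (?L *v \<phi>) = \<phi>"
    using inverse_lax(2)[of x i y] nonzero by (simp add: matrix_vector_mul_assoc)
  show ?thesis
  proof (rule P.vord_maximalI)
    show "P.ge ((?L *v \<phi>) $ j) m" for j using P.vordD[OF m] by (rule fwd)
    fix l assume "\<And>j. P.ge ((?L *v \<phi>) $ j) l"
    then have "P.ge (\<phi> $ j) l" for j using bwd[of "?L *v \<phi>" l j] SL by simp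
    then show "l \<le> m" by (rule P.vord_le[OF m])
  qed
qed

text \<open>Over \<open>z = 0\<close> the type lemmas describe the inverse matrices, so the jump is
  computed backwards, starting from the image.\<close>

lemma vord_unlax:
  assumes P: "curve_point R P" and m: "place.vord R P \<phi> m"
    and j: "\<And>l. place.vord R P (lax_matrix mf_const mf_zinv x y i *v \<phi>) l \<Longrightarrow>
      place.vord R P (inverse_lax x y i *v (lax_matrix mf_const mf_zinv x y i *v \<phi>)) (l + d)"
  shows "place.vord R P (lax_matrix mf_const mf_zinv x y i *v \<phi>) (m - d)"
proof -
  interpret P: place R P using P by (rule placeI)
  let ?L = "lax_matrix mf_const mf_zinv x y i"
  have SL: "inverse_lax x y i *v (?L *v \<phi>) = \<phi>"
    using inverse_lax(2)[of x i y] nonzero by (simp add: matrix_vector_mul_assoc)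
  have "\<exists>j. \<not> R dvd (?L *v \<phi>) $ j"
  proof (rule ccontr)
    assume "\<not> ?thesis"
    then have d: "R dvd (?L *v \<phi>) $ j" for j by blast
    have "R dvd (inverse_lax x y i *v (?L *v \<phi>)) $ j" for j using d by (rule dvd_matrix_vector_mult)
    then show False using m P.ge_dvd unfolding SL P.vord_def by blast
  qed
  then obtain l where l: "P.vord (?L *v \<phi>) l" using P.ex_vord by blast
  have "m = l + d" using P.vord_unique[OF m] j[OF l] unfolding SL by blast
  then show ?thesis using l by simp
qed

lemma lax_jump_odd:
  assumes P: "curve_point R P" and \<phi>: "eigenvector i \<phi>" and m: "place.vord R P \<phi> m" and odd: "odd n"
  shows "place.vord R P (lax_matrix mf_const mf_zinv x y i *v \<phi>) (m + (point_div W2 P - point_div O2 P))"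
proof -
  have ne: "W1 \<noteq> W2" "W1 \<noteq> O2" "O1 \<noteq> O2" "O1 \<noteq> W2" "W2 \<noteq> O2" using marked' by auto
  have \<phi>': "eigenvector (i + 1) (lax_matrix mf_const mf_zinv x y i *v \<phi>)" using \<phi> by (rule eigenvector_lax)
  consider "P = W1" | "P = W2" | "P = O1" | "P = O2" | "P mf_z = 0" "P \<noteq> W2" "P \<noteq> O2"
    using infinity_odd(3)[OF odd P] zero_odd(3)[OF odd P] marked' by (cases "P mf_z" "0 :: int" rule: linorder_cases) auto
  then show ?thesis
  proof cases
    case 1
    then show ?thesis using infinity_W1_type(4)[OF P \<phi> m] marked' ne by (simp add: point_div_def)
  next
    case 2
    then show ?thesis using infinity_double_type(4)[OF P \<phi> m] infinity_odd(2)[OF odd] marked' odd ne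
      by (simp add: point_div_def)
  next
    case 3
    have "place.vord R P (lax_matrix mf_const mf_zinv x y i *v \<phi>) (m - 0)"
      by (rule vord_unlax[OF P m]) (use zero_O1_type(4)[OF P \<phi>'] 3 marked' O1_k in simp)
    then show ?thesis using 3 ne by (simp add: point_div_def)
  next
    case 4
    have "place.vord R P (lax_matrix mf_const mf_zinv x y i *v \<phi>) (m - 1)"
      by (rule vord_unlax[OF P m]) (use zero_double_type(4)[OF P \<phi>'] 4 marked' zero_odd(2)[OF odd] odd in simp)
    then show ?thesis using 4 ne by (simp add: point_div_def)
  next
    case 5
    then show ?thesis using vord_lax_finite[OF P 5(1) m] by (simp add: point_div_def)
  qed
qed

text \<open>Used in the contrapositive: it rules out the alternative of
  \<open>infinity_simple_type\<close> whose product has the wrong parity.\<close>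

lemma W2_limit:
  assumes "even n" "order_ge R W2 (eigenvalue * mf_z ^ q - mf_const ((- 1) ^ q * alt_prod q y p)) 1"
  shows "even p"
proof -
  have "(- 1) ^ q * alt_prod q y p = (- 1) ^ q * (\<Prod>j | j < n \<and> even j. y (int j))"
    using assms(2) limits(3)[OF assms(1)] unique_limit placeI marked'(10) by metis
  then show ?thesis using distinct_products(2)[OF assms(1)] unfolding alt_prod_y[OF assms(1)] by (auto split: if_splits)
qed

lemma W3_limit:
  assumes "even n" "order_ge R W3 (eigenvalue * mf_z ^ q - mf_const ((- 1) ^ q * alt_prod q y p)) 1"
  shows "odd p"
proof -
  have "(- 1) ^ q * alt_prod q y p = (- 1) ^ q * (\<Prod>j | j < n \<and> odd j. y (int j))"
    using assms limits(4)[OF assms(1)] unique_limit placeI marked'(16) by metis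
  then show ?thesis using distinct_products(2)[OF assms(1)] unfolding alt_prod_y[OF assms(1)] by (auto split: if_splits)
qed

lemma O2_limit:
  assumes "even n" "order_ge R O2 (eigenvalue * mf_z ^ q - mf_const ((- 1) ^ q * (1 / alt_prod q x p))) 1"
  shows "odd p"
proof -
  have "(- 1) ^ q * (1 / alt_prod q x p) = (- 1) ^ q * (\<Prod>j | j < n \<and> odd j. 1 / x (int j))"
    using assms(2) limits(1)[OF assms(1)] unique_limit placeI marked'(4) by metis
  then show ?thesis using distinct_products(1)[OF assms(1)] unfolding alt_prod_x[OF assms(1)] x_prod_inverse
    by (auto split: if_splits)
qed

lemma O3_limit:
  assumes "even n" "order_ge R O3 (eigenvalue * mf_z ^ q - mf_const ((- 1) ^ q * (1 / alt_prod q x p))) 1"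
  shows "even p"
proof -
  have "(- 1) ^ q * (1 / alt_prod q x p) = (- 1) ^ q * (\<Prod>j | j < n \<and> even j. 1 / x (int j))"
    using assms limits(2)[OF assms(1)] unique_limit placeI marked'(13) by metis
  then show ?thesis using distinct_products(1)[OF assms(1)] unfolding alt_prod_x[OF assms(1)] x_prod_inverse
    by (auto split: if_splits)
qed

text \<open>Over infinity the order rises where \<open>stA\<close> holds; over zero it drops where
  the backward orbit starting at the image is in \<open>stA\<close>. Both alternate with
  \<open>i\<close>, and the limits fix which point has its turn.\<close>

lemma lax_jump_even:
  assumes P: "curve_point R P" and \<phi>: "eigenvector i \<phi>" and m: "place.vord R P \<phi> m" and ev: "even n"
  shows "place.vord R P (lax_matrix mf_const mf_zinv x y i *v \<phi>)
    (m + (if even i then point_div W3 P - point_div O2 P else point_div W2 P - point_div O3 P))"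
proof -
  have ne: "W1 \<noteq> W2" "W1 \<noteq> O2" "O1 \<noteq> O2" "O1 \<noteq> W2" "W2 \<noteq> O2" "W1 \<noteq> W3" "W1 \<noteq> O3" "O1 \<noteq> O3"
    "O1 \<noteq> W3" "W2 \<noteq> O3" "W3 \<noteq> O2" "W3 \<noteq> O3" using marked' ev by auto
  have \<phi>': "eigenvector (i + 1) (lax_matrix mf_const mf_zinv x y i *v \<phi>)" using \<phi> by (rule eigenvector_lax)
  consider "P = W1" | "P = W2" | "P = W3" | "P = O1" | "P = O2" | "P = O3"
    | "P mf_z = 0" "P \<noteq> W2" "P \<noteq> W3" "P \<noteq> O2" "P \<noteq> O3"
    using infinity_even(4)[OF ev P] zero_even(4)[OF ev P] marked' ev
    by (cases "P mf_z" "0 :: int" rule: linorder_cases) auto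
  then show ?thesis
  proof cases
    case 1
    then show ?thesis using infinity_W1_type(4)[OF P \<phi> m] marked' ne by (simp add: point_div_def)
  next
    case 2
    have "place.vord R P (lax_matrix mf_const mf_zinv x y i *v \<phi>) (m + (if even i then 0 else 1))"
      using infinity_simple_type[OF P \<phi> m _ _ ev] infinity_even(2)[OF ev] marked'(12) W2_limit[OF ev, of i]
        W2_limit[OF ev, of "i + 1"] unfolding 2 by auto
    then show ?thesis using 2 ne W2_W3[OF ev] by (simp add: point_div_def split: if_splits)
  next
    case 3
    have "place.vord R P (lax_matrix mf_const mf_zinv x y i *v \<phi>) (m + (if even i then 1 else 0))"
      using infinity_simple_type[OF P \<phi> m _ _ ev] infinity_even(3)[OF ev] marked'(18)[OF ev] W3_limit[OF ev, of i]
        W3_limit[OF ev, of "i + 1"] unfolding 3 by auto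
    then show ?thesis using 3 ne W2_W3[OF ev] by (simp add: point_div_def split: if_splits)
  next
    case 4
    have "place.vord R P (lax_matrix mf_const mf_zinv x y i *v \<phi>) (m - 0)"
      by (rule vord_unlax[OF P m]) (use zero_O1_type(4)[OF P \<phi>'] 4 marked' O1_k in simp)
    then show ?thesis using 4 ne by (simp add: point_div_def)
  next
    case 5
    have "place.vord R P (lax_matrix mf_const mf_zinv x y i *v \<phi>) (m - (if even i then 1 else 0))"
    proof (rule vord_unlax[OF P m])
      fix l assume l: "place.vord R P (lax_matrix mf_const mf_zinv x y i *v \<phi>) l"
      show "place.vord R P (inverse_lax x y i *v (lax_matrix mf_const mf_zinv x y i *v \<phi>)) (l + (if even i then 1 else 0))"
        using zero_simple_type[OF P \<phi>' l _ _ ev] zero_even(2)[OF ev] marked'(6) O2_limit[OF ev, of "i + 1"]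
          O2_limit[OF ev, of "i + 1 + 1"] unfolding 5 by auto
    qed
    then show ?thesis using 5 ne O2_O3[OF ev] by (simp add: point_div_def split: if_splits)
  next
    case 6
    have "place.vord R P (lax_matrix mf_const mf_zinv x y i *v \<phi>) (m - (if even i then 0 else 1))"
    proof (rule vord_unlax[OF P m])
      fix l assume l: "place.vord R P (lax_matrix mf_const mf_zinv x y i *v \<phi>) l"
      show "place.vord R P (inverse_lax x y i *v (lax_matrix mf_const mf_zinv x y i *v \<phi>)) (l + (if even i then 0 else 1))"
        using zero_simple_type[OF P \<phi>' l _ _ ev] zero_even(3)[OF ev] marked'(15)[OF ev] O3_limit[OF ev, of "i + 1"]
          O3_limit[OF ev, of "i + 1 + 1"] unfolding 6 by auto
    qed
    then show ?thesis using 6 ne O2_O3[OF ev] by (simp add: point_div_def split: if_splits)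
  next
    case 7
    then show ?thesis using vord_lax_finite[OF P 7(1) m] by (simp add: point_div_def)
  qed
qed

text \<open>All three combinations of \<open>ge_evolution_iff\<close> gain an order at
  \<open>O1\<close> only, and only at \<open>W2\<close> is the pole of \<open>z\<close> not
  compensated by a small second entry.\<close>

lemma evolution_jump:
  assumes P: "curve_point R P" and \<phi>: "eigenvector 0 \<phi>" and m: "place.vord R P \<phi> m"
    and X: "\<And>j. 1 - x j * y j \<noteq> 0"
  shows "place.vord R P (evolution_matrix x y 0 *v \<phi>) (m + (point_div O1 P - point_div W2 P))"
proof -
  interpret P: place R P using P by (rule placeI)
  define c where "c = 1 - x 2 * y 2"
  have c: "c \<noteq> 0" using X by (simp add: c_def)
  have iff: "P.vord (evolution_matrix x y 0 *v \<phi>) l \<longleftrightarrow>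
      (P.ge (\<phi> $ 1 + \<phi> $ 3) l \<and> P.ge (mf_z * \<phi> $ 2) l \<and> P.ge (\<phi> $ 2 - mf_const c * \<phi> $ 1) l) \<and>
      \<not> (P.ge (\<phi> $ 1 + \<phi> $ 3) (l + 1) \<and> P.ge (mf_z * \<phi> $ 2) (l + 1) \<and> P.ge (\<phi> $ 2 - mf_const c * \<phi> $ 1) (l + 1))" for l
    unfolding P.vord_def P.ge_evolution_iff[OF X nonzero(2)] c_def by simp
  have z: "P.eq mf_z (P mf_z)" by (rule P.eq_order[OF P.z_not_dvd])
  have g: "P.ge (\<phi> $ j) m" for j using m by (rule P.vordD)
  have zg: "P.ge (mf_z * f) (P mf_z + l)" if "P.ge f l" for f l using P.ge_mult[OF P.eq_imp_ge[OF z] that] .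
  have ze: "P.eq (mf_z * f) (P mf_z + l)" if "P.eq f l" for f l using P.eq_mult[OF z that] .
  have g3: "P.ge (\<phi> $ 2 - mf_const c * \<phi> $ 1) m" by (intro P.ge_diff P.ge_const_mult g)
  have g1: "P.ge (\<phi> $ 1 + \<phi> $ 3) m" by (intro P.ge_add g)
  have none: "P.vord (evolution_matrix x y 0 *v \<phi>) m"
    if "P.ge (mf_z * \<phi> $ 2) m" "P.eq (\<phi> $ 1 + \<phi> $ 3) m \<or> P.eq (\<phi> $ 2 - mf_const c * \<phi> $ 1) m"
    unfolding iff using that g1 g3 P.eq_not_ge[of "\<phi> $ 1 + \<phi> $ 3" m "m + 1"]
      P.eq_not_ge[of "\<phi> $ 2 - mf_const c * \<phi> $ 1" m "m + 1"] by auto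
  have pole: "P.vord (evolution_matrix x y 0 *v \<phi>) (m - 1)" if "P.eq (mf_z * \<phi> $ 2) (m - 1)"
    unfolding iff using that P.ge_mono[OF g1, of "m - 1"] P.ge_mono[OF g3, of "m - 1"] P.eq_imp_ge[OF that]
      P.eq_not_ge[OF that, of "m - 1 + 1"] by auto
  have ne: "W1 \<noteq> O1" "W2 \<noteq> O1" "O2 \<noteq> O1" "W1 \<noteq> W2" "O2 \<noteq> W2" using marked' by auto
  have ne': "W3 \<noteq> O1" "W3 \<noteq> W2" "O3 \<noteq> O1" "O3 \<noteq> W2" if "even n" using marked' that W2_W3 by auto
  consider "P = W1" | "P = W2" "odd n" | "P = W2" "even n" | "P = W3" "even n" | "P = O1" | "P = O2" "odd n"
    | "P = O2 \<or> P = O3" "even n" | "P mf_z = 0" "P \<noteq> W2" "P \<noteq> O1"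
    using infinity_even(4)[OF _ P] zero_even(4)[OF _ P] infinity_odd(3)[OF _ P] zero_odd(3)[OF _ P] marked'(2,11)
    by (cases "P mf_z" "0 :: int" rule: linorder_cases; cases "even n") auto
  then show ?thesis
  proof cases
    case 1
    note T = infinity_W1_type[OF P \<phi> m]
    have zW: "P mf_z = - 1" using 1 infinity_even(1) infinity_odd(1) by blast
    have "P mf_z < 0" "P mf_k = 0" using 1 marked' by simp_all
    note T = T[OF this]
    \<comment> \<open>At \<open>W1\<close> the third entry is to leading order
      \<open>- x 1 * y 1\<close> times the first, so the leading coefficient of
      \<open>u1 + u3\<close> contains the factor \<open>1 - x 1 * y 1\<close>, which is nonzero
      where the pentagram map is defined.\<close>
    have "P.eq (mf_const (1 - x 1 * y 1) * \<phi> $ 1) m" by (rule P.eq_const_mult[OF X T(1)])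
    then have "P.eq (mf_const (1 - x 1 * y 1) * \<phi> $ 1 + (\<phi> $ 3 + mf_const (x 1 * y 1) * \<phi> $ 1)) m"
      using T(3) by (intro P.eq_add) simp_all
    also have "mf_const (1 - x 1 * y 1) * \<phi> $ 1 + (\<phi> $ 3 + mf_const (x 1 * y 1) * \<phi> $ 1) = \<phi> $ 1 + \<phi> $ 3"
      by (simp add: mf_const_diff left_diff_distrib)
    finally have "P.eq (\<phi> $ 1 + \<phi> $ 3) m" .
    then show ?thesis using none zg[OF T(2)] zW 1 ne by (simp add: point_div_def)
  next
    case 2
    have zW: "P mf_z = - 2" "P mf_k > 0" using 2 infinity_odd(2) marked' by simp_all
    note T = infinity_double_type[OF P \<phi> m zW 2(2)]
    have "P.eq (\<phi> $ 1 - (\<phi> $ 1 - \<phi> $ 2)) (m + 1)" using P.eq_diff[OF T(2), of "\<phi> $ 1 - \<phi> $ 2"] T(3) by (simp add: add.assoc)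
    then have "P.eq (\<phi> $ 2) (m + 1)" by simp
    from ze[OF this] have "P.eq (mf_z * \<phi> $ 2) (m - 1)" using zW by simp
    then show ?thesis using pole 2 ne by (simp add: point_div_def)
  next
    case 3
    have zW: "P mf_z = - 1" "P mf_k > 0" using 3 infinity_even(2) marked' by simp_all
    \<comment> \<open>At index 0 the limit at \<open>W2\<close> excludes \<open>stA\<close>. In
      \<open>stB\<close> the second entry has the full order, and multiplication by \<open>z\<close>
      produces a pole.\<close>
    have "P.eq (\<phi> $ 1) m \<and> P.ge (\<phi> $ 1 - \<phi> $ 2) (m + 1)"
      using infinity_simple_type[OF P \<phi> m zW 3(2)] W2_limit[OF 3(2), of "0 + 1"] unfolding 3 by auto
    then have "P.eq (\<phi> $ 1 - (\<phi> $ 1 - \<phi> $ 2)) m" by (intro P.eq_diff) simp_all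
    then have "P.eq (\<phi> $ 2) m" by simp
    from ze[OF this] have "P.eq (mf_z * \<phi> $ 2) (m - 1)" using zW by simp
    then show ?thesis using pole 3 ne by (simp add: point_div_def)
  next
    case 4
    have zW: "P mf_z = - 1" "P mf_k > 0" using 4 infinity_even(3) marked' by simp_all
    \<comment> \<open>At \<open>W3\<close> the limit excludes \<open>stB\<close> instead; in
      \<open>stA\<close> the second entry is small and absorbs the pole of \<open>z\<close>.\<close>
    have T: "P.ge (\<phi> $ 1) (m + 1)" "P.ge (\<phi> $ 2) (m + 1)" "P.eq (\<phi> $ 3) m"
      using infinity_simple_type[OF P \<phi> m zW 4(2)] W3_limit[OF 4(2), of 0] unfolding 4 by auto
    have "P.eq (\<phi> $ 1 + \<phi> $ 3) m" by (rule P.eq_add'[OF T(1,3)])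
    then show ?thesis using none zg[OF T(2)] zW 4 ne'[OF 4(2)] by (simp add: point_div_def)
  next
    case 5
    have zO: "P mf_z = 1" using 5 zero_even(1) zero_odd(1) by blast
    have "P mf_z > 0" "P mf_k = 0" using 5 marked' O1_k by simp_all
    note T = zero_O1_type[OF P \<phi> m this]
    \<comment> \<open>The constant in the second row of the evolution matrix matches the leading
      terms at \<open>O1\<close>: both \<open>u1 + u3\<close> and \<open>u2 - c u1\<close> gain an
      order, and \<open>z u2\<close> gains exactly one from \<open>z\<close>.\<close>
    have "\<phi> $ 2 - mf_const c * \<phi> $ 1 = - (\<phi> $ 1 - \<phi> $ 2 - mf_const (x (0 + 2) * y (0 + 2)) * \<phi> $ 1)"
      by (simp add: c_def mf_const_diff left_diff_distrib)
    then have t3: "P.ge (\<phi> $ 2 - mf_const c * \<phi> $ 1) (m + 1)" using T(3) P.ge_minus_iff by metis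
    have "P.eq (mf_const c * \<phi> $ 1 + (\<phi> $ 2 - mf_const c * \<phi> $ 1)) m"
      by (rule P.eq_add[OF P.eq_const_mult[OF c T(1)] t3])
    then have "P.eq (\<phi> $ 2) m" by simp
    from ze[OF this] have e: "P.eq (mf_z * \<phi> $ 2) (m + 1)" using zO by (simp add: add.commute)
    have "P.vord (evolution_matrix x y 0 *v \<phi>) (m + 1)"
      unfolding iff using T(2) t3 P.eq_imp_ge[OF e] P.eq_not_ge[OF e, of "m + 1 + 1"] by auto
    then show ?thesis using 5 ne by (simp add: point_div_def)
  next
    case 6
    have zO: "P mf_z = 2" "P mf_k < 0" using 6 zero_odd(2) marked' by simp_all
    note T = zero_double_type[OF P \<phi> m zO 6(2)]
    have "P.eq (\<phi> $ 2 - mf_const c * \<phi> $ 1) m"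
      by (rule P.eq_diff[OF T(1) P.eq_imp_ge[OF P.eq_const_mult[OF c T(2)]]])
    moreover have "P.ge (mf_z * \<phi> $ 2) m" using P.ge_mono[OF zg[OF g], of m 2] zO by simp
    ultimately show ?thesis using none 6 ne by (simp add: point_div_def)
  next
    case 7
    have zO: "P mf_z = 1" "P mf_k < 0" using 7 zero_even(2,3) marked' by auto
    have "P.eq (\<phi> $ 2) m \<and> P.ge (\<phi> $ 1) (m + 1) \<or> P.eq (\<phi> $ 1) m \<and> P.ge (\<phi> $ 3) (m + 1)"
      using zero_simple_type[OF P \<phi> m zO 7(2)] by blast
    then have "P.eq (\<phi> $ 1 + \<phi> $ 3) m \<or> P.eq (\<phi> $ 2 - mf_const c * \<phi> $ 1) m"
    proof
      assume a: "P.eq (\<phi> $ 2) m \<and> P.ge (\<phi> $ 1) (m + 1)"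
      have "P.eq (\<phi> $ 2 - mf_const c * \<phi> $ 1) m"
        by (rule P.eq_diff[OF conjunct1[OF a] P.ge_const_mult[OF conjunct2[OF a]]])
      then show ?thesis ..
    next
      assume a: "P.eq (\<phi> $ 1) m \<and> P.ge (\<phi> $ 3) (m + 1)"
      have "P.eq (\<phi> $ 1 + \<phi> $ 3) m" by (rule P.eq_add[OF conjunct1[OF a] conjunct2[OF a]])
      then show ?thesis ..
    qed
    moreover have "P.ge (mf_z * \<phi> $ 2) m" using P.ge_mono[OF zg[OF g], of m 2] zO by simp
    ultimately show ?thesis using none 7 ne ne'[OF 7(2)] by (auto simp: point_div_def)
  next
    case 8
    have z2: "P.ge (mf_z * \<phi> $ 2) l \<longleftrightarrow> P.ge (\<phi> $ 2) l" for l
      using P.ge_mult_iff[OF z, of "\<phi> $ 2" l] 8(1) by simp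
    have "P.vord (evolution_matrix x y 0 *v \<phi>) m"
      unfolding iff
    proof (intro conjI notI)
      assume "P.ge (\<phi> $ 1 + \<phi> $ 3) (m + 1) \<and> P.ge (mf_z * \<phi> $ 2) (m + 1) \<and> P.ge (\<phi> $ 2 - mf_const c * \<phi> $ 1) (m + 1)"
      then have a: "P.ge (\<phi> $ 1 + \<phi> $ 3) (m + 1)" "P.ge (\<phi> $ 2) (m + 1)" "P.ge (\<phi> $ 2 - mf_const c * \<phi> $ 1) (m + 1)"
        using z2 by blast+
      have "P.ge (mf_const c * \<phi> $ 1) (m + 1)" using P.ge_diff[OF a(2,3)] by simp
      then have 1: "P.ge (\<phi> $ 1) (m + 1)" using P.ge_const_mult_iff[OF c] by blast
      have "P.ge (\<phi> $ 3) (m + 1)" using P.ge_diff[OF a(1) 1] by simp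
      with 1 a(2) have "\<forall>j. P.ge (\<phi> $ j) (m + 1)" by (simp add: forall_3)
      then show False using m by (simp add: P.vord_def)
    qed (use g1 g3 z2 g in blast)+
    then show ?thesis using 8 by (simp add: point_div_def)
  qed
qed

end

section \<open>The Riemann--Roch space of the pole divisor\<close>

text \<open>Induction on the degree of the denominator: a root at 0 is absorbed into the power of
  \<open>z\<close>; any other root is, by regularity, also a root of the numerator and
  cancels.\<close>

lemma regular_away_from_zero:
  assumes "q \<noteq> 0" "\<And>a. a \<noteq> 0 \<Longrightarrow> regular_at a (Fract p q)"
  shows "\<exists>N p'. Fract p q * fz ^ N = to_fract p'"
  using assms
proof (induction "degree q" arbitrary: p q rule: less_induct)
  case less
  show ?case
  proof (cases "degree q = 0")
    case True
    then obtain c where q: "q = [:c:]" by (rule degree_eq_zeroE)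
    with less.prems have c: "c \<noteq> 0" by simp
    have "Fract p q = to_fract (smult (1 / c) p)" unfolding to_fract_def q using c by (simp add: eq_fract)
    then have "Fract p q * fz ^ 0 = to_fract (smult (1 / c) p)" by simp
    then show ?thesis by blast
  next
    case False
    then have "\<not> constant (poly q)" by (simp add: constant_degree)
    then obtain a where a: "poly q a = 0" using fundamental_theorem_of_algebra by blast
    then have "[:- a, 1:] dvd q" by (simp only: poly_eq_0_iff_dvd)
    then obtain q1 where q1: "q = [:- a, 1:] * q1" by (rule dvdE)
    have q10: "q1 \<noteq> 0" using less.prems(1) q1 by auto
    have deg: "degree q1 < degree q" unfolding q1 using q10 by (subst degree_mult_eq) auto
    show ?thesis
    proof (cases "a = 0")
      case True
      have e: "Fract p q1 = Fract p q * fz"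
        using less.prems(1) q10 by (simp add: fz_def to_fract_def q1 True eq_fract)
      have "regular_at b (Fract p q1)" if "b \<noteq> 0" for b
        unfolding e fz_def by (intro regular_at_mult less.prems(2) that regular_at_to_fract)
      then obtain N p' where "Fract p q1 * fz ^ N = to_fract p'" using less.hyps[OF deg q10] by blast
      then have "Fract p q * fz ^ Suc N = to_fract p'" unfolding e by (simp add: mult_ac)
      then show ?thesis by blast
    next
      case False
      obtain p' q' where pq: "Fract p q = Fract p' q'" and q': "poly q' a \<noteq> 0"
        using less.prems(2)[OF False] unfolding regular_at_def by blast
      have "q' \<noteq> 0" using q' by auto
      then have "p * q' = p' * q" using less.prems(1) pq by (simp add: eq_fract)
      then have "poly (p * q') a = poly (p' * q) a" by simp
      then have "poly p a = 0" using a q' by simp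
      then have "[:- a, 1:] dvd p" by (simp only: poly_eq_0_iff_dvd)
      then obtain p1 where p1: "p = [:- a, 1:] * p1" by (rule dvdE)
      have e: "Fract p q = Fract p1 q1" unfolding p1 q1 by (rule mult_fract_cancel) simp
      show ?thesis using less.hyps[OF deg q10, of p1] less.prems(2) unfolding e by blast
    qed
  qed
qed

lemma laurent_vector:
  fixes c :: "complex poly fract ^ 3"
  assumes "\<And>a j. a \<noteq> 0 \<Longrightarrow> regular_at a (c $ j)"
  shows "\<exists>N p. \<forall>j. c $ j * fz ^ N = to_fract (p j)"
proof -
  have "\<exists>N p. c $ j * fz ^ N = to_fract p" for j
  proof (cases "c $ j" rule: Fract_cases)
    case (Fract p q)
    then show ?thesis using regular_away_from_zero[of q p] assms[of _ j] by simp
  qed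
  then obtain N p where Np: "\<And>j. c $ j * fz ^ N j = to_fract (p j)" by metis
  define M where "M = N 1 + N 2 + N 3"
  have le: "N j \<le> M" for j using exhaust_3[of j] by (auto simp: M_def)
  have "c $ j * fz ^ M = to_fract (p j * [:0, 1:] ^ (M - N j))" for j
  proof -
    have "fz ^ M = fz ^ N j * fz ^ (M - N j)" using le[of j] by (simp flip: power_add)
    moreover have "to_fract ([:0, 1:] ^ k) = fz ^ k" for k
      by (induction k) (simp_all only: power.simps to_fract_mult fz_def to_fract_1)
    ultimately show ?thesis using Np[of j] by (simp add: mult.assoc[symmetric])
  qed
  then show ?thesis by (intro exI[of _ M] exI[of _ "\<lambda>j. p j * [:0, 1:] ^ (M - N j)"]) blast
qed

lemma regular_lax_product:
  assumes "a \<noteq> 0"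
  shows "regular_at a (lax_product fconst (inverse fz) x y i m $ r $ s)"
proof (induction m arbitrary: r s)
  case 0
  have "regular_at a 1" using regular_at_fconst[of a 1] by (simp add: fconst_def)
  then show ?case by (simp add: mat_def regular_at_0)
next
  case (Suc m)
  have um: "regular_at a (- fconst c)" for c using regular_at_fconst[of a "- c"] by (simp add: fconst_def to_fract_def)
  have "regular_at a (lax_matrix fconst (inverse fz) x y j $ r $ s)" for j r s
    using exhaust_3[of r] exhaust_3[of s] assms
    by (auto simp: lax_matrix_def regular_at_0 regular_at_fconst um regular_at_inverse_fz)
  then show ?case unfolding lax_product.simps matrix_matrix_mult_def
    by (simp add: regular_at_sum regular_at_mult Suc.IH)
qed

lemma row_apply_add_row: "row_apply (r + s) \<phi> = row_apply r \<phi> + row_apply s \<phi>"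
  by (simp add: row_apply_def mf_rat_add distrib_right sum.distrib)

lemma row_apply_diff_row: "row_apply (r - s) \<phi> = row_apply r \<phi> - row_apply s \<phi>"
  by (simp add: row_apply_def mf_rat_diff left_diff_distrib sum_subtractf)

lemma row_apply_smult_row: "row_apply (k *s r) \<phi> = mf_rat k * row_apply r \<phi>"
  by (simp add: row_apply_def mf_rat_mult mult.assoc sum_distrib_left)

lemma row_apply_3:
  "row_apply r \<phi> = mf_rat (r $ 1) * \<phi> $ 1 + mf_rat (r $ 2) * \<phi> $ 2 + mf_rat (r $ 3) * \<phi> $ 3"
  by (simp add: row_apply_def sum_3)

definition combination :: "complex ^ 3 \<Rightarrow> mfun ^ 3 \<Rightarrow> mfun" where
  "combination \<gamma> \<phi> = mf_const (\<gamma> $ 1) * \<phi> $ 1 + mf_const (\<gamma> $ 2) * \<phi> $ 2 + mf_const (\<gamma> $ 3) * \<phi> $ 3"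

text \<open>Three distinct parameters on the moment curve give a Vandermonde system; if all three
  combinations had larger order, so would every component.\<close>

lemma (in place) finite_degenerate_combinations:
  assumes m: "vord \<phi> m"
  shows "finite {t. ge (combination (vector [1, t, t ^ 2]) \<phi>) (m + 1)}"
proof (rule ccontr)
  define B where "B = {t. ge (combination (vector [1, t, t ^ 2]) \<phi>) (m + 1)}"
  assume "\<not> ?thesis"
  then have B: "infinite B" by (simp add: B_def)
  then obtain t1 where t1: "t1 \<in> B" using infinite_imp_nonempty by blast
  have "infinite (B - {t1})" using B by simp
  then obtain t2 where t2: "t2 \<in> B - {t1}" using infinite_imp_nonempty by blast
  have "infinite (B - {t1, t2})" using B by simp
  then obtain t3 where t3: "t3 \<in> B - {t1, t2}" using infinite_imp_nonempty by blast
  have two: "ge (\<phi> $ 2 + mf_const (s + t) * \<phi> $ 3) (m + 1)" if "s \<in> B" "t \<in> B" "s \<noteq> t" for s t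
  proof -
    have "combination (vector [1, s, s ^ 2]) \<phi> - combination (vector [1, t, t ^ 2]) \<phi>
        = mf_const (s - t) * (\<phi> $ 2 + mf_const (s + t) * \<phi> $ 3)"
      by (simp add: combination_def mf_const_diff mf_const_add mf_const_mult power2_eq_square, simp only: algebra_simps) simp
    moreover have "ge (combination (vector [1, s, s ^ 2]) \<phi> - combination (vector [1, t, t ^ 2]) \<phi>) (m + 1)"
      using that by (intro ge_diff) (simp_all add: B_def)
    ultimately have "ge (mf_const (s - t) * (\<phi> $ 2 + mf_const (s + t) * \<phi> $ 3)) (m + 1)" by simp
    then show ?thesis using ge_const_mult_iff[of "s - t"] that(3) by simp
  qed
  have t23: "t2 - t3 \<noteq> 0" using t3 by auto
  have 12: "ge (\<phi> $ 2 + mf_const (t1 + t2) * \<phi> $ 3) (m + 1)" and 13: "ge (\<phi> $ 2 + mf_const (t1 + t3) * \<phi> $ 3) (m + 1)"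
    using t1 t2 t3 by (auto intro!: two)
  have "(\<phi> $ 2 + mf_const (t1 + t2) * \<phi> $ 3) - (\<phi> $ 2 + mf_const (t1 + t3) * \<phi> $ 3) = mf_const (t2 - t3) * \<phi> $ 3"
    by (simp add: mf_const_diff mf_const_add) (simp only: algebra_simps)
  then have "ge (mf_const (t2 - t3) * \<phi> $ 3) (m + 1)" using ge_diff[OF 12 13] by simp
  then have g3: "ge (\<phi> $ 3) (m + 1)" using ge_const_mult_iff[OF t23] by blast
  have g2: "ge (\<phi> $ 2) (m + 1)" using ge_diff[OF 12 ge_const_mult[OF g3, of "t1 + t2"]] by simp
  have "ge (combination (vector [1, t1, t1 ^ 2]) \<phi>) (m + 1)" using t1 by (simp add: B_def)
  then have "ge (\<phi> $ 1 + (mf_const t1 * \<phi> $ 2 + mf_const (t1 ^ 2) * \<phi> $ 3)) (m + 1)"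
    by (simp add: combination_def add.assoc)
  from ge_diff[OF this ge_add[OF ge_const_mult[OF g2] ge_const_mult[OF g3]], of t1 "t1 ^ 2"]
  have "ge (\<phi> $ 1) (m + 1)" by simp
  then show False using m g2 g3 by (simp add: vord_def forall_3)
qed

lemma (in place) ge_combination: "vord \<phi> m \<Longrightarrow> ge (combination \<gamma> \<phi>) m"
  unfolding combination_def by (intro ge_add ge_const_mult vordD)

context spectral_curve
begin

lemma in_powers_row_apply:
  assumes "eigenvector i \<phi>"
  defines "F \<equiv> fmonodromy n x y i"
  shows "R dvd in_powers r * row_apply s \<phi>
    - row_apply (r $ 1 *s s + r $ 2 *s (s v* F) + r $ 3 *s ((s v* F) v* F)) \<phi>"
proof -
  define s0 where "s0 = row_apply s \<phi>"
  define s1 where "s1 = row_apply (s v* F) \<phi>"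
  define s2 where "s2 = row_apply ((s v* F) v* F) \<phi>"
  have 1: "R dvd s1 - eigenvalue * s0" and 2: "R dvd s2 - eigenvalue * s1"
    unfolding s0_def s1_def s2_def F_def by (rule eigenvector_row_apply[OF assms(1)])+
  have "in_powers r * s0 - (mf_rat (r $ 1) * s0 + mf_rat (r $ 2) * s1 + mf_rat (r $ 3) * s2)
      = - (mf_rat (r $ 2) * (s1 - eigenvalue * s0) + mf_rat (r $ 3) * ((s2 - eigenvalue * s1) + eigenvalue * (s1 - eigenvalue * s0)))"
    by (simp add: in_powers_def power2_eq_square algebra_simps)
  also have "R dvd \<dots>" unfolding dvd_minus_iff
    by (rule dvd_add[OF dvd_mult[OF 1] dvd_mult[OF dvd_add[OF 2 dvd_mult[OF 1]]]])
  finally show ?thesis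
    unfolding row_apply_add_row row_apply_smult_row s0_def s1_def s2_def .
qed

text \<open>The components add up to 1, so their least order is at most 0; therefore neither the 0
  inserted in \<open>pole_divisor\<close> nor the dummy order of a zero component distorts the
  maximum.\<close>

lemma vord_normalized:
  assumes \<phi>: "normalized i \<phi>" and P: "curve_point R P"
  shows "place.vord R P \<phi> (- pole_divisor R \<phi> P)" "pole_divisor R \<phi> P \<ge> 0"
proof -
  interpret P: place R P using P by (rule placeI)
  have "\<exists>j. \<not> R dvd \<phi> $ j" using normalized_sum_not_dvd[OF \<phi>] by (meson dvd_sum)
  then obtain m where m: "P.vord \<phi> m" using P.ex_vord by blast
  have le: "m \<le> 0"
  proof (rule P.eq_not_ge)
    have "R dvd 1 - (\<Sum>j\<in>UNIV. \<phi> $ j)" using \<phi> by (simp add: normalized_def dvd_diff_commute)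
    moreover have "P.ge (\<Sum>j\<in>UNIV. \<phi> $ j) m" using P.vordD[OF m] by (intro P.ge_sum)
    ultimately show "P.ge 1 m" using P.ge_cong by blast
    show "P.eq 1 0" using P.eq_const[of 1] by simp
  qed
  have "Max (insert 0 (range (\<lambda>j. - P (\<phi> $ j)))) = - m"
  proof (rule Max_eqI)
    fix k assume "k \<in> insert 0 (range (\<lambda>j. - P (\<phi> $ j)))"
    then consider "k = 0" | j where "k = - P (\<phi> $ j)" by auto
    then show "k \<le> - m"
    proof cases
      case 2
      then show ?thesis using P.vordD[OF m, of j] P.dvd_zero[of "\<phi> $ j"] le by (auto simp: order_ge_def)
    qed (use le in simp)
  next
    obtain j where "\<not> P.ge (\<phi> $ j) (m + 1)" using m by (auto simp: P.vord_def)
    then have "P (\<phi> $ j) = m" using P.vordD[OF m, of j] by (auto simp: order_ge_def)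
    then show "- m \<in> insert 0 (range (\<lambda>j. - P (\<phi> $ j)))" by auto
  qed simp
  then show "place.vord R P \<phi> (- pole_divisor R \<phi> P)" "pole_divisor R \<phi> P \<ge> 0"
    using m le P by (simp_all add: pole_divisor_def)
qed

lemma is_divisor_pole_divisor: "is_divisor R (pole_divisor R \<phi>)"
proof -
  have "{P. pole_divisor R \<phi> P \<noteq> 0} \<subseteq> (\<Union>j. {P. curve_point R P \<and> P (\<phi> $ j) < 0})"
  proof
    fix P assume "P \<in> {P. pole_divisor R \<phi> P \<noteq> 0}"
    then have P: "curve_point R P" and M: "Max (insert 0 (range (\<lambda>j. - P (\<phi> $ j)))) \<noteq> 0"
      by (auto simp: pole_divisor_def split: if_splits)
    let ?M = "Max (insert 0 (range (\<lambda>j. - P (\<phi> $ j))))"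
    have "?M \<in> insert 0 (range (\<lambda>j. - P (\<phi> $ j)))"
      by (rule Max_in) simp_all
    with M obtain j where j: "?M = - P (\<phi> $ j)" by blast
    have "?M \<ge> 0" by (rule Max_ge) simp_all
    with M j have "P (\<phi> $ j) < 0" by linarith
    then show "P \<in> (\<Union>j. {P. curve_point R P \<and> P (\<phi> $ j) < 0})" using P by blast
  qed
  moreover have "finite (\<Union>j. {P. curve_point R P \<and> P (\<phi> $ j) < 0})"
    by (intro finite_UN_I finite_poles) simp
  ultimately have "finite {P. pole_divisor R \<phi> P \<noteq> 0}" by (rule finite_subset)
  then show ?thesis by (auto simp: is_divisor_def pole_divisor_def)
qed

end

section \<open>Functions whose poles are bounded by the pole divisor\<close>

context marked_curve
begin

abbreviation "D \<equiv> pole_divisor R \<psi>"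

lemma eigenvector_\<psi>: "eigenvector 0 \<psi>"
  using \<psi> by (simp add: normalized_def)

lemma vord_\<psi>: "curve_point R P \<Longrightarrow> place.vord R P \<psi> (- D P)"
  by (rule vord_normalized[OF \<psi>])

lemma combination_not_dvd:
  assumes "R dvd combination \<gamma> \<psi>"
  shows "\<gamma> = 0"
proof -
  have "row_apply (\<chi> j. fconst (\<gamma> $ j)) \<psi> = combination \<gamma> \<psi>"
    by (simp add: row_apply_3 combination_def mf_const_conv_mf_rat)
  then have "(\<chi> j. fconst (\<gamma> $ j)) = 0" using normalized_independent[OF \<psi>] assms by simp
  then show ?thesis by (simp add: vec_eq_iff fconst_def)
qed

text \<open>A generic constant combination \<open>\<theta>\<close> of the components has order
  exactly \<open>- D P\<close> at all points over \<open>a\<close>. Then \<open>f / \<theta>\<close>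
  is integral there and has regular coefficients in powers of the eigenvalue; multiplying by
  \<open>\<theta>\<close> turns these powers into powers of the monodromy, which is regular at
  \<open>a\<close>.\<close>

lemma regular_coefficients:
  assumes f: "\<And>P. curve_point R P \<Longrightarrow> order_ge R P f (- D P)" and c: "R dvd f - row_apply c \<psi>" and a: "a \<noteq> 0"
  shows "regular_at a (c $ j)"
proof -
  define S where "S = {P. curve_point R P \<and> order_ge R P (mf_z - mf_const a) 1}"
  have za: "\<not> R dvd mf_z - mf_const a"
    by (rule z_parameter_not_dvd) (auto simp: z_parameter_def)
  have "S \<subseteq> {P. curve_point R P \<and> P (mf_z - mf_const a) > 0}" using za by (auto simp: S_def order_ge_def)
  then have fS: "finite S" using finite_zeros[OF za] finite_subset by blast
  \<comment> \<open>The parameters for which \<open>\<theta>\<close> loses order at some point over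
    \<open>a\<close>; the fibre is finite, and each of its points excludes finitely many.\<close>
  define T where "T = (\<Union>P\<in>S. {t. order_ge R P (combination (vector [1, t, t ^ 2]) \<psi>) (- D P + 1)})"
  have "finite T" unfolding T_def
    by (intro finite_UN_I fS place.finite_degenerate_combinations vord_\<psi> placeI) (simp_all add: S_def)
  then obtain t where t: "t \<notin> T" using infinite_UNIV_char_0 by (metis UNIV_I finite_subset subsetI)
  define \<theta> where "\<theta> = combination (vector [1, t, t ^ 2]) \<psi>"
  have \<theta>: "\<not> R dvd \<theta>" unfolding \<theta>_def using combination_not_dvd[of "vector [1, t, t ^ 2]"]
    by (auto simp: vec_eq_iff forall_3)
  then obtain h where h: "R dvd \<theta> * h - 1" using inverse_mod_R by blast
  obtain r where r: "R dvd f * h - in_powers r" using in_powers_surj by blast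
  have reg: "regular_at a (r $ j)" for j
  proof (rule regular_in_powers[OF a r])
    fix P assume P: "curve_point R P" "order_ge R P (mf_z - mf_const a) 1"
    interpret P: place R P using P(1) by (rule placeI)
    have "t \<notin> {t. P.ge (combination (vector [1, t, t ^ 2]) \<psi>) (- D P + 1)}" using t P by (auto simp: T_def S_def)
    then have "P.eq \<theta> (- D P)"
      unfolding \<theta>_def using P.ge_combination[OF vord_\<psi>[OF P(1)]] by (intro P.eqI) auto
    then have "P.eq h (- (- D P))" using h by (rule P.eq_inverse)
    from P.ge_mult[OF f[OF P(1)] P.eq_imp_ge[OF this]] show "P.ge (f * h) 0" by simp
  qed
  define F where "F = fmonodromy n x y 0"
  define s :: "complex poly fract ^ 3" where "s = vector [1, fconst t, fconst (t ^ 2)]"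
  have s\<theta>: "row_apply s \<psi> = \<theta>"
    by (simp add: s_def \<theta>_def combination_def row_apply_3 flip: mf_const_conv_mf_rat)
  define s' where "s' = r $ 1 *s s + r $ 2 *s (s v* F) + r $ 3 *s ((s v* F) v* F)"
  have s': "R dvd in_powers r * \<theta> - row_apply s' \<psi>"
    using in_powers_row_apply[OF eigenvector_\<psi>, of r s] unfolding s\<theta> s'_def F_def .
  have "row_apply (c - s') \<psi> = (in_powers r * \<theta> - row_apply s' \<psi>) - (f - row_apply c \<psi>)
      + (f * h - in_powers r) * \<theta> - f * (\<theta> * h - 1)"
    by (simp add: row_apply_diff_row algebra_simps)
  also have "R dvd \<dots>"
    by (rule dvd_diff[OF dvd_add[OF dvd_diff[OF s' c] dvd_mult2[OF r]] dvd_mult[OF h]])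
  finally have "c - s' = 0" by (rule normalized_independent[OF \<psi>])
  then have c: "c = s'" by simp
  have regF: "regular_at a (F $ k $ l)" for k l
    unfolding F_def fmonodromy_def by (rule regular_lax_product[OF a])
  have regv: "regular_at a ((v v* F) $ k)" if "\<And>l. regular_at a (v $ l)" for v k
    unfolding vector_matrix_mult_def using that by (simp add: regular_at_sum regular_at_mult regF)
  have f1: "fconst 1 = 1" by (simp add: fconst_def)
  have regs: "regular_at a (s $ k)" for k
    using exhaust_3[of k] regular_at_fconst[of a 1] f1
    by (auto simp: s_def regular_at_fconst)
  show ?thesis unfolding c s'_def
    by (simp add: regular_at_add regular_at_mult reg regs regv)
qed

text \<open>The leading terms over \<open>z = 0\<close> are triangular. At \<open>O3\<close> only
  the second component counts, then at \<open>O2\<close> only the first, and at \<open>O1\<close>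
  the third remains; for odd \<open>n\<close> two successive orders at the double point
  \<open>O2\<close> replace the first two conditions.\<close>

lemma zero_leading:
  assumes g: "\<And>P. curve_point R P \<Longrightarrow> P mf_z > 0 \<Longrightarrow> order_ge R P (combination \<gamma> \<psi>) (- D P + P mf_z)"
  shows "\<gamma> = 0"
proof -
  have 2: "\<gamma> $ 2 = 0 \<and> \<gamma> $ 1 = 0"
  proof (cases "even n")
    case True
    have "\<gamma> $ 2 = 0"
    proof (rule ccontr)
      assume n0: "\<gamma> $ 2 \<noteq> 0"
      have P: "curve_point R O3" "O3 mf_z = 1" "O3 mf_k < 0" using marked' zero_even True by auto
      interpret P: place R O3 using P(1) by (rule placeI)
      have t: "P.ge (\<psi> $ 1) (- D O3 + 1) \<and> P.eq (\<psi> $ 2) (- D O3) \<and> P.ge (\<psi> $ 3) (- D O3 + 1)"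
        using zero_simple_type[OF P(1) eigenvector_\<psi> vord_\<psi>[OF P(1)] P(2,3) True] O3_limit[OF True, of "0 + 1"]
        by auto
      have "P.eq (combination \<gamma> \<psi>) (- D O3)"
        unfolding combination_def using t n0 by (intro P.eq_add[OF P.eq_add'] P.ge_const_mult P.eq_const_mult) auto
      from P.eq_not_ge[OF this g[OF P(1)]] show False using P(2) by simp
    qed
    moreover have "\<gamma> $ 1 = 0"
    proof (rule ccontr)
      assume n0: "\<gamma> $ 1 \<noteq> 0"
      have P: "curve_point R O2" "O2 mf_z = 1" "O2 mf_k < 0" using marked' zero_even True by auto
      interpret P: place R O2 using P(1) by (rule placeI)
      have t: "P.eq (\<psi> $ 1) (- D O2) \<and> P.ge (\<psi> $ 3) (- D O2 + 1)"
        using zero_simple_type[OF P(1) eigenvector_\<psi> vord_\<psi>[OF P(1)] P(2,3) True] O2_limit[OF True, of 0]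
        by auto
      have "P.eq (mf_const (\<gamma> $ 1) * \<psi> $ 1 + mf_const (\<gamma> $ 3) * \<psi> $ 3) (- D O2)"
        using t n0 by (intro P.eq_add P.ge_const_mult P.eq_const_mult) auto
      then have "P.eq (combination \<gamma> \<psi>) (- D O2)"
        unfolding combination_def using \<open>\<gamma> $ 2 = 0\<close> by simp
      from P.eq_not_ge[OF this g[OF P(1)]] show False using P(2) by simp
    qed
    ultimately show ?thesis by simp
  next
    case False
    have P: "curve_point R O2" "O2 mf_z = 2" "O2 mf_k < 0" using marked' zero_odd False by auto
    interpret P: place R O2 using P(1) by (rule placeI)
    note t = zero_double_type[OF P(1) eigenvector_\<psi> vord_\<psi>[OF P(1)] P(2,3) False]
    have gO: "P.ge (combination \<gamma> \<psi>) (- D O2 + 2)" using g[OF P(1)] P(2) by simp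
    have "\<gamma> $ 2 = 0"
    proof (rule ccontr)
      assume n0: "\<gamma> $ 2 \<noteq> 0"
      have t3: "P.ge (\<psi> $ 3) (- D O2 + 1)" by (rule P.ge_mono[OF t(3)]) simp
      have "P.eq (combination \<gamma> \<psi>) (- D O2)"
        unfolding combination_def
        by (intro P.eq_add[OF P.eq_add'] P.ge_const_mult P.eq_const_mult n0 t(1) t3 P.eq_imp_ge[OF t(2)])
      from P.eq_not_ge[OF this gO] show False by simp
    qed
    moreover have "\<gamma> $ 1 = 0"
    proof (rule ccontr)
      assume n0: "\<gamma> $ 1 \<noteq> 0"
      have t3: "P.ge (\<psi> $ 3) (- D O2 + 1 + 1)" using t(3) by (simp add: add.assoc)
      have "P.eq (mf_const (\<gamma> $ 1) * \<psi> $ 1 + mf_const (\<gamma> $ 3) * \<psi> $ 3) (- D O2 + 1)"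
        by (intro P.eq_add P.ge_const_mult P.eq_const_mult n0 t(2) t3)
      then have "P.eq (combination \<gamma> \<psi>) (- D O2 + 1)"
        unfolding combination_def using \<open>\<gamma> $ 2 = 0\<close> by simp
      from P.eq_not_ge[OF this gO] show False by simp
    qed
    ultimately show ?thesis by simp
  qed
  have "\<gamma> $ 3 = 0"
  proof (rule ccontr)
    assume n0: "\<gamma> $ 3 \<noteq> 0"
    have P: "curve_point R O1" "O1 mf_z > 0" "O1 mf_k = 0" using marked' O1_k by auto
    have z1: "O1 mf_z = 1" using zero_even(1) zero_odd(1) by blast
    interpret P: place R O1 using P(1) by (rule placeI)
    note t = zero_O1_type[OF P(1) eigenvector_\<psi> vord_\<psi>[OF P(1)] P(2,3)]
    have "P.eq ((\<psi> $ 1 + \<psi> $ 3) - \<psi> $ 1) (- D O1)" by (rule P.eq_diff'[OF t(2,1)])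
    then have "P.eq (\<psi> $ 3) (- D O1)" by simp
    then have "P.eq (combination \<gamma> \<psi>) (- D O1)"
      unfolding combination_def using 2 P.eq_const_mult[OF n0] by simp
    from P.eq_not_ge[OF this g[OF P(1,2)]] show False using z1 by simp
  qed
  with 2 show ?thesis by (simp add: vec_eq_iff forall_3)
qed

text \<open>Triangular again: \<open>W3\<close> gives the coefficient of the third component,
  \<open>W2\<close>, where the first two components agree to leading order, the sum of their
  coefficients, and \<open>W1\<close> the first one. For odd \<open>n\<close> the double point
  \<open>W2\<close> supplies two conditions.\<close>

lemma infinity_leading:
  assumes g: "\<And>P. curve_point R P \<Longrightarrow> P mf_z < 0 \<Longrightarrow> order_ge R P (combination \<gamma> \<psi>) (- D P - P mf_z)"
  shows "\<gamma> = 0"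
proof -
  have 3: "\<gamma> $ 3 = 0 \<and> \<gamma> $ 1 + \<gamma> $ 2 = 0"
  proof (cases "even n")
    case True
    have "\<gamma> $ 3 = 0"
    proof (rule ccontr)
      assume n0: "\<gamma> $ 3 \<noteq> 0"
      have P: "curve_point R W3" "W3 mf_z = - 1" "W3 mf_k > 0" using marked' infinity_even True by auto
      interpret P: place R W3 using P(1) by (rule placeI)
      have t: "P.ge (\<psi> $ 1) (- D W3 + 1) \<and> P.ge (\<psi> $ 2) (- D W3 + 1) \<and> P.eq (\<psi> $ 3) (- D W3)"
        using infinity_simple_type[OF P(1) eigenvector_\<psi> vord_\<psi>[OF P(1)] P(2,3) True] W3_limit[OF True, of 0]
        by auto
      have "P.eq (combination \<gamma> \<psi>) (- D W3)"
        unfolding combination_def using t n0 by (intro P.eq_add' P.ge_add P.ge_const_mult P.eq_const_mult) auto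
      from P.eq_not_ge[OF this g[OF P(1)]] show False using P(2) by simp
    qed
    moreover have "\<gamma> $ 1 + \<gamma> $ 2 = 0"
    proof (rule ccontr)
      assume n0: "\<gamma> $ 1 + \<gamma> $ 2 \<noteq> 0"
      have P: "curve_point R W2" "W2 mf_z = - 1" "W2 mf_k > 0" using marked' infinity_even True by auto
      interpret P: place R W2 using P(1) by (rule placeI)
      have t: "P.eq (\<psi> $ 1) (- D W2) \<and> P.ge (\<psi> $ 1 - \<psi> $ 2) (- D W2 + 1)"
        using infinity_simple_type[OF P(1) eigenvector_\<psi> vord_\<psi>[OF P(1)] P(2,3) True] W2_limit[OF True, of "0 + 1"]
        by auto
      have "P.eq (mf_const (\<gamma> $ 1 + \<gamma> $ 2) * \<psi> $ 1 - mf_const (\<gamma> $ 2) * (\<psi> $ 1 - \<psi> $ 2)) (- D W2)"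
        using t n0 by (intro P.eq_diff P.ge_const_mult P.eq_const_mult) auto
      moreover have "mf_const (\<gamma> $ 1 + \<gamma> $ 2) * \<psi> $ 1 - mf_const (\<gamma> $ 2) * (\<psi> $ 1 - \<psi> $ 2) = combination \<gamma> \<psi>"
        using \<open>\<gamma> $ 3 = 0\<close> by (simp add: combination_def mf_const_add algebra_simps)
      ultimately have "P.eq (combination \<gamma> \<psi>) (- D W2)" by simp
      from P.eq_not_ge[OF this g[OF P(1)]] show False using P(2) by simp
    qed
    ultimately show ?thesis by simp
  next
    case False
    have P: "curve_point R W2" "W2 mf_z = - 2" "W2 mf_k > 0" using marked' infinity_odd False by auto
    interpret P: place R W2 using P(1) by (rule placeI)
    note t = infinity_double_type[OF P(1) eigenvector_\<psi> vord_\<psi>[OF P(1)] P(2,3) False]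
    have gO: "P.ge (combination \<gamma> \<psi>) (- D W2 + 2)" using g[OF P(1)] P(2) by simp
    have e: "mf_const (\<gamma> $ 1 + \<gamma> $ 2) * \<psi> $ 1 - mf_const (\<gamma> $ 2) * (\<psi> $ 1 - \<psi> $ 2) + mf_const (\<gamma> $ 3) * \<psi> $ 3
        = combination \<gamma> \<psi>"
      by (simp add: combination_def mf_const_add algebra_simps)
    have "\<gamma> $ 3 = 0"
    proof (rule ccontr)
      assume n0: "\<gamma> $ 3 \<noteq> 0"
      have t3: "P.ge (\<psi> $ 1 - \<psi> $ 2) (- D W2 + 1)" by (rule P.ge_mono[OF t(3)]) simp
      have "P.eq (combination \<gamma> \<psi>) (- D W2)"
        unfolding e[symmetric]
        by (intro P.eq_add' P.ge_diff P.ge_const_mult P.eq_const_mult n0 t(1) t3 P.eq_imp_ge[OF t(2)])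
      from P.eq_not_ge[OF this gO] show False by simp
    qed
    moreover have "\<gamma> $ 1 + \<gamma> $ 2 = 0"
    proof (rule ccontr)
      assume n0: "\<gamma> $ 1 + \<gamma> $ 2 \<noteq> 0"
      have t3: "P.ge (\<psi> $ 1 - \<psi> $ 2) (- D W2 + 1 + 1)" using t(3) by (simp add: add.assoc)
      have "P.eq (mf_const (\<gamma> $ 1 + \<gamma> $ 2) * \<psi> $ 1 - mf_const (\<gamma> $ 2) * (\<psi> $ 1 - \<psi> $ 2)) (- D W2 + 1)"
        by (intro P.eq_diff P.ge_const_mult P.eq_const_mult n0 t(2) t3)
      then have "P.eq (combination \<gamma> \<psi>) (- D W2 + 1)"
        unfolding e[symmetric] using \<open>\<gamma> $ 3 = 0\<close> by simp
      from P.eq_not_ge[OF this gO] show False by simp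
    qed
    ultimately show ?thesis by simp
  qed
  have "\<gamma> $ 1 = 0"
  proof (rule ccontr)
    assume n0: "\<gamma> $ 1 \<noteq> 0"
    have P: "curve_point R W1" "W1 mf_z < 0" "W1 mf_k = 0" using marked' by auto
    have z1: "W1 mf_z = - 1" using infinity_even(1) infinity_odd(1) by blast
    interpret P: place R W1 using P(1) by (rule placeI)
    note t = infinity_W1_type[OF P(1) eigenvector_\<psi> vord_\<psi>[OF P(1)] P(2,3)]
    have "P.eq (mf_const (\<gamma> $ 1) * \<psi> $ 1 + mf_const (\<gamma> $ 2) * \<psi> $ 2) (- D W1)"
      by (intro P.eq_add P.eq_const_mult P.ge_const_mult n0 t)
    then have "P.eq (combination \<gamma> \<psi>) (- D W1)"
      unfolding combination_def using 3 by simp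
    from P.eq_not_ge[OF this g[OF P(1,2)]] show False using z1 by simp
  qed
  with 3 show ?thesis by (simp add: vec_eq_iff forall_3)
qed

end

lemma mf_rat_fz_power: "mf_rat (fz ^ k) = mf_z ^ k"
  by (induction k) (simp_all add: mf_rat_mult mf_z_conv_mf_rat)

context marked_curve
begin

text \<open>Lowers the exponent \<open>N\<close> to 0. The values of the numerators at
  \<open>z = 0\<close> form a constant combination that differs from a positive power of
  \<open>z\<close> times \<open>f\<close> by a multiple of \<open>z\<close>; over
  \<open>z = 0\<close> it gains the full order of \<open>z\<close> and must be trivial, so
  \<open>z\<close> can be cancelled.\<close>

lemma polynomial_coefficients:
  assumes f: "\<And>P. curve_point R P \<Longrightarrow> order_ge R P f (- D P)" and c: "R dvd f - row_apply c \<psi>"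
    and p: "\<And>j. c $ j * fz ^ N = to_fract (p j)"
  shows "\<exists>p. \<forall>j. c $ j = to_fract (p j)"
  using p
proof (induction N arbitrary: p)
  case 0
  then show ?case by (intro exI[of _ p]) simp
next
  case (Suc N)
  have "\<exists>p'. p j = [:poly (p j) 0:] + [:0, 1:] * p'" for j
    by (rule poly_split_at[of "p j" 0, unfolded minus_zero])
  then obtain p' where p': "\<And>j. p j = [:poly (p j) 0:] + [:0, 1:] * p' j" by metis
  define \<gamma> :: "complex ^ 3" where "\<gamma> = (\<chi> j. poly (p j) 0)"
  have e: "mf_rat (c $ j) * mf_z ^ Suc N = mf_const (\<gamma> $ j) + mf_z * cpoly_at (p' j) mf_z" for j
  proof -
    have "mf_rat (c $ j) * mf_z ^ Suc N = mf_rat (c $ j * fz ^ Suc N)"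
      by (simp only: mf_rat_mult mf_rat_fz_power)
    also have "\<dots> = cpoly_at (p j) mf_z" unfolding Suc.prems cpoly_at_z ..
    also have "\<dots> = cpoly_at ([:poly (p j) 0:] + [:0, 1:] * p' j) mf_z" by (simp only: p'[symmetric])
    also have "\<dots> = mf_const (\<gamma> $ j) + mf_z * cpoly_at (p' j) mf_z"
      by (simp only: cpoly_at_add cpoly_at_mult) (simp add: \<gamma>_def)
    finally show ?thesis .
  qed
  define h where "h = cpoly_at (p' 1) mf_z * \<psi> $ 1 + cpoly_at (p' 2) mf_z * \<psi> $ 2 + cpoly_at (p' 3) mf_z * \<psi> $ 3"
  have "mf_z ^ Suc N * row_apply c \<psi> = (mf_rat (c $ 1) * mf_z ^ Suc N) * \<psi> $ 1
      + (mf_rat (c $ 2) * mf_z ^ Suc N) * \<psi> $ 2 + (mf_rat (c $ 3) * mf_z ^ Suc N) * \<psi> $ 3"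
    unfolding row_apply_3 by (simp only: algebra_simps)
  also have "\<dots> = combination \<gamma> \<psi> + mf_z * h"
    unfolding e h_def combination_def by (simp only: algebra_simps)
  finally have comb: "combination \<gamma> \<psi> = mf_z ^ Suc N * row_apply c \<psi> - mf_z * h" by simp
  have \<gamma>: "\<gamma> = 0"
  proof (rule zero_leading)
    fix P assume P: "curve_point R P" "P mf_z > 0"
    interpret P: place R P using P(1) by (rule placeI)
    have z: "P.ge mf_z (P mf_z)" and z0: "P.ge mf_z 0" using P(2) by (simp_all add: order_ge_def)
    have "P.ge (row_apply c \<psi>) (- D P)" using P.ge_cong[OF c] f[OF P(1)] by blast
    from P.ge_mult[OF P.ge_power[OF z] this]
    have "P.ge (mf_z ^ Suc N * row_apply c \<psi>) (int (Suc N) * P mf_z + - D P)" .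
    then have 1: "P.ge (mf_z ^ Suc N * row_apply c \<psi>) (- D P + P mf_z)"
      by (rule P.ge_mono) (use P(2) in \<open>simp add: distrib_right\<close>)
    have "P.ge (cpoly_at p mf_z * \<psi> $ j) (- D P)" for p j
      using P.ge_mult[OF P.ge_cpoly_at[OF z0] P.vordD[OF vord_\<psi>[OF P(1)]]] by simp
    then have "P.ge h (- D P)" unfolding h_def by (intro P.ge_add)
    from P.ge_mult[OF z this] have 2: "P.ge (mf_z * h) (- D P + P mf_z)" by (simp only: add.commute)
    show "P.ge (combination \<gamma> \<psi>) (- D P + P mf_z)" unfolding comb by (rule P.ge_diff[OF 1 2])
  qed
  have "c $ j * fz ^ N = to_fract (p' j)" for j
  proof -
    have p0: "poly (p j) 0 = 0" using \<gamma> by (simp add: \<gamma>_def vec_eq_iff)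
    have "p j = [:poly (p j) 0:] + [:0, 1:] * p' j" by (rule p')
    then have "p j = [:0:] + [:0, 1:] * p' j" unfolding p0 .
    then have "to_fract (p j) = fz * to_fract (p' j)" by (simp only: pCons_0_0 add_0_left to_fract_mult fz_def)
    then have "(c $ j * fz ^ N) * fz = to_fract (p' j) * fz" using Suc.prems[of j] by (simp add: mult_ac)
    moreover have "fz \<noteq> 0" by (simp add: fz_def)
    ultimately show ?thesis by simp
  qed
  then show ?case by (rule Suc.IH)
qed

text \<open>The same argument over \<open>z = \<infinity>\<close>: the coefficients of the top power
  of \<open>z\<close> form a constant combination that gains the full order of \<open>1/z\<close>,
  so the degree drops.\<close>

lemma constant_coefficients:
  assumes f: "\<And>P. curve_point R P \<Longrightarrow> order_ge R P f (- D P)" and c: "R dvd f - row_apply c \<psi>"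
    and p: "\<And>j. c $ j = to_fract (p j)" and deg: "\<And>j. degree (p j) \<le> M"
  shows "\<exists>\<gamma>. R dvd f - combination \<gamma> \<psi>"
  using deg
proof (induction M)
  case 0
  have "c $ j = fconst (coeff (p j) 0)" for j
  proof -
    have "degree (p j) = 0" using 0[of j] by simp
    then obtain k where "p j = [:k:]" by (rule degree_eq_zeroE)
    then show ?thesis using p[of j] by (simp add: fconst_def)
  qed
  then have "row_apply c \<psi> = combination (\<chi> j. coeff (p j) 0) \<psi>"
    by (simp add: row_apply_3 combination_def mf_const_conv_mf_rat)
  with c show ?case by (intro exI[of _ "\<chi> j. coeff (p j) 0"]) simp
next
  case (Suc M)
  define \<gamma> :: "complex ^ 3" where "\<gamma> = (\<chi> j. coeff (p j) (Suc M))"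
  \<comment> \<open>The part of lower degree after division by \<open>z ^ (M + 1)\<close>, with one
    factor \<open>1/z\<close> split off.\<close>
  define g where "g j = (\<Sum>l\<le>M. mf_const (coeff (p j) l) * mf_zinv ^ (M - l))" for j
  have e: "mf_zinv ^ Suc M * mf_rat (c $ j) = mf_const (\<gamma> $ j) + mf_zinv * g j" for j
  proof -
    have zz: "mf_zinv ^ Suc M * mf_z ^ l = mf_zinv ^ (Suc M - l)" if "l \<le> Suc M" for l
    proof -
      have "mf_zinv ^ Suc M = mf_zinv ^ (Suc M - l) * mf_zinv ^ l" using that by (simp only: power_add[symmetric] le_add_diff_inverse2)
      then have "mf_zinv ^ Suc M * mf_z ^ l = mf_zinv ^ (Suc M - l) * (mf_z * mf_zinv) ^ l"
        by (simp only: power_mult_distrib mult_ac)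
      then show ?thesis by (simp only: mf_z_mult_zinv power_one mult_1_right)
    qed
    have "mf_rat (c $ j) = (\<Sum>l\<le>Suc M. mf_const (coeff (p j) l) * mf_z ^ l)"
      unfolding p cpoly_at_z[symmetric] by (rule cpoly_at_altdef[OF Suc.prems])
    then have "mf_zinv ^ Suc M * mf_rat (c $ j) = (\<Sum>l\<le>Suc M. mf_const (coeff (p j) l) * (mf_zinv ^ Suc M * mf_z ^ l))"
      by (simp only: sum_distrib_left mult_ac)
    also have "\<dots> = (\<Sum>l\<le>Suc M. mf_const (coeff (p j) l) * mf_zinv ^ (Suc M - l))"
      by (rule sum.cong) (simp_all only: zz atMost_iff)
    also have "\<dots> = (\<Sum>l\<le>M. mf_const (coeff (p j) l) * mf_zinv ^ (Suc M - l)) + mf_const (\<gamma> $ j)"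
      by (simp add: \<gamma>_def)
    also have "(\<Sum>l\<le>M. mf_const (coeff (p j) l) * mf_zinv ^ (Suc M - l)) = mf_zinv * g j"
      unfolding g_def sum_distrib_left by (rule sum.cong) (simp_all add: Suc_diff_le mult_ac)
    finally show ?thesis by (simp only: add.commute)
  qed
  define h where "h = g 1 * \<psi> $ 1 + g 2 * \<psi> $ 2 + g 3 * \<psi> $ 3"
  have "mf_zinv ^ Suc M * row_apply c \<psi> = (mf_zinv ^ Suc M * mf_rat (c $ 1)) * \<psi> $ 1
      + (mf_zinv ^ Suc M * mf_rat (c $ 2)) * \<psi> $ 2 + (mf_zinv ^ Suc M * mf_rat (c $ 3)) * \<psi> $ 3"
    unfolding row_apply_3 by (simp only: algebra_simps)
  also have "\<dots> = combination \<gamma> \<psi> + mf_zinv * h"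
    unfolding e h_def combination_def by (simp only: algebra_simps)
  finally have comb: "combination \<gamma> \<psi> = mf_zinv ^ Suc M * row_apply c \<psi> - mf_zinv * h" by simp
  have \<gamma>: "\<gamma> = 0"
  proof (rule infinity_leading)
    fix P assume P: "curve_point R P" "P mf_z < 0"
    interpret P: place R P using P(1) by (rule placeI)
    have z: "P.ge mf_zinv (- P mf_z)" and z0: "P.ge mf_zinv 0" using P(2) P.z_zinv by (simp_all add: order_ge_def)
    have "P.ge (row_apply c \<psi>) (- D P)" using P.ge_cong[OF c] f[OF P(1)] by blast
    from P.ge_mult[OF P.ge_power[OF z] this]
    have "P.ge (mf_zinv ^ Suc M * row_apply c \<psi>) (int (Suc M) * - P mf_z + - D P)" .
    then have 1: "P.ge (mf_zinv ^ Suc M * row_apply c \<psi>) (- P mf_z + - D P)"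
    proof (rule P.ge_mono)
      have "0 \<le> int M * - P mf_z" using P(2) by (intro mult_nonneg_nonneg) simp_all
      then show "- P mf_z + - D P \<le> int (Suc M) * - P mf_z + - D P" by (simp add: distrib_right)
    qed
    have "P.ge (g j) 0" for j unfolding g_def
    proof (rule P.ge_sum)
      fix l
      have "P.ge (mf_zinv ^ (M - l)) 0" using P.ge_power[OF z0, of "M - l"] by simp
      then show "P.ge (mf_const (coeff (p j) l) * mf_zinv ^ (M - l)) 0" by (rule P.ge_const_mult)
    qed
    from P.ge_mult[OF this P.vordD[OF vord_\<psi>[OF P(1)]]] have "P.ge (g j * \<psi> $ j) (- D P)" for j by simp
    then have "P.ge h (- D P)" unfolding h_def by (intro P.ge_add)
    from P.ge_mult[OF z this] have 2: "P.ge (mf_zinv * h) (- P mf_z + - D P)" .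
    have "- D P - P mf_z = - P mf_z + - D P" by simp
    then show "P.ge (combination \<gamma> \<psi>) (- D P - P mf_z)" unfolding comb using P.ge_diff[OF 1 2] by (simp only:)
  qed
  have "degree (p j) \<le> M" for j
  proof -
    have "coeff (p j) (Suc M) = 0" using \<gamma> by (simp add: \<gamma>_def vec_eq_iff)
    then show ?thesis using Suc.prems[of j] by (metis degree_0 le_Suc_eq leading_coeff_0_iff zero_le)
  qed
  then show ?case by (rule Suc.IH)
qed

lemma constant_combination:
  assumes f: "\<And>P. curve_point R P \<Longrightarrow> order_ge R P f (- D P)"
  shows "\<exists>\<gamma>. R dvd f - combination \<gamma> \<psi>"
proof -
  obtain r where r: "R dvd f - in_powers r" using in_powers_surj by blast
  define c where "c = r v* krylov 0"
  have "R dvd (f - in_powers r) + (in_powers r - row_apply c \<psi>)"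
    unfolding c_def by (rule dvd_add[OF r in_powers_apply[OF \<psi>]])
  then have c: "R dvd f - row_apply c \<psi>" by simp
  have "\<exists>N p. \<forall>j. c $ j * fz ^ N = to_fract (p j)"
    by (rule laurent_vector) (rule regular_coefficients[OF f c])
  then obtain N p where "\<And>j. c $ j * fz ^ N = to_fract (p j)" by blast
  from polynomial_coefficients[OF f c this] obtain p where p: "\<And>j. c $ j = to_fract (p j)" by blast
  show ?thesis
  proof (rule constant_coefficients[OF f c p])
    show "degree (p j) \<le> degree (p 1) + degree (p 2) + degree (p 3)" for j using exhaust_3[of j] by auto
  qed
qed

lemma mod_combination: "combination \<gamma> \<psi> mod R = mf_const (\<gamma> $ 1) * (\<psi> $ 1 mod R)
    + mf_const (\<gamma> $ 2) * (\<psi> $ 2 mod R) + mf_const (\<gamma> $ 3) * (\<psi> $ 3 mod R)"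
  by (simp add: combination_def poly_mod_add_left mod_smult_left mf_const_def)

lemma rr_space_D:
  assumes "f \<in> rr_space R B" "\<And>P. curve_point R P \<Longrightarrow> B P \<le> D P"
  obtains \<gamma> where "f = combination \<gamma> \<psi> mod R"
proof -
  have f: "degree f < degree R" "\<And>P. curve_point R P \<Longrightarrow> order_ge R P f (- B P)"
    using assms(1) by (auto simp: rr_space_def)
  have "order_ge R P f (- D P)" if "curve_point R P" for P
    using f(2)[OF that] assms(2)[OF that] by (auto simp: order_ge_def)
  then obtain \<gamma> where "R dvd f - combination \<gamma> \<psi>" using constant_combination by blast
  then have "f mod R = combination \<gamma> \<psi> mod R" by (simp add: mod_eq_dvd_iff)
  then show ?thesis using that f(1) by (simp add: mod_poly_less)
qed

text \<open>The pole divisor is nonnegative, so functions without poles are among the constant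
  combinations. This supplies the finite spanning set from which \<open>principal_divisor\<close>
  starts.\<close>

lemma rr_space_0: "rr_space R (\<lambda>_. 0) \<subseteq> mf.span {\<psi> $ 1 mod R, \<psi> $ 2 mod R, \<psi> $ 3 mod R}"
proof
  fix f assume "f \<in> rr_space R (\<lambda>_. 0)"
  then obtain \<gamma> where "f = combination \<gamma> \<psi> mod R" using vord_normalized(2)[OF \<psi>] by (rule rr_space_D)
  then show "f \<in> mf.span {\<psi> $ 1 mod R, \<psi> $ 2 mod R, \<psi> $ 3 mod R}"
    unfolding mod_combination by (simp only:) (intro mf.span_add mf.span_scale mf.span_base; simp)
qed

lemmas principal_divisor_of_curve = principal_divisor[OF _ _ rr_space_0, simplified]

text \<open>At \<open>A\<close> only the second component attains the full pole order, so its
  coefficient must vanish; among the remaining two the third alone attains it at \<open>B\<close>.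
  The first component has room for both points and spans the space.\<close>

lemma rr_dim_eq_1:
  assumes AB: "curve_point R A" "curve_point R B" "A \<noteq> B"
    and A: "order_ge R A (\<psi> $ 1) (- D A + 1)" "order_eq R A (\<psi> $ 2) (- D A)" "order_ge R A (\<psi> $ 3) (- D A + 1)"
    and B: "order_ge R B (\<psi> $ 1) (- D B + 1)" "order_eq R B (\<psi> $ 3) (- D B)"
  shows "rr_dim R (\<lambda>Q. D Q - (point_div A Q + point_div B Q)) = 1"
proof -
  let ?E = "\<lambda>Q. D Q - (point_div A Q + point_div B Q)"
  interpret A: place R A using AB(1) by (rule placeI)
  interpret B: place R B using AB(2) by (rule placeI)
  let ?v = "\<psi> $ 1 mod R"
  have "rr_space R ?E = mf.span {?v}"
  proof
    show "rr_space R ?E \<subseteq> mf.span {?v}"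
    proof
      fix f assume f: "f \<in> rr_space R ?E"
      obtain \<gamma> where \<gamma>: "f = combination \<gamma> \<psi> mod R"
        using f by (rule rr_space_D) (simp add: point_div_def)
      have cge: "order_ge R P (combination \<gamma> \<psi>) (- ?E P)" if "curve_point R P" for P
        using f that unfolding \<gamma> rr_space_mod by blast
      have 2: "\<gamma> $ 2 = 0"
      proof (rule ccontr)
        assume n0: "\<gamma> $ 2 \<noteq> 0"
        have "A.eq (combination \<gamma> \<psi>) (- D A)"
          unfolding combination_def by (intro A.eq_add[OF A.eq_add'] A.ge_const_mult A.eq_const_mult n0 A)
        from A.eq_not_ge[OF this cge[OF AB(1)]] show False using AB(3) by (simp add: point_div_def)
      qed
      have 3: "\<gamma> $ 3 = 0"
      proof (rule ccontr)
        assume n0: "\<gamma> $ 3 \<noteq> 0"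
        have "B.eq (mf_const (\<gamma> $ 1) * \<psi> $ 1 + mf_const (\<gamma> $ 3) * \<psi> $ 3) (- D B)"
          by (intro B.eq_add' B.ge_const_mult B.eq_const_mult n0 B)
        then have "B.eq (combination \<gamma> \<psi>) (- D B)" unfolding combination_def 2 by simp
        from B.eq_not_ge[OF this cge[OF AB(2)]] show False using AB(3) by (simp add: point_div_def)
      qed
      show "f \<in> mf.span {?v}" unfolding \<gamma> mod_combination 2 3
        by (simp only: mf_const_0 mult_zero_left add_0_right) (intro mf.span_scale mf.span_base; simp)
    qed
    have "?v \<in> rr_space R ?E" unfolding rr_space_mod
    proof (intro allI impI)
      fix P assume P: "curve_point R P"
      have "order_ge R P (\<psi> $ 1) (- D P)" by (rule place.vordD[OF placeI[OF P] vord_\<psi>[OF P]])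
      then show "order_ge R P (\<psi> $ 1) (- ?E P)"
        using A(1) B(1) AB(3) by (auto simp: point_div_def add.commute)
    qed
    moreover have "mf_const k * f \<in> rr_space R ?E" if f: "f \<in> rr_space R ?E" for f k
    proof -
      have "degree (mf_const k * f) \<le> degree f" by (simp add: mf_const_def)
      then have "degree (mf_const k * f) < degree R" using f by (simp add: rr_space_def)
      moreover have "order_ge R P (mf_const k * f) (- ?E P)" if "curve_point R P" for P
        by (rule place.ge_const_mult[OF placeI[OF that]]) (use f that in \<open>simp add: rr_space_def\<close>)
      ultimately show ?thesis by (simp add: rr_space_def)
    qed
    ultimately show "mf.span {?v} \<subseteq> rr_space R ?E" by (auto simp: mf.span_singleton)
  qed
  moreover have "?v \<noteq> 0"
  proof
    assume "?v = 0"
    then have "R dvd combination (vector [1, 0, 0]) \<psi>" by (simp add: combination_def mod_eq_0_iff_dvd)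
    then have "vector [1, 0, 0] = (0 :: complex ^ 3)" by (rule combination_not_dvd)
    then show False by (simp add: vec_eq_iff forall_3)
  qed
  ultimately show ?thesis unfolding rr_dim_def by (simp add: mf.dim_eq_card_independent)
qed

end

lemma div_degree_superset: "finite S \<Longrightarrow> {P. E P \<noteq> 0} \<subseteq> S \<Longrightarrow> div_degree E = (\<Sum>P\<in>S. E P)"
  unfolding div_degree_def by (rule sum.mono_neutral_left) auto

lemma div_degree_diff:
  assumes "finite {P. E P \<noteq> 0}" "finite {P. F P \<noteq> 0}"
  shows "div_degree (\<lambda>Q. E Q - F Q) = div_degree E - div_degree F"
proof -
  let ?S = "{P. E P \<noteq> 0} \<union> {P. F P \<noteq> 0}"
  have S: "finite ?S" using assms by simp
  have 1: "div_degree (\<lambda>Q. E Q - F Q) = (\<Sum>P\<in>?S. E P - F P)"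
    by (rule div_degree_superset[OF S]) auto
  have 2: "div_degree E = (\<Sum>P\<in>?S. E P)" "div_degree F = (\<Sum>P\<in>?S. F P)"
    by (rule div_degree_superset[OF S]; blast)+
  show ?thesis unfolding 1 2 by (rule sum_subtractf)
qed

context marked_curve
begin

text \<open>For the bound on the first component at \<open>i = 0\<close>, a sum of two distinct
  points, the space is a line; non-speciality then reads
  \<open>1 = (deg D - 2) + 1 - g\<close>.\<close>

lemma div_degree_D:
  assumes "nonspecial R (\<lambda>Q. D Q - bound_div n O2 O3 W1 W2 W3 0 1 Q)"
  shows "div_degree D = genus R + 2"
proof -
  have main: "div_degree D = genus R + 2"
    if E: "bound_div n O2 O3 W1 W2 W3 0 1 = (\<lambda>Q. point_div A Q + point_div B Q)" and ne: "A \<noteq> B"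
      and dim: "rr_dim R (\<lambda>Q. D Q - (point_div A Q + point_div B Q)) = 1" for A B
  proof -
    let ?E = "\<lambda>Q. point_div A Q + point_div B Q"
    have sub: "{P. ?E P \<noteq> 0} \<subseteq> {A, B}" by (auto simp: point_div_def)
    then have fin: "finite {P. ?E P \<noteq> 0}" using finite_subset by blast
    have "div_degree ?E = (\<Sum>P\<in>{A, B}. ?E P)" by (rule div_degree_superset[OF _ sub]) simp
    then have 2: "div_degree ?E = 2" using ne by (simp add: point_div_def)
    have "finite {P. D P \<noteq> 0}" using is_divisor_pole_divisor by (simp add: is_divisor_def)
    from div_degree_diff[OF this fin] show ?thesis
      using assms unfolding nonspecial_def E dim 2 by simp
  qed
  show ?thesis
  proof (cases "even n")
    case True
    have A: "curve_point R O3" "O3 mf_z = 1" "O3 mf_k < 0" using marked' zero_even True by auto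
    have B: "curve_point R W3" "W3 mf_z = - 1" "W3 mf_k > 0" using marked' infinity_even True by auto
    have ne: "O3 \<noteq> W3" using A B by auto
    \<comment> \<open>At \<open>i = 0\<close> the floors are \<open>1 div 2 = 0\<close> for
      \<open>O2\<close> and \<open>W2\<close>, and \<open>2 div 2 = 1\<close> for \<open>O3\<close>
      and \<open>W3\<close>.\<close>
    have E: "bound_div n O2 O3 W1 W2 W3 0 1 = (\<lambda>Q. point_div O3 Q + point_div W3 Q)"
      using True by (simp add: bound_div_def Let_def)
    show ?thesis
    proof (rule main[OF E ne rr_dim_eq_1[OF A(1) B(1) ne]])
      show "order_ge R O3 (\<psi> $ 1) (- D O3 + 1)" "order_eq R O3 (\<psi> $ 2) (- D O3)" "order_ge R O3 (\<psi> $ 3) (- D O3 + 1)"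
        using zero_simple_type[OF A(1) eigenvector_\<psi> vord_\<psi>[OF A(1)] A(2,3) True] O3_limit[OF True, of "0 + 1"]
        by auto
      show "order_ge R W3 (\<psi> $ 1) (- D W3 + 1)" "order_eq R W3 (\<psi> $ 3) (- D W3)"
        using infinity_simple_type[OF B(1) eigenvector_\<psi> vord_\<psi>[OF B(1)] B(2,3) True] W3_limit[OF True, of 0]
        by auto
    qed
  next
    case False
    have A: "curve_point R O2" "O2 mf_z = 2" "O2 mf_k < 0" using marked' zero_odd False by auto
    have B: "curve_point R W2" "W2 mf_z = - 2" "W2 mf_k > 0" using marked' infinity_odd False by auto
    have ne: "O2 \<noteq> W2" using A B by auto
    have E: "bound_div n O2 O3 W1 W2 W3 0 1 = (\<lambda>Q. point_div O2 Q + point_div W2 Q)"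
      using False by (simp add: bound_div_def Let_def)
    note tA = zero_double_type[OF A(1) eigenvector_\<psi> vord_\<psi>[OF A(1)] A(2,3) False]
    note tB = infinity_double_type[OF B(1) eigenvector_\<psi> vord_\<psi>[OF B(1)] B(2,3) False]
    have "order_ge R O2 (\<psi> $ 3) (- D O2 + 1)" by (rule place.ge_mono[OF placeI[OF A(1)] tA(3)]) simp
    from rr_dim_eq_1[OF A(1) B(1) ne place.eq_imp_ge[OF placeI[OF A(1)] tA(2)] tA(1) this
        place.eq_imp_ge[OF placeI[OF B(1)] tB(2)] tB(1)]
    show ?thesis by (rule main[OF E ne])
  qed
qed

end

section \<open>Linear equivalence of the pole divisors\<close>

context irreducible_curve
begin

lemma lin_equiv_refl:
  assumes "\<And>P. curve_point R P \<Longrightarrow> E P = E' P"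
  shows "lin_equiv R E E'"
  unfolding lin_equiv_def
proof (intro exI[of _ 1] conjI allI impI)
  fix P assume P: "curve_point R P"
  interpret P: place R P using P by (rule placeI)
  have "P.eq (mf_const 1) 0" by (rule P.eq_const) simp
  then show "E P - E' P = P 1" using assms[OF P] by (simp add: order_eq_def)
qed simp

lemma lin_equiv_sym: "lin_equiv R E F \<Longrightarrow> lin_equiv R F E"
proof -
  assume "lin_equiv R E F"
  then obtain f where f: "\<not> R dvd f" "\<And>P. curve_point R P \<Longrightarrow> E P - F P = P f"
    unfolding lin_equiv_def by blast
  obtain g where g: "R dvd f * g - 1" "\<not> R dvd g" using inverse_mod_R[OF f(1)] by blast
  have "F P - E P = P g" if P: "curve_point R P" for P
  proof -
    interpret P: place R P using P by (rule placeI)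
    show ?thesis using P.eq_inverse[OF P.eq_order[OF f(1)] g(1)] f(2)[OF P] by (simp add: order_eq_def)
  qed
  then show ?thesis unfolding lin_equiv_def using g(2) by blast
qed

lemma lin_equiv_trans:
  assumes "lin_equiv R E F" "lin_equiv R F G"
  shows "lin_equiv R E G"
proof -
  obtain f where f: "\<not> R dvd f" "\<And>P. curve_point R P \<Longrightarrow> E P - F P = P f"
    using assms(1) unfolding lin_equiv_def by blast
  obtain g where g: "\<not> R dvd g" "\<And>P. curve_point R P \<Longrightarrow> F P - G P = P g"
    using assms(2) unfolding lin_equiv_def by blast
  have "E P - G P = P (f * g)" if P: "curve_point R P" for P
  proof -
    interpret P: place R P using P by (rule placeI)
    show ?thesis using P.eq_mult[OF P.eq_order[OF f(1)] P.eq_order[OF g(1)]] f(2)[OF P] g(2)[OF P]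
      by (simp add: order_eq_def)
  qed
  moreover have "\<not> R dvd f * g" using f(1) g(1) by (simp add: prime_R)
  ultimately show ?thesis unfolding lin_equiv_def by blast
qed

lemma lin_equiv_shift: "lin_equiv R E F \<Longrightarrow> lin_equiv R (\<lambda>Q. E Q + G Q) (\<lambda>Q. F Q + G Q)"
  by (simp add: lin_equiv_def)

lemma divisor_class_eqI: "lin_equiv R E F \<Longrightarrow> divisor_class R E = divisor_class R F"
  unfolding divisor_class_def using lin_equiv_trans lin_equiv_sym by blast

text \<open>The transported solution is \<open>s\<close> times the normalized one. Hence the order
  of \<open>s\<close> is the difference between the new pole order and the old one corrected by the
  jump \<open>j\<close>, with the same \<open>s\<close> at every point.\<close>

lemma pole_shift:
  assumes P: "curve_point R P" and \<omega>: "place.vord R P \<omega> (- d + j)" and \<phi>: "place.vord R P \<phi> (- d')"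
    and s: "\<And>l. R dvd \<omega> $ l - s * \<phi> $ l"
  shows "\<not> R dvd s" "d' - (d - j) = P s"
proof -
  interpret P: place R P using P by (rule placeI)
  show ns: "\<not> R dvd s"
  proof
    assume "R dvd s"
    then have "R dvd (\<omega> $ l - s * \<phi> $ l) + s * \<phi> $ l" for l by (intro dvd_add[OF s] dvd_mult2)
    then have "R dvd \<omega> $ l" for l by simp
    then show False using \<omega> P.ge_dvd unfolding P.vord_def by blast
  qed
  have "P.vord (s *s \<phi>) (P s + - d')" by (rule P.vord_smult[OF P.eq_order[OF ns] \<phi>])
  moreover have "P.vord \<omega> (P s + - d') \<longleftrightarrow> P.vord (s *s \<phi>) (P s + - d')"
    by (rule P.vord_cong) (use s in simp)
  ultimately show "d' - (d - j) = P s" using P.vord_unique[OF \<omega>] by fastforce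
qed

end

context marked_curve
begin

text \<open>The jump has degree zero, and so has the divisor of \<open>s\<close>; this is why the
  degree is preserved along with the class up to the jump.\<close>

lemma step_equiv:
  assumes E: "is_divisor R E" "is_divisor R F" and AB: "curve_point R A" "curve_point R B"
    and s: "\<And>P. curve_point R P \<Longrightarrow> \<not> R dvd s \<and> F P - (E P - (point_div A P - point_div B P)) = P s"
  shows "lin_equiv R F (\<lambda>Q. E Q - (point_div A Q - point_div B Q))" "div_degree F = div_degree E"
proof -
  let ?J = "\<lambda>Q. point_div A Q - point_div B Q"
  have ns: "\<not> R dvd s" using s AB by blast
  show "lin_equiv R F (\<lambda>Q. E Q - ?J Q)" unfolding lin_equiv_def using s ns by blast
  have fin: "finite {P. E P \<noteq> 0}" "finite {P. F P \<noteq> 0}" using E by (simp_all add: is_divisor_def)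
  have sub: "{P. ?J P \<noteq> 0} \<subseteq> {A, B}" by (auto simp: point_div_def)
  then have finJ: "finite {P. ?J P \<noteq> 0}" using finite_subset by blast
  have "div_degree ?J = (\<Sum>P\<in>{A, B}. ?J P)" by (rule div_degree_superset[OF _ sub]) simp
  then have J: "div_degree ?J = 0" by (cases "A = B") (simp_all add: point_div_def)
  have "{P. E P - ?J P \<noteq> 0} \<subseteq> {P. E P \<noteq> 0} \<union> {P. ?J P \<noteq> 0}" by auto
  then have finEJ: "finite {P. E P - ?J P \<noteq> 0}" using finite_subset[OF _ finite_UnI[OF fin(1) finJ]] by blast
  \<comment> \<open>A \<open>point\<close> is an arbitrary map; outside the curve points all the
    divisors involved are 0, whatever value the map takes at \<open>s\<close>.\<close>
  define G where "G = (\<lambda>Q. F Q - (E Q - ?J Q))"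
  have G: "G P = (if curve_point R P then P s else 0)" for P
  proof (cases "curve_point R P")
    case False
    then have "F P = 0" "E P = 0" "P \<noteq> A" "P \<noteq> B" using E AB unfolding is_divisor_def by blast+
    with False show ?thesis by (simp add: G_def point_div_def)
  qed (use s[of P] in \<open>simp add: G_def\<close>)
  have "div_degree G = (\<Sum>P | curve_point R P \<and> P s \<noteq> 0. P s)"
    unfolding div_degree_def by (rule sum.cong) (auto simp: G)
  also have "\<dots> = 0" using principal_divisor_of_curve[OF ns] by blast
  finally have "div_degree F - div_degree (\<lambda>Q. E Q - ?J Q) = 0"
    unfolding G_def using div_degree_diff[OF fin(2) finEJ] by simp
  then show "div_degree F = div_degree E" using div_degree_diff[OF fin(1) finJ] J by simp
qed

lemma lax_step:
  assumes \<phi>: "normalized i \<phi>" and \<phi>': "normalized (i + 1) \<phi>'" and AB: "curve_point R A" "curve_point R B"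
    and jump: "\<And>P m. curve_point R P \<Longrightarrow> place.vord R P \<phi> m \<Longrightarrow>
      place.vord R P (lax_matrix mf_const mf_zinv x y i *v \<phi>) (m + (point_div A P - point_div B P))"
  shows "lin_equiv R (pole_divisor R \<phi>') (\<lambda>Q. pole_divisor R \<phi> Q - (point_div A Q - point_div B Q))"
    "div_degree (pole_divisor R \<phi>') = div_degree (pole_divisor R \<phi>)"
proof -
  let ?\<omega> = "lax_matrix mf_const mf_zinv x y i *v \<phi>"
  define s where "s = (\<Sum>l\<in>UNIV. ?\<omega> $ l)"
  have "eigenvector (i + 1) ?\<omega>" using \<phi> by (intro eigenvector_lax) (simp add: normalized_def)
  then have u: "R dvd ?\<omega> $ l - s * \<phi>' $ l" for l unfolding s_def by (rule normalized_unique[OF \<phi>'])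
  have "\<not> R dvd s \<and> pole_divisor R \<phi>' P - (pole_divisor R \<phi> P - (point_div A P - point_div B P)) = P s"
    if P: "curve_point R P" for P
    using pole_shift[OF P jump[OF P vord_normalized(1)[OF \<phi> P]] vord_normalized(1)[OF \<phi>' P] u] by blast
  from step_equiv[OF is_divisor_pole_divisor is_divisor_pole_divisor AB this]
  show "lin_equiv R (pole_divisor R \<phi>') (\<lambda>Q. pole_divisor R \<phi> Q - (point_div A Q - point_div B Q))"
    "div_degree (pole_divisor R \<phi>') = div_degree (pole_divisor R \<phi>)" by blast+
qed

lemma evolution_step:
  assumes step: "(x', y') = pentagram (x, y)" and X: "\<And>j. 1 - x j * y j \<noteq> 0"
    and nz: "\<And>j. x' j \<noteq> 0" "\<And>j. y' j \<noteq> 0" and \<phi>': "floquet_bloch n x' y' C 0 \<phi>'"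
  shows "lin_equiv R (pole_divisor R \<phi>') (\<lambda>Q. D Q - (point_div O1 Q - point_div W2 Q))"
proof -
  let ?\<omega> = "evolution_matrix x y 0 *v \<psi>"
  have R': "R = spectral_poly n x' y' C"
    unfolding R by (rule spectral_poly_pentagram[OF step nonzero X periodic, symmetric])
  \<comment> \<open>The new coordinates have the same \<open>R\<close>, so uniqueness of the
    normalized eigenvector is available at the new time.\<close>
  have "spectral_curve R n x' y' C"
    by unfold_locales (rule R', rule C, rule pentagram_periodic(1)[OF step periodic],
      rule pentagram_periodic(2)[OF step periodic], rule nz, rule nz)
  then interpret new: spectral_curve R n x' y' C .
  have \<phi>': "new.normalized 0 \<phi>'" using \<phi>' unfolding new.floquet_bloch_iff .
  define s where "s = (\<Sum>l\<in>UNIV. ?\<omega> $ l)"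
  have "new.eigenvector 0 ?\<omega>" unfolding new.eigenvector_def
  proof
    show "R dvd (monodromy n x' y' 0 *v ?\<omega> - new.eigenvalue *s ?\<omega>) $ j" for j
      by (rule eigenvector_evolution[OF step X eigenvector_\<psi>])
  qed
  then have u: "R dvd ?\<omega> $ l - s * \<phi>' $ l" for l unfolding s_def by (rule new.normalized_unique[OF \<phi>'])
  have "\<not> R dvd s \<and> pole_divisor R \<phi>' P - (D P - (point_div O1 P - point_div W2 P)) = P s"
    if P: "curve_point R P" for P
    using pole_shift[OF P evolution_jump[OF P eigenvector_\<psi> vord_\<psi>[OF P] X] new.vord_normalized(1)[OF \<phi>' P] u] by blast
  from step_equiv(1)[OF is_divisor_pole_divisor is_divisor_pole_divisor marked'(1,10) this] show ?thesis .
qed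

end

text \<open>In the alternating products the factors \<open>1 - x j * y j\<close> cancel, because
  starting two places later changes nothing. The \<open>x\<close> keep their index while the
  \<open>y\<close> are shifted by one, so the limits at \<open>O2\<close> and \<open>O3\<close> keep
  their form and those at \<open>W2\<close> and \<open>W3\<close> are exchanged.\<close>

lemma marked_points_pentagram:
  assumes step: "(x', y') = pentagram (x, y)"
    and nz: "\<And>j. x j \<noteq> 0" "\<And>j. y j \<noteq> 0" "\<And>j. 1 - x j * y j \<noteq> 0" "\<And>j. x' j \<noteq> 0" "\<And>j. y' j \<noteq> 0"
    and per: "\<And>j. x (j + int n) = x j" "\<And>j. y (j + int n) = y j"
    and marked: "marked_points n x y C O1 O2 O3 W1 W2 W3"
  shows "marked_points n x' y' C O1 O2 O3 W1 (if even n then W3 else W2) (if even n then W2 else W3)"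
proof -
  have R: "spectral_poly n x' y' C = spectral_poly n x y C"
    by (rule spectral_poly_pentagram[OF step nz(1-3) per])
  show ?thesis
  proof (cases "even n")
    case False
    then show ?thesis using marked unfolding marked_points_def R Let_def by simp
  next
    case True
    define q where "q = n div 2"
    have n: "n = 2 * q" using True by (simp add: q_def)
    then have n': "int n = 2 * int q" by simp
    define z where "z j = 1 - x j * y j" for j
    have x': "x' j = x j * z (j - 1) / z (j + 1)" and y': "y' j = y (j + 1) * z (j + 2) / z j" for j
      using step by (simp_all add: pentagram_def z_def)
    have z0: "z j \<noteq> 0" for j unfolding z_def by (rule nz)
    have perq: "x (j + 2 * int q) = x j" "y (j + 2 * int q) = y j" for j using per[of j] unfolding n' .
    then have zper: "z (j + 2 * int q) = z j" for j by (simp add: z_def)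
    have per': "x' (j + 2 * int q) = x' j" "y' (j + 2 * int q) = y' j" for j
      using pentagram_periodic[OF step per, of j] unfolding n' .
    have zshift: "alt_prod q z (p + 2) = alt_prod q z p" for p using zper z0 by (rule alt_prod_shift)
    have zn: "alt_prod q z p \<noteq> 0" for p using z0 by (simp add: alt_prod_def)
    have ax: "alt_prod q x' p = alt_prod q x p" for p
    proof -
      have "alt_prod q x' p = alt_prod q x p * alt_prod q z (p - 1) / alt_prod q z (p - 1 + 2)"
        unfolding alt_prod_def x' by (simp add: prod_dividef prod.distrib algebra_simps)
      then show ?thesis unfolding zshift using zn by simp
    qed
    have ay: "alt_prod q y' p = alt_prod q y (p + 1)" for p
    proof -
      have "alt_prod q y' p = alt_prod q y (p + 1) * alt_prod q z (p + 2) / alt_prod q z p"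
        unfolding alt_prod_def y' by (simp add: prod_dividef prod.distrib algebra_simps)
      then show ?thesis unfolding zshift using zn by simp
    qed
    note e = alt_prod_parity[where f = x and q = q, OF perq(1) nz(1), folded n]
      alt_prod_parity[where f = x' and q = q, OF per'(1) nz(4), folded n]
      alt_prod_parity[where f = y and q = q, OF perq(2) nz(2), folded n]
      alt_prod_parity[where f = y' and q = q, OF per'(2) nz(5), folded n]
    have X: "(\<Prod>j | j < n \<and> even j. x' (int j)) = (\<Prod>j | j < n \<and> even j. x (int j))"
      "(\<Prod>j | j < n \<and> odd j. x' (int j)) = (\<Prod>j | j < n \<and> odd j. x (int j))"
      using ax[of 0] ax[of 1] e by simp_all
    have Y: "(\<Prod>j | j < n \<and> even j. y' (int j)) = (\<Prod>j | j < n \<and> odd j. y (int j))"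
      "(\<Prod>j | j < n \<and> odd j. y' (int j)) = (\<Prod>j | j < n \<and> even j. y (int j))"
      using ay[of 0] ay[of 1] e by simp_all
    have X': "(\<Prod>j | j < n \<and> even j. 1 / x' (int j)) = (\<Prod>j | j < n \<and> even j. 1 / x (int j))"
      "(\<Prod>j | j < n \<and> odd j. 1 / x' (int j)) = (\<Prod>j | j < n \<and> odd j. 1 / x (int j))"
      unfolding prod_dividef X by (rule refl)+
    show ?thesis using marked True unfolding marked_points_def R Let_def X' Y by simp
  qed
qed

theorem theorem2:
  fixes n t i :: nat
    and \<phi> :: "int \<Rightarrow> (complex ^ 3) set"
    and V :: "int \<Rightarrow> complex ^ 3"
    and a b c :: "int \<Rightarrow> complex"
    and x y :: "nat \<Rightarrow> int \<Rightarrow> complex"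
    and C :: complex
    and R :: mfun
    and O1 O2 O3 W1 W2 W3 :: point
    and \<psi> :: "nat \<Rightarrow> nat \<Rightarrow> mfun ^ 3"
    and D :: "nat \<Rightarrow> nat \<Rightarrow> divisor"
  assumes n: "n \<ge> 4"
    and polygon: "twisted_polygon n \<phi>" "is_lift \<phi> V" "lift_recurrence V a b c"
    and time_0: "x 0 = coord_x a b c" "y 0 = coord_y a b"
    and time_step: "\<And>s. s < t \<Longrightarrow> (x (Suc s), y (Suc s)) = pentagram (x s, y s)"
    and coords_nonzero: "\<And>s j. s \<le> t \<Longrightarrow> x s j \<noteq> 0 \<and> y s j \<noteq> 0"
    and pentagram_defined: "\<And>s j. s < t \<Longrightarrow> 1 - x s j * y s j \<noteq> 0"
    and C: "mf_const (C ^ 3) = mf_z ^ n * det (monodromy n (x 0) (y 0) 0)"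
    and R: "R = spectral_poly n (x 0) (y 0) C"
    and marked: "marked_points n (x 0) (y 0) C O1 O2 O3 W1 W2 W3"
    and \<psi>: "\<And>s j. s \<le> t \<Longrightarrow> j < n \<Longrightarrow> floquet_bloch n (x s) (y s) C (int j) (\<psi> j s)"
    and D: "\<And>s j. s \<le> t \<Longrightarrow> j < n \<Longrightarrow> D j s = pole_divisor R (\<psi> j s)"
    and generic: "\<And>s. s \<le> t \<Longrightarrow> generic_spectral_data n (x s) (y s) C (D 0 s)"
    and i: "i < n"
  shows "div_degree (D i t) = genus R + 2 \<and>
    (odd n \<longrightarrow>
       divisor_class R (D i t) =
         divisor_class R (\<lambda>Q. D 0 0 Q - int t * point_div O1 Q + int i * point_div O2 Q
           + (int t - int i) * point_div W2 Q)) \<and>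
    (even n \<longrightarrow>
       divisor_class R (D i t) =
         divisor_class R (\<lambda>Q. D 0 0 Q - int t * point_div O1 Q
           + ((1 + int i) div 2) * point_div O2 Q + (int i div 2) * point_div O3 Q
           + ((1 + int t - int i) div 2) * point_div W2 Q
           + ((int t - int i) div 2) * point_div W3 Q)) \<and>
    (odd n \<longrightarrow>
       divisor_class R (D 0 t) =
         divisor_class R (\<lambda>Q. D 0 0 Q + int t * (point_div W2 Q - point_div O1 Q))) \<and>
    (even n \<longrightarrow>
       divisor_class R (D 0 t) =
         divisor_class R (\<lambda>Q. D 0 0 Q - int t * point_div O1 Q
           + ((1 + int t) div 2) * point_div W2 Q + (int t div 2) * point_div W3 Q)) \<and>
    (even n \<longrightarrow> (\<forall>s. t = 2 * s \<longrightarrow>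
       divisor_class R (D 0 t) =
         divisor_class R (\<lambda>Q. D 0 0 Q
           + int s * (point_div W2 Q + point_div W3 Q - 2 * point_div O1 Q))))"
proof -
  have n0: "0 < n" using n by simp
  have nz: "\<And>j. x s j \<noteq> 0" "\<And>j. y s j \<noteq> 0" if "s \<le> t" for s using coords_nonzero[OF that] by auto
  have C0: "C \<noteq> 0"
  proof
    assume "C = 0"
    then have "mf_z ^ n * det (monodromy n (x 0) (y 0) 0) = 0" using C by (simp add: zero_power)
    moreover have "mf_z \<noteq> 0" by (simp add: mf_z_def)
    moreover have "mf_zinv \<noteq> 0" using mf_z_mult_zinv by auto
    then have "det (monodromy n (x 0) (y 0) 0) \<noteq> 0"
      unfolding monodromy_def by (rule det_lax_product_nonzero) (use nz in simp_all)
    ultimately show False by simp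
  qed
  have per: "(\<forall>j. x s (j + int n) = x s j) \<and> (\<forall>j. y s (j + int n) = y s j)" if "s \<le> t" for s
    using that
  proof (induction s)
    case 0
    show ?case unfolding time_0 using coords_periodic[OF polygon] by blast
  next
    case (Suc s)
    then have p: "\<And>j. x s (j + int n) = x s j" "\<And>j. y s (j + int n) = y s j" and s: "s < t" by simp_all
    show ?case using pentagram_periodic[OF time_step[OF s] p] by blast
  qed
  then have per': "\<And>j. x s (j + int n) = x s j" "\<And>j. y s (j + int n) = y s j" if "s \<le> t" for s
    using that by blast+
  have R_s: "R = spectral_poly n (x s) (y s) C" if "s \<le> t" for s
    using that
  proof (induction s)
    case (Suc s)
    then have s: "s < t" "s \<le> t" by simp_all
    show ?case
      unfolding spectral_poly_pentagram[OF time_step[OF s(1)] nz[OF s(2)] pentagram_defined[OF s(1)] per'[OF s(2)]]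
      by (rule Suc.IH[OF s(2)])
  qed (rule R)
  \<comment> \<open>With respect to the coordinates at time \<open>s\<close>, \<open>Wa s\<close>
    has the role of \<open>W2\<close> and \<open>Wb s\<close> that of \<open>W3\<close>; they differ
    from the labels at time 0 only for even \<open>n\<close> and odd \<open>s\<close>.\<close>
  define Wa where "Wa s = (if even n \<and> odd s then W3 else W2)" for s :: nat
  define Wb where "Wb s = (if even n \<and> odd s then W2 else W3)" for s :: nat
  have marked_s: "marked_points n (x s) (y s) C O1 O2 O3 W1 (Wa s) (Wb s)" if "s \<le> t" for s
    using that
  proof (induction s)
    case 0
    show ?case using marked by (simp add: Wa_def Wb_def)
  next
    case (Suc s)
    then have s: "s < t" "s \<le> t" by simp_all
    have "marked_points n (x (Suc s)) (y (Suc s)) C O1 O2 O3 W1 (if even n then Wb s else Wa s) (if even n then Wa s else Wb s)"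
      by (rule marked_points_pentagram[OF time_step[OF s(1)] nz[OF s(2)] pentagram_defined[OF s(1)]
            nz[OF Suc.prems] per'[OF s(2)] Suc.IH[OF s(2)]])
    moreover have "(if even n then Wb s else Wa s) = Wa (Suc s)" "(if even n then Wa s else Wb s) = Wb (Suc s)"
      by (simp_all add: Wa_def Wb_def)
    ultimately show ?case by (simp only:)
  qed
  have generic_s: "generic_curve n (x s) (y s) C" if "s \<le> t" for s
    using generic[OF that] by (simp add: generic_spectral_data_def)
  have irr: "irreducible_curve R"
    using generic_s[of 0] by unfold_locales (simp add: generic_curve_def R[symmetric])
  interpret irreducible_curve R by (rule irr)
  have spectral: "spectral_curve R n (x s) (y s) C" if "s \<le> t" for s
    by unfold_locales (rule R_s[OF that], rule C0, rule per'(1)[OF that], rule per'(2)[OF that],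
      rule nz(1)[OF that], rule nz(2)[OF that])
  have curve: "marked_curve R n (x s) (y s) C O1 O2 O3 W1 (Wa s) (Wb s) (\<psi> 0 s)" if "s \<le> t" for s
  proof -
    interpret s: spectral_curve R n "x s" "y s" C by (rule spectral[OF that])
    note G = generic_s[OF that, unfolded generic_curve_def]
    have "s.normalized 0 (\<psi> 0 s)" using \<psi>[OF that n0] unfolding s.floquet_bloch_iff by simp
    then show ?thesis
      by unfold_locales (use G n marked_s[OF that] in blast)+
  qed
  \<comment> \<open>Genericity at time \<open>s\<close> quantifies over all labellings that are
    valid for the coordinates at that time, in particular over the exchanged one.\<close>
  have degree_0: "div_degree (D 0 s) = genus R + 2" if "s \<le> t" for s
  proof -
    have "0 < n \<Longrightarrow> nonspecial R (\<lambda>Q. D 0 s Q - bound_div n O2 O3 W1 (Wa s) (Wb s) (int 0) 1 Q)"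
      using generic[OF that] marked_s[OF that] unfolding generic_spectral_data_def R_s[OF that, symmetric] by blast
    then show ?thesis
      using marked_curve.div_degree_D[OF curve[OF that]] n0 D[OF that n0] by simp
  qed
  have time: "lin_equiv R (D 0 (Suc s)) (\<lambda>Q. D 0 s Q - (point_div O1 Q - point_div (Wa s) Q))" if "s < t" for s
  proof -
    have s: "s \<le> t" "Suc s \<le> t" using that by simp_all
    have fb: "floquet_bloch n (x (Suc s)) (y (Suc s)) C 0 (\<psi> 0 (Suc s))" using \<psi>[OF s(2) n0] by simp
    show ?thesis unfolding D[OF s(1) n0] D[OF s(2) n0]
      by (rule marked_curve.evolution_step[OF curve[OF s(1)] time_step[OF that] pentagram_defined[OF that] nz[OF s(2)] fb])
  qed
  interpret t: marked_curve R n "x t" "y t" C O1 O2 O3 W1 "Wa t" "Wb t" "\<psi> 0 t" by (rule curve) simp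
  have norm: "t.normalized (int j) (\<psi> j t)" if "j < n" for j
    using \<psi>[OF order_refl that] unfolding t.floquet_bloch_iff .
  \<comment> \<open>Passing from index \<open>j\<close> to \<open>j + 1\<close> subtracts
    \<open>A j\<close> from the class and adds \<open>B j\<close>; for even \<open>n\<close> both
    alternate with \<open>j\<close>.\<close>
  define A where "A j = (if odd n then W2 else if even j then Wb t else Wa t)" for j :: nat
  define B where "B j = (if odd n \<or> even j then O2 else O3)" for j :: nat
  have shift: "lin_equiv R (D (Suc j) t) (\<lambda>Q. D j t Q - (point_div (A j) Q - point_div (B j) Q))"
    "div_degree (D (Suc j) t) = div_degree (D j t)" if "Suc j < n" for j
  proof -
    have j: "j < n" "Suc j < n" using that by simp_all
    have n1: "t.normalized (int j + 1) (\<psi> (Suc j) t)" using norm[OF j(2)] by (simp add: add.commute)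
    have ev: "t.eigenvector (int j) (\<psi> j t)" using norm[OF j(1)] by (simp add: t.normalized_def)
    have AB: "curve_point R (A j)" "curve_point R (B j)"
      using t.marked'(4,10,13,16) by (auto simp: A_def B_def Wa_def split: if_splits)
    have jump: "place.vord R P (lax_matrix mf_const mf_zinv (x t) (y t) (int j) *v \<psi> j t)
        (m + (point_div (A j) P - point_div (B j) P))" if "curve_point R P" "place.vord R P (\<psi> j t) m" for P m
    proof (cases "odd n")
      case True
      then have "Wa t = W2" by (simp add: Wa_def)
      then show ?thesis using t.lax_jump_odd[OF that(1) ev that(2) True] True by (simp add: A_def B_def)
    next
      case False
      then have "even n" by simp
      from t.lax_jump_even[OF that(1) ev that(2) this] show ?thesis
        using False by (cases "even j") (simp_all add: A_def B_def)
    qed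
    note S = t.lax_step[OF norm[OF j(1)] n1 AB jump]
    show "lin_equiv R (D (Suc j) t) (\<lambda>Q. D j t Q - (point_div (A j) Q - point_div (B j) Q))"
      unfolding D[OF order_refl j(1)] D[OF order_refl j(2)] by (rule S(1))
    show "div_degree (D (Suc j) t) = div_degree (D j t)"
      unfolding D[OF order_refl j(1)] D[OF order_refl j(2)] by (rule S(2))
  qed
  have degree: "div_degree (D j t) = genus R + 2" if "j < n" for j
    using that by (induction j) (simp_all add: degree_0 shift(2))
  \<comment> \<open>Appends one step to a closed form that is known up to linear
    equivalence.\<close>
  have next_equiv: "lin_equiv R E' F'" if "lin_equiv R E' (\<lambda>Q. E Q - J Q)" "lin_equiv R E F" "\<And>Q. F' Q = F Q - J Q"
    for E E' F F' J
  proof -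
    have "lin_equiv R (\<lambda>Q. E Q + - J Q) (\<lambda>Q. F Q + - J Q)" using that(2) by (rule lin_equiv_shift)
    then have "lin_equiv R (\<lambda>Q. E Q - J Q) F'" using that(3) by (simp add: lin_equiv_def)
    with that(1) show ?thesis by (rule lin_equiv_trans)
  qed
  have odd_0: "lin_equiv R (D 0 s) (\<lambda>Q. D 0 0 Q - int s * point_div O1 Q + int s * point_div W2 Q)"
    if "odd n" "s \<le> t" for s
    using that(2)
  proof (induction s)
    case (Suc s)
    then have s: "s < t" "s \<le> t" by simp_all
    show ?case
      by (rule next_equiv[OF time[OF s(1)] Suc.IH[OF s(2)]]) (use that(1) in \<open>simp add: Wa_def algebra_simps\<close>)
  qed (simp add: lin_equiv_refl)
  have even_0: "lin_equiv R (D 0 s) (\<lambda>Q. D 0 0 Q - int s * point_div O1 Q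
      + ((1 + int s) div 2) * point_div W2 Q + (int s div 2) * point_div W3 Q)"
    if "even n" "s \<le> t" for s
    using that(2)
  proof (induction s)
    case (Suc s)
    then have s: "s < t" "s \<le> t" by simp_all
    \<comment> \<open>The step adds \<open>W2\<close> for even \<open>s\<close> and
      \<open>W3\<close> for odd \<open>s\<close>; the two floors increase in the same
      rhythm.\<close>
    have co: "(1 + int (Suc s)) div 2 = int s div 2 + 1" "int (Suc s) div 2 = (1 + int s) div 2" by simp_all
    have "even s \<Longrightarrow> (1 + int s) div 2 = int s div 2" "odd s \<Longrightarrow> (1 + int s) div 2 = int s div 2 + 1" by presburger+
    then show ?case unfolding co
      by (intro next_equiv[OF time[OF s(1)] Suc.IH[OF s(2)]])
        (cases "even s"; use that(1) in \<open>simp add: Wa_def algebra_simps\<close>)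
  qed (simp add: lin_equiv_refl)
  have odd_i: "lin_equiv R (D j t) (\<lambda>Q. D 0 0 Q - int t * point_div O1 Q + int j * point_div O2 Q
      + (int t - int j) * point_div W2 Q)" if "odd n" "j < n" for j
    using that(2)
  proof (induction j)
    case 0
    show ?case using odd_0[OF that(1) order_refl] by simp
  next
    case (Suc j)
    then have j: "j < n" by simp
    show ?case
      by (rule next_equiv[OF shift(1)[OF Suc.prems] Suc.IH[OF j]]) (use that(1) in \<open>simp add: A_def B_def algebra_simps\<close>)
  qed
  have even_i: "lin_equiv R (D j t) (\<lambda>Q. D 0 0 Q - int t * point_div O1 Q
      + ((1 + int j) div 2) * point_div O2 Q + (int j div 2) * point_div O3 Q
      + ((1 + int t - int j) div 2) * point_div W2 Q + ((int t - int j) div 2) * point_div W3 Q)"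
    if "even n" "j < n" for j
    using that(2)
  proof (induction j)
    case 0
    show ?case using even_0[OF that(1) order_refl] by simp
  next
    case (Suc j)
    then have j: "j < n" by simp
    define p where "p = (1 + int t - int j) div 2"
    define r where "r = (int t - int j) div 2"
    define u where "u = int j div 2"
    have co: "(1 + int (Suc j)) div 2 = u + 1" "int (Suc j) div 2 = (1 + int j) div 2"
      "(1 + int t - int (Suc j)) div 2 = r" "(int t - int (Suc j)) div 2 = p - 1"
      unfolding p_def r_def u_def by presburger+
    \<comment> \<open>Whether \<open>W2\<close> or \<open>W3\<close> is subtracted depends on the
      parity of \<open>t + j\<close>: the labels alternate with the time, the jump with the
      index.\<close>
    have par: "even (t + j) \<Longrightarrow> p = r" "odd (t + j) \<Longrightarrow> p = r + 1"
      unfolding p_def r_def by presburger+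
    have par': "even j \<Longrightarrow> (1 + int j) div 2 = u" "odd j \<Longrightarrow> (1 + int j) div 2 = u + 1"
      unfolding u_def by presburger+
    show ?case unfolding co
      by (rule next_equiv[OF shift(1)[OF Suc.prems] Suc.IH[OF j]], unfold p_def[symmetric] r_def[symmetric] u_def[symmetric],
          cases "even j"; cases "even t")
        (use that(1) par par' in \<open>simp_all add: A_def B_def Wa_def Wb_def algebra_simps\<close>)
  qed
  have class_0: "divisor_class R (D 0 t) = divisor_class R F" if "lin_equiv R (D 0 t) E" "\<And>Q. E Q = F Q" for E F
  proof -
    have "E = F" using that(2) by (simp add: fun_eq_iff)
    with that(1) show ?thesis using divisor_class_eqI by blast
  qed
  show ?thesis
  proof (intro conjI impI allI)
    show "div_degree (D i t) = genus R + 2" by (rule degree[OF i])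
  next
    assume "odd n"
    then show "divisor_class R (D i t) = divisor_class R (\<lambda>Q. D 0 0 Q - int t * point_div O1 Q
        + int i * point_div O2 Q + (int t - int i) * point_div W2 Q)"
      by (rule divisor_class_eqI[OF odd_i[OF _ i]])
  next
    assume "even n"
    then show "divisor_class R (D i t) = divisor_class R (\<lambda>Q. D 0 0 Q - int t * point_div O1 Q
        + ((1 + int i) div 2) * point_div O2 Q + (int i div 2) * point_div O3 Q
        + ((1 + int t - int i) div 2) * point_div W2 Q + ((int t - int i) div 2) * point_div W3 Q)"
      by (rule divisor_class_eqI[OF even_i[OF _ i]])
  next
    assume "odd n"
    then show "divisor_class R (D 0 t)
        = divisor_class R (\<lambda>Q. D 0 0 Q + int t * (point_div W2 Q - point_div O1 Q))"
      by (rule class_0[OF odd_0[OF _ order_refl]]) (simp add: algebra_simps)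
  next
    assume "even n"
    then show "divisor_class R (D 0 t) = divisor_class R (\<lambda>Q. D 0 0 Q - int t * point_div O1 Q
        + ((1 + int t) div 2) * point_div W2 Q + (int t div 2) * point_div W3 Q)"
      by (rule divisor_class_eqI[OF even_0[OF _ order_refl]])
  next
    \<comment> \<open>Two steps together add \<open>W2 + W3 - 2 O1\<close>, so the square of the
      evolution is a translation.\<close>
    fix s assume e: "even n" and s: "t = 2 * s"
    have "(1 + int t) div 2 = int s" "int t div 2 = int s" "int t = 2 * int s" using s by simp_all
    then show "divisor_class R (D 0 t)
        = divisor_class R (\<lambda>Q. D 0 0 Q + int s * (point_div W2 Q + point_div W3 Q - 2 * point_div O1 Q))"
      by (intro class_0[OF even_0[OF e order_refl]]) (simp add: algebra_simps)
  qed
qed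

end
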